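(* Let $n\ge3$, $d\in(0,n-1)$, let $\Gamma\subset\mathbb R^n$ be a closed unbounded $d$-Ahlfors-David regular set, let $\mathcal F$ be a family of pairwise disjoint dyadic cubes of $\Gamma$, and let $\Omega_{\mathcal F}$ be the associated dyadically-generated sawtooth domain (see context). Let $dm=w\,dX$ with $w(X)=\operatorname{dist}(X,\Gamma)^{d+1-n}$, and let $\sigma_\star$ be the measure on $\partial\Omega_{\mathcal F}$ given, for Borel $E\subset\partial\Omega_{\mathcal F}$, by $$\sigma_\star(E)=\mathcal H^d|_\Gamma(E\cap\Gamma)+\int_{E\setminus\Gamma}\operatorname{dist}(X,\Gamma)^{d+1-n}\,d\mathcal H^{n-1}|_{\partial\Omega_{\mathcal F}\setminus\Gamma}(X).$$ Write $\delta_\star(X)=\operatorname{dist}(X,\partial\Omega_{\mathcal F})$ and $\Delta_\star(x,r)=B(x,r)\cap\partial\Omega_{\mathcal F}$. Then $(\Omega_{\mathcal F},m,\sigma_\star)$ satisfies: (H1) There is a constant $c_1>0$ such that for each $x\in\partial\Omega_{\mathcal F}$ and $r>0$ there is a point $X\in B(x,r)$ with $B(X,c_1r)\subset\Omega_{\mathcal F}$. (H2) There is a positive integer $C_2=N+1$ such that for each $r>0$ and $X_1,X_2\in\Omega_{\mathcal F}$ with $\delta_\star(X_i)>r$ $(i=1,2)$ and $|X_1-X_2|\le7c_1^{-1}r$, there exist $N+1$ points $Z_0=X_1,Z_1,\dots,Z_N=X_2$ in $\Omega_{\mathcal F}$ with $|Z_i-Z_{i+1}|<\delta_\star(Z_i)/2$.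 (H3) The support of $\sigma_\star$ is $\partial\Omega_{\mathcal F}$, and $\sigma_\star$ is doubling: there is $C_3>1$ such that $\sigma_\star(\Delta_\star(x,2r))\le C_3\sigma_\star(\Delta_\star(x,r))$ for each $x\in\partial\Omega_{\mathcal F}$, $r>0$. (H4) $m$ is mutually absolutely continuous with respect to Lebesgue measure; that is, $m(E)=\iint_Ew(X)\,dX$ for Borel $E\subset\Omega_{\mathcal F}$ with a weight $w\in L^1_{loc}(\Omega_{\mathcal F})$ that is positive Lebesgue-a.e. in $\Omega_{\mathcal F}$. In addition $m$ is doubling in $\overline{\Omega_{\mathcal F}}$: there is $C_4$ with $m(B(X,2r)\cap\Omega_{\mathcal F})\le C_4m(B(X,r)\cap\Omega_{\mathcal F})$ for each $X\in\overline{\Omega_{\mathcal F}}$, $r>0$. (H5) The function $\rho(x,r):=\dfrac{m(B(x,r)\cap\Omega_{\mathcal F})}{r\,\sigma_\star(\Delta_\star(x,r))}$ ($x\in\partial\Omega_{\mathcal F}$, $r>0$) verifies, for some constant $C_5$ and $\varepsilon:=1/C_5$, $$\frac{\rho(x,r)}{\rho(x,s)}\le C_5\Big(\frac rs\Big)^{1-\varepsilon},\qquad x\in\partial\Omega_{\mathcal F},\ 0<s<r.$$ (H6) If $D$ is compactly contained in $\Omega_{\mathcal F}$ and $u_i\in C^\infty(\overline D)$ is a sequence with $\int_D|u_i|\,dm\to0$ and $\int_D|\nabla u_i-v|^2\,dm\to0$ as $i\to\infty$, where $v$ is a vector-valued function in $L^2(D,dm)$, then $v\equiv0$.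
   Context: **$d$-ADR.** $C_d^{-1}r^d\le\mathcal H^d(\Gamma\cap B(x,r))\le C_dr^d$ for all $x\in\Gamma$, $r>0$. $\Omega=\mathbb R^n\setminus\Gamma$, $\sigma=\mathcal H^d|_\Gamma$, $\delta(X)=\operatorname{dist}(X,\Gamma)$, $\Delta(x,r)=B(x,r)\cap\Gamma$. **Dyadic cubes.** Fix constants $a_0\in(0,1]$, $A_0\ge1$, $\zeta\in(0,1)$ (depending only on $n,d,C_d$) and, for each $k\in\mathbb Z$, a collection $\mathbb D^k$ of Borel subsets of $\Gamma$ (such a system exists) with: (i) $\Gamma$ is the union of $\mathbb D^k$; (ii) if $m\ge k$, $Q'\in\mathbb D^m$, $Q\in\mathbb D^k$, then $Q'\subset Q$ or $Q'\cap Q=\varnothing$; (iii) for $m<k$ each $Q\in\mathbb D^k$ lies in a unique element of $\mathbb D^m$; (iv) $\operatorname{diam}Q<A_02^{-k}$ for $Q\in\mathbb D^k$; (v) each $Q\in\mathbb D^k$ contains some $\Delta(x,a_02^{-k})$; (vi) $\sigma(\{x\in Q:\operatorname{dist}(x,\Gamma\setminus Q)\le\rho2^{-k}\})\le A_0\rho^\zeta\sigma(Q)$ for $Q\in\mathbb D^k$, $\rho\in(0,a_0)$. Let $\mathbb D=\bigcup_k\mathbb D^k$ (cubes regarded as subsets of $\Gamma$), $\ell(Q)=2^{-k(Q)}$ with $k(Q)=\min\{k:Q\in\mathbb D^k\}$, $\mathbb D_Q=\{Q'\in\mathbb D:Q'\subseteq Q\}$, and let the center $x_Q$ satisfy $\Delta(x_Q,a_0\ell(Q))\subset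 Q\subseteq\Delta(x_Q,A_0\ell(Q))$. Put $c_{\mathbb K}=a_0\big/\big(2^{(2d+1)/d}C_d^{2/d}A_0\big)$. **Whitney boxes.** $\mathcal W$ is a collection of closed dyadic boxes covering $\Omega$ with disjoint interiors, $4\operatorname{diam}I\le\operatorname{dist}(4I,\Gamma)\le\operatorname{dist}(I,\Gamma)\le40\operatorname{diam}I$, and $\frac14\operatorname{diam}I_1\le\operatorname{diam}I_2\le4\operatorname{diam}I_1$ if $\partial I_1\cap\partial I_2\ne\varnothing$. $X_I$ is the center and $\ell(I)$ the side length of $I$. **Corkscrews and Harnack Chains.** There are $c,c_{\mathcal H}\in(0,1)$ depending only on $n,d,C_d$ such that: every $\Delta(x,r)$ has a Corkscrew point $X$, i.e. $B(X,cr)\subset B(x,r)\cap\Omega$; and if $\Lambda\ge1$, $\delta(X_1),\delta(X_2)\ge s$, $|X_1-X_2|\le\Lambda s$, there are $Y_i\in B(X_i,s/2)$ with $\operatorname{dist}([Y_1,Y_2],\Gamma)\ge c_{\mathcal H}\Lambda^{-d/(n-1-d)}s$. A Harnack Chain connecting $X_1$ and $X_2$ (with parameters $s,\Lambda$) is the union of finitely many balls covering such a segment $[Y_1,Y_2]$, centered on it with centers spaced by the common radius $\frac12c_{\mathcal H}\Lambda^{-d/(n-1-d)}s$. **Sawtooth domain.** Fix $\eta\in(0,c_{\mathbb K})$, $K\ge500A_0a_0^{-1}$ and $\theta\in(0,1/(16\sqrt n))$; let $I^*=(1+\theta)I$ (concentric dilation). For $Q\in\mathbb D$ let $$\mathcal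 W_Q^0=\Big\{I\in\mathcal W:\tfrac{a_0c}{82\sqrt n}\eta\,\ell(Q)\le\ell(I)\le\tfrac{a_0}{4\sqrt n}K\ell(Q),\ \operatorname{dist}(I,Q)\le a_0K\ell(Q)\Big\}.$$ Fix a Corkscrew point $X_Q$ for $\Delta(x_Q,a_0\ell(Q))$ lying in some box of $\mathcal W_Q^0$; for each $I\in\mathcal W_Q^0$ fix a Harnack Chain $\mathcal H_I$ connecting $X_I$ to $X_Q$ with $s=\frac2{41}a_0c\eta\ell(Q)$ and $\Lambda=\frac{41}{2c\eta}(1+\frac54K+\frac{A_0}{a_0})$, meeting $I$. Let $\mathcal W_Q=\{J\in\mathcal W:\mathcal H_I\cap J\ne\varnothing\text{ for some }I\in\mathcal W_Q^0\}\supset\mathcal W_Q^0$, $U_Q=\bigcup_{I\in\mathcal W_Q}I^*$. For a family $\mathcal F=\{Q_j\}\subset\mathbb D$ of pairwise disjoint cubes let $\mathbb D_{\mathcal F}=\mathbb D\setminus\bigcup_j\mathbb D_{Q_j}$ and $\Omega_{\mathcal F}=\operatorname{int}\big(\bigcup_{Q\in\mathbb D_{\mathcal F}}U_Q\big)$. *)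

theory Defs
  imports "HOL-Analysis.Analysis"
begin

text \<open>
  Hausdorff measure with the normalisation \<open>H\<^sup>s(E) = lim inf (\<Sum>i. diam(U\<^sub>i)\<^sup>s)\<close>, without the volume
  factor of the unit ball (rescaling only changes the constants). It is only used for \<open>s > 0\<close>, where
  \<open>0 powr s = 0\<close> is the right convention. \<open>bounded\<close> is needed because \<^const>\<open>diameter\<close> is
  unspecified on unbounded sets.
\<close>

definition hausdorff_pre :: "real \<Rightarrow> real \<Rightarrow> 'a::metric_space set \<Rightarrow> ennreal" where
  "hausdorff_pre s \<delta> E =
     (INF U\<in>{U :: nat \<Rightarrow> 'a set. (\<forall>i. bounded (U i) \<and> diameter (U i) \<le> \<delta>) \<and> E \<subseteq> (\<Union>i. U i)}.
        \<Sum>i. ennreal (diameter (U i) powr s))"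

definition hausdorff_outer :: "real \<Rightarrow> 'a::metric_space set \<Rightarrow> ennreal" where
  "hausdorff_outer s E = (SUP \<delta>\<in>{0<..}. hausdorff_pre s \<delta> E)"

text \<open>
  \<^const>\<open>measure_of\<close> silently yields the zero measure if it is not given a measure; that this does
  not happen here is \<open>emeasure_hausdorff_measure\<close> below.
\<close>

definition hausdorff_measure :: "real \<Rightarrow> 'a::metric_space measure" where
  "hausdorff_measure s = measure_of UNIV (sets borel) (hausdorff_outer s)"

lemma hausdorff_pre_le:
  assumes "\<And>i. bounded (U i)" "\<And>i. diameter (U i) \<le> \<delta>" "E \<subseteq> (\<Union>i. U i)"
  shows "hausdorff_pre s \<delta> E \<le> (\<Sum>i. ennreal (diameter (U i) powr s))"
  unfolding hausdorff_pre_def using assms by (intro INF_lower) auto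

lemma hausdorff_pre_close:
  assumes "hausdorff_pre s \<delta> E < e"
  shows "\<exists>U. (\<forall>i. bounded (U i) \<and> diameter (U i) \<le> \<delta>) \<and> E \<subseteq> (\<Union>i. U i) \<and>
             (\<Sum>i. ennreal (diameter (U i) powr s)) < e"
  using assms unfolding hausdorff_pre_def INF_less_iff by auto

lemma hausdorff_pre_mono: "A \<subseteq> B \<Longrightarrow> hausdorff_pre s \<delta> A \<le> hausdorff_pre s \<delta> B"
  unfolding hausdorff_pre_def by (rule INF_superset_mono) auto

lemma hausdorff_pre_antimono: "\<delta> \<le> \<delta>' \<Longrightarrow> hausdorff_pre s \<delta>' A \<le> hausdorff_pre s \<delta> A"
  unfolding hausdorff_pre_def by (rule INF_superset_mono) (auto intro: order_trans)

lemma hausdorff_pre_subadditive: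
  "hausdorff_pre s \<delta> (\<Union>i. A i) \<le> (\<Sum>i. hausdorff_pre s \<delta> (A i))"
proof (rule ennreal_le_epsilon)
  fix e :: real assume e: "0 < e" and fin: "(\<Sum>n. hausdorff_pre s \<delta> (A n)) < top"
  let ?h = "\<lambda>U. ennreal (diameter U powr s)"
  from e fin have *: "\<And>n. hausdorff_pre s \<delta> (A n) < hausdorff_pre s \<delta> (A n) + e * (1/2)^Suc n"
    by (auto simp add: less_top dest!: ennreal_suminf_lessD)
  have "\<forall>n. \<exists>U. (\<forall>i. bounded (U i) \<and> diameter (U i) \<le> \<delta>) \<and> A n \<subseteq> (\<Union>i. U i) \<and>
      (\<Sum>i. ?h (U i)) < hausdorff_pre s \<delta> (A n) + e * (1/2)^Suc n"
    using hausdorff_pre_close[OF *] by blast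
  then obtain B where B: "\<And>n i. bounded (B n i)" "\<And>n i. diameter (B n i) \<le> \<delta>"
      "\<And>n. A n \<subseteq> (\<Union>i. B n i)"
      and Ble: "\<And>n. (\<Sum>i. ?h (B n i)) < hausdorff_pre s \<delta> (A n) + e * (1/2)^Suc n"
    by metis
  define C where "C = case_prod B o prod_decode"
  have "(\<Union>i. A i) \<subseteq> (\<Union>i. C i)"
    using B(3) by (auto simp add: C_def subset_eq) (metis prod.case prod_encode_inverse)
  then have "hausdorff_pre s \<delta> (\<Union>i. A i) \<le> (\<Sum>i. ?h (C i))"
    using B by (intro hausdorff_pre_le) (auto simp: C_def split_def)
  also have "\<dots> = (\<Sum>n. \<Sum>i. ?h (B n i))"
    unfolding C_def comp_def
    by (rule suminf_ennreal_2dimen[where f = "\<lambda>p. ?h (case_prod B p)"]) simp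
  also have "\<dots> \<le> (\<Sum>n. hausdorff_pre s \<delta> (A n) + e * (1/2) ^ Suc n)"
    by (intro suminf_le allI less_imp_le[OF Ble]) auto
  also have "... = (\<Sum>n. hausdorff_pre s \<delta> (A n)) + (\<Sum>n. ennreal e * ennreal ((1/2) ^ Suc n))"
    using \<open>0 < e\<close> by (subst suminf_add[symmetric])
                     (auto simp del: ennreal_suminf_cmult simp add: ennreal_mult[symmetric])
  also have "\<dots> = (\<Sum>n. hausdorff_pre s \<delta> (A n)) + e"
    unfolding ennreal_suminf_cmult
    by (subst suminf_ennreal_eq[OF zero_le_power power_half_series]) auto
  finally show "hausdorff_pre s \<delta> (\<Union>i. A i) \<le> (\<Sum>n. hausdorff_pre s \<delta> (A n)) + e" .
qed

lemma hausdorff_pre_le_outer: "\<delta> > 0 \<Longrightarrow> hausdorff_pre s \<delta> A \<le> hausdorff_outer s A"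
  unfolding hausdorff_outer_def by (rule SUP_upper) auto

lemma hausdorff_outer_space: "outer_measure_space UNIV (hausdorff_outer s)"
proof -
  have "hausdorff_pre s \<delta> {} = 0" if "\<delta> > 0" for \<delta> :: real
    using hausdorff_pre_le[of "\<lambda>_. {}" \<delta> "{}" s] that by simp
  then have "hausdorff_outer s {} = 0"
    unfolding hausdorff_outer_def by (intro antisym SUP_least) auto
  moreover have "hausdorff_outer s A \<le> hausdorff_outer s B" if "A \<subseteq> B" for A B :: "'a set"
    unfolding hausdorff_outer_def using hausdorff_pre_mono[OF that] by (intro SUP_mono) blast
  moreover have "hausdorff_outer s (\<Union>i. A i) \<le> (\<Sum>i. hausdorff_outer s (A i))" for A :: "nat \<Rightarrow> 'a set"
  proof -
    have "hausdorff_pre s \<delta> (\<Union>i. A i) \<le> (\<Sum>i. hausdorff_outer s (A i))" if "\<delta> > 0" for \<delta>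
      using hausdorff_pre_subadditive[of s \<delta> A]
      by (rule order_trans) (intro suminf_le hausdorff_pre_le_outer that summableI)
    then show ?thesis unfolding hausdorff_outer_def[of s "\<Union>i. A i"] by (intro SUP_least) auto
  qed
  ultimately show ?thesis
    unfolding outer_measure_space_def positive_def increasing_def countably_subadditive_def by auto
qed

lemma hausdorff_outer_separated:
  assumes e: "e > 0" and sep: "\<And>x y. x \<in> A \<Longrightarrow> y \<in> B \<Longrightarrow> e \<le> dist x y"
  shows "hausdorff_outer s A + hausdorff_outer s B \<le> hausdorff_outer s (A \<union> B)"
proof -
  have *: "hausdorff_pre s \<delta>1 A + hausdorff_pre s \<delta>2 B \<le> hausdorff_outer s (A \<union> B)"
    if d: "\<delta>1 > 0" "\<delta>2 > 0" for \<delta>1 \<delta>2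
  proof -
    define \<delta> where "\<delta> = min (e/2) (min \<delta>1 \<delta>2)"
    have \<delta>: "0 < \<delta>" "\<delta> < e" "\<delta> \<le> \<delta>1" "\<delta> \<le> \<delta>2" using e d by (auto simp: \<delta>_def)
    have "hausdorff_pre s \<delta>1 A + hausdorff_pre s \<delta>2 B \<le> hausdorff_pre s \<delta> A + hausdorff_pre s \<delta> B"
      using \<delta> by (intro add_mono hausdorff_pre_antimono)
    also have "\<dots> \<le> hausdorff_pre s \<delta> (A \<union> B)"
      unfolding hausdorff_pre_def[of s \<delta> "A \<union> B"]
    proof (safe intro!: INF_greatest)
      fix U :: "nat \<Rightarrow> 'a set"
      assume U: "\<forall>i. bounded (U i) \<and> diameter (U i) \<le> \<delta>" "A \<union> B \<subseteq> (\<Union>i. U i)"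
      define V where "V i = (if U i \<inter> A = {} then {} else U i)" for i
      define W where "W i = (if U i \<inter> A = {} then U i else {})" for i
      have disj: "U i \<inter> B = {}" if ne: "U i \<inter> A \<noteq> {}" for i
      proof (rule ccontr)
        assume "U i \<inter> B \<noteq> {}"
        then obtain x y where "x \<in> U i" "y \<in> U i" "x \<in> A" "y \<in> B" using ne by auto
                moreover have "bounded (U i)" "diameter (U i) \<le> \<delta>" using U(1) by auto
        ultimately show False
          using sep[of x y] diameter_bounded_bound[of "U i" x y] \<delta>(2) by linarith
      qed
      have "A \<subseteq> (\<Union>i. V i)" using U(2) by (fastforce simp: V_def)
      moreover have "B \<subseteq> (\<Union>i. W i)"
      proof
        fix y assume "y \<in> B"
        moreover then obtain i where "y \<in> U i" using U(2) by auto
        ultimately show "y \<in> (\<Union>i. W i)" using disj[of i] by (auto simp: W_def intro!: exI[of _ i])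
      qed
      ultimately have "hausdorff_pre s \<delta> A + hausdorff_pre s \<delta> B \<le>
          (\<Sum>i. ennreal (diameter (V i) powr s)) + (\<Sum>i. ennreal (diameter (W i) powr s))"
        using U(1) \<delta>(1) by (intro add_mono hausdorff_pre_le) (auto simp: V_def W_def)
      also have "\<dots> = (\<Sum>i. ennreal (diameter (V i) powr s) + ennreal (diameter (W i) powr s))"
        by (rule suminf_add) auto
      also have "\<dots> = (\<Sum>i. ennreal (diameter (U i) powr s))"
        by (rule arg_cong[where f=suminf]) (auto simp: V_def W_def fun_eq_iff)
      finally show "hausdorff_pre s \<delta> A + hausdorff_pre s \<delta> B \<le> (\<Sum>i. ennreal (diameter (U i) powr s))" .
    qed
    also have "\<dots> \<le> hausdorff_outer s (A \<union> B)" by (rule hausdorff_pre_le_outer[OF \<delta>(1)])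
    finally show ?thesis .
  qed
  have ne: "{0<..} \<noteq> ({} :: real set)" by auto
  have "hausdorff_outer s A + hausdorff_outer s B
      = (SUP \<delta>2\<in>{0<..}. SUP \<delta>1\<in>{0<..}. hausdorff_pre s \<delta>1 A + hausdorff_pre s \<delta>2 B)"
    unfolding hausdorff_outer_def
    by (simp add: ennreal_SUP_add_left[OF ne] ennreal_SUP_add_right[OF ne])
  also have "\<dots> \<le> hausdorff_outer s (A \<union> B)" using * by (intro SUP_least) auto
  finally show ?thesis .
qed

lemma metric_outer_closed:
  fixes f :: "'a::metric_space set \<Rightarrow> ennreal"
  assumes oms: "outer_measure_space UNIV f"
    and sep: "\<And>A B e. e > 0 \<Longrightarrow> (\<And>x y. x \<in> A \<Longrightarrow> y \<in> B \<Longrightarrow> e \<le> dist x y) \<Longrightarrow> f A + f B \<le> f (A \<union> B)"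
    and "closed A"
  shows "f (X \<inter> A) + f (X - A) \<le> f X"
proof (cases "A = {} \<or> f X = top")
  case True
  from oms have "f {} = 0" by (auto simp: outer_measure_space_def positive_def)
  with True show ?thesis by auto
next
  case False
  then have ne: "A \<noteq> {}" and fin: "f X < top" by (auto simp: less_top)
  from oms have f0: "f {} = 0" and mono: "\<And>S T. S \<subseteq> T \<Longrightarrow> f S \<le> f T"
    by (auto simp: outer_measure_space_def positive_def increasing_def)
  from oms have csa: "countably_subadditive UNIV f" by (auto simp: outer_measure_space_def)
  interpret U: sigma_algebra UNIV "UNIV :: 'a set set"
    using sigma_algebra_Pow[of "UNIV :: 'a set"] by simp
  have sa: "f (S \<union> T) \<le> f S + f T" for S T
  proof -
    have "f (S \<union> (T - S)) \<le> f S + f (T - S)"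
      using U.countably_subadditive_subadditive[OF _ csa] f0
      unfolding positive_def subadditive_def by (metis Diff_disjoint UNIV_I)
    also have "\<dots> \<le> f S + f T" by (intro add_left_mono mono) auto
    finally show ?thesis by simp
  qed
  define a where "a n = 1 / real (Suc n)" for n
  have apos: "0 < a n" and adec: "a (Suc n) < a n" for n by (auto simp: a_def field_simps)
  have alim: "a \<longlonglongrightarrow> 0" unfolding a_def by (rule LIMSEQ_Suc[OF lim_1_over_n, unfolded o_def])
  have amono: "a n \<le> a m" if "m \<le> n" for m n using that by (auto simp: a_def field_simps)
  define g where "g x = infdist x A" for x
  define B where "B n = {x \<in> X - A. a n \<le> g x}" for n
  define R where "R n = {x \<in> X - A. a (Suc n) \<le> g x \<and> g x < a n}" for n
  have gl: "\<bar>g x - g y\<bar> \<le> dist x y" for x y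
    unfolding g_def using infdist_triangle_abs[of x A y] by simp
  have gpos: "0 < g x" if "x \<notin> A" for x
    unfolding g_def using \<open>closed A\<close> ne that infdist_pos_not_in_closed by blast
  have split: "X - A \<subseteq> B n \<union> (\<Union>k. R (k + n))" for n
  proof
    fix x assume x: "x \<in> X - A"
    obtain N where N: "a N < g x"
      using order_tendstoD(2)[OF alim gpos[of x]] x by (auto simp: eventually_sequentially)
    show "x \<in> B n \<union> (\<Union>k. R (k + n))"
    proof (cases "a n \<le> g x")
      case True with x show ?thesis by (auto simp: B_def)
    next
      case F: False
      define m where "m = (LEAST m. a m \<le> g x)"
      have m: "a m \<le> g x" unfolding m_def by (rule LeastI[of _ N]) (use N in simp)
      have "m > n" using F m amono[of m n] by (cases "m \<le> n") auto
      have "\<not> a (m - 1) \<le> g x" using \<open>m > n\<close> unfolding m_def by (intro not_less_Least) auto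
      then have "x \<in> R (m - 1)" using m x \<open>m > n\<close> by (auto simp: R_def)
      moreover have "m - 1 = (m - 1 - n) + n" using \<open>m > n\<close> by simp
      ultimately show ?thesis by (metis UN_I UNIV_I UnI2)
    qed
  qed
  have par: "(\<Sum>k<N. f (R (2 * k + j))) \<le> f (X \<inter> (\<Union>k<N. R (2 * k + j)))" for N j
  proof (induction N)
    case 0 then show ?case by simp
  next
    case (Suc N)
    have "f (X \<inter> (\<Union>k<N. R (2 * k + j))) + f (R (2 * N + j))
       \<le> f ((X \<inter> (\<Union>k<N. R (2 * k + j))) \<union> R (2 * N + j))"
    proof (cases N)
      case 0 then show ?thesis by (simp add: f0)
    next
      case (Suc M)
      show ?thesis
      proof (rule sep[of "a (2 * M + j + 1) - a (2 * M + j + 2)"])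
        show "0 < a (2 * M + j + 1) - a (2 * M + j + 2)" using adec[of "2*M+j+1"] by simp
        fix x y assume "x \<in> X \<inter> (\<Union>k<N. R (2 * k + j))" and y: "y \<in> R (2 * N + j)"
        then obtain k where k: "k < N" "x \<in> R (2 * k + j)" by auto
        then have "a (2 * M + j + 1) \<le> g x"
          using amono[of "Suc (2 * k + j)" "2 * M + j + 1"] Suc by (auto simp: R_def)
        moreover have "g y < a (2 * M + j + 2)" using y Suc by (auto simp: R_def)
        ultimately show "a (2 * M + j + 1) - a (2 * M + j + 2) \<le> dist x y"
          using gl[of x y] by linarith
      qed
    qed
    also have "(X \<inter> (\<Union>k<N. R (2 * k + j))) \<union> R (2 * N + j) = X \<inter> (\<Union>k<Suc N. R (2 * k + j))"
      by (auto simp: less_Suc_eq R_def)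
    finally show ?case using Suc.IH by (simp add: add.commute) (meson add_left_mono order_trans)
  qed
  have par': "(\<Sum>k<N. f (R (2 * k + j))) \<le> f X" for N j
    by (rule order_trans[OF par mono]) auto
  have "(\<Sum>n. f (R n)) \<le> f X + f X"
  proof (rule suminf_le_const)
    fix n
    have "(\<Sum>k<n. f (R k)) \<le> (\<Sum>k<2*n. f (R k))" by (rule sum_mono2) auto
    also have "\<dots> = (\<Sum>k<n. f (R (2*k+0))) + (\<Sum>k<n. f (R (2*k+1)))"
      by (induction n) (auto simp: algebra_simps)
    also have "\<dots> \<le> f X + f X"
      by (intro add_mono par')
    finally show "(\<Sum>k<n. f (R k)) \<le> f X + f X" .
  qed auto
  then have Rfin: "(\<Sum>n. f (R n)) < top" 
    by (rule le_less_trans) (use fin in \<open>simp add: ennreal_add_eq_top less_top\<close>)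
  define r where "r n = enn2real (f (R n))" for n
  have r: "0 \<le> r n" "f (R n) = ennreal (r n)" for n
    using ennreal_suminf_lessD[OF Rfin, of n] by (simp_all add: r_def)
  have sr: "summable r"
    using Rfin r by (intro summable_suminf_not_top) auto
  have main: "f (X \<inter> A) + f (X - A) \<le> f X + (\<Sum>k. f (R (k + n)))" for n
  proof -
    have "f (X - A) \<le> f (B n \<union> (\<Union>k. R (k + n)))" by (rule mono[OF split])
    also have "\<dots> \<le> f (B n) + f (\<Union>k. R (k + n))" by (rule sa)
    also have "f (\<Union>k. R (k + n)) \<le> (\<Sum>k. f (R (k + n)))"
    proof -
      have "disjoint_family (\<lambda>k. R (k + n))"
        unfolding disjoint_family_on_def
      proof safe
        fix i j x assume "i \<noteq> j" "x \<in> R (i + n)" "x \<in> R (j + n)"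
        then show "x \<in> {}"
          using amono[of "Suc (i + n)" "j + n"] amono[of "Suc (j + n)" "i + n"]
          by (cases "i < j") (auto simp: R_def)
      qed
      then show ?thesis using csa by (auto simp: countably_subadditive_def)
    qed
    finally have 1: "f (X - A) \<le> f (B n) + (\<Sum>k. f (R (k + n)))" by (simp add: add_left_mono)
    have "f (X \<inter> A) + f (B n) \<le> f ((X \<inter> A) \<union> B n)"
    proof (rule sep[OF apos[of n]])
      fix x y assume "x \<in> X \<inter> A" "y \<in> B n"
      then show "a n \<le> dist x y"
        unfolding B_def g_def using infdist_le[of x A y] by (auto simp: dist_commute)
    qed
    also have "\<dots> \<le> f X" by (rule mono) (auto simp: B_def)
    finally have 2: "f (X \<inter> A) + f (B n) \<le> f X" .
    have "f (X \<inter> A) + f (X - A) \<le> f (X \<inter> A) + (f (B n) + (\<Sum>k. f (R (k + n))))"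
      by (rule add_left_mono[OF 1])
    also have "\<dots> = (f (X \<inter> A) + f (B n)) + (\<Sum>k. f (R (k + n)))" by (simp add: add.assoc)
    also have "\<dots> \<le> f X + (\<Sum>k. f (R (k + n)))" by (rule add_right_mono[OF 2])
    finally show ?thesis .
  qed
  show ?thesis
  proof (rule ennreal_le_epsilon)
    fix e :: real assume "0 < e"
    then obtain n where "norm (\<Sum>i. r (i + n)) < e" using suminf_exist_split[OF _ sr] by blast
    moreover have "(\<Sum>k. f (R (k + n))) = ennreal (\<Sum>k. r (k + n))"
      using r sr by (simp add: suminf_ennreal2 summable_ignore_initial_segment)
    ultimately have "(\<Sum>k. f (R (k + n))) \<le> ennreal e" by (auto intro!: ennreal_leI)
    then show "f (X \<inter> A) + f (X - A) \<le> f X + ennreal e"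
      using main[of n] by (meson add_left_mono order_trans)
  qed
qed

lemma measure_space_hausdorff: "measure_space UNIV (sets borel) (hausdorff_outer s :: 'a::metric_space set \<Rightarrow> _)"
proof -
  interpret U: sigma_algebra UNIV "UNIV :: 'a set set"
    using sigma_algebra_Pow[of "UNIV :: 'a set"] by simp
  let ?L = "lambda_system UNIV UNIV (hausdorff_outer s :: 'a set \<Rightarrow> _)"
  have ms: "measure_space UNIV ?L (hausdorff_outer s)"
    by (rule U.caratheodory_lemma[OF hausdorff_outer_space])
  have "A \<in> ?L" if "closed A" for A :: "'a set"
    unfolding lambda_system_def
  proof safe
    fix X :: "'a set"
    have csa: "countably_subadditive UNIV (hausdorff_outer s :: 'a set \<Rightarrow> _)"
      and pos: "positive UNIV (hausdorff_outer s :: 'a set \<Rightarrow> _)"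
      using hausdorff_outer_space[of s] by (auto simp: outer_measure_space_def)
    have "hausdorff_outer s ((A \<inter> X) \<union> ((UNIV - A) \<inter> X))
        \<le> hausdorff_outer s (A \<inter> X) + hausdorff_outer s ((UNIV - A) \<inter> X)"
      by (rule subadditiveD[OF U.countably_subadditive_subadditive[OF pos csa]]) auto
    also have "(A \<inter> X) \<union> ((UNIV - A) \<inter> X) = X" by auto
    finally have "hausdorff_outer s X
        \<le> hausdorff_outer s (A \<inter> X) + hausdorff_outer s ((UNIV - A) \<inter> X)" .
    moreover have "hausdorff_outer s (X \<inter> A) + hausdorff_outer s (X - A) \<le> hausdorff_outer s X"
      by (rule metric_outer_closed[OF hausdorff_outer_space hausdorff_outer_separated that])
    moreover have "X \<inter> A = A \<inter> X" "X - A = (UNIV - A) \<inter> X" by auto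
    ultimately show "hausdorff_outer s (A \<inter> X) + hausdorff_outer s ((UNIV - A) \<inter> X) = hausdorff_outer s X"
      by simp
  qed auto
  then have "sigma_sets UNIV (Collect closed) \<subseteq> ?L"
    using ms by (intro sigma_algebra.sigma_sets_subset) (auto simp: measure_space_def)
  then have "sets borel \<subseteq> ?L" by (simp add: borel_eq_closed)
  then show ?thesis
    using ms by (auto simp: measure_space_def positive_def countably_additive_def sets.sigma_algebra_axioms[of borel, simplified])
qed

lemma space_hausdorff_measure [simp]: "space (hausdorff_measure s) = UNIV"
  and sets_hausdorff_measure [simp, measurable_cong]: "sets (hausdorff_measure s) = sets borel"
  unfolding hausdorff_measure_def
  using sets.space_measure_of_eq[of borel] sets.sets_measure_of_eq[of borel] by simp_all

lemma emeasure_hausdorff_measure: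
  "A \<in> sets borel \<Longrightarrow> emeasure (hausdorff_measure s) A = hausdorff_outer s A"
  unfolding hausdorff_measure_def
  by (rule emeasure_measure_of_sigma) (use measure_space_hausdorff[of s] in \<open>unfold measure_space_def, blast+\<close>)

definition ahlfors_david_regular :: "real \<Rightarrow> real \<Rightarrow> 'a::metric_space set \<Rightarrow> bool" where
  "ahlfors_david_regular d C \<Gamma> \<longleftrightarrow>
     (\<forall>x\<in>\<Gamma>. \<forall>r>0. ennreal (inverse C * r powr d) \<le> emeasure (hausdorff_measure d) (\<Gamma> \<inter> ball x r) \<and>
        emeasure (hausdorff_measure d) (\<Gamma> \<inter> ball x r) \<le> ennreal (C * r powr d))"


subsection \<open>Dyadic cubes of the boundary set\<close>

definition dyadic_system ::
  "real \<Rightarrow> 'a::metric_space set \<Rightarrow> real \<Rightarrow> real \<Rightarrow> real \<Rightarrow> (int \<Rightarrow> 'a set set) \<Rightarrow> bool" where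
  "dyadic_system d \<Gamma> a0 A0 \<zeta> \<DD> \<longleftrightarrow>
     (\<forall>k. \<forall>Q\<in>\<DD> k. Q \<in> sets borel \<and> Q \<subseteq> \<Gamma>) \<and>
     (\<forall>k. \<Union>(\<DD> k) = \<Gamma>) \<and>
     (\<forall>k m. k \<le> m \<longrightarrow> (\<forall>Q'\<in>\<DD> m. \<forall>Q\<in>\<DD> k. Q' \<subseteq> Q \<or> Q' \<inter> Q = {})) \<and>
     (\<forall>k m. m < k \<longrightarrow> (\<forall>Q\<in>\<DD> k. \<exists>!R. R \<in> \<DD> m \<and> Q \<subseteq> R)) \<and>
     (\<forall>k. \<forall>Q\<in>\<DD> k. bounded Q \<and> diameter Q < A0 * 2 powi (- k)) \<and>
     (\<forall>k. \<forall>Q\<in>\<DD> k. \<exists>x\<in>\<Gamma>. ball x (a0 * 2 powi (- k)) \<inter> \<Gamma> \<subseteq> Q) \<and>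
     (\<forall>k. \<forall>Q\<in>\<DD> k. \<forall>\<rho>. 0 < \<rho> \<and> \<rho> < a0 \<longrightarrow>
        emeasure (hausdorff_measure d) {x \<in> Q. infdist x (\<Gamma> - Q) \<le> \<rho> * 2 powi (- k)}
          \<le> ennreal (A0 * \<rho> powr \<zeta>) * emeasure (hausdorff_measure d) Q)"

definition all_cubes :: "(int \<Rightarrow> 'a set set) \<Rightarrow> 'a set set" where
  "all_cubes \<DD> = (\<Union>k. \<DD> k)"

definition cube_length :: "(int \<Rightarrow> 'a set set) \<Rightarrow> 'a set \<Rightarrow> real" where
  "cube_length \<DD> Q = 2 powi (- (LEAST k. Q \<in> \<DD> k))"

definition cube_centres ::
  "'a::metric_space set \<Rightarrow> real \<Rightarrow> real \<Rightarrow> (int \<Rightarrow> 'a set set) \<Rightarrow> ('a set \<Rightarrow> 'a) \<Rightarrow> bool" where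
  "cube_centres \<Gamma> a0 A0 \<DD> xc \<longleftrightarrow>
     (\<forall>Q\<in>all_cubes \<DD>. xc Q \<in> \<Gamma> \<and> ball (xc Q) (a0 * cube_length \<DD> Q) \<inter> \<Gamma> \<subseteq> Q \<and>
        Q \<subseteq> ball (xc Q) (A0 * cube_length \<DD> Q) \<inter> \<Gamma>)"

definition cubes_below :: "(int \<Rightarrow> 'a set set) \<Rightarrow> 'a set \<Rightarrow> 'a set set" where
  "cubes_below \<DD> Q = {Q' \<in> all_cubes \<DD>. Q' \<subseteq> Q}"

definition cubes_outside :: "(int \<Rightarrow> 'a set set) \<Rightarrow> 'a set set \<Rightarrow> 'a set set" where
  "cubes_outside \<DD> \<F> = all_cubes \<DD> - (\<Union>Q\<in>\<F>. cubes_below \<DD> Q)"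


subsection \<open>Whitney boxes\<close>

text \<open>A box is represented by its centre and its side length.\<close>

type_synonym 'n box = "(real^'n) \<times> real"

definition box_set :: "'n box \<Rightarrow> (real^'n) set" where
  "box_set I = {y. \<forall>i. \<bar>y $ i - fst I $ i\<bar> \<le> snd I / 2}"

definition dilate :: "real \<Rightarrow> 'n::finite box \<Rightarrow> 'n box" where
  "dilate t I = (fst I, t * snd I)"

definition dyadic_box :: "'n::finite box \<Rightarrow> bool" where
  "dyadic_box I \<longleftrightarrow> (\<exists>k::int. snd I = 2 powi (- k) \<and>
     (\<forall>i. \<exists>j::int. fst I $ i = (real_of_int j + 1/2) * 2 powi (- k)))"

definition whitney_decomposition :: "(real^'n) set \<Rightarrow> 'n box set \<Rightarrow> bool" where
  "whitney_decomposition \<Gamma> W \<longleftrightarrow>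
     (\<forall>I\<in>W. dyadic_box I) \<and>
     - \<Gamma> \<subseteq> (\<Union>I\<in>W. box_set I) \<and>
     pairwise (\<lambda>I J. interior (box_set I) \<inter> interior (box_set J) = {}) W \<and>
     (\<forall>I\<in>W. 4 * diameter (box_set I) \<le> setdist (box_set (dilate 4 I)) \<Gamma> \<and>
        setdist (box_set (dilate 4 I)) \<Gamma> \<le> setdist (box_set I) \<Gamma> \<and>
        setdist (box_set I) \<Gamma> \<le> 40 * diameter (box_set I)) \<and>
     (\<forall>I\<in>W. \<forall>J\<in>W. frontier (box_set I) \<inter> frontier (box_set J) \<noteq> {} \<longrightarrow>
        diameter (box_set I) / 4 \<le> diameter (box_set J) \<and>
        diameter (box_set J) \<le> 4 * diameter (box_set I))"


subsection \<open>Corkscrew points and Harnack chains\<close>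

definition corkscrew_point :: "real \<Rightarrow> 'a::metric_space set \<Rightarrow> 'a \<Rightarrow> real \<Rightarrow> 'a \<Rightarrow> bool" where
  "corkscrew_point c \<Gamma> x r X \<longleftrightarrow> ball X (c * r) \<subseteq> ball x r \<inter> - \<Gamma>"

definition harnack_distance :: "real \<Rightarrow> real \<Rightarrow> 'n::finite itself \<Rightarrow> real \<Rightarrow> real \<Rightarrow> real" where
  "harnack_distance d cH _ s \<Lambda> = cH * \<Lambda> powr (- d / (real CARD('n) - 1 - d)) * s"

definition harnack_segment ::
  "real \<Rightarrow> real \<Rightarrow> (real^'n) set \<Rightarrow> real \<Rightarrow> real \<Rightarrow> real^'n \<Rightarrow> real^'n \<Rightarrow> real^'n \<Rightarrow> real^'n \<Rightarrow> bool" where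
  "harnack_segment d cH \<Gamma> s \<Lambda> X1 X2 Y1 Y2 \<longleftrightarrow>
     Y1 \<in> ball X1 (s/2) \<and> Y2 \<in> ball X2 (s/2) \<and>
     harnack_distance d cH TYPE('n) s \<Lambda> \<le> setdist (closed_segment Y1 Y2) \<Gamma>"

definition corkscrew_constant :: "real \<Rightarrow> 'a::metric_space set \<Rightarrow> bool" where
  "corkscrew_constant c \<Gamma> \<longleftrightarrow> 0 < c \<and> c < 1 \<and> (\<forall>x\<in>\<Gamma>. \<forall>r>0. \<exists>X. corkscrew_point c \<Gamma> x r X)"

definition harnack_constant :: "real \<Rightarrow> real \<Rightarrow> (real^'n) set \<Rightarrow> bool" where
  "harnack_constant d cH \<Gamma> \<longleftrightarrow> 0 < cH \<and> cH < 1 \<and>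
     (\<forall>\<Lambda> s X1 X2. 1 \<le> \<Lambda> \<and> 0 < s \<and> s \<le> infdist X1 \<Gamma> \<and> s \<le> infdist X2 \<Gamma> \<and> dist X1 X2 \<le> \<Lambda> * s \<longrightarrow>
        (\<exists>Y1 Y2. harnack_segment d cH \<Gamma> s \<Lambda> X1 X2 Y1 Y2))"

text \<open>The centres \<open>Z 0, \<dots>, Z m\<close> are equally spaced along the segment, the gap being the radius.\<close>

definition harnack_chain ::
  "real \<Rightarrow> real \<Rightarrow> (real^'n) set \<Rightarrow> real \<Rightarrow> real \<Rightarrow> real^'n \<Rightarrow> real^'n \<Rightarrow> (real^'n) set \<Rightarrow> bool" where
  "harnack_chain d cH \<Gamma> s \<Lambda> X1 X2 H \<longleftrightarrow>
     (\<exists>Y1 Y2 Z (m::nat). harnack_segment d cH \<Gamma> s \<Lambda> X1 X2 Y1 Y2 \<and>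
        (let \<rho> = harnack_distance d cH TYPE('n) s \<Lambda> / 2 in
          (\<forall>i\<le>m. Z i \<in> closed_segment Y1 Y2) \<and>
          (\<forall>i\<le>m. \<forall>j\<le>m. dist (Z i) (Z j) = \<bar>real i - real j\<bar> * \<rho>) \<and>
          closed_segment Y1 Y2 \<subseteq> (\<Union>i\<le>m. ball (Z i) \<rho>) \<and>
          H = (\<Union>i\<le>m. ball (Z i) \<rho>)))"


subsection \<open>The sawtooth domain\<close>

definition whitney_initial ::
  "real \<Rightarrow> real \<Rightarrow> real \<Rightarrow> real \<Rightarrow> (int \<Rightarrow> (real^'n) set set) \<Rightarrow> 'n box set \<Rightarrow> (real^'n) set \<Rightarrow> 'n box set" where
  "whitney_initial a0 c \<eta> K \<DD> W Q =
     {I \<in> W. a0 * c / (82 * sqrt (real CARD('n))) * \<eta> * cube_length \<DD> Q \<le> snd I \<and>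
             snd I \<le> a0 / (4 * sqrt (real CARD('n))) * K * cube_length \<DD> Q \<and>
             setdist (box_set I) Q \<le> a0 * K * cube_length \<DD> Q}"

definition whitney_region ::
  "'n box set \<Rightarrow> ((real^'n) set \<Rightarrow> 'n box set) \<Rightarrow> ((real^'n) set \<Rightarrow> 'n box \<Rightarrow> (real^'n) set)
    \<Rightarrow> (real^'n) set \<Rightarrow> 'n box set" where
  "whitney_region W W0 H Q = {J \<in> W. \<exists>I\<in>W0 Q. H Q I \<inter> box_set J \<noteq> {}}"

definition sawtooth_domain ::
  "(int \<Rightarrow> (real^'n) set set) \<Rightarrow> ((real^'n) set \<Rightarrow> 'n box set) \<Rightarrow> real \<Rightarrow> (real^'n) set set \<Rightarrow> (real^'n) set" where
  "sawtooth_domain \<DD> WQ \<theta> \<F> =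
     interior (\<Union>Q\<in>cubes_outside \<DD> \<F>. \<Union>I\<in>WQ Q. box_set (dilate (1 + \<theta>) I))"


subsection \<open>The measures\<close>

definition dist_weight :: "real \<Rightarrow> (real^'n) set \<Rightarrow> real^'n \<Rightarrow> real" where
  "dist_weight d \<Gamma> X = infdist X \<Gamma> powr (d + 1 - real CARD('n))"

definition interior_measure :: "real \<Rightarrow> (real^'n) set \<Rightarrow> (real^'n) measure" where
  "interior_measure d \<Gamma> = density lebesgue (\<lambda>X. ennreal (dist_weight d \<Gamma> X))"

definition sigma_star :: "real \<Rightarrow> (real^'n) set \<Rightarrow> (real^'n) set \<Rightarrow> (real^'n) measure" where
  "sigma_star d \<Gamma> \<Omega> =
     measure_of (frontier \<Omega>) (sets (restrict_space borel (frontier \<Omega>)))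
       (\<lambda>E. emeasure (hausdorff_measure d) (E \<inter> \<Gamma>) +
            (\<integral>\<^sup>+X\<in>E - \<Gamma>. ennreal (dist_weight d \<Gamma> X) \<partial>hausdorff_measure (real CARD('n) - 1)))"

lemma space_sigma_star [simp]: "space (sigma_star d \<Gamma> \<Omega>) = frontier \<Omega>"
  by (simp add: sigma_star_def space_measure_of_conv)

lemma sets_sigma_star [simp]: "sets (sigma_star d \<Gamma> \<Omega>) = sets (restrict_space borel (frontier \<Omega>))"
  unfolding sigma_star_def using sets.sets_measure_of_eq[of "restrict_space borel (frontier \<Omega>)"]
  by (simp add: space_restrict_space)

lemma emeasure_sigma_star:
  fixes \<Gamma> \<Omega> :: "(real^'n) set"
  assumes \<Gamma>: "closed \<Gamma>" and E: "E \<in> sets borel" "E \<subseteq> frontier \<Omega>"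
  shows "emeasure (sigma_star d \<Gamma> \<Omega>) E =
    emeasure (hausdorff_measure d) (E \<inter> \<Gamma>) +
    (\<integral>\<^sup>+X\<in>E - \<Gamma>. ennreal (dist_weight d \<Gamma> X) \<partial>hausdorff_measure (real CARD('n) - 1))"
proof -
  let ?F = "frontier \<Omega>" and ?H = "hausdorff_measure (real CARD('n) - 1) :: (real^'n) measure"
  let ?R = "restrict_space borel ?F"
  let ?D = "density ?H (\<lambda>X. ennreal (dist_weight d \<Gamma> X))"
  have \<Gamma>b: "\<Gamma> \<in> sets borel" using \<Gamma> by simp
  have R: "A \<in> sets ?R \<longleftrightarrow> A \<in> sets borel \<and> A \<subseteq> ?F" for A
    by (subst sets_restrict_space_iff) (auto simp: frontier_closed)
  have "(\<lambda>X. infdist X \<Gamma>) \<in> borel_measurable borel"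
    by (intro borel_measurable_continuous_onI continuous_intros)
  then have wm: "(\<lambda>X. ennreal (dist_weight d \<Gamma> X)) \<in> borel_measurable ?H"
    unfolding dist_weight_def by measurable
  have D: "(\<integral>\<^sup>+X\<in>A - \<Gamma>. ennreal (dist_weight d \<Gamma> X) \<partial>?H) = emeasure ?D (A - \<Gamma>)"
    if "A \<in> sets ?R" for A
    using that \<Gamma>b wm by (subst emeasure_density) (auto simp: R)
  let ?\<mu> = "\<lambda>E. emeasure (hausdorff_measure d) (E \<inter> \<Gamma>) +
            (\<integral>\<^sup>+X\<in>E - \<Gamma>. ennreal (dist_weight d \<Gamma> X) \<partial>?H)"
  have "countably_additive (sets ?R) ?\<mu>"
    unfolding countably_additive_def
  proof safe
    fix A :: "nat \<Rightarrow> (real^'n) set"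
    assume A: "range A \<subseteq> sets ?R" and disj: "disjoint_family A" and UA: "\<Union>(range A) \<in> sets ?R"
    have Ab: "A i \<in> sets borel" for i using A R by blast
    have "(\<Sum>i. ?\<mu> (A i)) = (\<Sum>i. emeasure (hausdorff_measure d) (A i \<inter> \<Gamma>) + emeasure ?D (A i - \<Gamma>))"
      using A by (intro suminf_cong) (subst D, auto)
    also have "\<dots> = (\<Sum>i. emeasure (hausdorff_measure d) (A i \<inter> \<Gamma>)) + (\<Sum>i. emeasure ?D (A i - \<Gamma>))"
      by (rule suminf_add[symmetric]) auto
    also have "(\<Sum>i. emeasure (hausdorff_measure d) (A i \<inter> \<Gamma>)) = emeasure (hausdorff_measure d) (\<Union>i. A i \<inter> \<Gamma>)"
      using Ab \<Gamma>b disj by (intro suminf_emeasure) (auto simp: disjoint_family_on_def)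
    also have "(\<Sum>i. emeasure ?D (A i - \<Gamma>)) = emeasure ?D (\<Union>i. A i - \<Gamma>)"
      using Ab \<Gamma>b disj by (intro suminf_emeasure) (auto simp: disjoint_family_on_def)
    also have "(\<Union>i. A i \<inter> \<Gamma>) = \<Union>(range A) \<inter> \<Gamma>" by auto
    also have "(\<Union>i. A i - \<Gamma>) = \<Union>(range A) - \<Gamma>" by auto
    finally show "(\<Sum>i. ?\<mu> (A i)) = ?\<mu> (\<Union>(range A))" using D[OF UA] by simp
  qed
  moreover have "positive (sets ?R) ?\<mu>" by (simp add: positive_def)
  moreover have "sigma_algebra ?F (sets ?R)"
    using sets.sigma_algebra_axioms[of ?R] by (simp add: space_restrict_space)
  ultimately show ?thesis
    unfolding sigma_star_def using E R by (subst emeasure_measure_of_sigma) auto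
qed

definition measure_support :: "'a::topological_space measure \<Rightarrow> 'a set" where
  "measure_support \<mu> = {x \<in> space \<mu>. \<forall>U. open U \<and> x \<in> U \<longrightarrow> 0 < emeasure \<mu> (U \<inter> space \<mu>)}"


subsection \<open>Functions smooth up to the closure\<close>

definition partial_deriv :: "'n \<Rightarrow> (real^'n \<Rightarrow> real) \<Rightarrow> real^'n \<Rightarrow> real" where
  "partial_deriv i u x = frechet_derivative u (at x) (axis i 1)"

definition gradient :: "(real^'n \<Rightarrow> real) \<Rightarrow> real^'n \<Rightarrow> real^'n" where
  "gradient u x = (\<chi> i. partial_deriv i u x)"

fun iterated_partial :: "'n list \<Rightarrow> (real^'n \<Rightarrow> real) \<Rightarrow> real^'n \<Rightarrow> real" where
  "iterated_partial [] u = u"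
| "iterated_partial (i # is) u = partial_deriv i (iterated_partial is u)"

text \<open>
  For open \<open>D\<close>: all iterated partial derivatives exist on \<open>D\<close> and extend continuously to the closure.
\<close>

definition smooth_on_closure :: "(real^'n) set \<Rightarrow> (real^'n \<Rightarrow> real) \<Rightarrow> bool" where
  "smooth_on_closure D u \<longleftrightarrow>
     (\<forall>is. (\<forall>x\<in>D. iterated_partial is u differentiable (at x)) \<and>
        (\<exists>g. continuous_on (closure D) g \<and> (\<forall>x\<in>D. g x = iterated_partial is u x)))"


subsection \<open>The hypotheses on a domain, an interior measure and a boundary measure\<close>

definition cond_H1 :: "(real^'n) set \<Rightarrow> real \<Rightarrow> bool" where
  "cond_H1 \<Omega> c1 \<longleftrightarrow> 0 < c1 \<and> (\<forall>x\<in>frontier \<Omega>. \<forall>r>0. \<exists>X\<in>ball x r. ball X (c1 * r) \<subseteq> \<Omega>)"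

definition cond_H2 :: "(real^'n) set \<Rightarrow> real \<Rightarrow> nat \<Rightarrow> bool" where
  "cond_H2 \<Omega> c1 N \<longleftrightarrow>
     (\<forall>r>0. \<forall>X1\<in>\<Omega>. \<forall>X2\<in>\<Omega>.
        r < infdist X1 (frontier \<Omega>) \<and> r < infdist X2 (frontier \<Omega>) \<and> dist X1 X2 \<le> 7 * inverse c1 * r \<longrightarrow>
        (\<exists>Z::nat \<Rightarrow> real^'n. Z 0 = X1 \<and> Z N = X2 \<and> (\<forall>i\<le>N. Z i \<in> \<Omega>) \<and>
           (\<forall>i<N. dist (Z i) (Z (Suc i)) < infdist (Z i) (frontier \<Omega>) / 2)))"

text \<open>
  Doubling is understood for measures that are finite on balls, as the real-valued quotient in
  \<open>cond_H5\<close> requires.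
\<close>

definition cond_H3 :: "(real^'n) set \<Rightarrow> (real^'n) measure \<Rightarrow> bool" where
  "cond_H3 \<Omega> \<sigma> \<longleftrightarrow> measure_support \<sigma> = frontier \<Omega> \<and>
     (\<exists>C3>1. \<forall>x\<in>frontier \<Omega>. \<forall>r>0.
        emeasure \<sigma> (ball x r \<inter> frontier \<Omega>) < \<infinity> \<and>
        emeasure \<sigma> (ball x (2 * r) \<inter> frontier \<Omega>) \<le> ennreal C3 * emeasure \<sigma> (ball x r \<inter> frontier \<Omega>))"

definition cond_H4 :: "(real^'n) set \<Rightarrow> (real^'n) measure \<Rightarrow> (real^'n \<Rightarrow> real) \<Rightarrow> bool" where
  "cond_H4 \<Omega> m w \<longleftrightarrow>
     absolutely_continuous (restrict_space lebesgue \<Omega>) (restrict_space m \<Omega>) \<and>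
     absolutely_continuous (restrict_space m \<Omega>) (restrict_space lebesgue \<Omega>) \<and>
     (\<forall>E\<in>sets borel. E \<subseteq> \<Omega> \<longrightarrow> emeasure m E = (\<integral>\<^sup>+X\<in>E. ennreal (w X) \<partial>lebesgue)) \<and>
     (\<forall>S. compact S \<and> S \<subseteq> \<Omega> \<longrightarrow> set_integrable lebesgue S w) \<and>
     (AE X in lebesgue. X \<in> \<Omega> \<longrightarrow> 0 < w X) \<and>
     (\<exists>C4. \<forall>X\<in>closure \<Omega>. \<forall>r>0.
        emeasure m (ball X r \<inter> \<Omega>) < \<infinity> \<and>
        emeasure m (ball X (2 * r) \<inter> \<Omega>) \<le> ennreal C4 * emeasure m (ball X r \<inter> \<Omega>))"

definition mass_ratio :: "(real^'n) set \<Rightarrow> (real^'n) measure \<Rightarrow> (real^'n) measure \<Rightarrow> real^'n \<Rightarrow> real \<Rightarrow> real" where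
  "mass_ratio \<Omega> m \<sigma> x r = measure m (ball x r \<inter> \<Omega>) / (r * measure \<sigma> (ball x r \<inter> frontier \<Omega>))"

definition cond_H5 :: "(real^'n) set \<Rightarrow> (real^'n) measure \<Rightarrow> (real^'n) measure \<Rightarrow> bool" where
  "cond_H5 \<Omega> m \<sigma> \<longleftrightarrow>
     (\<exists>C5>0. \<forall>x\<in>frontier \<Omega>. \<forall>r s. 0 < s \<and> s < r \<longrightarrow>
        mass_ratio \<Omega> m \<sigma> x r / mass_ratio \<Omega> m \<sigma> x s \<le> C5 * (r / s) powr (1 - 1 / C5))"

definition cond_H6 :: "(real^'n) set \<Rightarrow> (real^'n) measure \<Rightarrow> bool" where
  "cond_H6 \<Omega> m \<longleftrightarrow>
     (\<forall>D (u :: nat \<Rightarrow> real^'n \<Rightarrow> real) (v :: real^'n \<Rightarrow> real^'n).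
        open D \<and> compact (closure D) \<and> closure D \<subseteq> \<Omega> \<and>
        (\<forall>i. smooth_on_closure D (u i)) \<and>
        set_borel_measurable m D v \<and> (\<integral>\<^sup>+X\<in>D. ennreal ((norm (v X))\<^sup>2) \<partial>m) < \<infinity> \<and>
        (\<lambda>i. \<integral>\<^sup>+X\<in>D. ennreal \<bar>u i X\<bar> \<partial>m) \<longlonglongrightarrow> 0 \<and>
        (\<lambda>i. \<integral>\<^sup>+X\<in>D. ennreal ((norm (gradient (u i) X - v X))\<^sup>2) \<partial>m) \<longlonglongrightarrow> 0
        \<longrightarrow> (AE X in m. X \<in> D \<longrightarrow> v X = 0))"

end

theory Submission
  imports Defs
begin

text \<open>
  Everything follows from two-sided estimates: with \<open>\<delta>\<close> the distance to \<open>\<Gamma>\<close>, \<open>n\<close> the dimension and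
  \<open>\<alpha> = n - 1 - d\<close>, one has \<open>m(B(X,r) \<inter> \<Omega>) \<approx> r\<^sup>n (r + \<delta>(X))\<^sup>-\<^sup>\<alpha>\<close> and
  \<open>\<sigma>\<^sub>\<star>(B(x,r) \<inter> \<partial>\<Omega>) \<approx> r\<^sup>n\<^sup>-\<^sup>1 (r + \<delta>(x))\<^sup>-\<^sup>\<alpha>\<close>, so that both measures are doubling and the ratio in (H5) is bounded
  above and below.

  Below the scale of the distance to \<open>\<Gamma>\<close>, the face coordinates of the dilated boxes are separated by a
  fixed multiple of \<open>\<delta>\<close>, because they are dyadic numbers perturbed by multiples of \<open>\<theta>\<close>. Hence \<open>\<Omega>\<close>
  looks locally like a union of boundedly many cells of a coordinate hyperplane arrangement. At large scales,
  the part of \<open>\<partial>\<Omega>\<close> off \<open>\<Gamma>\<close> lies above thin strips along the boundaries of the removed cubes, whose total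
  measure is summable by the thin boundary property; conversely each removed cube carries a piece
  of \<open>\<partial>\<Omega>\<close> of comparable measure, and the points of \<open>\<Gamma>\<close> outside the removed cubes belong to \<open>\<partial>\<Omega>\<close>.

  Corkscrew points and Harnack chains are obtained by passing from a cube to its ancestors: the box
  containing \<open>X\<^sub>Q\<close> belongs to the Whitney region of the parent of \<open>Q\<close>, by the choice of \<open>\<eta>\<close>.
\<close>

subsection \<open>Separated nets and Hausdorff measure\<close>

text \<open>Two uniformity problems shape the constants. A set may be a cube of several generations,
  so \<open>cube_length\<close> agrees with the scale \<open>2 powi (- k)\<close> of a generation
  only up to the factor \<open>L0\<close>; the bound on \<eta> absorbs this factor, leaving
  \<open>4 * L0 * \<eta> < 1\<close>. And (H2) asks for one number of steps for all pairs of points,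
  so chains are recorded with a fixed ball radius and a length that may be increased.

  The thin boundary property gives summability because a boundary box of generation i over a removed
  cube of generation j sits above a strip of relative width about \<open>2 powi (j - i)\<close>,
  whose share of the measure is at most a multiple of that width to the power \<zeta>: a geometric
  series in i. The measure of a removed cube much larger than the ball is not controlled by the
  ball, so such a cube is first replaced by its subcubes of the size of the ball.

  Hausdorff measures are compared with Lebesgue measure: packing gives the upper bounds, extrusion
  of a facet the lower ones.\<close>

lemma max_separated:
  fixes S :: "'a::metric_space set"
  assumes card: "\<And>T. finite T \<Longrightarrow> T \<subseteq> S \<Longrightarrow> pairwise (\<lambda>x y. e \<le> dist x y) T \<Longrightarrow> real (card T) \<le> B"
    and e: "0 < e"
  obtains T where "finite T" "T \<subseteq> S" "pairwise (\<lambda>x y. e \<le> dist x y) T" "S \<subseteq> (\<Union>z\<in>T. ball z e)"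
    "real (card T) \<le> B"
proof -
  let ?P = "\<lambda>T. finite T \<and> T \<subseteq> S \<and> pairwise (\<lambda>x y. e \<le> dist x y) T"
  have "card T < nat \<lfloor>B\<rfloor> + 1" if "?P T" for T
    using card[of T] that by linarith
  then obtain T where T: "?P T" and max: "\<And>T'. ?P T' \<Longrightarrow> card T' \<le> card T"
    using ex_has_greatest_nat[of ?P "{}" card "nat \<lfloor>B\<rfloor> + 1"] by (auto simp: pairwise_empty)
  have "S \<subseteq> (\<Union>z\<in>T. ball z e)"
  proof
    fix y assume y: "y \<in> S"
    show "y \<in> (\<Union>z\<in>T. ball z e)"
    proof (rule ccontr)
      assume n: "y \<notin> (\<Union>z\<in>T. ball z e)"
      then have "y \<notin> T" using e by auto
      moreover have "?P (insert y T)"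
        using T y n by (auto simp: pairwise_insert dist_commute not_less)
      ultimately show False using max[of "insert y T"] T by auto
    qed
  qed
  then show ?thesis using T that card by blast
qed

lemma sum_measure_disjoint_le:
  assumes "finite T" "disjoint_family_on A T" "\<And>z. z \<in> T \<Longrightarrow> A z \<in> sets M \<and> A z \<subseteq> E" "E \<in> fmeasurable M"
  shows "(\<Sum>z\<in>T. measure M (A z)) \<le> measure M E"
proof -
  have fm: "A z \<in> fmeasurable M" if "z \<in> T" for z
    using assms(3)[OF that] assms(4) by (auto intro: fmeasurableI2)
  have "(\<Sum>z\<in>T. measure M (A z)) = measure M (\<Union>z\<in>T. A z)"
    using assms fm by (intro measure_finite_Union[symmetric]) (auto simp: fmeasurableD2)
  also have "\<dots> \<le> measure M E"
    using assms by (intro measure_mono_fmeasurable) auto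
  finally show ?thesis .
qed

text \<open>The packing argument behind the cardinality bounds for separated sets, for Whitney boxes
  and for removed cubes.\<close>

lemma card_measure_disjoint_le:
  assumes "finite T" "disjoint_family_on A T" "\<And>z. z \<in> T \<Longrightarrow> A z \<in> sets M \<and> A z \<subseteq> E" "E \<in> fmeasurable M"
    "\<And>z. z \<in> T \<Longrightarrow> c \<le> measure M (A z)"
  shows "real (card T) * c \<le> measure M E"
  using sum_measure_disjoint_le[OF assms(1-4)] sum_bounded_below[of T c "\<lambda>z. measure M (A z)"] assms(5)
  by (simp add: mult.commute)

lemma separated_balls_disjoint:
  assumes "pairwise (\<lambda>x y. e \<le> dist x y) T"
  shows "disjoint_family_on (\<lambda>z. ball z (e/2)) T"
  unfolding disjoint_family_on_def
proof (intro ballI impI)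
  fix x y assume "x \<in> T" "y \<in> T" "x \<noteq> y"
  then have "e \<le> dist x y" using assms by (auto simp: pairwise_def)
  then have "False" if "dist x z < e/2" "dist y z < e/2" for z
    using dist_triangle2[of x y z] that by linarith
  then show "ball x (e/2) \<inter> ball y (e/2) = {}" by auto
qed

text \<open>Continuity from below along an enumeration. Boxes and removed cubes form countable
  families, while their sums and overlaps are estimated for finite subfamilies; this passes to the
  union.\<close>

lemma emeasure_UN_le_finite:
  assumes X: "countable X" and A: "\<And>i. i \<in> X \<Longrightarrow> A i \<in> sets M"
    and le: "\<And>F. finite F \<Longrightarrow> F \<subseteq> X \<Longrightarrow> emeasure M (\<Union>i\<in>F. A i) \<le> c"
  shows "emeasure M (\<Union>i\<in>X. A i) \<le> c"
proof (cases "X = {}")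
  case True then show ?thesis by simp
next
  case False
  let ?f = "from_nat_into X"
  let ?B = "\<lambda>n. \<Union>i\<in>?f ` {..n}. A i"
  have f: "?f n \<in> X" for n using False by (simp add: from_nat_into)
  have "(\<Union>i\<in>range ?f. A i) = (\<Union>n. ?B n)" by auto
  then have "(\<Union>i\<in>X. A i) = (\<Union>n. ?B n)"
    using range_from_nat_into[OF False X] by simp
  moreover have "incseq ?B" by (fastforce simp: incseq_def)
  moreover have "range ?B \<subseteq> sets M" using A f by auto
  ultimately have "emeasure M (\<Union>i\<in>X. A i) = (SUP n. emeasure M (?B n))"
    by (simp add: SUP_emeasure_incseq)
  also have "\<dots> \<le> c" using f by (intro SUP_least le) auto
  finally show ?thesis .
qed

lemma hausdorff_pre_finite_cover:
  assumes T: "finite T" and U: "\<And>z. z \<in> T \<Longrightarrow> bounded (U z) \<and> diameter (U z) \<le> \<delta>" and \<delta>: "0 \<le> \<delta>"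
    and E: "E \<subseteq> (\<Union>z\<in>T. U z)"
  shows "hausdorff_pre s \<delta> E \<le> (\<Sum>z\<in>T. ennreal (diameter (U z) powr s))"
proof -
  obtain h where h: "bij_betw h {0..<card T} T" using ex_bij_betw_nat_finite[OF T] by blast
  \<comment> \<open>The sequence is padded with empty sets, which cost nothing: their diameter is 0
    and \<open>0 powr s = 0\<close>.\<close>
  define V where "V i = (if i < card T then U (h i) else {})" for i
  have hT: "i < card T \<Longrightarrow> h i \<in> T" for i using h by (auto simp: bij_betw_def)
  have "hausdorff_pre s \<delta> E \<le> (\<Sum>i. ennreal (diameter (V i) powr s))"
  proof (rule hausdorff_pre_le)
    show "E \<subseteq> (\<Union>i. V i)"
    proof
      fix y assume "y \<in> E"
      then obtain z where z: "z \<in> T" "y \<in> U z" using E by auto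
      then obtain i where "i < card T" "h i = z" using h unfolding bij_betw_def by force
      then show "y \<in> (\<Union>i. V i)" using z by (auto simp: V_def intro!: exI[of _ i])
    qed
  qed (use U hT \<delta> in \<open>auto simp: V_def\<close>)
  also have "\<dots> = (\<Sum>i\<in>{0..<card T}. ennreal (diameter (V i) powr s))"
    by (rule suminf_finite) (auto simp: V_def)
  also have "\<dots> = (\<Sum>i\<in>{0..<card T}. ennreal (diameter (U (h i)) powr s))"
    by (intro sum.cong) (auto simp: V_def)
  also have "\<dots> = (\<Sum>z\<in>T. ennreal (diameter (U z) powr s))"
    by (rule sum.reindex_bij_betw[OF h])
  finally show ?thesis .
qed

lemma prod_one_coordinate:
  fixes i :: "'n::finite" and a b :: real
  shows "(\<Prod>j\<in>UNIV. if j = i then a else b) = a * b ^ (CARD('n) - 1)"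
proof -
  have "(\<Prod>j\<in>UNIV. if j = i then a else b) = (\<Prod>j\<in>insert i (UNIV - {i}). if j = i then a else b)"
    by (simp add: insert_absorb)
  also have "\<dots> = a * (\<Prod>j\<in>UNIV - {i}. if j = i then a else b)"
    by (subst prod.insert) auto
  also have "(\<Prod>j\<in>UNIV - {i}. if j = i then a else b) = (\<Prod>j\<in>UNIV - {i}. b)"
    by (intro prod.cong) auto
  finally show ?thesis by simp
qed

text \<open>The thickness \<open>a\<close> in direction \<open>i\<close> is kept apart from the
  width \<open>b\<close>: the upper bound for hyperplanes uses a slab as thin as the mesh, the lower
  bound for facets slabs of fixed thickness and varying width.\<close>

lemma slab_content:
  fixes x :: "real^'n" and i :: 'n and a b f :: real
  assumes "0 \<le> a" "0 \<le> b"
  defines "S \<equiv> {y :: real^'n. \<forall>j. if j = i then f \<le> y$j \<and> y$j \<le> f + a else x$j \<le> y$j \<and> y$j \<le> x$j + b}"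
  shows "S = cbox (\<chi> j. if j = i then f else x$j) (\<chi> j. if j = i then f + a else x$j + b)"
    and "measure lborel S = a * b ^ (CARD('n) - 1)" and "S \<in> fmeasurable lborel"
proof -
  show S: "S = cbox (\<chi> j. if j = i then f else x$j) (\<chi> j. if j = i then f + a else x$j + b)"
    unfolding S_def by (auto simp: mem_box_cart split: if_splits)
  then show "S \<in> fmeasurable lborel" by simp
  have "x$j \<le> x$j + b" "f \<le> f + a" for j using assms by auto
  then have "cbox (\<chi> j. if j = i then f else x$j) (\<chi> j. if j = i then f + a else x$j + b) \<noteq> {}"
    by (auto simp: interval_ne_empty_cart)
  then have "measure lborel S = (\<Prod>j\<in>UNIV. if j = i then a else b)"
    unfolding S by (subst content_cbox_cart) (simp_all, rule prod.cong, simp_all)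
  then show "measure lborel S = a * b ^ (CARD('n) - 1)" by (simp add: prod_one_coordinate)
qed

text \<open>Balls of radius \<open>e/2\<close> around \<open>e\<close>-separated points of the
  hyperplane lie in a slab of thickness \<open>e\<close> and width \<open>4*t\<close>. Comparing
  volumes, there are at most about \<open>(t/e) ^ N\<close> of them, and the balls of radius
  \<open>e\<close> around them cover at a cost independent of \<open>e\<close>.\<close>

lemma hausdorff_hyperplane_ball:
  assumes n: "2 \<le> CARD('n)"
  shows "\<exists>C>0. \<forall>(i::'n) f (x::real^'n) t. 0 < t \<longrightarrow>
     emeasure (hausdorff_measure (real CARD('n) - 1)) ({y. y$i = f} \<inter> ball x t) \<le> ennreal (C * t ^ (CARD('n) - 1))"
proof -
  define N where "N = CARD('n) - 1"
  have N: "real CARD('n) - 1 = real N" "CARD('n) = Suc N" using n by (auto simp: N_def)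
  define \<omega> where "\<omega> = unit_ball_vol (real CARD('n))"
  have \<omega>: "0 < \<omega>" by (simp add: \<omega>_def unit_ball_vol_pos)
  define C where "C = 4 ^ N * 2 ^ Suc N * 2 ^ N / \<omega>"
  have "emeasure (hausdorff_measure (real CARD('n) - 1)) ({y. y$i = f} \<inter> ball x t) \<le> ennreal (C * t ^ N)"
    if t: "0 < t" for i :: 'n and f and x :: "real^'n" and t
  proof -
    let ?S = "{y. y$i = f} \<inter> ball x t"
    have "closed {y::real^'n. y$i = f}" by (intro closed_Collect_eq continuous_intros)
    then have Sb: "?S \<in> sets borel" by auto
    have "hausdorff_pre (real N) \<delta> ?S \<le> ennreal (C * t ^ N)" if \<delta>: "0 < \<delta>" for \<delta>
    proof -
      define e where "e = min (\<delta>/2) t"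
      have e: "0 < e" "e \<le> t" "2 * e \<le> \<delta>" using \<delta> t by (auto simp: e_def)
      define B where "B = e * (4*t)^N / (\<omega> * (e/2)^Suc N)"
      have "real (card T) \<le> B" if T: "finite T" "T \<subseteq> ?S" "pairwise (\<lambda>x y. e \<le> dist x y) T" for T
      proof -
        let ?E = "{y :: real^'n. \<forall>j. if j = i then f - e/2 \<le> y$j \<and> y$j \<le> (f - e/2) + e
            else (x - (\<chi> i. 2*t))$j \<le> y$j \<and> y$j \<le> (x - (\<chi> i. 2*t))$j + 4*t}"
        have E: "measure lborel ?E = e * (4*t)^N" "?E \<in> fmeasurable lborel"
          unfolding N_def using e t by (intro slab_content; simp)+
        have "real (card T) * (\<omega> * (e/2)^Suc N) \<le> measure lborel ?E"
        proof (rule card_measure_disjoint_le[OF T(1) separated_balls_disjoint[OF T(3)] _ E(2)])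
          fix z assume z: "z \<in> T"
          have "y \<in> ?E" if y: "dist z y < e/2" for y
          proof -
            have "\<bar>(y - z)$j\<bar> < e/2" for j
              using component_le_norm_cart[of "y - z" j] y by (simp add: dist_norm norm_minus_commute)
            moreover have "\<bar>(z - x)$j\<bar> < t" for j
              using component_le_norm_cart[of "z - x" j] z T(2) by (force simp: dist_norm norm_minus_commute)
            ultimately have *: "\<bar>y$j - z$j\<bar> < e/2" "\<bar>z$j - x$j\<bar> < t" for j by auto
            have "z$i = f" using z T by auto
            then have "f - e/2 \<le> y$i \<and> y$i \<le> f - e/2 + e" using *(1)[of i] by linarith
            moreover have "x$j - 2*t \<le> y$j \<and> y$j \<le> x$j - 2*t + 4*t" for j using *[of j] e by linarith
            ultimately show ?thesis by simp
          qed
          then have sub: "ball z (e/2) \<subseteq> ?E" by (intro subsetI) (simp only: mem_ball)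
          show "ball z (e/2) \<in> sets lborel \<and> ball z (e/2) \<subseteq> ?E" by (rule conjI[OF _ sub]) simp
          show "\<omega> * (e/2)^Suc N \<le> measure lborel (ball z (e/2))"
            using e by (simp add: content_ball \<omega>_def N)
        qed
        then show ?thesis unfolding E B_def using \<omega> e by (simp add: field_simps)
      qed
      then obtain T where T: "finite T" "?S \<subseteq> (\<Union>z\<in>T. ball z e)" "real (card T) \<le> B"
        using max_separated[of ?S e B] e by metis
      have "hausdorff_pre (real N) \<delta> ?S \<le> (\<Sum>z\<in>T. ennreal (diameter (ball z e) powr real N))"
        using T e \<delta> by (intro hausdorff_pre_finite_cover) (auto simp: diameter_ball)
      also have "\<dots> = ennreal (real (card T) * (2*e)^N)"
        using e by (simp add: diameter_ball powr_realpow ennreal_mult'' ennreal_of_nat_eq_real_of_nat)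
      also have "\<dots> \<le> ennreal (B * (2*e)^N)"
        using T e by (intro ennreal_leI mult_right_mono) auto
      also have "B * (2*e)^N = C * t ^ N"
        using e \<omega> by (simp add: B_def C_def field_simps power_mult_distrib)
      finally show ?thesis .
    qed
    then show ?thesis unfolding emeasure_hausdorff_measure[OF Sb] hausdorff_outer_def N
      by (intro SUP_least) auto
  qed
  moreover have "0 < C" using \<omega> by (simp add: C_def)
  ultimately show ?thesis unfolding N_def by blast
qed

text \<open>Extruding by the length \<open>t\<close> in direction \<open>i\<close> turns a cover of
  the facet into a cover of an n-dimensional box by slabs: a set of diameter \<open>d k\<close>
  becomes one of volume \<open>t * (2 * d k) ^ N\<close>. The volume of the box bounds the sum from
  below and a factor \<open>t\<close> cancels. Nothing depends on the mesh, so mesh 1 is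
  taken.\<close>

lemma hausdorff_facet_ge:
  fixes i :: "'n::finite" and f :: real and p q :: "real^'n"
  assumes n: "2 \<le> CARD('n)" and t: "0 < t" and pq: "\<And>j. j \<noteq> i \<Longrightarrow> t \<le> q$j - p$j"
    and F: "F \<in> sets borel" "{y :: real^'n. y$i = f \<and> (\<forall>j. j \<noteq> i \<longrightarrow> p$j < y$j \<and> y$j < q$j)} \<subseteq> F"
  shows "ennreal ((t/2) ^ (CARD('n) - 1)) \<le> emeasure (hausdorff_measure (real CARD('n) - 1)) F"
proof -
  define N where "N = CARD('n) - 1"
  have N: "real CARD('n) - 1 = real N" "CARD('n) = Suc N" "1 \<le> N" using n by (auto simp: N_def)
  let ?F = "{y :: real^'n. y$i = f \<and> (\<forall>j. j \<noteq> i \<longrightarrow> p$j < y$j \<and> y$j < q$j)}"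
  have "ennreal ((t/2)^N) \<le> hausdorff_pre (real N) 1 F"
    unfolding hausdorff_pre_def
  proof (rule INF_greatest, safe)
    fix U :: "nat \<Rightarrow> (real^'n) set"
    assume U: "\<forall>i. bounded (U i) \<and> diameter (U i) \<le> 1" "F \<subseteq> (\<Union>i. U i)"
    define d where "d k = diameter (U k)" for k
    have d0: "0 \<le> d k" for k unfolding d_def using U by (simp add: diameter_ge_0)
    \<comment> \<open>A base point of each covering set. For an empty set it is arbitrary, which is
      harmless: the cover below uses only sets containing a point of the facet.\<close>
    define u where "u k = (SOME u. u \<in> U k)" for k
    define V where "V k = {y :: real^'n. \<forall>j. if j = i then 0 \<le> y$j \<and> y$j \<le> 0 + t else
        (u k - (\<chi> j. d k))$j \<le> y$j \<and> y$j \<le> (u k - (\<chi> j. d k))$j + 2 * d k}" for k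
    have V: "measure lborel (V k) = t * (2 * d k)^N" "V k \<in> fmeasurable lborel" for k
      unfolding V_def N_def using t d0 by (intro slab_content; simp)+
    have Vb: "V k \<in> sets borel" for k using fmeasurableD[OF V(2)] by simp
    have eV: "emeasure lborel (V k) = ennreal (t * 2^N) * ennreal (d k powr real N)" for k
    proof -
      have "d k powr real N = d k ^ N"
        using d0[of k] N(3) by (cases "d k = 0") (auto simp: powr_realpow)
      then show ?thesis
        using V[of k] d0[of k] t emeasure_eq_measure2[OF V(2)[of k]]
        by (simp add: ennreal_mult[symmetric] power_mult_distrib mult.assoc)
    qed
    define p' q' :: "real^'n" where "p' = (\<chi> j. if j = i then 0 else p$j)" and "q' = (\<chi> j. if j = i then t else q$j)"
    have sub: "box p' q' \<subseteq> (\<Union>k. V k)"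
    proof
      fix y assume y: "y \<in> box p' q'"
      have yj: "p$j < y$j \<and> y$j < q$j" if "j \<noteq> i" for j
        using y that by (auto simp: mem_box_cart p'_def q'_def dest!: spec[of _ j])
      have yi: "0 < y$i \<and> y$i < t"
        using y by (auto simp: mem_box_cart p'_def q'_def dest!: spec[of _ i])
      \<comment> \<open>\<open>y\<close> is projected back onto the hyperplane, because the given
        sets cover only the facet.\<close>
      define y' :: "real^'n" where "y' = (\<chi> j. if j = i then f else y$j)"
      have "y' \<in> ?F" using yj by (simp add: y'_def)
      then obtain k where k: "y' \<in> U k" using F(2) U(2) by blast
      then have "u k \<in> U k" unfolding u_def by (rule someI)
      then have "dist y' (u k) \<le> d k" unfolding d_def using U k diameter_bounded_bound by blast
      then have "\<bar>y'$j - u k$j\<bar> \<le> d k" for j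
        using component_le_norm_cart[of "y' - u k" j] by (simp add: dist_norm)
      then have "\<bar>y$j - u k$j\<bar> \<le> d k" if "j \<noteq> i" for j using that by (simp add: y'_def) (smt (verit, best))
      then have "y \<in> V k" using yi unfolding V_def by (auto simp: abs_le_iff)
        (metis add.commute add_le_cancel_left diff_add_cancel diff_le_eq minus_diff_eq)+
      then show "y \<in> (\<Union>k. V k)" by blast
    qed
    have "ennreal (t * t^N) \<le> emeasure lborel (box p' q')"
    proof -
      have le: "t \<le> q'$j - p'$j" for j using pq by (auto simp: p'_def q'_def)
      then have "cbox p' q' \<noteq> {}" using t by (auto simp: interval_ne_empty_cart) (smt (verit, best))
      then have "measure lborel (box p' q') = (\<Prod>j\<in>UNIV. q'$j - p'$j)"
        by (subst content_cbox_cart[symmetric]) (auto simp: measure_lborel_box_eq measure_lborel_cbox_eq)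
      moreover have "(\<Prod>j\<in>(UNIV::'n set). t) \<le> (\<Prod>j\<in>UNIV. q'$j - p'$j)"
        using le t by (intro prod_mono) auto
      moreover have "(\<Prod>j\<in>(UNIV::'n set). t) = t * t^N" by (simp add: N)
      ultimately show ?thesis
        by (subst emeasure_eq_ennreal_measure) (auto intro!: ennreal_leI simp: emeasure_lborel_box_eq)
    qed
    also have "\<dots> \<le> emeasure lborel (\<Union>k. V k)"
      using sub Vb by (intro emeasure_mono) auto
    also have "\<dots> \<le> (\<Sum>k. emeasure lborel (V k))"
      using Vb by (intro emeasure_subadditive_countably) auto
    also have "\<dots> = ennreal (t * 2^N) * (\<Sum>k. ennreal (d k powr real N))"
      unfolding eV by (rule ennreal_suminf_cmult)
    finally have "ennreal (1 / (t * 2^N)) * ennreal (t * t^N) \<le>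
        ennreal (1 / (t * 2^N)) * (ennreal (t * 2^N) * (\<Sum>k. ennreal (d k powr real N)))"
      by (rule mult_left_mono) simp
    moreover have "ennreal (1 / (t * 2^N)) * ennreal (t * 2^N) = 1"
      using t by (simp add: ennreal_mult[symmetric])
    moreover have "ennreal (1 / (t * 2^N)) * ennreal (t * t^N) = ennreal ((t/2)^N)"
      using t by (simp add: ennreal_mult[symmetric] power_divide)
    ultimately show "ennreal ((t/2)^N) \<le> (\<Sum>k. ennreal (diameter (U k) powr real N))"
      by (simp add: mult.assoc[symmetric] d_def)
  qed
  also have "\<dots> \<le> hausdorff_outer (real N) F" by (rule hausdorff_pre_le_outer) simp
  finally show ?thesis unfolding emeasure_hausdorff_measure[OF F(1)] N by (simp add: N)
qed

section \<open>Dyadic scales\<close>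

abbreviation sc :: "int \<Rightarrow> real" where "sc k \<equiv> 2 powi (- k)"

lemma sc_pos: "0 < sc k" by simp

lemma sc_mono: "m \<le> k \<Longrightarrow> sc k \<le> sc m"
  by (simp add: power_int_increasing)

lemma sc_le_iff: "sc k \<le> sc m \<longleftrightarrow> m \<le> k"
  by (metis linorder_not_le neg_less_iff_less one_less_numeral_iff power_int_strict_increasing sc_mono semiring_norm(76))

lemma sc_diff: "sc (k - int j) = 2 ^ j * sc k"
  using power_int_add[of "2::real" "int j" "- k"] by simp

lemma ex_scale:
  assumes "0 < R" obtains k where "R \<le> sc k" "sc k < 2 * R"
proof -
  define k where "k = - \<lceil>log 2 R\<rceil>"
  have "sc k = 2 powr (real_of_int \<lceil>log 2 R\<rceil>)" by (simp add: k_def powr_real_of_int')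
  moreover have "log 2 R \<le> real_of_int \<lceil>log 2 R\<rceil>" "real_of_int \<lceil>log 2 R\<rceil> < log 2 R + 1" by linarith+
  moreover have "2 powr (log 2 R) = R" "2 powr (log 2 R + 1) = 2 * R" using assms by (auto simp: powr_add)
  ultimately show ?thesis using that[of k]
    by (metis one_less_numeral_iff powr_less_mono powr_mono semiring_norm(76) less_imp_le)
qed

subsection \<open>Dyadic cubes\<close>

locale sawtooth =
  fixes \<Gamma> \<Omega> :: "(real^'n) set"
    and d Cd a0 A0 \<zeta> c cH \<eta> K \<theta> :: real
    and \<DD> :: "int \<Rightarrow> (real^'n) set set"
    and xc XQ :: "(real^'n) set \<Rightarrow> real^'n"
    and W :: "'n box set"
    and W0 :: "(real^'n) set \<Rightarrow> 'n box set"
    and H :: "(real^'n) set \<Rightarrow> 'n box \<Rightarrow> (real^'n) set"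
    and \<F> :: "(real^'n) set set"
  assumes n3: "3 \<le> CARD('n)" and d0: "0 < d" and dn: "d < real CARD('n) - 1"
    and closed_\<Gamma>: "closed \<Gamma>" and unbounded_\<Gamma>: "\<not> bounded \<Gamma>"
    and Cd0: "0 < Cd" and adr: "ahlfors_david_regular d Cd \<Gamma>"
    and a0: "0 < a0" and a01: "a0 \<le> 1" and A01: "1 \<le> A0" and \<zeta>0: "0 < \<zeta>" and \<zeta>1: "\<zeta> < 1"
    and dyadic: "dyadic_system d \<Gamma> a0 A0 \<zeta> \<DD>" and centres: "cube_centres \<Gamma> a0 A0 \<DD> xc"
    and whitney: "whitney_decomposition \<Gamma> W"
    and corkscrew: "corkscrew_constant c \<Gamma>" and harnack: "harnack_constant d cH \<Gamma>"
    and \<eta>0: "0 < \<eta>" and \<eta>1: "\<eta> < a0 / (2 powr ((2 * d + 1) / d) * Cd powr (2 / d) * A0)"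
    and K500: "500 * A0 / a0 \<le> K"
    and \<theta>0: "0 < \<theta>" and \<theta>1: "\<theta> < 1 / (16 * sqrt (real CARD('n)))"
    and W0_def: "W0 = whitney_initial a0 c \<eta> K \<DD> W"
    and XQ: "\<forall>Q\<in>all_cubes \<DD>. corkscrew_point c \<Gamma> (xc Q) (a0 * cube_length \<DD> Q) (XQ Q) \<and>
           (\<exists>I\<in>W0 Q. XQ Q \<in> box_set I)"
    and chains: "\<forall>Q\<in>all_cubes \<DD>. \<forall>I\<in>W0 Q.
           harnack_chain d cH \<Gamma> (2 / 41 * a0 * c * \<eta> * cube_length \<DD> Q)
             (41 / (2 * c * \<eta>) * (1 + 5 / 4 * K + A0 / a0)) (fst I) (XQ Q) (H Q I) \<and>
           H Q I \<inter> box_set I \<noteq> {}"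
    and \<F>_cubes: "\<F> \<subseteq> all_cubes \<DD>" and \<F>_disjoint: "disjoint \<F>"
    and \<Omega>_def: "\<Omega> = sawtooth_domain \<DD> (whitney_region W W0 H) \<theta> \<F>"
begin

abbreviation \<delta> :: "real^'n \<Rightarrow> real" where "\<delta> X \<equiv> infdist X \<Gamma>"
abbreviation cl :: "(real^'n) set \<Rightarrow> real" where "cl Q \<equiv> cube_length \<DD> Q"
abbreviation DF :: "(real^'n) set set" where "DF \<equiv> cubes_outside \<DD> \<F>"
abbreviation WQ :: "(real^'n) set \<Rightarrow> 'n box set" where "WQ \<equiv> whitney_region W W0 H"
abbreviation \<sigma> :: "(real^'n) set \<Rightarrow> real" where "\<sigma> E \<equiv> measure (hausdorff_measure d) E"

text \<open>By \<open>sub_cube_scale\<close> this bounds how far the scale of a generation of a cube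
  can exceed that of a larger cube. In particular the scales of two generations of the same set
  differ at most by this factor.\<close>

definition L0 :: real where "L0 = Cd powr (2/d) * A0 / a0"

lemma powr_compare:
  assumes "0 \<le> x" "0 \<le> y" "0 < B" "x powr d \<le> B * y powr d"
  shows "x \<le> B powr (1/d) * y"
proof -
  have "(x powr d) powr (1/d) \<le> (B * y powr d) powr (1/d)"
    using assms d0 by (intro powr_mono2) auto
  then show ?thesis using assms d0 by (simp add: powr_mult powr_powr)
qed

section \<open>Measure of balls and cubes in the boundary set\<close>

lemma \<Gamma>_nonempty: "\<Gamma> \<noteq> {}" using unbounded_\<Gamma> by auto

lemma \<Gamma>_borel: "\<Gamma> \<in> sets borel" using closed_\<Gamma> by simp

lemma \<Gamma>_ball_fm: "x \<in> \<Gamma> \<Longrightarrow> \<Gamma> \<inter> ball x r \<in> fmeasurable (hausdorff_measure d)"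
proof (cases "0 < r")
  case True
  assume "x \<in> \<Gamma>"
  then have "emeasure (hausdorff_measure d) (\<Gamma> \<inter> ball x r) \<le> ennreal (Cd * r powr d)"
    using adr True unfolding ahlfors_david_regular_def by blast
  also have "\<dots> < \<infinity>" by simp
  finally show ?thesis using \<Gamma>_borel by (auto simp: fmeasurable_def)
qed (simp add: ball_empty)

lemma \<sigma>_ball:
  assumes "x \<in> \<Gamma>" "0 < r"
  shows "r powr d / Cd \<le> \<sigma> (\<Gamma> \<inter> ball x r)" "\<sigma> (\<Gamma> \<inter> ball x r) \<le> Cd * r powr d"
proof -
  have e: "emeasure (hausdorff_measure d) (\<Gamma> \<inter> ball x r) = ennreal (\<sigma> (\<Gamma> \<inter> ball x r))"
    using \<Gamma>_ball_fm[OF assms(1)] by (simp add: emeasure_eq_measure2)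
  have "ennreal (inverse Cd * r powr d) \<le> ennreal (\<sigma> (\<Gamma> \<inter> ball x r))"
    "ennreal (\<sigma> (\<Gamma> \<inter> ball x r)) \<le> ennreal (Cd * r powr d)"
    using adr assms unfolding ahlfors_david_regular_def e[symmetric] by blast+
  then show "r powr d / Cd \<le> \<sigma> (\<Gamma> \<inter> ball x r)" "\<sigma> (\<Gamma> \<inter> ball x r) \<le> Cd * r powr d"
    using Cd0 by (simp_all add: field_simps ennreal_le_iff)
qed

lemma bounded_fm:
  assumes "E \<in> sets borel" "E \<subseteq> \<Gamma>" "bounded E"
  shows "E \<in> fmeasurable (hausdorff_measure d)"
proof -
  obtain x where x: "x \<in> \<Gamma>" using \<Gamma>_nonempty by auto
  obtain r where "E \<subseteq> ball x r" using bounded_subset_ballD[OF assms(3), of x] by blast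
  then have "E \<subseteq> \<Gamma> \<inter> ball x r" using assms(2) by simp
  then show ?thesis using fmeasurableI2[OF \<Gamma>_ball_fm[OF x]] assms(1) by simp
qed

lemmas dyadic_parts =
  dyadic[unfolded dyadic_system_def, THEN conjunct1]
  dyadic[unfolded dyadic_system_def, THEN conjunct2, THEN conjunct1]
  dyadic[unfolded dyadic_system_def, THEN conjunct2, THEN conjunct2, THEN conjunct1]
  dyadic[unfolded dyadic_system_def, THEN conjunct2, THEN conjunct2, THEN conjunct2, THEN conjunct2, THEN conjunct1]
  dyadic[unfolded dyadic_system_def, THEN conjunct2, THEN conjunct2, THEN conjunct2, THEN conjunct2, THEN conjunct2, THEN conjunct1]
  dyadic[unfolded dyadic_system_def, THEN conjunct2, THEN conjunct2, THEN conjunct2, THEN conjunct2, THEN conjunct2, THEN conjunct2]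

lemma cubeD:
  assumes "Q \<in> \<DD> k"
  shows "Q \<in> sets borel" "Q \<subseteq> \<Gamma>" "bounded Q" "diameter Q < A0 * sc k"
    "\<exists>x\<in>\<Gamma>. ball x (a0 * sc k) \<inter> \<Gamma> \<subseteq> Q" "Q \<noteq> {}" "Q \<in> all_cubes \<DD>" "Q \<in> fmeasurable (hausdorff_measure d)"
proof -
  show *: "Q \<in> sets borel" "Q \<subseteq> \<Gamma>" "bounded Q" "diameter Q < A0 * sc k"
    "\<exists>x\<in>\<Gamma>. ball x (a0 * sc k) \<inter> \<Gamma> \<subseteq> Q" "Q \<in> all_cubes \<DD>"
    using dyadic_parts(1,4,5) assms unfolding all_cubes_def by auto
  then obtain x where "x \<in> \<Gamma>" "ball x (a0 * sc k) \<inter> \<Gamma> \<subseteq> Q" by auto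
  moreover have "x \<in> ball x (a0 * sc k)" using a0 by simp
  ultimately show "Q \<noteq> {}" by blast
  show "Q \<in> fmeasurable (hausdorff_measure d)" using bounded_fm * by blast
qed

lemma cube_dist: "Q \<in> \<DD> k \<Longrightarrow> x \<in> Q \<Longrightarrow> y \<in> Q \<Longrightarrow> dist x y < A0 * sc k"
  using diameter_bounded_bound[OF cubeD(3), of Q k x y] cubeD(4)[of Q k] by linarith

lemma cube_cover: "x \<in> \<Gamma> \<Longrightarrow> \<exists>Q\<in>\<DD> k. x \<in> Q"
  using dyadic_parts(2) by blast

lemma cube_nested: "k \<le> m \<Longrightarrow> Q' \<in> \<DD> m \<Longrightarrow> Q \<in> \<DD> k \<Longrightarrow> Q' \<inter> Q \<noteq> {} \<Longrightarrow> Q' \<subseteq> Q"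
  using dyadic_parts(3) by blast

lemma cube_eq: "Q' \<in> \<DD> k \<Longrightarrow> Q \<in> \<DD> k \<Longrightarrow> Q' \<inter> Q \<noteq> {} \<Longrightarrow> Q' = Q"
  using cube_nested[of k k Q' Q] cube_nested[of k k Q Q'] by blast

lemma cube_ancestor:
  assumes "Q \<in> \<DD> k" "m \<le> k" shows "\<exists>R\<in>\<DD> m. Q \<subseteq> R"
proof -
  obtain x where "x \<in> Q" using cubeD(6)[OF assms(1)] by auto
  moreover then obtain R where "R \<in> \<DD> m" "x \<in> R" using cube_cover[of x m] cubeD(2)[OF assms(1)] by auto
  ultimately show ?thesis using cube_nested[OF assms(2,1)] by blast
qed

lemma cube_thin: "Q \<in> \<DD> k \<Longrightarrow> 0 < \<rho> \<Longrightarrow> \<rho> < a0 \<Longrightarrow>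
   emeasure (hausdorff_measure d) {x \<in> Q. infdist x (\<Gamma> - Q) \<le> \<rho> * sc k}
     \<le> ennreal (A0 * \<rho> powr \<zeta>) * emeasure (hausdorff_measure d) Q"
  using dyadic_parts(6) by blast

lemma cube_\<sigma>:
  assumes Q: "Q \<in> \<DD> k"
  shows "(a0 * sc k) powr d / Cd \<le> \<sigma> Q" "\<sigma> Q \<le> Cd * (A0 * sc k) powr d"
proof -
  obtain x where x: "x \<in> \<Gamma>" "ball x (a0 * sc k) \<inter> \<Gamma> \<subseteq> Q" using cubeD(5)[OF Q] by auto
  have p: "0 < a0 * sc k" "0 < A0 * sc k" using a0 A01 by auto
  have "\<sigma> (\<Gamma> \<inter> ball x (a0 * sc k)) \<le> \<sigma> Q"
    using x(2) \<Gamma>_ball_fm[OF x(1)] cubeD[OF Q] by (intro measure_mono_fmeasurable) (simp_all add: \<Gamma>_borel sets.Int Int_commute)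
  then show "(a0 * sc k) powr d / Cd \<le> \<sigma> Q" using \<sigma>_ball(1)[OF x(1) p(1)] by linarith
  obtain y where y: "y \<in> Q" using cubeD(6)[OF Q] by auto
  then have y\<Gamma>: "y \<in> \<Gamma>" using cubeD(2)[OF Q] by auto
  have "Q \<subseteq> \<Gamma> \<inter> ball y (A0 * sc k)" using cube_dist[OF Q y] cubeD(2)[OF Q] by auto
  then have "\<sigma> Q \<le> \<sigma> (\<Gamma> \<inter> ball y (A0 * sc k))"
    using \<Gamma>_ball_fm[OF y\<Gamma>] cubeD[OF Q] by (intro measure_mono_fmeasurable) (auto simp: fmeasurableD)
  then show "\<sigma> Q \<le> Cd * (A0 * sc k) powr d" using \<sigma>_ball(2)[OF y\<Gamma> p(2)] by linarith
qed

text \<open>The measure of a cube of scale \<open>s\<close> is comparable to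
  \<open>s powr d\<close>, and a subset has no larger measure; \<open>L0\<close> is what remains
  after taking d-th roots.\<close>

lemma sub_cube_scale:
  assumes Q: "Q \<in> \<DD> k" and R: "R \<in> \<DD> m" and "Q \<subseteq> R"
  shows "sc k \<le> L0 * sc m"
proof -
  have "\<sigma> Q \<le> \<sigma> R" using assms cubeD by (intro measure_mono_fmeasurable) (auto simp: fmeasurableD)
  then have "(a0 * sc k) powr d / Cd \<le> Cd * (A0 * sc m) powr d"
    using cube_\<sigma>(1)[OF Q] cube_\<sigma>(2)[OF R] by linarith
  then have "(a0 * sc k) powr d \<le> (Cd * Cd) * (A0 * sc m) powr d"
    using Cd0 by (simp add: field_simps)
  then have "a0 * sc k \<le> (Cd * Cd) powr (1/d) * (A0 * sc m)"
    using a0 A01 Cd0 by (intro powr_compare) auto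
  also have "(Cd * Cd) powr (1/d) = Cd powr (2/d)"
    using Cd0 by (simp add: powr_mult powr_add[symmetric] flip: mult_2)
  finally show ?thesis using a0 by (simp add: L0_def field_simps)
qed

lemma L0_pos: "0 < L0" using Cd0 A01 a0 by (simp add: L0_def)

lemma L0_ge: "1 \<le> L0"
proof -
  obtain x where "x \<in> \<Gamma>" using \<Gamma>_nonempty by auto
  then obtain Q where "Q \<in> \<DD> 0" using cube_cover by blast
  then show ?thesis using sub_cube_scale[of Q 0 Q 0] by simp
qed

text \<open>The exponent \<open>(2 * d + 1) / d\<close> is \<open>2 + 1/d\<close>, so the upper
  bound for \<eta> contains the factor 1/4 and the reciprocal of \<open>L0\<close>. This inequality
  lets a box that contains \<open>XQ Q\<close> satisfy the lower size bound in the region of the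
  parent or of a neighbour of \<open>Q\<close>.\<close>

lemma \<eta>_L0: "4 * L0 * \<eta> < 1"
proof -
  have "2 powr ((2 * d + 1) / d) = 2 powr (2 + 1/d)" using d0 by (simp add: add_divide_distrib)
  also have "\<dots> = 4 * 2 powr (1/d)" by (simp add: powr_add)
  finally have *: "\<eta> * (4 * 2 powr (1/d) * Cd powr (2/d) * A0) < a0"
    using \<eta>1 a0 A01 Cd0 by (simp add: field_simps)
  have "1 \<le> 2 powr (1/d)" using d0 by (simp add: ge_one_powr_ge_zero)
  then have "\<eta> * (4 * 1 * Cd powr (2/d) * A0) \<le> \<eta> * (4 * 2 powr (1/d) * Cd powr (2/d) * A0)"
    using \<eta>0 A01 by (intro mult_left_mono mult_right_mono) auto
  then have "\<eta> * (4 * Cd powr (2/d) * A0) < a0" using * by (simp only: mult_1_right)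
  then show ?thesis using a0 by (simp add: L0_def field_simps)
qed

text \<open>\<open>LEAST\<close> over the integers is meaningful only when the generations of
  \<open>Q\<close> are bounded below. They are, because the scale of any of them is at most
  \<open>L0\<close> times that of a given one.\<close>

lemma cube_length_exact:
  assumes "Q \<in> all_cubes \<DD>"
  shows "\<exists>k. Q \<in> \<DD> k \<and> cl Q = sc k \<and> (\<forall>m. Q \<in> \<DD> m \<longrightarrow> k \<le> m)"
proof -
  obtain k where k: "Q \<in> \<DD> k" using assms by (auto simp: all_cubes_def)
  obtain b where b: "L0 * sc k \<le> sc b"
    using ex_scale[of "L0 * sc k"] L0_pos by (metis mult_pos_pos sc_pos)
  have lb: "b \<le> m" if "Q \<in> \<DD> m" for m
    using sub_cube_scale[OF that k] b by (meson order_refl order_trans sc_le_iff)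
  obtain m where m: "Q \<in> \<DD> m" "\<And>y. Q \<in> \<DD> y \<Longrightarrow> nat (m - b) \<le> nat (y - b)"
    using ex_has_least_nat[of "\<lambda>k. Q \<in> \<DD> k" k "\<lambda>k. nat (k - b)"] k by auto
  have min: "m \<le> y" if "Q \<in> \<DD> y" for y
    using m(2)[OF that] lb[OF that] lb[OF m(1)] by linarith
  have "(LEAST k. Q \<in> \<DD> k) = m" by (rule Least_equality) (use m min in auto)
  then show ?thesis using m min by (auto simp: cube_length_def)
qed

lemma cl_pos: "0 < cl Q" by (simp add: cube_length_def)

lemma cl_bounds:
  assumes Q: "Q \<in> \<DD> k" shows "sc k \<le> cl Q" "cl Q \<le> L0 * sc k"
proof -
  obtain m where m: "Q \<in> \<DD> m" "cl Q = sc m" "m \<le> k" using cube_length_exact[OF cubeD(7)[OF Q]] Q by blast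
  show "sc k \<le> cl Q" "cl Q \<le> L0 * sc k"
    using m sub_cube_scale[OF m(1) Q] by (auto intro: sc_mono)
qed

lemma cl_mono:
  assumes Q: "Q \<in> all_cubes \<DD>" and R: "R \<in> all_cubes \<DD>" and QR: "Q \<subseteq> R"
  shows "cl Q \<le> cl R"
proof (rule ccontr)
  assume n: "\<not> cl Q \<le> cl R"
  obtain k m where k: "Q \<in> \<DD> k" "cl Q = sc k" and m: "R \<in> \<DD> m" "cl R = sc m"
    using cube_length_exact Q R by meson
  have "k \<le> m" using n k m sc_mono[of m k] by linarith
  then have "R \<subseteq> Q" using cube_nested[OF _ m(1) k(1)] QR cubeD(6)[OF k(1)] by blast
  then show False using n QR by auto
qed

lemma cl_dist:
  assumes "Q \<in> all_cubes \<DD>" "x \<in> Q" "y \<in> Q" shows "dist x y < A0 * cl Q"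
  using cube_length_exact[OF assms(1)] cube_dist assms by metis

text \<open>Each cube contains a relatively open ball, hence a point of a countable dense subset of
  \<Gamma>; disjointness within a generation makes the choice of such points injective.\<close>

lemma countable_level: "countable (\<DD> k)"
proof -
  obtain T where T: "countable T" "T \<subseteq> \<Gamma>" "\<Gamma> \<subseteq> closure T" using separable by blast
  have ex: "\<exists>t\<in>T. t \<in> Q" if Q: "Q \<in> \<DD> k" for Q
  proof -
    obtain x where x: "x \<in> \<Gamma>" "ball x (a0 * sc k) \<inter> \<Gamma> \<subseteq> Q" using cubeD(5)[OF Q] by auto
    then have "x \<in> closure T" using T by auto
    then obtain t where "t \<in> T" "dist t x < a0 * sc k"
      using a0 by (meson closure_approachable mult_pos_pos sc_pos)
    then show ?thesis using x T by (intro bexI[of _ t]) (auto simp: dist_commute)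
  qed
  define f where "f Q = (SOME t. t \<in> T \<and> t \<in> Q)" for Q
  have f: "f Q \<in> T \<and> f Q \<in> Q" if "Q \<in> \<DD> k" for Q
    unfolding f_def by (rule someI_ex) (use ex[OF that] in auto)
  have "inj_on f (\<DD> k)"
  proof (rule inj_onI)
    fix Q R assume "Q \<in> \<DD> k" "R \<in> \<DD> k" "f Q = f R"
    moreover from this have "f Q \<in> Q \<inter> R" using f[of Q] f[of R] by simp
    ultimately show "Q = R" using cube_eq by blast
  qed
  moreover have "f ` \<DD> k \<subseteq> T" using f by auto
  ultimately show ?thesis using T(1) countable_image_inj_on countable_subset by blast
qed

lemma countable_cubes: "countable (all_cubes \<DD>)"
  unfolding all_cubes_def using countable_level by auto

section \<open>Kept and removed cubes\<close>

lemma DF_cube: "Q \<in> DF \<Longrightarrow> Q \<in> all_cubes \<DD>"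
  by (auto simp: cubes_outside_def)

lemma DF_up: "Q \<in> DF \<Longrightarrow> R \<in> all_cubes \<DD> \<Longrightarrow> Q \<subseteq> R \<Longrightarrow> R \<in> DF"
  by (auto simp: cubes_outside_def cubes_below_def)

lemma DF_iff: "Q \<in> all_cubes \<DD> \<Longrightarrow> Q \<in> DF \<longleftrightarrow> \<not> (\<exists>P\<in>\<F>. Q \<subseteq> P)"
  by (auto simp: cubes_outside_def cubes_below_def)

lemma \<F>_eq: "P \<in> \<F> \<Longrightarrow> P' \<in> \<F> \<Longrightarrow> P \<inter> P' \<noteq> {} \<Longrightarrow> P = P'"
  using \<F>_disjoint by (auto simp: disjoint_def pairwise_def disjnt_def)

lemma cube_nonempty: "Q \<in> all_cubes \<DD> \<Longrightarrow> Q \<noteq> {}"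
  by (auto simp: all_cubes_def dest: cubeD(6))

text \<open>Start from the coarsest generation \<open>k\<close> of \<open>P\<close>. If its ancestor
  of generation \<open>k - 1\<close> lay in a removed cube, that cube would meet \<open>P\<close>,
  hence be \<open>P\<close>, and \<open>P\<close> itself would be of generation
  \<open>k - 1\<close>.\<close>

lemma \<F>_parent:
  assumes P: "P \<in> \<F>"
  obtains k R where "P \<in> \<DD> k" "cl P = sc k" "R \<in> \<DD> (k - 1)" "P \<subseteq> R" "R \<in> DF"
proof -
  have Pc: "P \<in> all_cubes \<DD>" using \<F>_cubes P by auto
  then obtain k where k: "P \<in> \<DD> k" "cl P = sc k" "\<And>m. P \<in> \<DD> m \<Longrightarrow> k \<le> m"
    using cube_length_exact by blast
  obtain R where R: "R \<in> \<DD> (k - 1)" "P \<subseteq> R" using cube_ancestor[OF k(1), of "k - 1"] by auto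
  have "\<not> R \<subseteq> P'" if P': "P' \<in> \<F>" for P'
  proof
    assume "R \<subseteq> P'"
    then have "P = P'" using \<F>_eq[OF P P'] R cube_nonempty[OF Pc] by blast
    then have "P \<in> \<DD> (k - 1)" using \<open>R \<subseteq> P'\<close> R by auto
    then show False using k(3) by force
  qed
  then have "R \<in> DF" using DF_iff cubeD(7)[OF R(1)] by blast
  then show ?thesis using that k R by blast
qed

text \<open>This makes \<Omega> and its frontier nonempty, so that \<open>infdist\<close> to the
  frontier is an attained distance and not the default value 0.\<close>

lemma DF_nonempty: "DF \<noteq> {}"
proof (cases "\<F> = {}")
  case True
  obtain x where "x \<in> \<Gamma>" using \<Gamma>_nonempty by auto
  then obtain Q where "Q \<in> \<DD> 0" using cube_cover by blast
  then show ?thesis using True cubeD(7) by (auto simp: cubes_outside_def)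
next
  case False then show ?thesis using \<F>_parent by blast
qed

lemma \<delta>_pos: "x \<notin> \<Gamma> \<Longrightarrow> 0 < \<delta> x"
  using closed_\<Gamma> \<Gamma>_nonempty infdist_pos_not_in_closed by blast

lemma \<delta>_zero: "x \<in> \<Gamma> \<Longrightarrow> \<delta> x = 0" by simp

lemma \<delta>_attained: obtains y where "y \<in> \<Gamma>" "dist x y = \<delta> x"
  using infdist_attains_inf[OF closed_\<Gamma> \<Gamma>_nonempty, of x] by metis

lemma \<delta>_lipschitz: "\<delta> x \<le> \<delta> y + dist x y"
  by (rule infdist_triangle)

end

subsection \<open>Whitney boxes and Whitney regions\<close>

lemma norm_le_sqrt_card:
  fixes v :: "real^'n" assumes "\<And>i. \<bar>v$i\<bar> \<le> b"
  shows "norm v \<le> sqrt (real CARD('n)) * b"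
proof -
  have b: "0 \<le> b" using assms[of undefined] by linarith
  have "norm v = sqrt (\<Sum>i\<in>UNIV. (v$i)\<^sup>2)" by (simp add: norm_vec_def L2_set_def)
  also have "\<dots> \<le> sqrt (\<Sum>i\<in>(UNIV::'n set). b\<^sup>2)"
    using abs_le_square_iff[of _ b] assms b by (intro real_sqrt_le_mono sum_mono) (metis abs_of_nonneg)
  also have "\<dots> = sqrt (real CARD('n)) * b" using b by (simp add: real_sqrt_mult)
  finally show ?thesis .
qed

lemma box_set_cbox:
  fixes I :: "'n::finite box"
  shows "box_set I = cbox (fst I - (\<chi> i. snd I / 2)) (fst I + (\<chi> i. snd I / 2))"
proof (intro set_eqI)
  fix x
  have "(\<bar>x $ i - fst I $ i\<bar> \<le> snd I / 2) = (fst I $ i - snd I / 2 \<le> x $ i \<and> x $ i \<le> fst I $ i + snd I / 2)" for i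
    by linarith
  then show "x \<in> box_set I \<longleftrightarrow> x \<in> cbox (fst I - (\<chi> i. snd I / 2)) (fst I + (\<chi> i. snd I / 2))"
    by (simp add: box_set_def mem_box_cart)
qed

lemma compact_box_set: "compact (box_set (I :: 'n::finite box))"
  and convex_box_set: "convex (box_set I)"
  and closed_box_set: "closed (box_set I)" and borel_box_set: "box_set I \<in> sets borel"
  by (simp_all add: box_set_cbox closed_cbox)

lemma centre_in_box: "0 \<le> snd I \<Longrightarrow> fst I \<in> box_set I"
  by (simp add: box_set_def)

lemma interior_box_set:
  fixes I :: "'n::finite box"
  shows "interior (box_set I) = {y. \<forall>i. \<bar>y $ i - fst I $ i\<bar> < snd I / 2}"
proof -
  have "interior (box_set I) = box (fst I - (\<chi> i. snd I / 2)) (fst I + (\<chi> i. snd I / 2))"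
    by (simp add: box_set_cbox interior_cbox)
  also have "\<dots> = {y. \<forall>i. \<bar>y $ i - fst I $ i\<bar> < snd I / 2}"
  proof (intro set_eqI)
    fix x
    have "(\<bar>x $ i - fst I $ i\<bar> < snd I / 2) = (fst I $ i - snd I / 2 < x $ i \<and> x $ i < fst I $ i + snd I / 2)" for i
      by linarith
    then show "x \<in> box (fst I - (\<chi> i. snd I / 2)) (fst I + (\<chi> i. snd I / 2))
        \<longleftrightarrow> x \<in> {y. \<forall>i. \<bar>y $ i - fst I $ i\<bar> < snd I / 2}"
      by (simp add: mem_box_cart)
  qed
  finally show ?thesis .
qed

lemma diameter_box_set:
  fixes I :: "'n::finite box"
  assumes "0 \<le> snd I" shows "diameter (box_set I) = sqrt (real CARD('n)) * snd I"
proof -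
  have "diameter (box_set I) = dist (fst I - (\<chi> i. snd I / 2)) (fst I + (\<chi> i. snd I / 2))"
    unfolding box_set_cbox using assms
    by (intro diameter_cbox) (auto simp: Basis_vec_def inner_axis)
  also have "\<dots> = norm ((\<chi> i. - snd I) :: real^'n)"
    unfolding dist_norm by (rule arg_cong[where f=norm]) (simp add: vec_eq_iff)
  also have "\<dots> = sqrt (real CARD('n)) * snd I"
    using assms by (simp add: norm_vec_def L2_set_def real_sqrt_mult)
  finally show ?thesis .
qed

lemma dist_box_sets:
  fixes x y :: "real^'n"
  assumes "x \<in> box_set (dilate s I)" "y \<in> box_set (dilate t I)"
  shows "dist x y \<le> sqrt (real CARD('n)) * ((s + t) / 2 * snd I)"
  unfolding dist_norm
proof (rule norm_le_sqrt_card)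
  fix i
  have "\<bar>x$i - fst I$i\<bar> \<le> s * snd I / 2" "\<bar>y$i - fst I$i\<bar> \<le> t * snd I / 2"
    using assms by (auto simp: box_set_def dilate_def)
  then have "\<bar>x$i - y$i\<bar> \<le> s * snd I / 2 + t * snd I / 2" by linarith
  then show "\<bar>(x - y)$i\<bar> \<le> (s + t) / 2 * snd I" by (simp add: field_simps)
qed

lemma dilate_1 [simp]: "dilate 1 I = I" by (simp add: dilate_def)

lemma box_set_dilate_mono: "s \<le> t \<Longrightarrow> 0 \<le> snd I \<Longrightarrow> box_set (dilate s I) \<subseteq> box_set (dilate t I)"
proof (intro subsetI)
  fix y assume st: "s \<le> t" "0 \<le> snd I" and "y \<in> box_set (dilate s I)"
  then have y: "\<bar>y$i - fst I$i\<bar> \<le> s * snd I / 2" for i by (simp add: box_set_def dilate_def)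
  have "s * snd I \<le> t * snd I" using st by (intro mult_right_mono)
  then have "\<bar>y$i - fst I$i\<bar> \<le> t * snd I / 2" for i using y[of i] by linarith
  then show "y \<in> box_set (dilate t I)" by (simp add: box_set_def dilate_def)
qed

lemma ball_in_dilate:
  assumes "y \<in> box_set I" "r \<le> t * snd I / 2"
  shows "ball y r \<subseteq> interior (box_set (dilate (1 + t) I))"
  unfolding interior_box_set
proof (intro subsetI CollectI allI)
  fix z i assume z: "z \<in> ball y r"
  have "\<bar>z$i - y$i\<bar> < r"
    using component_le_norm_cart[of "z - y" i] z by (simp add: dist_norm norm_minus_commute)
  moreover have "\<bar>y$i - fst I$i\<bar> \<le> snd I / 2" using assms by (simp add: box_set_def)
  ultimately have "\<bar>z$i - fst I$i\<bar> < snd I / 2 + t * snd I / 2"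
    using assms(2) unfolding vector_minus_component by linarith
  then show "\<bar>z$i - fst (dilate (1 + t) I)$i\<bar> < snd (dilate (1 + t) I) / 2"
    by (simp add: dilate_def algebra_simps add_divide_distrib)
qed

context sawtooth begin

definition rn :: real where "rn = sqrt (real CARD('n))"
abbreviation star :: "'n box \<Rightarrow> (real^'n) set" where "star I \<equiv> box_set (dilate (1 + \<theta>) I)"

lemma rn1: "1 \<le> rn" using n3 by (simp add: rn_def)

lemmas norm_le_rn = norm_le_sqrt_card[where 'n='n, folded rn_def]
  and dist_box_sets_rn = dist_box_sets[where 'n='n, folded rn_def]
  and diameter_box_set_rn = diameter_box_set[where 'n='n, folded rn_def]

lemma \<theta>_small: "\<theta> < 1/16"
proof -
  have "1 / (16 * rn) \<le> 1/16" using rn1 by (simp add: field_simps)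
  moreover have "\<theta> < 1 / (16 * rn)" using \<theta>1 unfolding rn_def .
  ultimately show ?thesis by linarith
qed

lemmas whitney_parts =
  whitney[unfolded whitney_decomposition_def, THEN conjunct1]
  whitney[unfolded whitney_decomposition_def, THEN conjunct2, THEN conjunct1]
  whitney[unfolded whitney_decomposition_def, THEN conjunct2, THEN conjunct2, THEN conjunct1]
  whitney[unfolded whitney_decomposition_def, THEN conjunct2, THEN conjunct2, THEN conjunct2, THEN conjunct1]

lemma W_pos: "I \<in> W \<Longrightarrow> 0 < snd I"
  using whitney_parts(1) by (auto simp: dyadic_box_def)

lemma W_cover: "x \<notin> \<Gamma> \<Longrightarrow> \<exists>I\<in>W. x \<in> box_set I"
  using whitney_parts(2) by auto

lemma box_in_star: "I \<in> W \<Longrightarrow> box_set I \<subseteq> star I"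
  using box_set_dilate_mono[of 1 "1 + \<theta>" I] W_pos \<theta>0 by fastforce

text \<open>Since \<open>1 + \<theta> \<le> 4\<close>, the dilated box lies in the fourfold one,
  whose distance to \<Gamma> the Whitney property controls.\<close>

lemma \<delta>_star_ge:
  assumes I: "I \<in> W" and y: "y \<in> star I" shows "4 * rn * snd I \<le> \<delta> y"
proof -
  have p: "0 < snd I" using W_pos I by auto
  have y4: "y \<in> box_set (dilate 4 I)" using box_set_dilate_mono[of "1 + \<theta>" 4 I] p y \<theta>_small by auto
  obtain g where g: "g \<in> \<Gamma>" "dist y g = \<delta> y" by (rule \<delta>_attained)
  have "4 * diameter (box_set I) \<le> setdist (box_set (dilate 4 I)) \<Gamma>" using whitney_parts(4) I by blast
  also have "\<dots> \<le> dist y g" using y4 g by (intro setdist_le_dist) auto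
  finally show ?thesis using p g by (simp add: diameter_box_set_rn)
qed

lemma \<delta>_dilate_le:
  assumes I: "I \<in> W" and y: "y \<in> box_set (dilate t I)"
  shows "\<delta> y \<le> (40 + (1 + t) / 2) * rn * snd I"
proof -
  have p: "0 < snd I" using W_pos I by auto
  obtain x g where g: "x \<in> box_set I" "g \<in> \<Gamma>" "dist x g = setdist (box_set I) \<Gamma>"
    using setdist_compact_closed[OF compact_box_set closed_\<Gamma>, of I] \<Gamma>_nonempty centre_in_box[of I] p by fastforce
  have "\<delta> y \<le> dist y g" using g by (intro infdist_le)
  also have "\<dots> \<le> dist y x + dist x g" by (rule dist_triangle)
  also have "dist y x \<le> rn * ((t + 1) / 2 * snd I)" using dist_box_sets_rn[OF y, of x 1] g by simp
  also have "dist x g \<le> 40 * (rn * snd I)"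
    using g whitney_parts(4) I p by (metis diameter_box_set_rn less_imp_le)
  finally show ?thesis by (simp add: algebra_simps)
qed

lemma \<delta>_box_le: "I \<in> W \<Longrightarrow> y \<in> box_set I \<Longrightarrow> \<delta> y \<le> 41 * rn * snd I"
  using \<delta>_dilate_le[of I y 1] by simp

lemma \<delta>_star_le:
  assumes "I \<in> W" "y \<in> star I" shows "\<delta> y \<le> 42 * rn * snd I"
proof -
  have "\<delta> y \<le> (40 + (1 + (1 + \<theta>)) / 2) * rn * snd I" using \<delta>_dilate_le assms by blast
  also have "\<dots> \<le> 42 * rn * snd I"
    using W_pos[OF assms(1)] rn1 \<theta>_small by (intro mult_right_mono) auto
  finally show ?thesis .
qed

lemma star_disjoint_\<Gamma>: "I \<in> W \<Longrightarrow> y \<in> star I \<Longrightarrow> y \<notin> \<Gamma>"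
proof
  assume a: "I \<in> W" "y \<in> star I" "y \<in> \<Gamma>"
  have "0 < 4 * rn * snd I" using W_pos[OF a(1)] rn1 by (intro mult_pos_pos) auto
  then show False using \<delta>_star_ge[OF a(1,2)] \<delta>_zero[OF a(3)] by linarith
qed

lemma dist_star: 
  assumes "I \<in> W" "x \<in> star I" "y \<in> star I" shows "dist x y \<le> 2 * rn * snd I"
proof -
  have "dist x y \<le> rn * (((1 + \<theta>) + (1 + \<theta>)) / 2 * snd I)" using dist_box_sets_rn assms by blast
  also have "\<dots> \<le> rn * (2 * snd I)"
    using W_pos[OF assms(1)] rn1 \<theta>_small by (intro mult_left_mono mult_right_mono) auto
  finally show ?thesis by (simp add: algebra_simps)
qed

section \<open>Harnack chains attached to a cube and the regions they generate\<close>

lemma c01: "0 < c" "c < 1" using corkscrew by (auto simp: corkscrew_constant_def)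

lemma cH01: "0 < cH" "cH < 1" using harnack by (auto simp: harnack_constant_def)

lemma K_ge: "500 * A0 \<le> a0 * K" "500 \<le> a0 * K" "500 \<le> K"
proof -
  show 1: "500 * A0 \<le> a0 * K" using K500 a0 by (simp add: field_simps)
  then show 2: "500 \<le> a0 * K" using A01 by linarith
  have "0 < K" using 2 a0 by (smt (verit) zero_less_mult_pos)
  then have "a0 * K \<le> K" using a01 by (simp add: mult_le_cancel_right1)
  then show "500 \<le> K" using 2 by linarith
qed

lemma \<eta>_small: "\<eta> < 1/4"
proof -
  have "4 * 1 * \<eta> \<le> 4 * L0 * \<eta>" using L0_ge \<eta>0 by (intro mult_right_mono) auto
  then show ?thesis using \<eta>_L0 by linarith
qed

text \<open>The radius of the chain balls of a cube in units of its length, which is half the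
  distance that the chain segments are guaranteed to keep from \<Gamma>. It is one number because
  \<open>s\<close> is proportional to the cube length and \<Lambda> is the same for all
  cubes.\<close>

definition hr :: real where
  "hr = harnack_distance d cH TYPE('n) (2 / 41 * a0 * c * \<eta>) (41 / (2 * c * \<eta>) * (1 + 5 / 4 * K + A0 / a0)) / 2"

lemma hr_pos: "0 < hr"
proof -
  have "0 < 41 / (2 * c * \<eta>) * (1 + 5 / 4 * K + A0 / a0)"
    using c01 \<eta>0 K_ge a0 A01 by (intro mult_pos_pos) (auto intro!: add_pos_pos divide_pos_pos)
  then show ?thesis using c01 cH01 \<eta>0 a0 by (auto simp: hr_def harnack_distance_def intro!: mult_pos_pos)
qed

lemma hr_le_1: "hr * cl Q * 2 = harnack_distance d cH TYPE('n) (2 / 41 * a0 * c * \<eta> * cl Q)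
     (41 / (2 * c * \<eta>) * (1 + 5 / 4 * K + A0 / a0))"
  by (simp add: hr_def harnack_distance_def)

abbreviation sQ :: "(real^'n) set \<Rightarrow> real" where "sQ Q \<equiv> 2 / 41 * a0 * c * \<eta> * cl Q"

lemma chain_info:
  assumes Q: "Q \<in> all_cubes \<DD>" and I: "I \<in> W0 Q"
  obtains Y1 Y2 Z and m :: nat where "Y1 \<in> ball (fst I) (sQ Q / 2)" "Y2 \<in> ball (XQ Q) (sQ Q / 2)"
    "\<And>i. i \<le> m \<Longrightarrow> Z i \<in> closed_segment Y1 Y2" "H Q I = (\<Union>i\<le>m. ball (Z i) (hr * cl Q))"
    "closed_segment Y1 Y2 \<subseteq> H Q I" "\<And>p. p \<in> closed_segment Y1 Y2 \<Longrightarrow> 2 * (hr * cl Q) \<le> \<delta> p"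
proof -
  have hc: "harnack_chain d cH \<Gamma> (sQ Q) (41 / (2 * c * \<eta>) * (1 + 5 / 4 * K + A0 / a0)) (fst I) (XQ Q) (H Q I)"
    using chains Q I by blast
  then obtain Y1 Y2 Z and m :: nat where *: 
      "harnack_segment d cH \<Gamma> (sQ Q) (41 / (2 * c * \<eta>) * (1 + 5 / 4 * K + A0 / a0)) (fst I) (XQ Q) Y1 Y2"
      "\<forall>i\<le>m. Z i \<in> closed_segment Y1 Y2" "closed_segment Y1 Y2 \<subseteq> (\<Union>i\<le>m. ball (Z i) (hr * cl Q))"
      "H Q I = (\<Union>i\<le>m. ball (Z i) (hr * cl Q))"
    unfolding harnack_chain_def Let_def hr_le_1[symmetric] by auto
  have "2 * (hr * cl Q) \<le> \<delta> p" if p: "p \<in> closed_segment Y1 Y2" for p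
  proof -
    obtain g where g: "g \<in> \<Gamma>" "dist p g = \<delta> p" by (rule \<delta>_attained)
    have "2 * (hr * cl Q) \<le> setdist (closed_segment Y1 Y2) \<Gamma>"
      using *(1) unfolding harnack_segment_def hr_le_1[symmetric] by (simp add: mult.commute)
    also have "\<dots> \<le> dist p g" using p g by (intro setdist_le_dist)
    finally show ?thesis using g by simp
  qed
  moreover have "Y1 \<in> ball (fst I) (sQ Q / 2)" "Y2 \<in> ball (XQ Q) (sQ Q / 2)"
    using *(1) unfolding harnack_segment_def by simp_all
  ultimately show ?thesis using that[of Y1 Y2 m Z] *(2-4) by simp
qed

lemma W0_D:
  assumes "I \<in> W0 Q"
  shows "I \<in> W" "a0 * c / (82 * rn) * \<eta> * cl Q \<le> snd I" "snd I \<le> a0 / (4 * rn) * K * cl Q"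
    "setdist (box_set I) Q \<le> a0 * K * cl Q"
  using assms unfolding W0_def whitney_initial_def rn_def by auto

lemma W0_I:
  assumes "I \<in> W" "a0 * c * \<eta> * cl Q \<le> 82 * rn * snd I" "4 * rn * snd I \<le> a0 * K * cl Q"
    "setdist (box_set I) Q \<le> a0 * K * cl Q"
  shows "I \<in> W0 Q"
  using assms rn1 unfolding W0_def whitney_initial_def rn_def by (auto simp: field_simps)

lemma xc_props:
  assumes "Q \<in> all_cubes \<DD>"
  shows "xc Q \<in> \<Gamma>" "xc Q \<in> Q" "ball (xc Q) (a0 * cl Q) \<inter> \<Gamma> \<subseteq> Q"
proof -
  show *: "xc Q \<in> \<Gamma>" "ball (xc Q) (a0 * cl Q) \<inter> \<Gamma> \<subseteq> Q"
    using centres assms unfolding cube_centres_def by blast+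
  moreover have "xc Q \<in> ball (xc Q) (a0 * cl Q)" using a0 cl_pos by simp
  ultimately show "xc Q \<in> Q" by blast
qed

lemma infdist_ge: "ball x r \<inter> \<Gamma> = {} \<Longrightarrow> r \<le> \<delta> x"
  by (metis \<delta>_attained disjoint_iff mem_ball not_le_imp_less)

lemma XQ_props:
  assumes "Q \<in> all_cubes \<DD>"
  shows "c * a0 * cl Q \<le> \<delta> (XQ Q)" "dist (XQ Q) (xc Q) < a0 * cl Q"
proof -
  have p: "0 < c * (a0 * cl Q)" using c01 a0 cl_pos by simp
  have *: "ball (XQ Q) (c * (a0 * cl Q)) \<subseteq> ball (xc Q) (a0 * cl Q) \<inter> - \<Gamma>"
    using XQ assms unfolding corkscrew_point_def by blast
  then show "c * a0 * cl Q \<le> \<delta> (XQ Q)" using infdist_ge[of "XQ Q" "c * (a0 * cl Q)"] by (auto simp: mult.assoc)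
  have "XQ Q \<in> ball (XQ Q) (c * (a0 * cl Q))" using p by simp
  then have "XQ Q \<in> ball (xc Q) (a0 * cl Q)" using * by blast
  then show "dist (XQ Q) (xc Q) < a0 * cl Q" by (simp add: dist_commute)
qed

lemma IQ_props:
  assumes Q: "Q \<in> all_cubes \<DD>" and I: "I \<in> W" "XQ Q \<in> box_set I"
  shows "c * a0 * cl Q \<le> 41 * rn * snd I" "4 * rn * snd I \<le> a0 * cl Q"
proof -
  show "c * a0 * cl Q \<le> 41 * rn * snd I" using XQ_props(1)[OF Q] \<delta>_box_le[OF I] by linarith
  have "4 * rn * snd I \<le> \<delta> (XQ Q)" using \<delta>_star_ge I box_in_star by blast
  also have "\<dots> \<le> dist (XQ Q) (xc Q)" using xc_props[OF Q] by (intro infdist_le)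
  finally show "4 * rn * snd I \<le> a0 * cl Q" using XQ_props(2)[OF Q] by linarith
qed

lemma ex_IQ: "Q \<in> all_cubes \<DD> \<Longrightarrow> \<exists>I\<in>W0 Q. XQ Q \<in> box_set I"
  using XQ by blast

text \<open>The side of a box containing \<open>XQ Q\<close> is bounded below by a multiple of
  \<open>cl Q\<close> that does not involve \<eta>. The lower size bound in the region of
  \<open>R\<close> carries the factor \<eta>, so it tolerates \<open>cl R\<close> as large as
  \<open>2 * cl Q / \<eta>\<close>; the upper bounds follow from the size of \<open>K\<close>. This
  one box will link \<open>XQ Q\<close> to \<open>XQ R\<close>.\<close>

lemma IQ_in_W0:
  assumes Q: "Q \<in> all_cubes \<DD>" and R: "R \<in> all_cubes \<DD>" and I: "I \<in> W" "XQ Q \<in> box_set I"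
    and le: "cl Q \<le> 125 * cl R" "\<eta> * cl R \<le> 2 * cl Q" and z: "z \<in> R" "dist (xc Q) z \<le> 250 * A0 * cl R"
  shows "I \<in> W0 R"
proof (rule W0_I[OF I(1)])
  have "a0 * c * (\<eta> * cl R) \<le> a0 * c * (2 * cl Q)" using le a0 c01 by (intro mult_left_mono) auto
  then show "a0 * c * \<eta> * cl R \<le> 82 * rn * snd I" using IQ_props(1)[OF Q I] by (simp add: algebra_simps)
  have "1 * cl R \<le> A0 * cl R" "a0 * cl Q \<le> 1 * cl Q"
    using A01 a01 cl_pos[of Q] cl_pos[of R] by (auto intro!: mult_right_mono)
  moreover have "(500 * A0) * cl R \<le> (a0 * K) * cl R"
    using K_ge cl_pos[of R] by (intro mult_right_mono) auto
  ultimately have *: "500 * (A0 * cl R) \<le> a0 * K * cl R" "cl R \<le> A0 * cl R" "a0 * cl Q \<le> cl Q" by auto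
  show "4 * rn * snd I \<le> a0 * K * cl R"
    using IQ_props(2)[OF Q I] * le cl_pos[of R] by linarith
  have "setdist (box_set I) R \<le> dist (XQ Q) z" using I z by (intro setdist_le_dist)
  also have "\<dots> \<le> dist (XQ Q) (xc Q) + dist (xc Q) z" by (rule dist_triangle)
  also have "\<dots> \<le> a0 * cl Q + 250 * A0 * cl R" using XQ_props(2)[OF Q] z by linarith
  also have "\<dots> \<le> a0 * K * cl R" using * le cl_pos[of R] by linarith
  finally show "setdist (box_set I) R \<le> a0 * K * cl R" .
qed

text \<open>The segment of a chain ends at a point within \<open>sQ Q / 2\<close> of
  \<open>XQ Q\<close>. This puts the missing last piece of the path into boxes of the region as
  well.\<close>

lemma near_XQ_in_W0:
  assumes Q: "Q \<in> all_cubes \<DD>" and p: "dist (XQ Q) p < sQ Q / 2"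
  shows "\<exists>J\<in>W0 Q. p \<in> box_set J"
proof -
  let ?q = "a0 * c * cl Q"
  have q0: "0 < ?q" using a0 c01 cl_pos by simp
  have s: "sQ Q / 2 = \<eta> / 41 * ?q" by simp
  have s2: "\<eta> / 41 * ?q \<le> 1/41 * ?q" using \<eta>_small q0 by (intro mult_right_mono) auto
  have q1: "?q \<le> a0 * cl Q" using c01 a0 cl_pos by (simp add: mult_le_cancel_right1)
  have "\<delta> (XQ Q) \<le> \<delta> p + dist (XQ Q) p" by (rule \<delta>_lipschitz)
  then have \<delta>p: "?q - \<eta> / 41 * ?q \<le> \<delta> p" using XQ_props(1)[OF Q] p s by (simp add: algebra_simps)
  have dp: "dist p (xc Q) \<le> 2 * (a0 * cl Q)"
    using dist_triangle[of p "xc Q" "XQ Q"] XQ_props(2)[OF Q] p s s2 q0 q1 dist_commute[of p "XQ Q"] by linarith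
  have "0 < \<delta> p" using \<delta>p s2 q0 by linarith
  then have "p \<notin> \<Gamma>" using \<delta>_zero by fastforce
  then obtain J where J: "J \<in> W" "p \<in> box_set J" using W_cover by blast
  have "J \<in> W0 Q"
  proof (rule W0_I[OF J(1)])
    have "\<eta> * ?q \<le> 1 * ?q" using \<eta>_small q0 by (intro mult_right_mono) auto
    then show "a0 * c * \<eta> * cl Q \<le> 82 * rn * snd J"
      using \<delta>_box_le[OF J] \<delta>p s2 q0 by (simp add: algebra_simps)
    have dK: "2 * (a0 * cl Q) \<le> a0 * K * cl Q"
      using mult_right_mono[of 2 K "a0 * cl Q"] K_ge a0 cl_pos[of Q] by (simp add: algebra_simps)
    have "4 * rn * snd J \<le> \<delta> p" using \<delta>_star_ge J box_in_star by blast
    also have "\<dots> \<le> dist p (xc Q)" using xc_props[OF Q] by (intro infdist_le)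
    finally show "4 * rn * snd J \<le> a0 * K * cl Q" using dp dK by linarith
    have "setdist (box_set J) Q \<le> dist p (xc Q)" using J xc_props[OF Q] by (intro setdist_le_dist)
    then show "setdist (box_set J) Q \<le> a0 * K * cl Q" using dp dK by linarith
  qed
  then show ?thesis using J by blast
qed

lemma WQ_D: "J \<in> WQ Q \<Longrightarrow> J \<in> W" "J \<in> WQ Q \<Longrightarrow> \<exists>I\<in>W0 Q. H Q I \<inter> box_set J \<noteq> {}"
  by (auto simp: whitney_region_def)

lemma W0_sub: "Q \<in> all_cubes \<DD> \<Longrightarrow> I \<in> W0 Q \<Longrightarrow> I \<in> WQ Q"
  using chains W0_D(1)[of I Q] unfolding whitney_region_def by blast

text \<open>The radius of the balls is half the distance that the segment keeps from \<Gamma>, so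
  the other half is left on the whole chain. A box containing a chain point belongs to the region by
  definition.\<close>

lemma H_point:
  assumes Q: "Q \<in> all_cubes \<DD>" and I: "I \<in> W0 Q" and p: "p \<in> H Q I"
  shows "hr * cl Q \<le> \<delta> p" and "\<exists>J\<in>WQ Q. p \<in> box_set J"
    and "dist p (xc Q) \<le> (hr + 2 + a0 * K * 2 + A0) * cl Q"
proof -
  obtain Y1 Y2 Z and m :: nat where Y: "Y1 \<in> ball (fst I) (sQ Q / 2)" "Y2 \<in> ball (XQ Q) (sQ Q / 2)"
    "\<And>i. i \<le> m \<Longrightarrow> Z i \<in> closed_segment Y1 Y2" "H Q I = (\<Union>i\<le>m. ball (Z i) (hr * cl Q))"
    "\<And>p. p \<in> closed_segment Y1 Y2 \<Longrightarrow> 2 * (hr * cl Q) \<le> \<delta> p"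
    using chain_info[OF Q I] by metis
  obtain i where i: "i \<le> m" "dist (Z i) p < hr * cl Q" using p Y(4) by auto
  have "\<delta> (Z i) \<le> \<delta> p + dist (Z i) p" by (rule \<delta>_lipschitz)
  then show 1: "hr * cl Q \<le> \<delta> p" using Y(5)[OF Y(3)[OF i(1)]] i by linarith
  then have "0 < \<delta> p" using hr_pos cl_pos[of Q] by (smt (verit) mult_pos_pos)
  then have "p \<notin> \<Gamma>" using \<delta>_zero by fastforce
  then show "\<exists>J\<in>WQ Q. p \<in> box_set J" using W_cover[of p] I p by (auto simp: whitney_region_def)
  have IW: "I \<in> W" using W0_D I by blast
  have p': "0 < snd I" using W_pos IW by blast
  have "setdist (box_set I) Q < a0 * K * cl Q + cl Q" using W0_D(4)[OF I] cl_pos[of Q] by linarith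
  then obtain x y where xy: "x \<in> box_set I" "y \<in> Q" "dist x y < a0 * K * cl Q + cl Q"
    using setdist_ltE[of "box_set I" Q] centre_in_box[of I] p' cube_nonempty[OF Q] by (metis empty_iff less_imp_le)
  have "dist (fst I) x \<le> 2 * rn * snd I"
    using dist_star[OF IW] box_in_star[OF IW] xy centre_in_box[of I] p' by (meson less_imp_le subsetD)
  also have "\<dots> \<le> a0 * K * cl Q"
  proof -
    have "0 < rn * snd I" using rn1 p' by (intro mult_pos_pos) auto
    moreover have "4 * (rn * snd I) \<le> a0 * K * cl Q" using W0_D(3)[OF I] rn1 by (simp add: field_simps)
    ultimately show ?thesis by linarith
  qed
  finally have fx: "dist (fst I) x \<le> a0 * K * cl Q" .
  have yx: "dist y (xc Q) \<le> A0 * cl Q" using cl_dist[OF Q xy(2) xc_props(2)[OF Q]] by simp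
  have s: "sQ Q / 2 \<le> cl Q"
  proof -
    have "a0 * (c * (\<eta> / 41)) * cl Q \<le> 1 * cl Q"
      using a0 a01 c01 \<eta>0 \<eta>_small cl_pos[of Q] by (intro mult_right_mono mult_le_one) auto
    then show ?thesis by (simp add: algebra_simps)
  qed
  let ?R = "(2 + a0 * K * 2 + A0) * cl Q"
  have "dist Y1 (xc Q) \<le> ?R"
    using dist_triangle[of Y1 "xc Q" "fst I"] dist_triangle[of "fst I" "xc Q" x] dist_triangle[of x "xc Q" y]
      Y(1) fx xy yx s by (simp add: algebra_simps dist_commute)
  moreover have "dist Y2 (xc Q) \<le> ?R"
  proof -
    have "a0 * cl Q \<le> 1 * cl Q" using a01 cl_pos[of Q] by (intro mult_right_mono) auto
    moreover have "0 \<le> (a0 * K * 2 + A0) * cl Q" using K_ge A01 cl_pos[of Q] by (intro mult_nonneg_nonneg) auto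
    ultimately show ?thesis
      using dist_triangle[of Y2 "xc Q" "XQ Q"] Y(2) XQ_props(2)[OF Q] s by (simp add: algebra_simps dist_commute)
  qed
  ultimately have "closed_segment Y1 Y2 \<subseteq> cball (xc Q) ?R"
    by (intro closed_segment_subset) (auto simp: dist_commute)
  then have "dist (Z i) (xc Q) \<le> ?R" using Y(3)[OF i(1)] by (auto simp: dist_commute)
  then show "dist p (xc Q) \<le> (hr + 2 + a0 * K * 2 + A0) * cl Q"
    using dist_triangle[of p "xc Q" "Z i"] i by (simp add: algebra_simps dist_commute)
qed

text \<open>A region box contains a chain point, which is at least \<open>hr * cl Q\<close> away
  from \<Gamma> and at most a multiple of \<open>cl Q\<close> away from the centre of
  \<open>Q\<close>; the Whitney property transfers both bounds to the box.\<close>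

lemma ex_CW: "\<exists>C\<ge>1. \<forall>Q\<in>all_cubes \<DD>. \<forall>J\<in>WQ Q. cl Q \<le> C * snd J \<and> snd J \<le> C * cl Q \<and>
    (\<forall>y\<in>star J. \<forall>z\<in>Q. dist y z \<le> C * cl Q)"
proof -
  define B where "B = hr + 2 + a0 * K * 2 + A0"
  have B: "1 \<le> B" using hr_pos K_ge A01 by (simp add: B_def)
  define C where "C = 41 * rn / hr + 2 * B + A0"
  have C0: "0 \<le> 41 * rn / hr" using rn1 hr_pos by simp
  have C: "41 * rn / hr \<le> C" "2 * B + A0 \<le> C" "1 \<le> C"
    using C0 B A01 unfolding C_def by linarith+
  have "cl Q \<le> C * snd J \<and> snd J \<le> C * cl Q \<and> (\<forall>y\<in>star J. \<forall>z\<in>Q. dist y z \<le> C * cl Q)"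
    if Q: "Q \<in> all_cubes \<DD>" and J: "J \<in> WQ Q" for Q J
  proof -
    obtain I p where I: "I \<in> W0 Q" and p: "p \<in> H Q I" "p \<in> box_set J" using WQ_D(2)[OF J] by auto
    have JW: "J \<in> W" using WQ_D J by blast
    have J0: "0 < snd J" using W_pos[OF JW] .
    have 1: "hr * cl Q \<le> 41 * rn * snd J" using H_point(1)[OF Q I p(1)] \<delta>_box_le[OF JW p(2)] by linarith
    then have "cl Q \<le> 41 * rn / hr * snd J" using hr_pos by (simp add: field_simps)
    also have "\<dots> \<le> C * snd J" using C J0 by (intro mult_right_mono) auto
    finally have a: "cl Q \<le> C * snd J" .
    have dp: "dist p (xc Q) \<le> B * cl Q" using H_point(3)[OF Q I p(1)] by (simp add: B_def)
    have "4 * rn * snd J \<le> \<delta> p" using \<delta>_star_ge JW p box_in_star by blast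
    also have "\<dots> \<le> dist p (xc Q)" using xc_props[OF Q] by (intro infdist_le)
    finally have 2: "4 * rn * snd J \<le> B * cl Q" using dp by linarith
    have "1 * snd J \<le> rn * snd J" using rn1 J0 by (intro mult_right_mono) auto
    then have "snd J \<le> B * cl Q" using 2 J0 by linarith
    also have "\<dots> \<le> C * cl Q" using C B A01 cl_pos[of Q] by (intro mult_right_mono) auto
    finally have b: "snd J \<le> C * cl Q" .
    have "dist y z \<le> C * cl Q" if y: "y \<in> star J" and z: "z \<in> Q" for y z
    proof -
      have "dist y p \<le> 2 * rn * snd J" using dist_star[OF JW y] p box_in_star[OF JW] by blast
      moreover have "2 * rn * snd J \<le> B * cl Q" using 2 mult_pos_pos[of rn "snd J"] J0 rn1 by linarith
      moreover have "dist (xc Q) z \<le> A0 * cl Q" using cl_dist[OF Q xc_props(2)[OF Q] z] by simp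
      ultimately have "dist y z \<le> (2 * B + A0) * cl Q"
        using dist_triangle[of y z p] dist_triangle[of p z "xc Q"] dp by (simp add: algebra_simps)
      also have "\<dots> \<le> C * cl Q" using C cl_pos[of Q] by (intro mult_right_mono) auto
      finally show ?thesis .
    qed
    with a b show ?thesis by blast
  qed
  with C show ?thesis by blast
qed

text \<open>Fixed by choice so that later definitions and statements can refer to one
  constant.\<close>

definition CW :: real where
  "CW = (SOME C. C \<ge> 1 \<and> (\<forall>Q\<in>all_cubes \<DD>. \<forall>J\<in>WQ Q. cl Q \<le> C * snd J \<and> snd J \<le> C * cl Q \<and>
    (\<forall>y\<in>star J. \<forall>z\<in>Q. dist y z \<le> C * cl Q)))"

lemma CW_props: "CW \<ge> 1 \<and> (\<forall>Q\<in>all_cubes \<DD>. \<forall>J\<in>WQ Q. cl Q \<le> CW * snd J \<and> snd J \<le> CW * cl Q \<and>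
    (\<forall>y\<in>star J. \<forall>z\<in>Q. dist y z \<le> CW * cl Q))"
  unfolding CW_def using ex_CW by (rule someI_ex)

lemma CW1: "1 \<le> CW" using CW_props by blast

lemma region_props:
  assumes "Q \<in> all_cubes \<DD>" "J \<in> WQ Q"
  shows "cl Q \<le> CW * snd J" "snd J \<le> CW * cl Q" "y \<in> star J \<Longrightarrow> z \<in> Q \<Longrightarrow> dist y z \<le> CW * cl Q"
  using CW_props assms by blast+

text \<open>The cube has scale about \<open>rn * snd J\<close> and contains a point of \<Gamma>
  nearest to \<open>J\<close>. Its length may exceed its scale by \<open>L0\<close>, which
  \<open>\<eta>_L0\<close> compensates in the lower size bound.\<close>

lemma box_region:
  assumes J: "J \<in> W"
  shows "\<exists>k. \<exists>Q\<in>\<DD> k. J \<in> WQ Q \<and> rn * snd J \<le> sc k \<and> sc k \<le> 2 * rn * snd J"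
proof -
  have J0: "0 < snd J" using W_pos[OF J] .
  have r0: "0 < rn * snd J" using J0 rn1 by (intro mult_pos_pos) auto
  obtain k where k: "rn * snd J \<le> sc k" "sc k < 2 * (rn * snd J)" using ex_scale[OF r0] .
  obtain x g where g: "x \<in> box_set J" "g \<in> \<Gamma>" "dist x g = setdist (box_set J) \<Gamma>"
    using setdist_compact_closed[OF compact_box_set closed_\<Gamma>, of J] \<Gamma>_nonempty centre_in_box[of J] J0 by fastforce
  obtain Q where Q: "Q \<in> \<DD> k" "g \<in> Q" using cube_cover[OF g(2)] by blast
  note cb = cl_bounds[OF Q(1)]
  have Kc: "500 * (rn * snd J) \<le> a0 * K * cl Q"
    using K_ge(2) k cb r0 by (intro mult_mono) auto
  have "J \<in> W0 Q"
  proof (rule W0_I[OF J])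
    have "cl Q \<le> L0 * (2 * (rn * snd J))"
      using cb(2) mult_left_mono[of "sc k" "2 * (rn * snd J)" L0] k L0_pos by linarith
    then have "\<eta> * cl Q \<le> \<eta> * (L0 * (2 * (rn * snd J)))" using \<eta>0 by (intro mult_left_mono) auto
    also have "\<dots> = (4 * L0 * \<eta>) * (rn * snd J / 2)" by simp
    also have "\<dots> \<le> 1 * (rn * snd J / 2)" using \<eta>_L0 r0 by (intro mult_right_mono) auto
    finally have e: "\<eta> * cl Q \<le> rn * snd J / 2" by simp
    have "(a0 * c) * (\<eta> * cl Q) \<le> 1 * (\<eta> * cl Q)"
      using a0 a01 c01 \<eta>0 cl_pos[of Q] by (intro mult_right_mono mult_le_one) auto
    then show "a0 * c * \<eta> * cl Q \<le> 82 * rn * snd J" using e r0 by (simp add: mult.assoc)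
    show "4 * rn * snd J \<le> a0 * K * cl Q" using Kc r0 by simp
    have "setdist (box_set J) Q \<le> dist x g" using g Q by (intro setdist_le_dist)
    also have "\<dots> \<le> 40 * (rn * snd J)"
      using g whitney_parts(4) J J0 by (metis diameter_box_set_rn less_imp_le)
    finally show "setdist (box_set J) Q \<le> a0 * K * cl Q" using Kc r0 by linarith
  qed
  then have "J \<in> WQ Q" using W0_sub cubeD(7)[OF Q(1)] by blast
  then show ?thesis using k Q by (auto simp: mult.assoc intro!: less_imp_le)
qed

end

subsection \<open>The sawtooth domain\<close>

text \<open>Each coordinate of \<open>x\<close> is clamped to the interval that leaves a margin
  \<open>t\<close> on both sides; \<open>u\<close> measures how far \<open>x\<close> may lie outside
  the box.\<close>

lemma deep_point:
  fixes a b x :: "real^'n"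
  assumes t: "\<And>i. 2 * t \<le> b$i - a$i" and u: "\<And>i. a$i - u \<le> x$i \<and> x$i \<le> b$i + u" and t0: "0 \<le> t" "0 \<le> u"
  obtains p where "ball p t \<subseteq> cbox a b" "dist x p \<le> sqrt (real CARD('n)) * (t + u)"
proof -
  define p :: "real^'n" where "p = (\<chi> i. max (a$i + t) (min (b$i - t) (x$i)))"
  have p: "a$i + t \<le> p$i \<and> p$i \<le> b$i - t \<and> \<bar>x$i - p$i\<bar> \<le> t + u" for i
    using t[of i] u[of i] t0 by (simp add: p_def max_def min_def)
  have "ball p t \<subseteq> cbox a b"
  proof
    fix y assume "y \<in> ball p t"
    then have "\<bar>y$i - p$i\<bar> < t" for i
      using component_le_norm_cart[of "y - p" i] by (simp add: dist_norm norm_minus_commute)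
    then show "y \<in> cbox a b" unfolding mem_box_cart using p by (smt (verit, ccfv_threshold))
  qed
  moreover have "dist x p \<le> sqrt (real CARD('n)) * (t + u)"
    unfolding dist_norm using p by (intro norm_le_sqrt_card) simp
  ultimately show ?thesis using that by blast
qed

lemma bounded_borel_fmeasurable:
  fixes S :: "'a::euclidean_space set"
  shows "S \<in> sets borel \<Longrightarrow> bounded S \<Longrightarrow> S \<in> fmeasurable lborel"
  using emeasure_bounded_finite[of S] by (intro fmeasurableI) (simp_all add: infinity_ennreal_def)

text \<open>In units of \<open>sc l\<close> the difference is an integer \<open>m\<close> plus
  \<open>\<theta> / 2 * (s * 2^j - s')\<close>, with \<open>2^j\<close> at most 16. For nonzero
  \<open>m\<close> the perturbation is at most 17/32 and cannot cancel the integer; for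
  \<open>m = 0\<close> it vanishes only if \<open>j = 0\<close> and \<open>s = s'\<close>, and
  otherwise has size at least \<open>\<theta> / 2\<close>.\<close>

lemma grid_separation:
  fixes a b :: int and s s' :: real
  assumes kl: "k \<le> l" and le: "sc k \<le> 16 * sc l" and th: "0 < \<theta>" "\<theta> < 1/16"
    and s: "s \<in> {1, -1}" "s' \<in> {1, -1}"
  defines "D \<equiv> (a * sc k + s * \<theta> * sc k / 2) - (b * sc l + s' * \<theta> * sc l / 2)"
  shows "(D = 0 \<and> s = s') \<or> \<theta> * sc l / 2 \<le> \<bar>D\<bar>"
proof -
  define j where "j = nat (l - k)"
  define \<mu> where "\<mu> = sc l"
  have \<mu>: "0 < \<mu>" by (simp add: \<mu>_def)
  have k: "k = l - int j" using kl by (simp add: j_def)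
  have sk: "sc k = 2^j * \<mu>" unfolding k \<mu>_def by (rule sc_diff)
  define m where "m = a * 2^j - b"
  have D: "D = m * \<mu> + \<theta> / 2 * (s * 2^j - s') * \<mu>"
    unfolding D_def sk m_def \<mu>_def[symmetric] by (simp add: algebra_simps)
  have j16: "(2::real)^j \<le> 16" using le \<mu> unfolding sk \<mu>_def[symmetric] by simp
  have j1: "(1::real) \<le> 2^j" by simp
  have E: "\<bar>s * 2^j - s'\<bar> \<le> 17" 
  proof -
    have "\<bar>s\<bar> = 1" "\<bar>s'\<bar> = 1" using s by auto
    then show ?thesis using abs_triangle_ineq4[of "s * 2^j" s'] j16 by (simp add: abs_mult)
  qed
  show ?thesis
  proof (cases "m = 0")
    case True
    show ?thesis
    proof (cases "s * 2^j = s'")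
      case True
      have "(2::real)^j \<noteq> -1" using j1 by linarith
      then have "s = s'" using True s by auto
      moreover have "D = 0" unfolding D \<open>m = 0\<close> True by simp
      ultimately show ?thesis by simp
    next
      case False
      have "1 \<le> \<bar>s * 2^j - s'\<bar>"
      proof (cases j)
        case 0 then show ?thesis using s False by auto
      next
        case (Suc i)
        then have "(2::real) \<le> 2^j" by simp
        then show ?thesis using s by auto
      qed
      then have "\<theta> / 2 * 1 * \<mu> \<le> \<theta> / 2 * \<bar>s * 2^j - s'\<bar> * \<mu>"
        using th \<mu> by (intro mult_right_mono mult_left_mono) auto
      also have "\<dots> = \<bar>\<theta> / 2 * (s * 2^j - s') * \<mu>\<bar>" using th \<mu> by (simp add: abs_mult)
      also have "\<dots> = \<bar>D\<bar>" unfolding D \<open>m = 0\<close> by simp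
      finally show ?thesis by (simp add: \<mu>_def)
    qed
  next
    case False
    have "\<bar>\<theta> / 2 * (s * 2^j - s')\<bar> = \<theta> / 2 * \<bar>s * 2^j - s'\<bar>" using th by (simp add: abs_mult)
    also have "\<dots> \<le> (1/16) / 2 * 17" using th E by (intro mult_mono) auto
    finally have "\<bar>\<theta> / 2 * (s * 2^j - s')\<bar> \<le> 17/32" by simp
    moreover have "1 \<le> \<bar>real_of_int m\<bar>" using False by linarith
    ultimately have "\<theta> / 2 \<le> \<bar>m + \<theta> / 2 * (s * 2^j - s')\<bar>" using th by linarith
    then have "\<theta> / 2 * \<mu> \<le> \<bar>m + \<theta> / 2 * (s * 2^j - s')\<bar> * \<mu>" using \<mu> by (intro mult_right_mono) auto
    also have "\<dots> = \<bar>(m + \<theta> / 2 * (s * 2^j - s')) * \<mu>\<bar>" using \<mu> by (simp add: abs_mult)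
    also have "\<dots> = \<bar>D\<bar>" unfolding D by (simp add: algebra_simps)
    finally show ?thesis by (simp add: \<mu>_def)
  qed
qed

context sawtooth begin

definition WF :: "'n box set" where "WF = (\<Union>Q\<in>DF. WQ Q)"

text \<open>Boxes near \<open>z\<close> satisfy \<open>\<delta> z \<le> 50 * rn * snd I\<close>, so
  \<open>\<kappa> * \<delta> z\<close> is at most \<open>\<theta> * snd I / 2\<close>, the gap that
  \<open>grid_separation\<close> leaves between distinct face coordinates.\<close>

definition \<kappa> :: real where "\<kappa> = \<theta> / (100 * rn)"

definition face :: "'n box \<Rightarrow> real \<Rightarrow> 'n \<Rightarrow> real" where
  "face I s i = fst I $ i + s * (1 + \<theta>) * snd I / 2"

lemma \<Omega>_eq: "\<Omega> = interior (\<Union>I\<in>WF. star I)"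
  unfolding \<Omega>_def sawtooth_domain_def WF_def by (simp add: UN_UN_flatten)

lemma open_\<Omega>: "open \<Omega>" by (simp add: \<Omega>_eq)

lemma WF_W: "I \<in> WF \<Longrightarrow> I \<in> W"
  unfolding WF_def using WQ_D(1) by blast

lemma WF_I: "Q \<in> DF \<Longrightarrow> J \<in> WQ Q \<Longrightarrow> J \<in> WF"
  by (auto simp: WF_def)

lemma \<Omega>_star: "x \<in> \<Omega> \<Longrightarrow> \<exists>I\<in>WF. x \<in> star I"
  using interior_subset unfolding \<Omega>_eq by blast

lemma open_sub_\<Omega>: "I \<in> WF \<Longrightarrow> open S \<Longrightarrow> S \<subseteq> star I \<Longrightarrow> S \<subseteq> \<Omega>"
  unfolding \<Omega>_eq by (intro interior_maximal) auto

lemma box_ball: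
  assumes "J \<in> WF" "y \<in> box_set J" shows "ball y (\<theta> * snd J / 2) \<subseteq> \<Omega>"
  using ball_in_dilate[OF assms(2), of "\<theta> * snd J / 2" \<theta>] interior_subset
  by (intro open_sub_\<Omega>[OF assms(1)]) auto

lemma \<Omega>_\<Gamma>: "\<Omega> \<inter> \<Gamma> = {}"
  using \<Omega>_star star_disjoint_\<Gamma> WF_W by blast

lemma DF_region:
  assumes "Q \<in> DF" "J \<in> WQ Q" "y \<in> box_set J"
  shows "ball y (\<theta> / (2 * CW) * cl Q) \<subseteq> \<Omega>"
proof -
  have "cl Q / CW \<le> snd J" using region_props(1)[OF DF_cube] assms CW1 by (simp add: field_simps)
  then have "\<theta> / 2 * (cl Q / CW) \<le> \<theta> / 2 * snd J" using \<theta>0 by (intro mult_left_mono) auto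
  then have "ball y (\<theta> / (2 * CW) * cl Q) \<subseteq> ball y (\<theta> * snd J / 2)" by (intro subset_ball) simp
  then show ?thesis using box_ball[OF WF_I[OF assms(1,2)] assms(3)] by blast
qed

lemma XQ_ball: "Q \<in> DF \<Longrightarrow> ball (XQ Q) (\<theta> / (2 * CW) * cl Q) \<subseteq> \<Omega>"
  using DF_region W0_sub ex_IQ DF_cube by metis

lemma \<Omega>_nonempty: "\<Omega> \<noteq> {}"
proof -
  obtain Q where Q: "Q \<in> DF" using DF_nonempty by auto
  have "0 < \<theta> / (2 * CW) * cl Q" using \<theta>0 CW1 cl_pos[of Q] by (intro mult_pos_pos) auto
  then have "XQ Q \<in> ball (XQ Q) (\<theta> / (2 * CW) * cl Q)" by simp
  then show ?thesis using XQ_ball[OF Q] by blast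
qed

lemma frontier_nonempty: "frontier \<Omega> \<noteq> {}"
  using \<Omega>_nonempty \<Omega>_\<Gamma> \<Gamma>_nonempty by (auto simp: frontier_eq_empty)

lemma frontier_\<Omega>_disjoint: "x \<in> frontier \<Omega> \<Longrightarrow> x \<notin> \<Omega>"
  using open_\<Omega> by (simp add: frontier_def interior_open)

lemma frontier_closure: "x \<in> frontier \<Omega> \<Longrightarrow> x \<in> closure \<Omega>"
  by (simp add: frontier_def)

lemma infdist_frontier_ge:
  assumes "ball x r \<subseteq> \<Omega>" shows "r \<le> infdist x (frontier \<Omega>)"
proof -
  obtain y where "y \<in> frontier \<Omega>" "infdist x (frontier \<Omega>) = dist x y"
    using infdist_attains_inf[OF frontier_closed frontier_nonempty, of x] by metis
  then show ?thesis using assms frontier_\<Omega>_disjoint by (metis mem_ball not_le_imp_less subsetD)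
qed

lemma ball_sub_\<Omega>:
  assumes "x \<in> \<Omega>" "r \<le> infdist x (frontier \<Omega>)" shows "ball x r \<subseteq> \<Omega>"
proof (rule ccontr)
  assume n: "\<not> ball x r \<subseteq> \<Omega>"
  then have "0 < r" by (metis ball_empty empty_subsetI not_le_imp_less)
  then have "x \<in> ball x r \<inter> \<Omega>" using assms by simp
  then have "ball x r \<inter> \<Omega> \<noteq> {}" by blast
  then have "ball x r \<inter> frontier \<Omega> \<noteq> {}" using n by (intro connected_Int_frontier) auto
  then obtain y where "y \<in> frontier \<Omega>" "dist x y < r" by auto
  then show False using infdist_le[of y "frontier \<Omega>" x] assms by linarith
qed

section \<open>Local finiteness of the boxes and separation of their faces\<close>

lemma measure_box_interior:
  fixes I :: "'n box" assumes "0 \<le> snd I"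
  shows "measure lborel (interior (box_set I)) = snd I ^ CARD('n)"
proof -
  have "measure lborel (interior (box_set I)) = measure lborel (cbox (fst I - (\<chi> i. snd I / 2)) (fst I + (\<chi> i. snd I / 2)))"
    unfolding box_set_cbox interior_cbox by (simp add: measure_lborel_box_eq measure_lborel_cbox_eq)
  also have "\<dots> = snd I ^ CARD('n)"
  proof -
    have "cbox (fst I - (\<chi> i. snd I / 2)) (fst I + (\<chi> i. snd I / 2)) \<noteq> {}"
      using assms by (simp add: interval_ne_empty_cart)
    then show ?thesis by (subst content_cbox_cart) simp_all
  qed
  finally show ?thesis .
qed

lemma W_count:
  assumes T: "finite T" "T \<subseteq> W" and s: "0 < s" "0 < B" and "\<And>J. J \<in> T \<Longrightarrow> s \<le> snd J \<and> box_set J \<subseteq> ball z (B * s)"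
  shows "real (card T) \<le> unit_ball_vol (real CARD('n)) * B ^ CARD('n)"
proof -
  have "real (card T) * s ^ CARD('n) \<le> measure lborel (ball z (B * s))"
  proof (rule card_measure_disjoint_le[where A = "\<lambda>J. interior (box_set J)"])
    have "J \<noteq> J' \<Longrightarrow> interior (box_set J) \<inter> interior (box_set J') = {}" if "J \<in> T" "J' \<in> T" for J J'
      using whitney_parts(3) that T unfolding pairwise_def by blast
    then show "disjoint_family_on (\<lambda>J. interior (box_set J)) T" by (simp add: disjoint_family_on_def)
    show "interior (box_set J) \<in> sets lborel \<and> interior (box_set J) \<subseteq> ball z (B * s)" if "J \<in> T" for J
      using assms(5)[OF that] interior_subset[of "box_set J"] by auto
    show "s ^ CARD('n) \<le> measure lborel (interior (box_set J))" if "J \<in> T" for J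
      using assms(5)[OF that] s by (subst measure_box_interior) (auto intro: power_mono)
  qed (use T in \<open>auto simp: bounded_borel_fmeasurable\<close>)
  also have "\<dots> = unit_ball_vol (real CARD('n)) * B ^ CARD('n) * s ^ CARD('n)"
    using s by (simp add: content_ball power_mult_distrib)
  finally show ?thesis using s by simp
qed

text \<open>In this ball the distance to \<Gamma> varies by at most a tenth of its value at
  \<open>z\<close>, so all these boxes have sides comparable to \<open>\<delta> z\<close>.\<close>

abbreviation near_boxes :: "real^'n \<Rightarrow> 'n box set" where
  "near_boxes z \<equiv> {J \<in> W. star J \<inter> ball z (\<delta> z / 10) \<noteq> {}}"

lemma near_boxes_size:
  assumes "J \<in> near_boxes z"
  shows "40 * rn * snd J \<le> 11 * \<delta> z" "9 * \<delta> z \<le> 420 * rn * snd J"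
proof -
  obtain y where y: "y \<in> star J" "dist z y < \<delta> z / 10" and J: "J \<in> W" using assms by auto
  have "\<delta> z \<le> \<delta> y + dist z y" "\<delta> y \<le> \<delta> z + dist z y"
    using \<delta>_lipschitz[of z y] \<delta>_lipschitz[of y z] by (auto simp: dist_commute)
  then show "40 * rn * snd J \<le> 11 * \<delta> z" "9 * \<delta> z \<le> 420 * rn * snd J"
    using y \<delta>_star_ge[OF J y(1)] \<delta>_star_le[OF J y(1)] by linarith+
qed

text \<open>The value of \<open>W_count\<close> for boxes of side at least
  \<open>\<delta> z / (50 * rn)\<close> inside a ball of radius
  \<open>2 * \<delta> z\<close>.\<close>

definition near_count :: real where
  "near_count = unit_ball_vol (real CARD('n)) * (100 * rn) ^ CARD('n)"

lemma near_boxes_finite: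
  assumes "z \<notin> \<Gamma>"
  shows "finite (near_boxes z)" "real (card (near_boxes z)) \<le> near_count"
proof -
  have \<delta>z: "0 < \<delta> z" using \<delta>_pos assms .
  have *: "real (card T) \<le> near_count" if T: "finite T" "T \<subseteq> near_boxes z" for T
    unfolding near_count_def
  proof (rule W_count[OF T(1)])
    show "0 < \<delta> z / (50 * rn)" using \<delta>z rn1 by simp
    fix J assume "J \<in> T"
    then have J: "J \<in> near_boxes z" using T by auto
    then obtain y where y: "y \<in> star J" "dist z y < \<delta> z / 10" and JW: "J \<in> W" by auto
    note ns = near_boxes_size[OF J]
    have "\<delta> z \<le> (50 * rn) * snd J" using ns \<delta>z by linarith
    then have 1: "\<delta> z / (50 * rn) \<le> snd J" using rn1 by (simp add: field_simps)
    have "dist z w < 2 * \<delta> z" if "w \<in> box_set J" for w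
      using dist_star[OF JW, of y w] y that box_in_star[OF JW] dist_triangle[of z w y] ns \<delta>z by (force simp: subset_iff)
    then show "\<delta> z / (50 * rn) \<le> snd J \<and> box_set J \<subseteq> ball z (100 * rn * (\<delta> z / (50 * rn)))"
      using 1 rn1 by auto
  qed (use T rn1 in auto)
  have "card T \<le> nat \<lfloor>near_count\<rfloor>" if "finite T" "T \<subseteq> near_boxes z" for T
    using *[OF that] by linarith
  then show f: "finite (near_boxes z)"
    using finite_if_finite_subsets_card_bdd[of "near_boxes z"] by blast
  then show "real (card (near_boxes z)) \<le> near_count" using * by blast
qed

text \<open>Only finitely many dilated boxes come near \<open>x\<close>, so their union is closed,
  and a limit off \<Gamma> of points of \<Omega> lies in one of them.\<close>

lemma closure_\<Omega>_star:
  assumes x: "x \<in> closure \<Omega>" "x \<notin> \<Gamma>"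
  shows "\<exists>I\<in>WF. x \<in> star I"
proof (rule ccontr)
  assume n: "\<not> (\<exists>I\<in>WF. x \<in> star I)"
  let ?U = "\<Union>I\<in>WF \<inter> near_boxes x. star I"
  have "closed ?U" using near_boxes_finite(1)[OF x(2)] by (intro closed_UN ballI closed_box_set) auto
  moreover have "x \<notin> ?U" using n by auto
  ultimately obtain e where e0: "0 < e" "ball x e \<subseteq> - ?U"
    using open_contains_ball[of "- ?U"] by (meson ComplI open_Compl)
  then have e: "0 < e" "ball x e \<inter> ?U = {}" by blast+
  have "0 < min e (\<delta> x / 10)" using e \<delta>_pos[OF x(2)] by auto
  then obtain y where y: "y \<in> \<Omega>" "dist y x < min e (\<delta> x / 10)" using x(1) closure_approachable by metis
  obtain I where I: "I \<in> WF" "y \<in> star I" using \<Omega>_star[OF y(1)] by auto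
  have "y \<in> ball x (\<delta> x / 10)" "y \<in> ball x e" using y by (auto simp: dist_commute)
  then have "y \<in> ?U" using I WF_W by blast
  then show False using e \<open>y \<in> ball x e\<close> by blast
qed

lemma \<kappa>_pos: "0 < \<kappa>" and \<kappa>_small: "\<kappa> < 1/1600"
proof -
  show "0 < \<kappa>" using \<theta>0 rn1 by (simp add: \<kappa>_def)
  have "\<theta> / (100 * rn) \<le> \<theta> / 100" using rn1 \<theta>0 by (intro divide_left_mono) auto
  then show "\<kappa> < 1/1600" using \<theta>_small by (simp add: \<kappa>_def)
qed

lemma W_grid:
  assumes "I \<in> W" "s \<in> {1, -1}"
  obtains k and a :: int where "snd I = sc k" "face I s i = a * sc k + s * \<theta> * sc k / 2"
proof -
  obtain k where k: "snd I = sc k" "\<forall>i. \<exists>j::int. fst I $ i = (real_of_int j + 1/2) * sc k"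
    using whitney_parts(1) assms unfolding dyadic_box_def by blast
  then obtain j :: int where j: "fst I $ i = (real_of_int j + 1/2) * sc k" by blast
  \<comment> \<open>Centres are half-integers in units of \<open>sc k\<close>, so the undilated face
    in direction \<open>s\<close> is at an integer.\<close>
  define a where "a = (if s = 1 then j + 1 else j)"
  have "face I s i = a * sc k + s * \<theta> * sc k / 2"
    using assms(2) by (auto simp: face_def j k(1) a_def field_simps)
  then show ?thesis using that k by blast
qed

text \<open>Near boxes have side ratio at most 16, the range of \<open>grid_separation\<close>. That
  lemma takes the coarser box first, hence the two cases.\<close>

lemma face_separation:
  assumes I: "I \<in> near_boxes z" and J: "J \<in> near_boxes z" and s: "s \<in> {1, -1}" "s' \<in> {1, -1}" and z: "z \<notin> \<Gamma>"
  shows "(face I s i = face J s' i \<and> s = s') \<or> \<kappa> * \<delta> z \<le> \<bar>face I s i - face J s' i\<bar>"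
proof -
  have IW: "I \<in> W" "J \<in> W" using I J by auto
  have \<delta>z: "0 < \<delta> z" using \<delta>_pos z .
  obtain k a where k: "snd I = sc k" "face I s i = real_of_int a * sc k + s * \<theta> * sc k / 2"
    using W_grid[OF IW(1) s(1)] by metis
  obtain l b where l: "snd J = sc l" "face J s' i = real_of_int b * sc l + s' * \<theta> * sc l / 2"
    using W_grid[OF IW(2) s(2)] by metis
  have ns: "40 * (rn * sc k) \<le> 11 * \<delta> z" "9 * \<delta> z \<le> 420 * (rn * sc k)"
     "40 * (rn * sc l) \<le> 11 * \<delta> z" "9 * \<delta> z \<le> 420 * (rn * sc l)"
    using near_boxes_size[OF I] near_boxes_size[OF J] k l by (simp_all add: mult.assoc)
  have "rn * sc k \<le> rn * (16 * sc l)" "rn * sc l \<le> rn * (16 * sc k)" using ns \<delta>z by simp_all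
  then have c: "sc k \<le> 16 * sc l" "sc l \<le> 16 * sc k" using rn1 by simp_all
  have \<kappa>\<mu>: "\<kappa> * \<delta> z \<le> \<theta> * \<mu> / 2" if "9 * \<delta> z \<le> 420 * (rn * \<mu>)" for \<mu>
  proof -
    have "\<delta> z \<le> 50 * rn * \<mu>" using that \<delta>z by linarith
    then have "\<kappa> * \<delta> z \<le> \<kappa> * (50 * rn * \<mu>)" using \<kappa>_pos by (intro mult_left_mono) auto
    also have "\<dots> = \<theta> * \<mu> / 2" using rn1 by (simp add: \<kappa>_def)
    finally show ?thesis .
  qed
  show ?thesis
  proof (cases "k \<le> l")
    case True
    show ?thesis using grid_separation[OF True c(1) \<theta>0 \<theta>_small s, of a b] \<kappa>\<mu>[OF ns(4)] k l by auto
  next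
    case False
    then have lk: "l \<le> k" by simp
    have "(face J s' i - face I s i = 0 \<and> s' = s) \<or> \<theta> * sc k / 2 \<le> \<bar>face J s' i - face I s i\<bar>"
      unfolding k(2) l(2) by (rule grid_separation[OF lk c(2) \<theta>0 \<theta>_small s(2,1)])
    then show ?thesis using \<kappa>\<mu>[OF ns(2)] abs_minus_commute[of "face I s i" "face J s' i"] by auto
  qed
qed

lemma star_cbox: "star I = cbox (\<chi> i. face I (-1) i) (\<chi> i. face I 1 i)"
proof (intro set_eqI)
  fix x
  have "(\<bar>x$i - fst I$i\<bar> \<le> (1 + \<theta>) * snd I / 2) = (face I (-1) i \<le> x$i \<and> x$i \<le> face I 1 i)" for i
  proof -
    define q where "q = (1 + \<theta>) * snd I / 2"
    have "face I (-1) i = fst I $ i - q" "face I 1 i = fst I $ i + q" by (simp_all add: face_def q_def field_simps)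
    then show ?thesis unfolding q_def[symmetric] by linarith
  qed
  then show "x \<in> star I \<longleftrightarrow> x \<in> cbox (\<chi> i. face I (-1) i) (\<chi> i. face I 1 i)"
    by (simp add: box_set_def dilate_def mem_box_cart)
qed

lemma deep_in_star:
  assumes I: "I \<in> W" and x: "x \<in> star I" and t: "2 * t \<le> snd I" "0 \<le> t"
  obtains p where "ball p t \<subseteq> star I" "dist x p \<le> rn * t"
proof (rule deep_point[of t "\<chi> i. face I 1 i" "\<chi> i. face I (-1) i" 0 x])
  fix i
  have "face I 1 i - face I (-1) i = (1 + \<theta>) * snd I" by (simp add: face_def field_simps)
  moreover have "snd I \<le> (1 + \<theta>) * snd I" using \<theta>0 W_pos[OF I] by simp
  ultimately show "2 * t \<le> (\<chi> i. face I 1 i) $ i - (\<chi> i. face I (-1) i) $ i" using t by simp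
  show "(\<chi> i. face I (-1) i) $ i - 0 \<le> x $ i \<and> x $ i \<le> (\<chi> i. face I 1 i) $ i + 0"
    using x by (simp add: star_cbox mem_box_cart)
next
  fix p assume "ball p t \<subseteq> cbox (\<chi> i. face I (-1) i) (\<chi> i. face I 1 i)" "dist x p \<le> sqrt (real CARD('n)) * (t + 0)"
  then show thesis using that[of p] by (simp add: star_cbox rn_def)
qed (use t in auto)

text \<open>A point of \<Omega> within \<open>R\<close> of \<open>x\<close> lies in a dilated box of
  side at most \<open>R\<close>, which comes from a kept cube of length at most
  \<open>CW * R\<close>. Ancestors of kept cubes are kept, so one can climb to the scale of
  \<open>R\<close>.\<close>

lemma near_cube:
  "\<exists>C\<ge>1. \<forall>x\<in>closure \<Omega>. \<forall>R>0. \<delta> x \<le> R \<longrightarrow>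
     (\<exists>k. \<exists>Q\<in>\<DD> k. Q \<in> DF \<and> R \<le> sc k \<and> sc k \<le> C * R \<and> Q \<subseteq> cball x (C * R))"
proof -
  define C where "C = 1 + CW * CW + 2 * A0 * CW + 2 * CW"
  have "0 \<le> CW * CW" "0 \<le> A0 * CW" using CW1 A01 by auto
  then have C: "1 \<le> C" "2 * CW \<le> C" "1 + CW * CW + 2 * A0 * CW \<le> C" using CW1 unfolding C_def by linarith+
  have "\<exists>k. \<exists>Q\<in>\<DD> k. Q \<in> DF \<and> R \<le> sc k \<and> sc k \<le> C * R \<and> Q \<subseteq> cball x (C * R)"
    if x: "x \<in> closure \<Omega>" and R: "0 < R" "\<delta> x \<le> R" for x R
  proof -
    obtain Y where Y: "Y \<in> \<Omega>" "dist Y x < R" using x R closure_approachable by metis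
    obtain I Q0 where I: "Y \<in> star I" "I \<in> WQ Q0" "Q0 \<in> DF" using \<Omega>_star[OF Y(1)] by (auto simp: WF_def)
    have IW: "I \<in> W" using WQ_D I by blast
    have Q0: "Q0 \<in> all_cubes \<DD>" using DF_cube I by blast
    have "4 * rn * snd I \<le> \<delta> Y" using \<delta>_star_ge IW I by blast
    moreover have "\<delta> Y \<le> \<delta> x + dist Y x" by (rule \<delta>_lipschitz)
    moreover have "1 * snd I \<le> rn * snd I" using rn1 W_pos[OF IW] by (intro mult_right_mono) auto
    ultimately have sI: "snd I \<le> R" using Y R by linarith
    have clQ: "cl Q0 \<le> CW * R"
      using region_props(1)[OF Q0 I(2)] mult_left_mono[OF sI, of CW] CW1 by linarith
    obtain k0 where k0: "Q0 \<in> \<DD> k0" "cl Q0 = sc k0" using cube_length_exact[OF Q0] by blast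
    obtain k where k: "CW * R \<le> sc k" "sc k < 2 * (CW * R)" using ex_scale[of "CW * R"] CW1 R by auto
    have "k \<le> k0" using clQ k k0 sc_le_iff[of k0 k] by linarith
    then obtain Q where Q: "Q \<in> \<DD> k" "Q0 \<subseteq> Q" using cube_ancestor[OF k0(1)] by blast
    have QF: "Q \<in> DF" using DF_up[OF I(3)] Q cubeD(7) by blast
    obtain z0 where z0: "z0 \<in> Q0" using cube_nonempty[OF Q0] by auto
    have "1 * R \<le> CW * R" using CW1 R by (intro mult_right_mono) auto
    then have 1: "R \<le> sc k" using k by linarith
    have "2 * CW * R \<le> C * R" by (rule mult_right_mono[OF C(2)]) (use R in simp)
    then have 2: "sc k \<le> C * R" using k by linarith
    have "dist x z \<le> C * R" if z: "z \<in> Q" for z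
    proof -
      have "dist Y z0 \<le> CW * cl Q0" using region_props(3)[OF Q0 I(2,1) z0] .
      also have "\<dots> \<le> CW * (CW * R)" using clQ CW1 by (intro mult_left_mono) auto
      finally have a: "dist Y z0 \<le> CW * CW * R" by (simp add: mult.assoc)
      have "dist z0 z \<le> A0 * sc k" using cube_dist[OF Q(1)] z z0 Q(2) by (meson less_imp_le subsetD)
      also have "\<dots> \<le> A0 * (2 * (CW * R))" using k A01 by (intro mult_left_mono) auto
      finally have "dist x z \<le> (1 + CW * CW + 2 * A0 * CW) * R"
        using a Y dist_triangle[of x z Y] dist_triangle[of Y z z0] by (simp add: algebra_simps dist_commute)
      also have "\<dots> \<le> C * R" using C R by (intro mult_right_mono) auto
      finally show ?thesis .
    qed
    then show ?thesis using 1 2 Q QF by (auto intro!: exI[of _ k] bexI[of _ Q])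
  qed
  with C show ?thesis by blast
qed

text \<open>If \<open>r\<close> is large compared with the distance to \<Gamma>, the point
  \<open>XQ Q\<close> of a kept cube of scale about \<open>r\<close> serves; otherwise a point well
  inside the dilated box containing \<open>x\<close>. Taking \<open>x\<close> in the closure, and
  not just in the frontier, covers the lower bound for \<open>m\<close> too.\<close>

lemma interior_corkscrew:
  "\<exists>c1>0. \<forall>x\<in>closure \<Omega>. \<forall>r>0. \<exists>X\<in>ball x r. ball X (c1 * r) \<subseteq> \<Omega>"
proof -
  obtain C where C: "1 \<le> C" and near: "\<And>x R. x \<in> closure \<Omega> \<Longrightarrow> 0 < R \<Longrightarrow> \<delta> x \<le> R \<Longrightarrow>
     (\<exists>k. \<exists>Q\<in>\<DD> k. Q \<in> DF \<and> R \<le> sc k \<and> sc k \<le> C * R \<and> Q \<subseteq> cball x (C * R))"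
    using near_cube by blast
  \<comment> \<open>\<open>C + L0 * C\<close> bounds the distance from \<open>x\<close> to
    \<open>XQ Q\<close> in units of \<open>R\<close>; the factor 2 makes it strictly smaller than
    \<open>r\<close>.\<close>
  define M where "M = 2 * (C + L0 * C)"
  have M: "2 \<le> M" using C L0_pos unfolding M_def by (smt (verit) mult_pos_pos)
  define c1 where "c1 = min (\<theta> / (2 * CW * M)) (1 / (200 * rn * M))"
  have c1: "0 < c1" "c1 \<le> \<theta> / (2 * CW * M)" "c1 \<le> 1 / (200 * rn * M)"
    using \<theta>0 CW1 M rn1 by (auto simp: c1_def)
  have "\<exists>X\<in>ball x r. ball X (c1 * r) \<subseteq> \<Omega>" if x: "x \<in> closure \<Omega>" and r: "0 < r" for x r
  proof (cases "M * \<delta> x \<le> r")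
    case True
    define R where "R = r / M"
    have R: "0 < R" "\<delta> x \<le> R" "r = M * R" using r M True by (auto simp: R_def field_simps)
    obtain k Q where Q: "Q \<in> \<DD> k" "Q \<in> DF" "R \<le> sc k" "sc k \<le> C * R" "Q \<subseteq> cball x (C * R)"
      using near[OF x R(1,2)] by blast
    have Qc: "Q \<in> all_cubes \<DD>" using cubeD(7) Q by blast
    have "cl Q \<le> L0 * (C * R)"
      using order_trans[OF cl_bounds(2)[OF Q(1)] mult_left_mono[OF Q(4)]] L0_pos by simp
    then have "a0 * cl Q \<le> 1 * (L0 * (C * R))"
      using a0 a01 cl_pos[of Q] by (intro mult_mono) auto
    moreover have "dist x (xc Q) \<le> C * R" using xc_props(2)[OF Qc] Q(5) by auto
    moreover have "0 < C * R + L0 * (C * R)" using C R L0_pos by (auto intro!: add_pos_pos)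
    ultimately have "dist x (XQ Q) < r"
      using XQ_props(2)[OF Qc] dist_triangle[of x "XQ Q" "xc Q"] unfolding R(3) M_def
      by (simp add: algebra_simps dist_commute)
    moreover have "c1 * r \<le> \<theta> / (2 * CW) * cl Q"
    proof -
      have "c1 * r \<le> \<theta> / (2 * CW * M) * r" using c1 r by (intro mult_right_mono) auto
      also have "\<dots> = \<theta> / (2 * CW) * R" using M R by simp
      also have "\<dots> \<le> \<theta> / (2 * CW) * cl Q"
        using Q(3) cl_bounds(1)[OF Q(1)] \<theta>0 CW1 by (intro mult_left_mono) auto
      finally show ?thesis .
    qed
    ultimately show ?thesis using XQ_ball[OF Q(2)] by (intro bexI[of _ "XQ Q"]) (auto dest: subset_ball)
  next
    case False
    then have "0 < M * \<delta> x" using r by linarith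
    then have "0 < \<delta> x" using M by (simp add: zero_less_mult_iff)
    then have "x \<notin> \<Gamma>" by auto
    then obtain I where I: "I \<in> WF" "x \<in> star I" using closure_\<Omega>_star x by blast
    have IW: "I \<in> W" using WF_W I by blast
    define t where "t = r / (100 * rn * M)"
    have t0: "0 < t" using r rn1 M by (simp add: t_def)
    have "r < M * (42 * rn * snd I)"
      using False \<delta>_star_le[OF IW I(2)] M by (smt (verit) mult_left_mono)
    moreover have "0 < M * (rn * snd I)" using M rn1 W_pos[OF IW] by (intro mult_pos_pos) auto
    ultimately have "r \<le> 50 * (M * (rn * snd I))" by simp
    then have t: "2 * t \<le> snd I" using rn1 M by (simp add: t_def field_simps)
    obtain p where p: "ball p t \<subseteq> star I" "dist x p \<le> rn * t"
      using deep_in_star[OF IW I(2) t] t0 by auto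
    have "rn * t \<le> r / 200"
      using rn1 M r by (simp add: t_def field_simps)
    then have "dist x p < r" using p(2) r by simp
    moreover have "ball p (c1 * r) \<subseteq> \<Omega>"
    proof -
      have "c1 * r \<le> 1 / (200 * rn * M) * r" using c1 r by (intro mult_right_mono) auto
      also have "\<dots> = t / 2" by (simp add: t_def)
      finally have "ball p (c1 * r) \<subseteq> ball p t" using t0 by (intro subset_ball) linarith
      also have "\<dots> \<subseteq> \<Omega>" using p(1) by (intro open_sub_\<Omega>[OF I(1)]) auto
      finally show ?thesis .
    qed
    ultimately show ?thesis by (intro bexI[of _ p]) simp_all
  qed
  with c1 show ?thesis by blast
qed

end

subsection \<open>Harnack chains\<close>

context sawtooth begin

text \<open>The radius \<open>t\<close> is the same along the whole chain and the number of steps is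
  exactly \<open>N\<close>. This makes chains easy to compose, and repeating the last point pads
  them to the single length that (H2) demands.\<close>

definition conn :: "real \<Rightarrow> nat \<Rightarrow> real^'n \<Rightarrow> real^'n \<Rightarrow> bool" where
  "conn t N X Y \<longleftrightarrow> (\<exists>Z. Z 0 = X \<and> Z N = Y \<and> (\<forall>i\<le>N. ball (Z i) t \<subseteq> \<Omega>) \<and>
     (\<forall>i<N. dist (Z i) (Z (Suc i)) < t / 2))"

lemma conn_refl: "0 < t \<Longrightarrow> ball X t \<subseteq> \<Omega> \<Longrightarrow> conn t N X X"
  unfolding conn_def by (rule exI[of _ "\<lambda>_. X"]) simp

lemma conn_sym:
  assumes "conn t N X Y" shows "conn t N Y X"
proof -
  obtain Z where Z: "Z 0 = X" "Z N = Y" "\<And>i. i \<le> N \<Longrightarrow> ball (Z i) t \<subseteq> \<Omega>"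
     "\<And>i. i < N \<Longrightarrow> dist (Z i) (Z (Suc i)) < t / 2" using assms unfolding conn_def by blast
  have "dist (Z (N - i)) (Z (N - Suc i)) < t / 2" if "i < N" for i
    using Z(4)[of "N - Suc i"] that by (simp add: Suc_diff_Suc dist_commute)
  then show ?thesis unfolding conn_def using Z by (intro exI[of _ "\<lambda>i. Z (N - i)"]) auto
qed

lemma conn_trans:
  assumes "conn t N X Y" "conn t M Y Y'" shows "conn t (N + M) X Y'"
proof -
  obtain Z where Z: "Z 0 = X" "Z N = Y" "\<And>i. i \<le> N \<Longrightarrow> ball (Z i) t \<subseteq> \<Omega>"
     "\<And>i. i < N \<Longrightarrow> dist (Z i) (Z (Suc i)) < t / 2" using assms(1) unfolding conn_def by blast
  obtain V where V: "V 0 = Y" "V M = Y'" "\<And>i. i \<le> M \<Longrightarrow> ball (V i) t \<subseteq> \<Omega>"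
     "\<And>i. i < M \<Longrightarrow> dist (V i) (V (Suc i)) < t / 2" using assms(2) unfolding conn_def by blast
  define U where "U i = (if i \<le> N then Z i else V (i - N))" for i
  have "U (N + M) = Y'" using Z V by (cases M) (auto simp: U_def)
  moreover have "ball (U i) t \<subseteq> \<Omega>" if "i \<le> N + M" for i using Z(3) V(3) that by (simp add: U_def)
  moreover have "dist (U i) (U (Suc i)) < t / 2" if "i < N + M" for i
  proof -
    consider "i < N" | "i = N" | "N < i" by linarith
    then show ?thesis
    proof cases
      case 1 then show ?thesis using Z(4) by (simp add: U_def)
    next
      case 2 then show ?thesis using V(4)[of 0] V(1) Z(2) that by (simp add: U_def)
    next
      case 3 then show ?thesis using V(4)[of "i - N"] that by (simp add: U_def Suc_diff_le)
    qed
  qed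
  ultimately show ?thesis unfolding conn_def using Z(1) by (intro exI[of _ U]) (simp add: U_def)
qed

lemma conn_end: "conn t N X Y \<Longrightarrow> ball Y t \<subseteq> \<Omega>"
  unfolding conn_def by blast

lemma conn_pad:
  assumes "conn t N X Y" "0 < t" "N \<le> M" shows "conn t M X Y"
proof -
  have "ball Y t \<subseteq> \<Omega>" using conn_end[OF assms(1)] .
  then show ?thesis using conn_trans[OF assms(1) conn_refl[OF assms(2), of Y "M - N"]] assms(3) by simp
qed

lemma conn_segment:
  assumes "\<And>p. p \<in> closed_segment X Y \<Longrightarrow> ball p t \<subseteq> \<Omega>" "dist X Y < real N * t / 2"
  shows "conn t N X Y"
proof -
  have N: "0 < N" using assms(2) zero_le_dist[of X Y] by (cases N) auto
  define Z where "Z i = (1 - real i / real N) *\<^sub>R X + (real i / real N) *\<^sub>R Y" for i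
  have "Z i \<in> closed_segment X Y" if "i \<le> N" for i
    unfolding closed_segment_def Z_def using that N by (auto intro!: exI[of _ "real i / real N"])
  moreover have "dist (Z i) (Z (Suc i)) < t / 2" for i
  proof -
    have "Z i - Z (Suc i) = (1 / real N) *\<^sub>R (X - Y)"
      by (simp add: Z_def algebra_simps add_divide_distrib)
    then have "dist (Z i) (Z (Suc i)) = dist X Y / real N" using N by (simp add: dist_norm)
    moreover have "dist X Y / real N < t / 2"
      using assms(2) N by (subst pos_divide_less_eq) (auto simp: mult.commute)
    ultimately show ?thesis by simp
  qed
  ultimately show ?thesis unfolding conn_def using assms(1) N by (intro exI[of _ Z]) (auto simp: Z_def)
qed

text \<open>By convexity \<open>B\<close> contains the cone from \<open>X\<close> over
  \<open>ball p a\<close>, which at parameter \<open>l\<close> contains a ball of radius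
  \<open>l * a\<close>. Near its tip \<open>X\<close> the cone is too thin, and there
  \<open>ball X r\<close> is used instead.\<close>

lemma segment_thick:
  fixes B :: "(real^'n) set"
  assumes B: "convex B" "interior B \<subseteq> \<Omega>" and X: "X \<in> B" "ball X r \<subseteq> \<Omega>" "0 < r"
    and p: "ball p a \<subseteq> B" "0 < a" "dist X p \<le> D" "0 < D" and q: "q \<in> closed_segment X p"
  shows "ball q (min (r/2) (a * r / (2 * D))) \<subseteq> \<Omega>"
proof -
  obtain l where l: "0 \<le> l" "l \<le> 1" "q = (1 - l) *\<^sub>R X + l *\<^sub>R p" using q by (auto simp: closed_segment_def)
  have "X - q = l *\<^sub>R (X - p)" by (simp add: l algebra_simps)
  then have "dist X q = l * dist X p" using l by (simp add: dist_norm)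
  also have "\<dots> \<le> l * D" using l p by (intro mult_left_mono) auto
  finally have dq: "dist X q \<le> l * D" .
  show ?thesis
  proof (cases "l * D \<le> r / 2")
    case True
    have "ball q (r/2) \<subseteq> ball X r"
    proof
      fix y assume "y \<in> ball q (r/2)"
      then show "y \<in> ball X r" using dq True dist_triangle[of X y q] by simp
    qed
    moreover have "ball q (min (r/2) (a * r / (2 * D))) \<subseteq> ball q (r/2)" by (intro subset_ball) simp
    ultimately show ?thesis using X(2) by blast
  next
    case False
    then have l0: "0 < l" using X(3) l(1) by (cases "l = 0") auto
    have "r / (2 * D) \<le> l" using False p(4) by (simp add: field_simps)
    then have "a * (r / (2 * D)) \<le> a * l" using p by (intro mult_left_mono) auto
    then have "min (r/2) (a * r / (2 * D)) \<le> l * a" by (simp add: mult.commute)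
    moreover have "ball q (l * a) \<subseteq> B"
    proof
      fix y assume y: "y \<in> ball q (l * a)"
      define w where "w = p + (1 / l) *\<^sub>R (y - q)"
      have "dist p w = (1 / l) * norm (y - q)" using l0 by (simp add: w_def dist_norm)
      also have "\<dots> < a" using y l0 by (simp add: dist_norm norm_minus_commute field_simps)
      finally have "w \<in> B" using p(1) by auto
      moreover have "y = (1 - l) *\<^sub>R X + l *\<^sub>R w" using l0 by (simp add: w_def l(3) algebra_simps)
      ultimately show "y \<in> B" using B(1) X(1) l(1,2) by (simp add: convex_alt)
    qed
    then have "ball q (l * a) \<subseteq> \<Omega>" using B(2) interior_maximal[of "ball q (l * a)" B] by auto
    ultimately show ?thesis using subset_ball[of "min (r/2) (a * r / (2 * D))" "l * a" q] by blast
  qed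
qed

lemma conn_H2:
  assumes "conn t N X1 X2" "0 < t"
  shows "\<exists>Z::nat \<Rightarrow> real^'n. Z 0 = X1 \<and> Z N = X2 \<and> (\<forall>i\<le>N. Z i \<in> \<Omega>) \<and>
           (\<forall>i<N. dist (Z i) (Z (Suc i)) < infdist (Z i) (frontier \<Omega>) / 2)"
proof -
  obtain Z where Z: "Z 0 = X1" "Z N = X2" "\<And>i. i \<le> N \<Longrightarrow> ball (Z i) t \<subseteq> \<Omega>"
    "\<And>i. i < N \<Longrightarrow> dist (Z i) (Z (Suc i)) < t / 2" using assms(1) unfolding conn_def by blast
  have "Z i \<in> \<Omega>" if "i \<le> N" for i using Z(3)[OF that] assms(2) by (meson centre_in_ball subsetD)
  moreover have "dist (Z i) (Z (Suc i)) < infdist (Z i) (frontier \<Omega>) / 2" if "i < N" for i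
    using Z(4)[OF that] infdist_frontier_ge[OF Z(3), of i] that by simp
  ultimately show ?thesis using Z(1,2) by blast
qed

text \<open>Four segments: from the centre of \<open>J\<close> to a chain point in \<open>J\<close>,
  on to the centre of a chain ball containing it, along the chain to \<open>Y2\<close>, and from
  there to \<open>XQ Q\<close>. Every point on the way lies in a box of the region, so a ball around
  it of radius proportional to \<open>cl Q\<close> stays in \<Omega>.\<close>

lemma region_conn:
  "\<exists>\<kappa>1>0. \<exists>C1>0. \<forall>Q\<in>DF. \<forall>J\<in>WQ Q. \<forall>t N. 0 < t \<and> t \<le> \<kappa>1 * cl Q \<and> C1 * cl Q \<le> real N * t \<longrightarrow>
     conn t (4 * N) (fst J) (XQ Q)"
proof -
  define \<kappa>1 where "\<kappa>1 = \<theta> / (2 * CW)"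
  define E where "E = hr + 2 + a0 * K * 2 + A0"
  define B where "B = 2 * rn * CW + 2 * E + hr + 1"
  have E: "1 \<le> E" using hr_pos K_ge A01 by (simp add: E_def)
  have "0 \<le> rn * CW" using rn1 CW1 by simp
  then have B: "2 * rn * CW \<le> B" "2 * E \<le> B" "hr \<le> B" "1 \<le> B" using E hr_pos by (auto simp: B_def)
  have "conn t (4 * N) (fst J) (XQ Q)"
    if Q: "Q \<in> DF" and J: "J \<in> WQ Q" and t: "0 < t" "t \<le> \<kappa>1 * cl Q" "4 * B * cl Q \<le> real N * t" for Q J t N
  proof -
    have Qc: "Q \<in> all_cubes \<DD>" using DF_cube Q .
    have thick: "ball p t \<subseteq> \<Omega>" if "J' \<in> WQ Q" "p \<in> box_set J'" for J' p
      using DF_region[OF Q that] t(2) subset_ball[of t "\<kappa>1 * cl Q" p] unfolding \<kappa>1_def by blast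
    have short: "dist X Y < real N * t / 2" if "dist X Y \<le> b * cl Q" "b \<le> B" for X Y b
    proof -
      have "dist X Y \<le> B * cl Q" using that cl_pos[of Q] by (meson less_imp_le mult_right_mono order_trans)
      moreover have "0 < B * cl Q" using B cl_pos[of Q] by (intro mult_pos_pos) auto
      ultimately show ?thesis using t(3) by linarith
    qed
    obtain I P where I: "I \<in> W0 Q" and P: "P \<in> H Q I" "P \<in> box_set J" using WQ_D(2)[OF J] by auto
    have JW: "J \<in> W" using WQ_D J by blast
    obtain Y1 Y2 Z and m :: nat where Y: "Y2 \<in> ball (XQ Q) (sQ Q / 2)"
      "\<And>i. i \<le> m \<Longrightarrow> Z i \<in> closed_segment Y1 Y2" "H Q I = (\<Union>i\<le>m. ball (Z i) (hr * cl Q))"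
      "closed_segment Y1 Y2 \<subseteq> H Q I"
      using chain_info[OF Qc I] by metis
    obtain i where i: "i \<le> m" "P \<in> ball (Z i) (hr * cl Q)" using P(1) Y(3) by auto
    have Hthick: "ball p t \<subseteq> \<Omega>" if "p \<in> H Q I" for p
      using H_point(2)[OF Qc I that] thick by blast
    have c0: "fst J \<in> box_set J" using W_pos[OF JW] by (intro centre_in_box) simp
    have s1: "conn t N (fst J) P"
    proof (rule conn_segment)
      show "ball p t \<subseteq> \<Omega>" if "p \<in> closed_segment (fst J) P" for p
        using thick[OF J, of p] closed_segment_subset[OF c0 P(2) convex_box_set] that by blast
      have "dist (fst J) P \<le> 2 * rn * snd J"
        using dist_star[OF JW] box_in_star[OF JW] c0 P(2) by blast
      also have "\<dots> \<le> 2 * rn * (CW * cl Q)"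
        using region_props(2)[OF Qc J] rn1 by (intro mult_left_mono) auto
      finally show "dist (fst J) P < real N * t / 2" using short[OF _ B(1)] by (simp add: mult.assoc)
    qed
    have Zb: "ball (Z i) (hr * cl Q) \<subseteq> H Q I" using Y(3) i by auto
    have zc: "Z i \<in> ball (Z i) (hr * cl Q)" using hr_pos cl_pos by simp
    have s2: "conn t N P (Z i)"
    proof (rule conn_segment)
      show "ball p t \<subseteq> \<Omega>" if "p \<in> closed_segment P (Z i)" for p
        using Hthick[of p] closed_segment_subset[OF i(2) zc convex_ball] that Zb by blast
      show "dist P (Z i) < real N * t / 2" using short[OF less_imp_le B(3)] i by (simp add: dist_commute)
    qed
    have Y2s: "Y2 \<in> closed_segment Y1 Y2" by simp
    have s3: "conn t N (Z i) Y2"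
    proof (rule conn_segment)
      show "ball p t \<subseteq> \<Omega>" if "p \<in> closed_segment (Z i) Y2" for p
        using Hthick[of p] closed_segment_subset[OF Y(2)[OF i(1)] Y2s convex_closed_segment] that Y(4) by blast
      have "dist (Z i) (xc Q) \<le> E * cl Q" "dist Y2 (xc Q) \<le> E * cl Q"
        using H_point(3)[OF Qc I] Zb zc Y2s Y(4) unfolding E_def by blast+
      then have "dist (Z i) Y2 \<le> 2 * E * cl Q" using dist_triangle2[of "Z i" Y2 "xc Q"] by linarith
      then show "dist (Z i) Y2 < real N * t / 2" using short[OF _ B(2)] by simp
    qed
    have s4: "conn t N Y2 (XQ Q)"
    proof (rule conn_segment)
      fix p assume p: "p \<in> closed_segment Y2 (XQ Q)"
      have "XQ Q \<in> ball (XQ Q) (sQ Q / 2)" using a0 c01 \<eta>0 cl_pos by simp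
      then have "p \<in> ball (XQ Q) (sQ Q / 2)" using closed_segment_subset[OF Y(1) _ convex_ball] p by blast
      then have "dist (XQ Q) p < sQ Q / 2" unfolding mem_ball .
      from near_XQ_in_W0[OF Qc this] obtain J' where "J' \<in> W0 Q" "p \<in> box_set J'" by blast
      then show "ball p t \<subseteq> \<Omega>" using thick W0_sub[OF Qc] by blast
    next
      have "Y2 \<in> H Q I" using Y(4) Y2s by blast
      then have "dist Y2 (xc Q) \<le> E * cl Q" using H_point(3)[OF Qc I] unfolding E_def by blast
      moreover have "a0 * cl Q \<le> E * cl Q" using E a01 cl_pos[of Q] by (intro mult_right_mono) auto
      ultimately have "dist Y2 (XQ Q) \<le> 2 * E * cl Q"
        using XQ_props(2)[OF Qc] dist_triangle2[of Y2 "XQ Q" "xc Q"] by linarith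
      then show "dist Y2 (XQ Q) < real N * t / 2" using short[OF _ B(2)] by simp
    qed
    show ?thesis using conn_trans[OF s1 conn_trans[OF s2 conn_trans[OF s3 s4]]]
      by (simp add: algebra_simps numeral_eq_Suc)
  qed
  moreover have "0 < \<kappa>1" "0 < 4 * B" using \<theta>0 CW1 B by (auto simp: \<kappa>1_def)
  ultimately show ?thesis by (intro exI[of _ \<kappa>1] conjI exI[of _ "4 * B"]) auto
qed

text \<open>The box containing \<open>XQ R'\<close> belongs to the regions of \<open>R'\<close> and
  of its parent, so two applications of \<open>rc\<close> join their corkscrew points.
  \<open>t\<close> is adapted to the finest scale and \<open>N\<close> to the coarsest, so the same
  pair works in every generation.\<close>

lemma ancestor_conn:
  assumes k1: "0 < \<kappa>1" and C1: "0 < C1"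
    and rc: "\<And>Q J t N. Q \<in> DF \<Longrightarrow> J \<in> WQ Q \<Longrightarrow> 0 < t \<Longrightarrow> t \<le> \<kappa>1 * cl Q \<Longrightarrow> C1 * cl Q \<le> real N * t \<Longrightarrow>
     conn t (4 * N) (fst J) (XQ Q)"
    and t: "0 < t" "t \<le> \<kappa>1 * sc k"
    and Q: "Q \<in> \<DD> k" "Q \<in> DF"
  shows "R \<in> \<DD> (k - int m) \<Longrightarrow> Q \<subseteq> R \<Longrightarrow> C1 * (L0 * sc (k - int m)) \<le> real N * t \<Longrightarrow>
     conn t (m * (8 * N)) (XQ Q) (XQ R)"
proof (induction m arbitrary: R)
  case 0
  then have "R = Q" using cube_eq[OF _ Q(1), of R] cubeD(6)[OF Q(1)] by auto
  obtain I where I: "I \<in> W0 Q" using ex_IQ cubeD(7)[OF Q(1)] by blast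
  \<comment> \<open>A chain of some length shows that \<open>ball (XQ Q) t\<close> lies in \<Omega>;
    the constant chain then settles the base case.\<close>
  obtain M :: nat where "C1 * cl Q / t < real M" using reals_Archimedean2 by blast
  then have "C1 * cl Q \<le> real M * t" using t by (simp add: field_simps)
  moreover have "t \<le> \<kappa>1 * cl Q"
    using t(2) mult_left_mono[OF cl_bounds(1)[OF Q(1)], of \<kappa>1] k1 by linarith
  ultimately have "conn t (4 * M) (fst I) (XQ Q)"
    using rc[OF Q(2) W0_sub[OF cubeD(7)[OF Q(1)] I] t(1)] by blast
  then have "ball (XQ Q) t \<subseteq> \<Omega>" by (rule conn_end)
  then show ?case using conn_refl[OF t(1)] \<open>R = Q\<close> by simp
next
  case (Suc m)
  let ?k = "k - int m"
  obtain R' where R': "R' \<in> \<DD> ?k" "Q \<subseteq> R'" using cube_ancestor[OF Q(1), of ?k] by auto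
  have R: "R \<in> \<DD> (?k - 1)" using Suc.prems(1) by (simp add: algebra_simps)
  have "R' \<inter> R \<noteq> {}" using R'(2) Suc.prems(2) cubeD(6)[OF Q(1)] by blast
  then have RR: "R' \<subseteq> R" using cube_nested[OF _ R'(1) R] by simp
  have RF: "R \<in> DF" "R' \<in> DF" using DF_up[OF Q(2)] cubeD(7) R R'(1) R'(2) Suc.prems(2) by blast+
  have Rc: "R \<in> all_cubes \<DD>" "R' \<in> all_cubes \<DD>" using DF_cube RF by blast+
  have s2: "sc (?k - 1) = 2 * sc ?k" using sc_diff[of ?k 1] by simp
  have sS: "sc (k - int (Suc m)) = sc (?k - 1)" by (simp add: algebra_simps)
  have big: "C1 * (L0 * sc (?k - 1)) \<le> real N * t" using Suc.prems(3) unfolding sS .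
  have "C1 * (L0 * sc ?k) \<le> C1 * (L0 * sc (?k - 1))"
    using C1 L0_pos sc_mono[of "?k - 1" ?k] by (intro mult_left_mono) auto
  then have big': "C1 * (L0 * sc ?k) \<le> real N * t" using big by linarith
  have IH: "conn t (m * (8 * N)) (XQ Q) (XQ R')" by (rule Suc.IH[OF R' big'])
  obtain I where I: "I \<in> W0 R'" "XQ R' \<in> box_set I" using ex_IQ[OF Rc(2)] by blast
  have cm: "cl R' \<le> cl R" using cl_mono[OF Rc(2,1) RR] .
  have "cl R \<le> L0 * (2 * sc ?k)" using cl_bounds(2)[OF R] s2 by simp
  also have "\<dots> \<le> L0 * (2 * cl R')" using cl_bounds(1)[OF R'(1)] L0_pos by (intro mult_left_mono) auto
  finally have "\<eta> * cl R \<le> \<eta> * (L0 * (2 * cl R'))" using \<eta>0 by (intro mult_left_mono) auto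
  also have "\<dots> = (4 * L0 * \<eta>) * (cl R' / 2)" by simp
  also have "\<dots> \<le> 1 * (cl R' / 2)" using \<eta>_L0 cl_pos[of R'] by (intro mult_right_mono) auto
  finally have e: "\<eta> * cl R \<le> 2 * cl R'" using cl_pos[of R'] by linarith
  have "I \<in> W0 R"
  proof (rule IQ_in_W0[OF Rc(2,1) W0_D(1)[OF I(1)] I(2) _ e])
    show "cl R' \<le> 125 * cl R" using cm cl_pos[of R] by linarith
    show "xc R' \<in> R" using xc_props(2)[OF Rc(2)] RR by blast
    show "dist (xc R') (xc R') \<le> 250 * A0 * cl R" using A01 cl_pos[of R] by simp
  qed
  then have IR: "I \<in> WQ R" "I \<in> WQ R'" using W0_sub Rc I by blast+
  have "t \<le> \<kappa>1 * cl R'" "t \<le> \<kappa>1 * cl R"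
  proof -
    have "sc k \<le> cl R'" "sc k \<le> cl R" using cl_bounds(1)[OF R'(1)] cm sc_mono[of ?k k] by linarith+
    then have "\<kappa>1 * sc k \<le> \<kappa>1 * cl R'" "\<kappa>1 * sc k \<le> \<kappa>1 * cl R" using k1 by (auto intro: mult_left_mono)
    then show "t \<le> \<kappa>1 * cl R'" "t \<le> \<kappa>1 * cl R" using t by linarith+
  qed
  moreover have "C1 * cl R' \<le> real N * t" "C1 * cl R \<le> real N * t"
    using big big' mult_left_mono[OF cl_bounds(2)[OF R'(1)], of C1] mult_left_mono[OF cl_bounds(2)[OF R], of C1] C1
    by linarith+
  ultimately have "conn t (4 * N) (fst I) (XQ R')" "conn t (4 * N) (fst I) (XQ R)"
    using rc[OF RF(2) IR(2) t(1)] rc[OF RF(1) IR(1) t(1)] by blast+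
  then have "conn t (4 * N + 4 * N) (XQ R') (XQ R)" using conn_sym conn_trans by blast
  from conn_trans[OF IH this] show ?case by (simp add: algebra_simps)
qed

text \<open>As for parents, the box at \<open>XQ Q\<close> lies in the regions of both cubes. The
  assumption \<open>le\<close> gives the upper size bound for that box; the caller swaps the cubes
  if necessary.\<close>

lemma across_conn:
  assumes C1: "0 < C1" and k1: "0 < \<kappa>1"
    and rc: "\<And>Q J t N. Q \<in> DF \<Longrightarrow> J \<in> WQ Q \<Longrightarrow> 0 < t \<Longrightarrow> t \<le> \<kappa>1 * cl Q \<Longrightarrow> C1 * cl Q \<le> real N * t \<Longrightarrow>
     conn t (4 * N) (fst J) (XQ Q)"
    and t: "0 < t" "t \<le> \<kappa>1 * sc k"
    and Q: "Q \<in> \<DD> k" "Q \<in> DF" and R: "R \<in> \<DD> k" "R \<in> DF" and N: "C1 * (L0 * sc k) \<le> real N * t"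
    and xy: "x \<in> Q" "y \<in> R" "dist x y \<le> 100 * sc k" and le: "cl Q \<le> cl R"
  shows "conn t (8 * N) (XQ Q) (XQ R)"
proof -
  have Qc: "Q \<in> all_cubes \<DD>" "R \<in> all_cubes \<DD>" using DF_cube Q R by blast+
  obtain I where I: "I \<in> W0 Q" "XQ Q \<in> box_set I" using ex_IQ[OF Qc(1)] by blast
  have "cl R \<le> L0 * cl Q"
    using cl_bounds(2)[OF R(1)] mult_left_mono[OF cl_bounds(1)[OF Q(1)], of L0] L0_pos by linarith
  then have "\<eta> * cl R \<le> \<eta> * (L0 * cl Q)" using \<eta>0 by (intro mult_left_mono) auto
  also have "\<dots> = (4 * L0 * \<eta>) * (cl Q / 4)" by simp
  also have "\<dots> \<le> 1 * (cl Q / 4)" using \<eta>_L0 cl_pos[of Q] by (intro mult_right_mono) auto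
  finally have e: "\<eta> * cl R \<le> 2 * cl Q" using cl_pos[of Q] by linarith
  have "I \<in> W0 R"
  proof (rule IQ_in_W0[OF Qc W0_D(1)[OF I(1)] I(2) _ e xy(2)])
    show "cl Q \<le> 125 * cl R" using le cl_pos[of R] by linarith
    have "dist (xc Q) x \<le> A0 * sc k" using cube_dist[OF Q(1) xc_props(2)[OF Qc(1)] xy(1)] by simp
    also have "\<dots> \<le> A0 * cl R" using cl_bounds(1)[OF R(1)] A01 by (intro mult_left_mono) auto
    finally have "dist (xc Q) x \<le> A0 * cl R" .
    moreover have "sc k \<le> A0 * cl R"
      using cl_bounds(1)[OF R(1)] A01 cl_pos[of R] mult_right_mono[OF A01, of "cl R"] by linarith
    ultimately have "dist (xc Q) y \<le> 101 * (A0 * cl R)" using xy(3) dist_triangle[of "xc Q" y x] by linarith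
    moreover have "0 \<le> A0 * cl R" using A01 cl_pos[of R] by simp
    ultimately show "dist (xc Q) y \<le> 250 * A0 * cl R" by simp
  qed
  then have IR: "I \<in> WQ R" "I \<in> WQ Q" using W0_sub Qc I by blast+
  have "t \<le> \<kappa>1 * cl Q" "t \<le> \<kappa>1 * cl R"
    using t(2) mult_left_mono[OF cl_bounds(1)[OF Q(1)], of \<kappa>1] mult_left_mono[OF cl_bounds(1)[OF R(1)], of \<kappa>1] k1
    by linarith+
  moreover have "C1 * cl Q \<le> real N * t" "C1 * cl R \<le> real N * t"
    using N mult_left_mono[OF cl_bounds(2)[OF Q(1)], of C1] mult_left_mono[OF cl_bounds(2)[OF R(1)], of C1] C1
    by linarith+
  ultimately have "conn t (4 * N) (fst I) (XQ Q)" "conn t (4 * N) (fst I) (XQ R)"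
    using rc[OF Q(2) IR(2) t(1)] rc[OF R(2) IR(1) t(1)] by blast+
  from conn_trans[OF conn_sym[OF this(1)] this(2)] show ?thesis by simp
qed

text \<open>When \<open>\<delta> X1\<close> is large compared with \<open>r\<close>, the dilated
  boxes containing the two points overlap in a box of side at least \<open>r\<close>, by the
  separation of faces. Both points are joined to a point deep in the overlap, each inside its own
  convex box.\<close>

lemma close_conn:
  assumes L: "0 < L" and r: "0 < r" and X: "X1 \<in> \<Omega>" "X2 \<in> \<Omega>" "ball X1 r \<subseteq> \<Omega>" "ball X2 r \<subseteq> \<Omega>"
    and d: "dist X1 X2 \<le> L * r" and close: "2 * (L + 1) * r \<le> \<kappa> * \<delta> X1"
    and D: "D = L + rn * (1/2 + L)" and t: "t = r * min (1/2) (1 / (4 * D))" and N: "D * r < real N * t / 2"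
  shows "conn t (2 * N) X1 X2"
proof -
  have D0: "0 < D" unfolding D using L rn1 by (intro add_pos_nonneg mult_nonneg_nonneg) auto
  have z: "X1 \<notin> \<Gamma>" using X \<Omega>_\<Gamma> by auto
  have \<delta>1: "0 < \<delta> X1" using \<delta>_pos[OF z] .
  obtain I1 where I1: "I1 \<in> WF" "X1 \<in> star I1" using \<Omega>_star[OF X(1)] by blast
  obtain I2 where I2: "I2 \<in> WF" "X2 \<in> star I2" using \<Omega>_star[OF X(2)] by blast
  have Lr: "L * r < \<kappa> * \<delta> X1" "r \<le> \<kappa> * \<delta> X1"
    using close mult_pos_pos[OF L r] r by (simp_all add: algebra_simps)
  have "\<kappa> * \<delta> X1 \<le> 1/10 * \<delta> X1" using \<kappa>_small \<delta>1 by (intro mult_right_mono) auto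
  then have "dist X1 X2 < \<delta> X1 / 10" using d Lr by linarith
  then have "X1 \<in> ball X1 (\<delta> X1 / 10)" "X2 \<in> ball X1 (\<delta> X1 / 10)" using \<delta>1 by auto
  then have nb: "I1 \<in> near_boxes X1" "I2 \<in> near_boxes X1" using I1 I2 WF_W by blast+
  have X1i: "face I1 (-1) i \<le> X1$i \<and> X1$i \<le> face I1 1 i" and X2i: "face I2 (-1) i \<le> X2$i \<and> X2$i \<le> face I2 1 i" for i
    using I1(2) I2(2) by (simp_all add: star_cbox mem_box_cart)
  have dX: "\<bar>X1$i - X2$i\<bar> \<le> L * r" for i
    using component_le_norm_cart[of "X1 - X2" i] d by (simp add: dist_norm)
  \<comment> \<open>An upper and a lower face have different orientations, so their coordinates are
    at least \<open>\<kappa> * \<delta> X1\<close> apart. Since \<open>X1\<close> and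
    \<open>X2\<close> lie in the boxes and within \<open>L * r\<close> of each other, the difference
    is at least \<open>- (L * r)\<close>, which settles its sign.\<close>
  have gap: "\<kappa> * \<delta> X1 \<le> face J 1 i - face J' (-1) i" if "J \<in> {I1, I2}" "J' \<in> {I1, I2}" for J J' i
  proof -
    have "J \<in> near_boxes X1" "J' \<in> near_boxes X1" using that nb by blast+
    then have "\<kappa> * \<delta> X1 \<le> \<bar>face J 1 i - face J' (-1) i\<bar>"
      using face_separation[of J X1 J' 1 "-1" i] z by force
    moreover have "- (L * r) \<le> face J 1 i - face J' (-1) i"
      using that X1i[of i] X2i[of i] dX[of i] mult_pos_pos[OF L r] by auto
    ultimately show ?thesis using Lr by linarith
  qed
  obtain p where p: "ball p (r/2) \<subseteq> cbox (\<chi> i. max (face I1 (-1) i) (face I2 (-1) i)) (\<chi> i. min (face I1 1 i) (face I2 1 i))"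
    "dist X1 p \<le> sqrt (real CARD('n)) * (r/2 + L * r)"
  proof (rule deep_point[of "r/2" "\<chi> i. min (face I1 1 i) (face I2 1 i)" "\<chi> i. max (face I1 (-1) i) (face I2 (-1) i)" "L * r" X1])
    fix i
    show "2 * (r / 2) \<le> (\<chi> i. min (face I1 1 i) (face I2 1 i)) $ i - (\<chi> i. max (face I1 (-1) i) (face I2 (-1) i)) $ i"
      using gap[of I1 I1 i] gap[of I1 I2 i] gap[of I2 I1 i] gap[of I2 I2 i] Lr(2) by (simp add: min_def max_def)
    show "(\<chi> i. max (face I1 (-1) i) (face I2 (-1) i)) $ i - L * r \<le> X1 $ i \<and>
         X1 $ i \<le> (\<chi> i. min (face I1 1 i) (face I2 1 i)) $ i + L * r"
      unfolding vec_lambda_beta using X1i[of i] X2i[of i] dX[of i] mult_pos_pos[OF L r] by (intro conjI; linarith)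
  qed (use r L that in auto)
  have p12: "ball p (r/2) \<subseteq> star I1" "ball p (r/2) \<subseteq> star I2"
    using p(1) by (force simp: star_cbox mem_box_cart subset_iff)+
  have dp1: "dist X1 p \<le> rn * (1/2 + L) * r" using p(2) by (simp add: rn_def algebra_simps)
  then have dp: "dist X1 p \<le> D * r" "dist X2 p \<le> D * r"
    using d dist_triangle[of X2 p X1] mult_pos_pos[OF L r] by (simp_all add: D algebra_simps dist_commute)
  have Dr: "0 < D * r" using D0 r by simp
  have tt: "min (r/2) (r/2 * r / (2 * (D * r))) = t" using r D0 by (simp add: t min_mult_distrib_left field_simps)
  have "conn t N X1 p"
  proof (rule conn_segment)
    show "dist X1 p < real N * t / 2" using dp N by linarith
    fix q assume "q \<in> closed_segment X1 p"
    from segment_thick[OF convex_box_set open_sub_\<Omega>[OF I1(1)] I1(2) X(3) r p12(1) _ dp(1) Dr this]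
    show "ball q t \<subseteq> \<Omega>" using r interior_subset unfolding tt by auto
  qed
  moreover have "conn t N X2 p"
  proof (rule conn_segment)
    show "dist X2 p < real N * t / 2" using dp N by linarith
    fix q assume "q \<in> closed_segment X2 p"
    from segment_thick[OF convex_box_set open_sub_\<Omega>[OF I2(1)] I2(2) X(4) r p12(2) _ dp(2) Dr this]
    show "ball q t \<subseteq> \<Omega>" using r interior_subset unfolding tt by auto
  qed
  ultimately have "conn t (N + N) X1 X2" using conn_sym conn_trans by blast
  then show ?thesis by (simp add: mult_2)
qed

text \<open>\<open>X\<close> may be close to the boundary of its dilated box; the ball of radius
  \<open>r\<close> thickens the beginning of the segment to the centre.\<close>

lemma start_conn:
  assumes X: "X \<in> \<Omega>" "ball X r \<subseteq> \<Omega>" "0 < r"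
  obtains I Q where "I \<in> WQ Q" "Q \<in> DF" "X \<in> star I" "r \<le> 42 * rn * snd I" "4 * rn * snd I \<le> \<delta> X"
    "\<And>t N. 0 < t \<Longrightarrow> t \<le> r / (8 * rn) \<Longrightarrow> 2 * rn * snd I < real N * t / 2 \<Longrightarrow> conn t N X (fst I)"
proof -
  obtain I where I: "I \<in> WF" "X \<in> star I" using \<Omega>_star[OF X(1)] by blast
  then obtain Q where Q: "I \<in> WQ Q" "Q \<in> DF" unfolding WF_def by blast
  have IW: "I \<in> W" using WF_W I by blast
  have I0: "0 < snd I" using W_pos[OF IW] .
  have "ball X r \<inter> \<Gamma> = {}" using X(2) \<Omega>_\<Gamma> by blast
  then have "r \<le> \<delta> X" by (rule infdist_ge)
  then have 1: "r \<le> 42 * rn * snd I" using \<delta>_star_le[OF IW I(2)] by linarith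
  have b: "ball (fst I) (snd I / 2) \<subseteq> star I"
  proof
    fix y assume y: "y \<in> ball (fst I) (snd I / 2)"
    have "\<bar>y$i - fst I$i\<bar> \<le> snd I / 2" for i
      using component_le_norm_cart[of "y - fst I" i] y by (simp add: dist_norm norm_minus_commute)
    then have "y \<in> box_set I" by (simp add: box_set_def)
    then show "y \<in> star I" using box_in_star[OF IW] by blast
  qed
  have dI: "dist X (fst I) \<le> 2 * rn * snd I"
    using dist_star[OF IW I(2)] b I0 by (metis centre_in_ball half_gt_zero subsetD)
  have D: "0 < 2 * rn * snd I" using rn1 I0 by (intro mult_pos_pos) auto
  have I2: "0 < snd I / 2" using I0 by simp
  have "conn t N X (fst I)" if t: "0 < t" "t \<le> r / (8 * rn)" "2 * rn * snd I < real N * t / 2" for t N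
  proof (rule conn_segment)
    show "dist X (fst I) < real N * t / 2" using dI t by linarith
    fix q assume q: "q \<in> closed_segment X (fst I)"
    have "r / (8 * rn) \<le> r / 2" using rn1 X(3) by (intro divide_left_mono) auto
    moreover have "snd I / 2 * r / (2 * (2 * rn * snd I)) = r / (8 * rn)" using I0 by simp
    ultimately have "t \<le> min (r/2) (snd I / 2 * r / (2 * (2 * rn * snd I)))" using t(2) by simp
    moreover have "interior (star I) \<subseteq> \<Omega>" by (intro open_sub_\<Omega>[OF I(1)]) (auto simp: interior_subset)
    ultimately show "ball q t \<subseteq> \<Omega>"
      using segment_thick[OF convex_box_set _ I(2) X(2,3) b I2 dI D q] subset_ball by blast
  qed
  then show ?thesis using that[OF Q I(2) 1 \<delta>_star_ge[OF IW I(2)]] by blast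
qed

text \<open>If \<open>\<delta> X1\<close> is large compared with \<open>r\<close>,
  \<open>close_conn\<close> applies. Otherwise both points lie at distance comparable to
  \<open>r\<close> from \<Gamma>: each is joined to the corkscrew point of a kept cube, then to that
  of an ancestor of scale about \<open>E * r\<close>, and the two ancestors are close enough for
  \<open>across_conn\<close>.\<close>

lemma harnack_chains:
  assumes c1: "0 < c1" shows "\<exists>N. cond_H2 \<Omega> c1 N"
proof -
  obtain \<kappa>1 C1 where k1: "0 < \<kappa>1" and C1: "0 < C1" and
    rc: "\<And>Q J t N. Q \<in> DF \<Longrightarrow> J \<in> WQ Q \<Longrightarrow> 0 < t \<Longrightarrow> t \<le> \<kappa>1 * cl Q \<Longrightarrow> C1 * cl Q \<le> real N * t \<Longrightarrow>
     conn t (4 * N) (fst J) (XQ Q)"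
    using region_conn by metis
  define L where "L = 7 * inverse c1"
  have L: "0 < L" using c1 by (simp add: L_def)
  define D where "D = L + rn * (1/2 + L)"
  have D0: "0 < D" unfolding D_def using L rn1 by (intro add_pos_nonneg mult_nonneg_nonneg) auto
  define \<tau>1 where "\<tau>1 = min (1/2) (1 / (4 * D))"
  have \<tau>1: "0 < \<tau>1" using D0 by (simp add: \<tau>1_def)
  obtain N1 :: nat where N1: "2 * D / \<tau>1 < real N1" using reals_Archimedean2 by blast
  define B where "B = 2 * (L + 1) / \<kappa>"
  have B: "0 < B" using L \<kappa>_pos by (simp add: B_def)
  define E where "E = CW * (B + L) + 2 * (CW * (CW * (B + L))) + L"
  have E: "CW * (B + L) \<le> E" "2 * (CW * (CW * (B + L))) + L \<le> E" "0 < E"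
    using CW1 B L by (auto simp: E_def intro!: add_pos_pos mult_pos_pos)
  \<comment> \<open>The starting cube has length at least \<open>r / (42 * rn * CW)\<close> and the
    common scale is below \<open>2 * E * r\<close>, so fewer than \<open>M\<close> generations are
    climbed.\<close>
  obtain M :: nat where M: "84 * (E * (rn * CW)) < 2 ^ M" using real_arch_pow[of 2] by auto
  define \<tau> where "\<tau> = min (1 / (8 * rn)) (\<kappa>1 / (42 * (rn * CW)))"
  have \<tau>: "0 < \<tau>" "\<tau> \<le> 1 / (8 * rn)" "\<tau> \<le> \<kappa>1 / (42 * (rn * CW))"
    using rn1 k1 CW1 by (auto simp: \<tau>_def)
  obtain N0 :: nat where N0: "(C1 * (L0 * (2 * E)) + 4 * rn * (B + L)) / \<tau> < real N0" using reals_Archimedean2 by blast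
  have pos: "0 < C1 * (L0 * (2 * E))" "0 < 4 * rn * (B + L)" using C1 L0_pos E rn1 B L by auto
  have N0': "C1 * (L0 * (2 * E)) \<le> real N0 * \<tau>" "4 * rn * (B + L) < real N0 * \<tau>"
  proof -
    have "C1 * (L0 * (2 * E)) + 4 * rn * (B + L) < real N0 * \<tau>" using N0 \<tau> by (simp add: field_simps)
    then show "C1 * (L0 * (2 * E)) \<le> real N0 * \<tau>" "4 * rn * (B + L) < real N0 * \<tau>" using pos by linarith+
  qed
  \<comment> \<open>For each of the two points a start, a region and a climb, plus one crossing
    between the ancestors.\<close>
  define NA where "NA = 2 * (N0 + 4 * N0 + M * (8 * N0)) + 8 * N0"
  define N where "N = max (2 * N1) NA"
  have main: "\<exists>t>0. conn t N X1 X2"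
    if r: "0 < r" and X: "X1 \<in> \<Omega>" "X2 \<in> \<Omega>" "ball X1 r \<subseteq> \<Omega>" "ball X2 r \<subseteq> \<Omega>" and d: "dist X1 X2 \<le> L * r" for r X1 X2
  proof (cases "2 * (L + 1) * r \<le> \<kappa> * \<delta> X1")
    case True
    have t: "0 < r * \<tau>1" using r \<tau>1 by simp
    have "2 * D < real N1 * \<tau>1" using N1 \<tau>1 by (simp add: field_simps)
    then have "2 * D * r < real N1 * \<tau>1 * r" using r by (intro mult_strict_right_mono)
    then have "D * r < real N1 * (r * \<tau>1) / 2" by (simp add: algebra_simps)
    then have "conn (r * \<tau>1) (2 * N1) X1 X2"
      using close_conn[OF L r X d True D_def, of "r * \<tau>1" N1] by (simp add: \<tau>1_def)
    then have "conn (r * \<tau>1) N X1 X2" using conn_pad t by (simp add: N_def)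
    then show ?thesis using t by blast
  next
    case False
    then have d1: "\<delta> X1 \<le> B * r" using \<kappa>_pos by (simp add: B_def field_simps)
    then have d2: "\<delta> X2 \<le> (B + L) * r" using \<delta>_lipschitz[of X2 X1] d by (simp add: algebra_simps dist_commute)
    have d1': "\<delta> X1 \<le> (B + L) * r" using d1 mult_pos_pos[OF L r] by (simp add: algebra_simps)
    define t where "t = \<tau> * r"
    have t0: "0 < t" using \<tau> r by (simp add: t_def)
    have N0t: "C1 * (L0 * (2 * E * r)) \<le> real N0 * t" "4 * rn * (B + L) * r < real N0 * t"
      using mult_right_mono[OF N0'(1), of r] mult_strict_right_mono[OF N0'(2) r] r
      by (simp_all add: t_def algebra_simps)
    have te: "t \<le> r / (8 * rn)" using mult_right_mono[OF \<tau>(2), of r] r by (simp add: t_def)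
    obtain k where k: "E * r \<le> sc k" "sc k < 2 * (E * r)" using ex_scale[of "E * r"] E r by auto
    have big: "C1 * (L0 * sc k) \<le> real N0 * t"
    proof -
      have "C1 * (L0 * sc k) \<le> C1 * (L0 * (2 * (E * r)))"
        using k C1 L0_pos by (intro mult_left_mono) auto
      then show ?thesis using N0t(1) by (simp add: mult.assoc)
    qed
    have start: "\<exists>R Q. R \<in> \<DD> k \<and> R \<in> DF \<and> Q \<subseteq> R \<and> Q \<noteq> {} \<and> (\<forall>z\<in>Q. dist X z \<le> CW * (CW * (B + L)) * r) \<and>
       conn t (N0 + 4 * N0 + M * (8 * N0)) X (XQ R) \<and> t \<le> \<kappa>1 * sc k"
      if XX: "X \<in> \<Omega>" "ball X r \<subseteq> \<Omega>" and dX: "\<delta> X \<le> (B + L) * r" for X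
    proof -
      obtain I Q where I: "I \<in> WQ Q" "Q \<in> DF" "X \<in> star I" "r \<le> 42 * rn * snd I" "4 * rn * snd I \<le> \<delta> X"
        and cn: "\<And>t N. 0 < t \<Longrightarrow> t \<le> r / (8 * rn) \<Longrightarrow> 2 * rn * snd I < real N * t / 2 \<Longrightarrow> conn t N X (fst I)"
        using start_conn[OF XX r] by metis
      have Qc: "Q \<in> all_cubes \<DD>" using DF_cube I by blast
      have I0: "0 < snd I" using W_pos WQ_D(1) I by blast
      have "1 * snd I \<le> rn * snd I" using rn1 I0 by (intro mult_right_mono) auto
      then have sI: "snd I \<le> (B + L) * r" using I(5) dX I0 by linarith
      have "2 * rn * snd I \<le> 2 * rn * ((B + L) * r)" using sI rn1 by (intro mult_left_mono) auto
      then have "2 * rn * snd I < real N0 * t / 2" using N0t(2) by (simp add: algebra_simps)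
      then have s1: "conn t N0 X (fst I)" using cn[OF t0 te] by blast
      have clQ: "cl Q \<le> CW * ((B + L) * r)"
        using region_props(1)[OF Qc I(1)] mult_left_mono[OF sI, of CW] CW1 by linarith
      have "r \<le> 42 * rn * (CW * cl Q)"
        using I(4) mult_left_mono[OF region_props(2)[OF Qc I(1)], of "42 * rn"] rn1 by linarith
      then have rQ: "r \<le> 42 * (rn * CW) * cl Q" by (simp add: mult.assoc)
      have rc0: "0 < rn * CW" using rn1 CW1 by (intro mult_pos_pos) auto
      have "t \<le> \<kappa>1 / (42 * (rn * CW)) * r" using mult_right_mono[OF \<tau>(3), of r] r by (simp add: t_def)
      also have "\<dots> \<le> \<kappa>1 / (42 * (rn * CW)) * (42 * (rn * CW) * cl Q)"
        using rQ k1 rc0 by (intro mult_left_mono) auto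
      also have "\<dots> = \<kappa>1 * cl Q" using rn1 CW1 by simp
      finally have tQ: "t \<le> \<kappa>1 * cl Q" .
      obtain kq where kq: "Q \<in> \<DD> kq" "cl Q = sc kq" using cube_length_exact[OF Qc] by blast
      have Er: "CW * ((B + L) * r) \<le> E * r" using mult_right_mono[OF E(1), of r] r by (simp add: algebra_simps)
      then have "sc kq \<le> sc k" using clQ kq k by linarith
      then have kk: "k \<le> kq" by (simp add: sc_le_iff)
      define m where "m = nat (kq - k)"
      have km: "k = kq - int m" using kk by (simp add: m_def)
      obtain R where R: "R \<in> \<DD> k" "Q \<subseteq> R" using cube_ancestor[OF kq(1) kk] by blast
      have "2 ^ m * sc kq = sc k" unfolding km by (rule sc_diff[symmetric])
      also have "\<dots> \<le> 2 * E * (42 * (rn * CW) * cl Q)" 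
      proof -
        have "2 * E * r \<le> 2 * E * (42 * (rn * CW) * cl Q)" using rQ E(3) by (intro mult_left_mono) auto
        then show ?thesis using k by linarith
      qed
      finally have "2 ^ m * sc kq \<le> 84 * (E * (rn * CW)) * sc kq" using kq by simp
      then have "(2::real) ^ m \<le> 84 * (E * (rn * CW))" using mult_le_cancel_right_pos sc_pos by blast
      then have "(2::real) ^ m < 2 ^ M" using M by linarith
      then have mM: "m \<le> M" using power_less_imp_less_exp[of "2::real" m M] by simp
      have clE: "C1 * cl Q \<le> real N0 * t"
      proof -
        have "cl Q \<le> 1 * sc k" using \<open>sc kq \<le> sc k\<close> kq by simp
        also have "\<dots> \<le> L0 * sc k" by (intro mult_right_mono L0_ge) simp
        finally have "C1 * cl Q \<le> C1 * (L0 * sc k)" using C1 by (intro mult_left_mono) auto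
        then show ?thesis using big by linarith
      qed
      have s2: "conn t (4 * N0) (fst I) (XQ Q)" by (rule rc[OF I(2,1) t0 tQ clE])
      have s3: "conn t (m * (8 * N0)) (XQ Q) (XQ R)"
        by (rule ancestor_conn[OF k1 C1 rc t0 _ kq(1) I(2) _ R(2)]) (use tQ kq big R km in auto)
      have s3': "conn t (M * (8 * N0)) (XQ Q) (XQ R)" using conn_pad[OF s3 t0] mM by simp
      have "conn t (N0 + 4 * N0 + M * (8 * N0)) X (XQ R)" using conn_trans[OF conn_trans[OF s1 s2] s3'] .
      moreover have "R \<in> DF" using DF_up[OF I(2) cubeD(7)[OF R(1)] R(2)] .
      moreover have "dist X z \<le> CW * (CW * (B + L)) * r" if "z \<in> Q" for z
        using order_trans[OF region_props(3)[OF Qc I(1,3) that] mult_left_mono[OF clQ, of CW]] CW1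
        by (simp only: mult.assoc)
      moreover have "t \<le> \<kappa>1 * sc k"
        using order_trans[OF tQ[unfolded kq(2)] mult_left_mono[OF \<open>sc kq \<le> sc k\<close>, of \<kappa>1]] k1 by simp
      ultimately show ?thesis using R cubeD(6)[OF kq(1)] by blast
    qed
    obtain R1 Q1 where R1: "R1 \<in> \<DD> k" "R1 \<in> DF" "Q1 \<subseteq> R1" "Q1 \<noteq> {}" "\<forall>z\<in>Q1. dist X1 z \<le> CW * (CW * (B + L)) * r"
       "conn t (N0 + 4 * N0 + M * (8 * N0)) X1 (XQ R1)" "t \<le> \<kappa>1 * sc k" using start[OF X(1,3) d1'] by blast
    obtain R2 Q2 where R2: "R2 \<in> \<DD> k" "R2 \<in> DF" "Q2 \<subseteq> R2" "Q2 \<noteq> {}" "\<forall>z\<in>Q2. dist X2 z \<le> CW * (CW * (B + L)) * r"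
       "conn t (N0 + 4 * N0 + M * (8 * N0)) X2 (XQ R2)" using start[OF X(2,4) d2] by blast
    obtain x y where xy: "x \<in> Q1" "y \<in> Q2" using R1 R2 by auto
    have "dist x y \<le> dist X1 x + dist X1 X2 + dist X2 y"
      using dist_triangle[of x y X1] dist_triangle[of X1 y X2] by (simp add: dist_commute)
    also have "\<dots> \<le> (2 * (CW * (CW * (B + L))) + L) * r" using R1(5) R2(5) xy d by (fastforce simp: algebra_simps)
    also have "\<dots> \<le> E * r" using E(2) r by (intro mult_right_mono) auto
    finally have xyd: "dist x y \<le> 100 * sc k" using k E(3) r mult_pos_pos[OF E(3) r] by linarith
    have "conn t (8 * N0) (XQ R1) (XQ R2)"
    proof (cases "cl R1 \<le> cl R2")
      case True
      show ?thesis
        by (rule across_conn[OF C1 k1 rc t0 R1(7) R1(1,2) R2(1,2) big _ _ xyd True]) (use xy R1 R2 in auto)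
    next
      case False
      then have le: "cl R2 \<le> cl R1" by simp
      have yxd: "dist y x \<le> 100 * sc k" using xyd by (simp add: dist_commute)
      have "conn t (8 * N0) (XQ R2) (XQ R1)"
        by (rule across_conn[OF C1 k1 rc t0 R1(7) R2(1,2) R1(1,2) big _ _ yxd le]) (use xy R1 R2 in auto)
      then show ?thesis by (rule conn_sym)
    qed
    note c12 = conn_trans[OF conn_trans[OF R1(6) this] conn_sym[OF R2(6)]]
    have "conn t NA X1 X2"
      using c12 by (rule back_subst[where P = "\<lambda>m. conn t m X1 X2"]) (simp add: NA_def)
    then have "conn t N X1 X2" using conn_pad t0 by (simp add: N_def)
    then show ?thesis using t0 by blast
  qed
  have "cond_H2 \<Omega> c1 N"
    unfolding cond_H2_def
  proof (intro allI ballI impI)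
    fix r :: real and X1 X2
    assume r: "0 < r" and X: "X1 \<in> \<Omega>" "X2 \<in> \<Omega>" and a: "r < infdist X1 (frontier \<Omega>) \<and> r < infdist X2 (frontier \<Omega>) \<and>
       dist X1 X2 \<le> 7 * inverse c1 * r"
    have b: "ball X1 r \<subseteq> \<Omega>" "ball X2 r \<subseteq> \<Omega>" using ball_sub_\<Omega> X a by auto
    have "dist X1 X2 \<le> L * r" using a unfolding L_def by blast
    from main[OF r X b this] obtain t where "0 < t" "conn t N X1 X2" by blast
    then show "\<exists>Z::nat \<Rightarrow> real^'n. Z 0 = X1 \<and> Z N = X2 \<and> (\<forall>i\<le>N. Z i \<in> \<Omega>) \<and>
           (\<forall>i<N. dist (Z i) (Z (Suc i)) < infdist (Z i) (frontier \<Omega>) / 2)"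
      by (intro conn_H2)
  qed
  then show ?thesis by blast
qed

end

subsection \<open>The interior measure\<close>

context sawtooth begin

abbreviation m :: "(real^'n) measure" where "m \<equiv> interior_measure d \<Gamma>"
abbreviation w :: "real^'n \<Rightarrow> real" where "w \<equiv> dist_weight d \<Gamma>"

text \<open>The weight is \<open>\<delta> X powr (- \<alpha>)\<close>. As \<open>0 powr\<close> of
  anything is 0, it vanishes on \<Gamma> although it blows up nearby; several steps below rely on
  this value.\<close>

definition \<alpha> :: real where "\<alpha> = real CARD('n) - 1 - d"
definition \<omega> :: real where "\<omega> = unit_ball_vol (real CARD('n))"

lemma \<alpha>_pos: "0 < \<alpha>" using dn by (simp add: \<alpha>_def)

lemma \<omega>_pos: "0 < \<omega>" by (simp add: \<omega>_def unit_ball_vol_pos)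

lemma w_eq: "w X = \<delta> X powr (- \<alpha>)"
  by (simp add: dist_weight_def \<alpha>_def algebra_simps)

lemma continuous_\<delta>: "continuous_on S \<delta>" by (intro continuous_intros)

lemma \<delta>_measurable [measurable]: "\<delta> \<in> borel_measurable borel"
  by (intro borel_measurable_continuous_onI continuous_\<delta>)

lemma w_measurable [measurable]: "w \<in> borel_measurable borel"
  unfolding w_eq[abs_def] by measurable

lemma m_eq:
  assumes "E \<in> sets borel"
  shows "emeasure m E = (\<integral>\<^sup>+X. ennreal (w X) * indicator E X \<partial>lborel)"
proof -
  have "(\<lambda>X. ennreal (w X)) \<in> borel_measurable lebesgue"
    by (intro measurable_completion) measurable
  then show ?thesis unfolding interior_measure_def using assms
    by (subst emeasure_density) (auto simp: nn_integral_completion)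
qed

lemma vol_ball: "0 \<le> r \<Longrightarrow> emeasure lborel (ball (x::real^'n) r) = ennreal (\<omega> * r ^ CARD('n))"
  by (simp add: emeasure_ball \<omega>_def)

text \<open>By regularity a maximal \<open>t\<close>-separated subset of
  \<open>\<Gamma> \<inter> ball x (2 * r)\<close> has at most about \<open>(r / t) powr d\<close>
  points, and balls of radius \<open>2 * t\<close> around them cover the neighbourhood.\<close>

lemma \<Gamma>_neighbourhood_volume:
  "\<exists>C>0. \<forall>x\<in>\<Gamma>. \<forall>r t. 0 < t \<and> t \<le> r \<longrightarrow>
     emeasure lborel {y \<in> ball x r. \<delta> y < t} \<le> ennreal (C * t powr (real CARD('n) - d) * r powr d)"
proof -
  define C where "C = Cd * Cd * 6 powr d * \<omega> * 2 ^ CARD('n)"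
  have "emeasure lborel {y \<in> ball x r. \<delta> y < t} \<le> ennreal (C * t powr (real CARD('n) - d) * r powr d)"
    if x: "x \<in> \<Gamma>" and t: "0 < t" "t \<le> r" for x r t
  proof -
    define B where "B = Cd * Cd * (6 * r / t) powr d"
    have "real (card T) \<le> B" if T: "finite T" "T \<subseteq> \<Gamma> \<inter> ball x (2 * r)" "pairwise (\<lambda>x y. t \<le> dist x y) T" for T
    proof -
      have "real (card T) * ((t/2) powr d / Cd) \<le> \<sigma> (\<Gamma> \<inter> ball x (3 * r))"
      proof (rule card_measure_disjoint_le[where A = "\<lambda>z. \<Gamma> \<inter> ball z (t/2)"])
        show "disjoint_family_on (\<lambda>z. \<Gamma> \<inter> ball z (t / 2)) T"
          using separated_balls_disjoint[OF T(3)] unfolding disjoint_family_on_def by blast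
        fix z assume z: "z \<in> T"
        then have z': "z \<in> \<Gamma>" "dist x z < 2 * r" using T by auto
        show "(t/2) powr d / Cd \<le> \<sigma> (\<Gamma> \<inter> ball z (t/2))" using \<sigma>_ball(1)[OF z'(1)] t by simp
        have "ball z (t/2) \<subseteq> ball x (3 * r)"
        proof
          fix y assume "y \<in> ball z (t/2)"
          then show "y \<in> ball x (3 * r)" using z' t dist_triangle[of x y z] by simp
        qed
        then show "\<Gamma> \<inter> ball z (t/2) \<in> sets (hausdorff_measure d) \<and> \<Gamma> \<inter> ball z (t/2) \<subseteq> \<Gamma> \<inter> ball x (3 * r)"
          using \<Gamma>_borel by auto
      qed (use T \<Gamma>_ball_fm x in auto)
      also have "\<dots> \<le> Cd * (3 * r) powr d" using \<sigma>_ball(2)[OF x] t by simp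
      finally have "real (card T) * (t/2) powr d \<le> Cd * Cd * (3 * r) powr d" using Cd0 by (simp add: field_simps)
      also have "(3 * r) powr d = (6 * r / t) powr d * (t/2) powr d"
        using t by (subst powr_mult[symmetric]) (auto simp: field_simps)
      finally show ?thesis unfolding B_def using t by simp
    qed
    then obtain T where T: "finite T" "\<Gamma> \<inter> ball x (2 * r) \<subseteq> (\<Union>z\<in>T. ball z t)" "real (card T) \<le> B"
      using max_separated[of "\<Gamma> \<inter> ball x (2 * r)" t B] t(1) by metis
    have "{y \<in> ball x r. \<delta> y < t} \<subseteq> (\<Union>z\<in>T. ball z (2 * t))"
    proof
      fix y assume "y \<in> {y \<in> ball x r. \<delta> y < t}"
      then have y: "dist x y < r" "\<delta> y < t" by auto
      obtain g where g: "g \<in> \<Gamma>" "dist y g = \<delta> y" by (rule \<delta>_attained)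
      have "g \<in> \<Gamma> \<inter> ball x (2 * r)" using g y t dist_triangle[of x g y] by auto
      then obtain z where z: "z \<in> T" "dist z g < t" using T(2) by auto
      then have "dist z y < 2 * t" using dist_triangle[of z y g] g y by (simp add: dist_commute)
      then show "y \<in> (\<Union>z\<in>T. ball z (2 * t))" using z by auto
    qed
    then have "emeasure lborel {y \<in> ball x r. \<delta> y < t} \<le> emeasure lborel (\<Union>z\<in>T. ball z (2 * t))"
      by (intro emeasure_mono) (auto intro: borel_open)
    also have "\<dots> \<le> (\<Sum>z\<in>T. emeasure lborel (ball z (2 * t)))"
      using T by (intro emeasure_subadditive_finite) auto
    also have "\<dots> = ennreal (real (card T) * (\<omega> * (2 * t) ^ CARD('n)))"
      using t \<omega>_pos by (simp add: vol_ball ennreal_of_nat_eq_real_of_nat ennreal_mult)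
    also have "\<dots> \<le> ennreal (B * (\<omega> * (2 * t) ^ CARD('n)))"
      using T t \<omega>_pos by (intro ennreal_leI mult_right_mono) auto
    also have "B * (\<omega> * (2 * t) ^ CARD('n)) = C * t powr (real CARD('n) - d) * r powr d"
      using t by (simp add: B_def C_def powr_diff powr_mult powr_divide powr_realpow power_mult_distrib field_simps)
    finally show ?thesis .
  qed
  moreover have "0 < C" using Cd0 \<omega>_pos by (simp add: C_def)
  ultimately show ?thesis by blast
qed

text \<open>Decompose by the dyadic size of \<delta>. Where \<open>\<delta> y\<close> is about
  \<open>r / 2^k\<close>, the weight is about \<open>(r / 2^k) powr (- \<alpha>)\<close> and the
  volume at most a multiple of \<open>(r / 2^k) powr (n - d) * r powr d\<close>. Since
  \<open>n - d - \<alpha> = 1\<close>, the product decays like \<open>1 / 2^k\<close>.\<close>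

lemma weight_ball_\<Gamma>:
  "\<exists>C>0. \<forall>x\<in>\<Gamma>. \<forall>r>0. emeasure m (ball x r) \<le> ennreal (C * r powr (d + 1))"
proof -
  obtain C where C: "0 < C" and vol: "\<And>x r t. x \<in> \<Gamma> \<Longrightarrow> 0 < t \<Longrightarrow> t \<le> r \<Longrightarrow>
     emeasure lborel {y \<in> ball x r. \<delta> y < t} \<le> ennreal (C * t powr (real CARD('n) - d) * r powr d)"
    using \<Gamma>_neighbourhood_volume by blast
  have "emeasure m (ball x r) \<le> ennreal (C * 2 powr \<alpha> * 2 * r powr (d + 1))" if x: "x \<in> \<Gamma>" and r: "0 < r" for x r
  proof -
    define S where "S k = {y \<in> ball x r. \<delta> y < r / 2^k}" for k :: nat
    define b where "b k = (r / 2^Suc k) powr (- \<alpha>)" for k :: nat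
    have Sb: "S k \<in> sets borel" for k unfolding S_def by measurable
    have pw: "ennreal (w y) * indicator (ball x r) y \<le> (\<Sum>k. ennreal (b k) * indicator (S k) y)" for y
    proof (cases "y \<in> ball x r \<and> \<delta> y \<noteq> 0")
      case False
      then show ?thesis using \<alpha>_pos by (auto simp: w_eq)
    next
      case True
      then have \<delta>0: "0 < \<delta> y" using infdist_nonneg[of y \<Gamma>] by linarith
      have "\<delta> y \<le> dist y x" using x by (intro infdist_le)
      then have "\<not> r / 2^0 \<le> \<delta> y" using True by (auto simp: dist_commute)
      moreover obtain j where "r / \<delta> y < 2^j" using real_arch_pow[of 2] by auto
      then have "r / 2^j \<le> \<delta> y" using \<delta>0 by (simp add: field_simps)
      ultimately obtain k where k: "\<not> r / 2^k \<le> \<delta> y" "r / 2^(k + 1) \<le> \<delta> y"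
        using ex_least_nat_less[of "\<lambda>j. r / 2^j \<le> \<delta> y" j] by auto
      have "w y \<le> b k" unfolding w_eq b_def using k r \<alpha>_pos by (intro powr_mono2') auto
      moreover have "y \<in> S k" using k True by (auto simp: S_def)
      ultimately have "ennreal (w y) * indicator (ball x r) y \<le> ennreal (b k) * indicator (S k) y"
        using True by (auto intro: ennreal_leI)
      also have "\<dots> \<le> (\<Sum>k. ennreal (b k) * indicator (S k) y)"
        using sum_le_suminf[of "\<lambda>k. ennreal (b k) * indicator (S k) y" "{k}"]
        by (simp del: sum_mult_indicator)
      finally show ?thesis .
    qed
    have "emeasure m (ball x r) \<le> (\<integral>\<^sup>+y. (\<Sum>k. ennreal (b k) * indicator (S k) y) \<partial>lborel)"
      by (subst m_eq) (auto intro!: nn_integral_mono pw)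
    also have "\<dots> = (\<Sum>k. ennreal (b k) * emeasure lborel (S k))"
      using Sb by (subst nn_integral_suminf) (auto simp: nn_integral_cmult_indicator)
    also have "\<dots> \<le> (\<Sum>k. ennreal (C * 2 powr \<alpha> * 2 * r powr (d + 1) * (1/2)^Suc k))"
    proof (intro suminf_le)
      fix k
      have "r / 2^k \<le> r" using r by (simp add: divide_le_eq)
      then have "emeasure lborel (S k) \<le> ennreal (C * (r / 2^k) powr (real CARD('n) - d) * r powr d)"
        unfolding S_def using r by (intro vol[OF x]) auto
      then have "ennreal (b k) * emeasure lborel (S k) \<le>
          ennreal (b k) * ennreal (C * (r / 2^k) powr (real CARD('n) - d) * r powr d)"
        by (intro mult_left_mono) auto
      also have "\<dots> = ennreal (b k * (C * (r / 2^k) powr (real CARD('n) - d) * r powr d))"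
        using C by (simp add: ennreal_mult b_def)
      also have "b k * (C * (r / 2^k) powr (real CARD('n) - d) * r powr d)
          = C * 2 powr \<alpha> * 2 * r powr (d + 1) * (1/2)^Suc k"
      proof -
        define s where "s = r / 2^k"
        have s: "0 < s" "r / 2^Suc k = s / 2" using r by (auto simp: s_def)
        have "b k = s powr (- \<alpha>) * 2 powr \<alpha>" unfolding b_def s(2) using s(1)
          by (simp add: powr_divide powr_minus field_simps)
        then have "b k * (C * s powr (real CARD('n) - d) * r powr d)
            = C * 2 powr \<alpha> * (s powr (- \<alpha>) * s powr (real CARD('n) - d)) * r powr d" by simp
        also have "s powr (- \<alpha>) * s powr (real CARD('n) - d) = s"
          using s by (simp add: powr_add[symmetric] \<alpha>_def)
        also have "C * 2 powr \<alpha> * s * r powr d = C * 2 powr \<alpha> * 2 * r powr (d + 1) * (1/2)^Suc k"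
          using r by (simp add: s_def powr_add power_divide)
        finally show ?thesis unfolding s_def .
      qed
      finally show "ennreal (b k) * emeasure lborel (S k) \<le> ennreal (C * 2 powr \<alpha> * 2 * r powr (d + 1) * (1/2)^Suc k)" .
    qed auto
    also have "\<dots> = ennreal (C * 2 powr \<alpha> * 2 * r powr (d + 1))"
    proof -
      have "(\<lambda>k. C * 2 powr \<alpha> * 2 * r powr (d + 1) * (1/2)^Suc k) sums (C * 2 powr \<alpha> * 2 * r powr (d + 1) * 1)"
        by (intro sums_mult power_half_series)
      then show ?thesis using C r by (intro suminf_ennreal_eq) auto
    qed
    finally show ?thesis .
  qed
  moreover have "0 < C * 2 powr \<alpha> * 2" using C by simp
  ultimately show ?thesis by blast
qed

definition \<phi> :: "real^'n \<Rightarrow> real \<Rightarrow> real" where "\<phi> X r = r ^ CARD('n) * (r + \<delta> X) powr (- \<alpha>)"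

lemma \<phi>_pos: "0 < r \<Longrightarrow> 0 < \<phi> X r"
  using infdist_nonneg[of X \<Gamma>] by (auto simp: \<phi>_def intro!: mult_pos_pos)

lemma \<phi>_double: "0 < r \<Longrightarrow> \<phi> X (2 * r) \<le> 2 ^ CARD('n) * \<phi> X r"
proof -
  assume r: "0 < r"
  have "(2 * r + \<delta> X) powr (- \<alpha>) \<le> (r + \<delta> X) powr (- \<alpha>)"
    using r \<alpha>_pos infdist_nonneg[of X \<Gamma>] by (intro powr_mono2') auto
  then have "(2 * r) ^ CARD('n) * (2 * r + \<delta> X) powr (- \<alpha>) \<le> (2 * r) ^ CARD('n) * (r + \<delta> X) powr (- \<alpha>)"
    using r by (intro mult_left_mono) auto
  then show ?thesis by (simp add: \<phi>_def power_mult_distrib mult.assoc)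
qed

text \<open>If \<open>r\<close> is at least half the distance to \<Gamma>, the ball sits in one of
  comparable radius centred on \<Gamma>; otherwise the weight on it is at most
  \<open>(\<delta> X / 2) powr (- \<alpha>)\<close>.\<close>

lemma m_upper: "\<exists>C>0. \<forall>X. \<forall>r>0. emeasure m (ball X r) \<le> ennreal (C * \<phi> X r)"
proof -
  obtain C where C: "0 < C" and ub: "\<And>x r. x \<in> \<Gamma> \<Longrightarrow> 0 < r \<Longrightarrow> emeasure m (ball x r) \<le> ennreal (C * r powr (d + 1))"
    using weight_ball_\<Gamma> by metis
  define C' where "C' = C * 3 powr (d + 1) * 3 powr \<alpha> + 3 powr \<alpha> * \<omega>"
  have C': "0 < C'" using C \<omega>_pos by (simp add: C'_def add_pos_pos)
  have "emeasure m (ball X r) \<le> ennreal (C' * \<phi> X r)" if r: "0 < r" for X r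
  proof (cases "\<delta> X \<le> 2 * r")
    case True
    obtain g where g: "g \<in> \<Gamma>" "dist X g = \<delta> X" by (rule \<delta>_attained)
    have "ball X r \<subseteq> ball g (3 * r)"
    proof
      fix y assume "y \<in> ball X r"
      then show "y \<in> ball g (3 * r)" using g True dist_triangle[of g y X] by (simp add: dist_commute)
    qed
    then have "emeasure m (ball X r) \<le> emeasure m (ball g (3 * r))"
      by (intro emeasure_mono) (auto simp: interior_measure_def)
    also have "\<dots> \<le> ennreal (C * (3 * r) powr (d + 1))" using ub[OF g(1)] r by simp
    also have "\<dots> \<le> ennreal (C' * \<phi> X r)"
    proof (rule ennreal_leI)
      have "(3 * r) powr (- \<alpha>) \<le> (r + \<delta> X) powr (- \<alpha>)"
        using r True \<alpha>_pos infdist_nonneg[of X \<Gamma>] by (intro powr_mono2') auto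
      then have "r ^ CARD('n) * (3 * r) powr (- \<alpha>) \<le> \<phi> X r"
        unfolding \<phi>_def using r by (intro mult_left_mono) auto
      moreover have "r ^ CARD('n) * (3 * r) powr (- \<alpha>) = 3 powr (- \<alpha>) * r powr (d + 1)"
      proof -
        have "r ^ CARD('n) * (3 * r) powr (- \<alpha>) = 3 powr (- \<alpha>) * (r powr (real CARD('n)) * r powr (- \<alpha>))"
          using r by (simp add: powr_mult powr_realpow)
        also have "r powr (real CARD('n)) * r powr (- \<alpha>) = r powr (d + 1)"
          using r by (simp add: powr_add[symmetric] \<alpha>_def algebra_simps)
        finally show ?thesis .
      qed
      ultimately have a: "3 powr (- \<alpha>) * r powr (d + 1) \<le> \<phi> X r" by simp
      have "C * (3 * r) powr (d + 1) = C * 3 powr (d + 1) * 3 powr \<alpha> * (3 powr (- \<alpha>) * r powr (d + 1))"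
        using r by (simp add: powr_mult powr_minus)
      also have "\<dots> \<le> C * 3 powr (d + 1) * 3 powr \<alpha> * \<phi> X r"
        using a C by (intro mult_left_mono) auto
      also have "\<dots> \<le> C' * \<phi> X r"
        using \<phi>_pos[OF r, of X] \<omega>_pos by (intro mult_right_mono) (auto simp: C'_def)
      finally show "C * (3 * r) powr (d + 1) \<le> C' * \<phi> X r" .
    qed
    finally show ?thesis .
  next
    case False
    have bd: "w y \<le> (\<delta> X / 2) powr (- \<alpha>)" if "y \<in> ball X r" for y
    proof -
      have "\<delta> X \<le> \<delta> y + dist X y" by (rule \<delta>_lipschitz)
      then have "\<delta> X / 2 \<le> \<delta> y" using that False by simp
      then show ?thesis unfolding w_eq using False r \<alpha>_pos by (intro powr_mono2') auto
    qed
    have "emeasure m (ball X r) \<le> (\<integral>\<^sup>+y. ennreal ((\<delta> X / 2) powr (- \<alpha>)) * indicator (ball X r) y \<partial>lborel)"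
      by (subst m_eq) (auto intro!: nn_integral_mono ennreal_leI bd split: split_indicator)
    also have "\<dots> = ennreal ((\<delta> X / 2) powr (- \<alpha>)) * ennreal (\<omega> * r ^ CARD('n))"
      using r by (simp add: nn_integral_cmult_indicator vol_ball)
    also have "\<dots> = ennreal ((\<delta> X / 2) powr (- \<alpha>) * (\<omega> * r ^ CARD('n)))"
      using \<omega>_pos r by (simp add: ennreal_mult)
    also have "\<dots> \<le> ennreal (C' * \<phi> X r)"
    proof (rule ennreal_leI)
      have "(3 * (\<delta> X / 2)) powr (- \<alpha>) \<le> (r + \<delta> X) powr (- \<alpha>)"
        using r False \<alpha>_pos by (intro powr_mono2') auto
      then have "3 powr \<alpha> * (3 * (\<delta> X / 2)) powr (- \<alpha>) \<le> 3 powr \<alpha> * (r + \<delta> X) powr (- \<alpha>)"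
        by (intro mult_left_mono) auto
      moreover have "3 powr \<alpha> * (3 * (\<delta> X / 2)) powr (- \<alpha>) = (\<delta> X / 2) powr (- \<alpha>)"
        using False r by (simp add: powr_mult powr_minus powr_divide)
      ultimately have "(\<delta> X / 2) powr (- \<alpha>) \<le> 3 powr \<alpha> * (r + \<delta> X) powr (- \<alpha>)" by linarith
      then have "(\<delta> X / 2) powr (- \<alpha>) * (\<omega> * r ^ CARD('n)) \<le> 3 powr \<alpha> * (r + \<delta> X) powr (- \<alpha>) * (\<omega> * r ^ CARD('n))"
        using \<omega>_pos r by (intro mult_right_mono) auto
      also have "\<dots> = 3 powr \<alpha> * \<omega> * \<phi> X r" by (simp add: \<phi>_def)
      also have "\<dots> \<le> C' * \<phi> X r"
        using \<phi>_pos[OF r, of X] C by (intro mult_right_mono) (auto simp: C'_def)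
      finally show "(\<delta> X / 2) powr (- \<alpha>) * (\<omega> * r ^ CARD('n)) \<le> C' * \<phi> X r" .
    qed
    finally show ?thesis .
  qed
  with C' show ?thesis by blast
qed

text \<open>An interior corkscrew ball has volume comparable to \<open>r ^ n\<close>, and the weight
  on it is at least \<open>(r + \<delta> X) powr (- \<alpha>)\<close> because \<open>w\<close>
  decreases in \<delta> off \<Gamma>.\<close>

lemma m_lower: "\<exists>b>0. \<forall>X\<in>closure \<Omega>. \<forall>r>0. ennreal (b * \<phi> X r) \<le> emeasure m (ball X r \<inter> \<Omega>)"
proof -
  obtain c1 where c1: "0 < c1" and ck: "\<And>x r. x \<in> closure \<Omega> \<Longrightarrow> 0 < r \<Longrightarrow> \<exists>X\<in>ball x r. ball X (c1 * r) \<subseteq> \<Omega>"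
    using interior_corkscrew by metis
  define e where "e = min c1 1 / 2"
  have e: "0 < e" "e \<le> 1/2" "e \<le> c1 / 2" using c1 by (auto simp: e_def)
  have "ennreal (\<omega> * e ^ CARD('n) * \<phi> X r) \<le> emeasure m (ball X r \<inter> \<Omega>)" if X: "X \<in> closure \<Omega>" and r: "0 < r" for X r
  proof -
    obtain Y where Y: "dist X Y < r/2" "ball Y (c1 * (r/2)) \<subseteq> \<Omega>" using ck[OF X, of "r/2"] r by auto
    have er: "e * r \<le> c1 * (r/2)" "e * r \<le> r/2"
      using mult_right_mono[OF e(3), of r] mult_right_mono[OF e(2), of r] r by auto
    have sub: "ball Y (e * r) \<subseteq> ball X r \<inter> \<Omega>"
    proof
      fix y assume y: "y \<in> ball Y (e * r)"
      then have "dist X y < r" using Y er dist_triangle[of X y Y] by simp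
      moreover have "y \<in> \<Omega>" using y er Y(2) by auto
      ultimately show "y \<in> ball X r \<inter> \<Omega>" by simp
    qed
    have bd: "(r + \<delta> X) powr (- \<alpha>) \<le> w y" if "y \<in> ball Y (e * r)" for y
    proof -
      have y: "dist X y < r" "y \<in> \<Omega>" using sub that by auto
      then have "0 < \<delta> y" using \<Omega>_\<Gamma> \<delta>_pos by blast
      moreover have "\<delta> y \<le> r + \<delta> X" using \<delta>_lipschitz[of y X] y by (simp add: dist_commute)
      ultimately show ?thesis unfolding w_eq using \<alpha>_pos by (intro powr_mono2') auto
    qed
    have "ennreal (\<omega> * e ^ CARD('n) * \<phi> X r) = ennreal ((r + \<delta> X) powr (- \<alpha>)) * ennreal (\<omega> * (e * r) ^ CARD('n))"
      using e r \<omega>_pos by (simp add: \<phi>_def ennreal_mult[symmetric] power_mult_distrib algebra_simps)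
    also have "\<dots> = (\<integral>\<^sup>+y. ennreal ((r + \<delta> X) powr (- \<alpha>)) * indicator (ball Y (e * r)) y \<partial>lborel)"
      using e r by (simp add: nn_integral_cmult_indicator vol_ball)
    also have "\<dots> \<le> (\<integral>\<^sup>+y. ennreal (w y) * indicator (ball X r \<inter> \<Omega>) y \<partial>lborel)"
      using sub bd by (intro nn_integral_mono) (auto split: split_indicator intro!: ennreal_leI)
    also have "\<dots> = emeasure m (ball X r \<inter> \<Omega>)" using open_\<Omega> by (intro m_eq[symmetric]) auto
    finally show ?thesis .
  qed
  moreover have "0 < \<omega> * e ^ CARD('n)" using e \<omega>_pos by simp
  ultimately show ?thesis by blast
qed

lemma m_estimates:
  obtains b C where "0 < b" "0 < C"
    "\<And>X r. X \<in> closure \<Omega> \<Longrightarrow> 0 < r \<Longrightarrow> ennreal (b * \<phi> X r) \<le> emeasure m (ball X r \<inter> \<Omega>)"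
    "\<And>X r. 0 < r \<Longrightarrow> emeasure m (ball X r \<inter> \<Omega>) \<le> ennreal (C * \<phi> X r)"
proof -
  obtain C where C: "0 < C" "\<And>X r. 0 < r \<Longrightarrow> emeasure m (ball X r) \<le> ennreal (C * \<phi> X r)" using m_upper by metis
  obtain c where c: "0 < c" "\<And>X r. X \<in> closure \<Omega> \<Longrightarrow> 0 < r \<Longrightarrow> ennreal (c * \<phi> X r) \<le> emeasure m (ball X r \<inter> \<Omega>)"
    using m_lower by metis
  have "emeasure m (ball X r \<inter> \<Omega>) \<le> emeasure m (ball X r)" for X r
    by (intro emeasure_mono) (auto simp: interior_measure_def)
  then have "0 < r \<Longrightarrow> emeasure m (ball X r \<inter> \<Omega>) \<le> ennreal (C * \<phi> X r)" for X r
    using C(2) order_trans by blast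
  then show ?thesis using that c C(1) by blast
qed

lemma doubling_condition_H4: "cond_H4 \<Omega> m w"
proof -
  have wm: "(\<lambda>X. ennreal (w X)) \<in> borel_measurable lebesgue"
    by (intro measurable_completion) measurable
  have \<Omega>s: "\<Omega> \<in> sets lebesgue" "\<Omega> \<in> sets borel" using open_\<Omega> by auto
  then have \<Omega>m: "\<Omega> \<in> sets m" by (simp add: interior_measure_def)
  have wpos: "0 < w X" if "X \<in> \<Omega>" for X
  proof -
    have "0 < \<delta> X" using \<Omega>_\<Gamma> \<delta>_pos that by blast
    then show ?thesis by (simp add: w_eq)
  qed
  have null: "A \<in> null_sets m \<longleftrightarrow> A \<in> null_sets lebesgue" if A: "A \<subseteq> \<Omega>" for A
  proof -
    have "A \<in> null_sets m \<longleftrightarrow> A \<in> sets lebesgue \<and> (AE x in lebesgue. x \<in> A \<longrightarrow> ennreal (w x) = 0)"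
      unfolding interior_measure_def by (rule null_sets_density_iff[OF wm])
    also have "\<dots> \<longleftrightarrow> A \<in> sets lebesgue \<and> (AE x in lebesgue. x \<notin> A)"
      using wpos A by (intro conj_cong AE_cong refl) (fastforce simp: ennreal_eq_0_iff)
    also have "\<dots> \<longleftrightarrow> A \<in> null_sets lebesgue" using AE_iff_null_sets[of A lebesgue] null_setsD2 by blast
    finally show ?thesis .
  qed
  have 1: "absolutely_continuous (restrict_space lebesgue \<Omega>) (restrict_space m \<Omega>)"
    "absolutely_continuous (restrict_space m \<Omega>) (restrict_space lebesgue \<Omega>)"
    unfolding absolutely_continuous_def using null \<Omega>s \<Omega>m by (auto simp: null_sets_restrict_space)
  have 2: "emeasure m E = (\<integral>\<^sup>+X\<in>E. ennreal (w X) \<partial>lebesgue)" if "E \<in> sets borel" for E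
    unfolding interior_measure_def using that by (subst emeasure_density[OF wm]) auto
  have 3: "set_integrable lebesgue S w" if S: "compact S" "S \<subseteq> \<Omega>" for S
  proof -
    have "\<delta> X \<noteq> 0" if "X \<in> S" for X using S that \<Omega>_\<Gamma> \<delta>_pos[of X] by force
    then have "continuous_on S w" unfolding w_eq[abs_def] by (intro continuous_intros) auto
    then have "integrable lborel (\<lambda>x. indicator S x *\<^sub>R w x)" using S by (intro borel_integrable_compact)
    then show ?thesis unfolding set_integrable_def by (subst integrable_completion) auto
  qed
  have 4: "AE X in lebesgue. X \<in> \<Omega> \<longrightarrow> 0 < w X" using wpos by simp
  obtain c C where cC: "0 < c" "0 < C"
    "\<And>X r. X \<in> closure \<Omega> \<Longrightarrow> 0 < r \<Longrightarrow> ennreal (c * \<phi> X r) \<le> emeasure m (ball X r \<inter> \<Omega>)"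
    "\<And>X r. 0 < r \<Longrightarrow> emeasure m (ball X r \<inter> \<Omega>) \<le> ennreal (C * \<phi> X r)"
    by (rule m_estimates) blast
  have 5: "emeasure m (ball X r \<inter> \<Omega>) < \<infinity> \<and>
      emeasure m (ball X (2 * r) \<inter> \<Omega>) \<le> ennreal (C * 2 ^ CARD('n) / c) * emeasure m (ball X r \<inter> \<Omega>)"
    if X: "X \<in> closure \<Omega>" and r: "0 < r" for X r
  proof
    show "emeasure m (ball X r \<inter> \<Omega>) < \<infinity>" using cC(4)[OF r, of X] by (simp add: order_le_less_trans)
    have "emeasure m (ball X (2 * r) \<inter> \<Omega>) \<le> ennreal (C * \<phi> X (2 * r))" using cC(4) r by simp
    also have "\<dots> \<le> ennreal (C * (2 ^ CARD('n) * \<phi> X r))"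
      using \<phi>_double[OF r] cC(2) by (intro ennreal_leI mult_left_mono) auto
    also have "\<dots> = ennreal (C * 2 ^ CARD('n) / c) * ennreal (c * \<phi> X r)"
      using cC(1,2) \<phi>_pos[OF r, of X] by (simp add: ennreal_mult[symmetric])
    also have "\<dots> \<le> ennreal (C * 2 ^ CARD('n) / c) * emeasure m (ball X r \<inter> \<Omega>)"
      using cC(3)[OF X r] by (intro mult_left_mono) auto
    finally show "emeasure m (ball X (2 * r) \<inter> \<Omega>) \<le> ennreal (C * 2 ^ CARD('n) / c) * emeasure m (ball X r \<inter> \<Omega>)" .
  qed
  then have "\<exists>C4. \<forall>X\<in>closure \<Omega>. \<forall>r>0. emeasure m (ball X r \<inter> \<Omega>) < \<infinity> \<and>
      emeasure m (ball X (2 * r) \<inter> \<Omega>) \<le> ennreal C4 * emeasure m (ball X r \<inter> \<Omega>)" by blast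
  then show ?thesis unfolding cond_H4_def using 1 2 3 4 by blast
qed

end

subsection \<open>The boundary measure at small scales\<close>

context sawtooth begin

abbreviation Hn :: "(real^'n) measure" where "Hn \<equiv> hausdorff_measure (real CARD('n) - 1)"

text \<open>The second summand of \<open>sigma_star\<close> as a Borel measure on the whole space.
  Integrating over \<open>E\<close> or over \<open>E - \<Gamma>\<close> is the same, as the weight
  is 0 on \<Gamma>.\<close>

definition surf :: "(real^'n) measure" where "surf = density Hn (\<lambda>X. ennreal (w X))"

lemma sets_surf [simp, measurable_cong]: "sets surf = sets borel"
  by (simp add: surf_def)

lemma emeasure_surf:
  "E \<in> sets borel \<Longrightarrow> emeasure surf E = (\<integral>\<^sup>+X. ennreal (w X) * indicator E X \<partial>Hn)"
  unfolding surf_def by (subst emeasure_density) auto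

lemma surf_le:
  assumes "E \<in> sets borel" "\<And>X. X \<in> E \<Longrightarrow> w X \<le> b" "0 \<le> b"
  shows "emeasure surf E \<le> ennreal b * emeasure Hn E"
proof -
  have "emeasure surf E \<le> (\<integral>\<^sup>+X. ennreal b * indicator E X \<partial>Hn)"
    unfolding emeasure_surf[OF assms(1)] using assms(2)
    by (intro nn_integral_mono) (auto split: split_indicator intro: ennreal_leI)
  then show ?thesis using assms by (simp add: nn_integral_cmult_indicator)
qed

lemma surf_ge:
  assumes "E \<in> sets borel" "\<And>X. X \<in> E \<Longrightarrow> b \<le> w X"
  shows "ennreal b * emeasure Hn E \<le> emeasure surf E"
proof -
  have "(\<integral>\<^sup>+X. ennreal b * indicator E X \<partial>Hn) \<le> emeasure surf E"
    unfolding emeasure_surf[OF assms(1)] using assms(2)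
    by (intro nn_integral_mono) (auto split: split_indicator intro: ennreal_leI)
  then show ?thesis using assms by (simp add: nn_integral_cmult_indicator)
qed

lemma frontier_borel [measurable, simp]: "frontier \<Omega> \<in> sets borel"
  by (simp add: frontier_closed)

lemma sigma_star_eq:
  assumes "E \<in> sets borel" "E \<subseteq> frontier \<Omega>"
  shows "emeasure (sigma_star d \<Gamma> \<Omega>) E = emeasure (hausdorff_measure d) (E \<inter> \<Gamma>) + emeasure surf E"
proof -
  have "ennreal (w X) * indicator (E - \<Gamma>) X = ennreal (w X) * indicator E X" for X
    using \<alpha>_pos by (auto simp: w_eq split: split_indicator)
  then show ?thesis unfolding emeasure_sigma_star[OF closed_\<Gamma> assms] emeasure_surf[OF assms(1)] by simp
qed

lemma star_boundary:
  assumes "y \<in> star I" "y \<notin> interior (star I)"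
  shows "\<exists>i. \<exists>s\<in>{1,-1}. y $ i = face I s i"
proof (rule ccontr)
  assume n: "\<not> ?thesis"
  have "face I (-1) i < y$i \<and> y$i < face I 1 i" for i
  proof -
    have "face I (-1) i \<le> y$i \<and> y$i \<le> face I 1 i" using assms(1) by (simp add: star_cbox mem_box_cart)
    moreover have "y$i \<noteq> face I (-1) i" "y$i \<noteq> face I 1 i" using n by auto
    ultimately show ?thesis by linarith
  qed
  then have "y \<in> box (\<chi> i. face I (-1) i) (\<chi> i. face I 1 i)" by (simp add: mem_box_cart)
  then show False using assms(2) by (simp add: star_cbox interior_cbox)
qed

lemma interior_star_sub: "I \<in> WF \<Longrightarrow> interior (star I) \<subseteq> \<Omega>"
  by (rule open_sub_\<Omega>[OF _ open_interior interior_subset])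

lemma near_ball_\<delta>:
  assumes "dist z y < \<delta> z / 10" shows "9/10 * \<delta> z \<le> \<delta> y" "\<delta> y \<le> 11/10 * \<delta> z"
  using \<delta>_lipschitz[of z y] \<delta>_lipschitz[of y z] assms by (simp_all add: dist_commute)

text \<open>A boundary point near \<open>z\<close> lies on the boundary of the dilated box
  containing it, hence on one of at most \<open>2 * n * near_count\<close> face hyperplanes.\<close>

lemma local_upper:
  "\<exists>C>0. \<forall>z t. z \<notin> \<Gamma> \<and> 0 < t \<and> t \<le> \<delta> z / 10 \<longrightarrow>
     emeasure Hn (frontier \<Omega> \<inter> ball z t) \<le> ennreal (C * t ^ (CARD('n) - 1))"
proof -
  have n2: "2 \<le> CARD('n)" using n3 by simp
  obtain C where C: "0 < C" and hp: "\<And>(i::'n) f (x::real^'n) t. 0 < t \<Longrightarrow>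
     emeasure Hn ({y. y$i = f} \<inter> ball x t) \<le> ennreal (C * t ^ (CARD('n) - 1))"
    using hausdorff_hyperplane_ball[OF n2] by blast
  define C' where "C' = near_count * (real CARD('n) * 2) * C + 1"
  have nc: "0 \<le> near_count" using rn1 by (simp add: near_count_def unit_ball_vol_pos less_imp_le)
  have "emeasure Hn (frontier \<Omega> \<inter> ball z t) \<le> ennreal (C' * t ^ (CARD('n) - 1))"
    if z: "z \<notin> \<Gamma>" and t: "0 < t" "t \<le> \<delta> z / 10" for z t
  proof -
    define T where "T = near_boxes z \<times> (UNIV :: 'n set) \<times> {1, -1 :: real}"
    define P where "P = (\<lambda>(I, i, s). {y::real^'n. y$i = face I s i} \<inter> ball z t)"
    have fin: "finite T" unfolding T_def using near_boxes_finite(1)[OF z] by auto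
    have "card T = card (near_boxes z) * (CARD('n) * 2)"
      unfolding T_def by (simp add: card_cartesian_product)
    then have cT: "real (card T) \<le> near_count * (real CARD('n) * 2)"
      using near_boxes_finite(2)[OF z] by (simp add: mult_right_mono)
    have Pb: "P p \<in> sets borel" for p
    proof -
      have "closed {y::real^'n. y$i = f}" for i f by (intro closed_Collect_eq continuous_intros)
      then show ?thesis by (auto simp: P_def split: prod.split)
    qed
    have "frontier \<Omega> \<inter> ball z t \<subseteq> (\<Union>p\<in>T. P p)"
    proof
      fix y assume y: "y \<in> frontier \<Omega> \<inter> ball z t"
      have dz: "dist z y < \<delta> z / 10" using y t by auto
      then have "0 < \<delta> y" using near_ball_\<delta>(1) \<delta>_pos[OF z] by fastforce
      then have "y \<notin> \<Gamma>" by auto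
      then obtain I where I: "I \<in> WF" "y \<in> star I" using closure_\<Omega>_star frontier_closure y by blast
      have "y \<notin> interior (star I)" using interior_star_sub[OF I(1)] frontier_\<Omega>_disjoint y by blast
      then obtain i s where fc: "s \<in> {1,-1}" "y $ i = face I s i" using star_boundary[OF I(2)] by blast
      have "I \<in> near_boxes z" using I WF_W dz by auto
      then have "(I, i, s) \<in> T" using fc by (simp add: T_def)
      moreover have "y \<in> P (I, i, s)" using fc y by (simp add: P_def)
      ultimately show "y \<in> (\<Union>p\<in>T. P p)" by blast
    qed
    then have "emeasure Hn (frontier \<Omega> \<inter> ball z t) \<le> emeasure Hn (\<Union>p\<in>T. P p)"
      using Pb fin by (intro emeasure_mono) auto
    also have "\<dots> \<le> (\<Sum>p\<in>T. emeasure Hn (P p))"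
      using Pb fin by (intro emeasure_subadditive_finite) auto
    also have "\<dots> \<le> (\<Sum>p\<in>T. ennreal (C * t ^ (CARD('n) - 1)))"
      using hp[OF t(1)] by (intro sum_mono) (auto simp: P_def split: prod.split)
    also have "\<dots> = ennreal (real (card T) * (C * t ^ (CARD('n) - 1)))"
      using C t by (simp add: ennreal_of_nat_eq_real_of_nat ennreal_mult)
    also have "\<dots> \<le> ennreal (C' * t ^ (CARD('n) - 1))"
    proof (rule ennreal_leI)
      have "real (card T) * (C * t ^ (CARD('n) - 1)) \<le> near_count * (real CARD('n) * 2) * (C * t ^ (CARD('n) - 1))"
        using cT C t by (intro mult_right_mono) auto
      also have "\<dots> \<le> C' * t ^ (CARD('n) - 1)" using t by (simp add: C'_def algebra_simps)
      finally show "real (card T) * (C * t ^ (CARD('n) - 1)) \<le> C' * t ^ (CARD('n) - 1)" .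
    qed
    finally show ?thesis .
  qed
  moreover have "0 < C'" using nc C by (simp add: C'_def add_nonneg_pos)
  ultimately show ?thesis by blast
qed

text \<open>Within the cube of radius \<open>h\<close> about a boundary point at most one face coordinate occurs in each
  direction, so the coordinate hyperplanes cut the cube into cells that lie inside or outside the
  domain. Flipping the coordinates of an inner cell to those of an outer one, one at a time, yields
  two adjacent cells of opposite kind; the facet between them belongs to the boundary.\<close>

lemma boundary_facet:
  assumes x: "x \<in> frontier \<Omega>" "x \<notin> \<Gamma>" and h: "0 < h" "2 * h \<le> \<kappa> * \<delta> x"
  shows "\<exists>(i::'n) p q. (\<forall>j. j \<noteq> i \<longrightarrow> h \<le> q$j - p$j) \<and>
     {y :: real^'n. y$i = x$i \<and> (\<forall>j. j \<noteq> i \<longrightarrow> p$j < y$j \<and> y$j < q$j)} \<subseteq> frontier \<Omega> \<inter> {y. \<forall>j. \<bar>y$j - x$j\<bar> < h}"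
proof -
  have \<delta>x: "0 < \<delta> x" using \<delta>_pos x by blast
  define Cu where "Cu = {y::real^'n. \<forall>j. \<bar>y$j - x$j\<bar> < h}"
  have Cu_near: "I \<in> near_boxes x" if "y \<in> Cu" "y \<in> star I" "I \<in> W" for y I
  proof -
    have "dist x y \<le> rn * h"
      unfolding dist_norm using that(1) by (intro norm_le_rn) (simp add: Cu_def abs_minus_commute less_imp_le)
    also have "\<dots> \<le> rn * (\<kappa> * \<delta> x)" using h rn1 by (intro mult_left_mono) auto
    also have "\<dots> = \<theta> / 100 * \<delta> x" using rn1 by (simp add: \<kappa>_def)
    also have "\<dots> < 1/10 * \<delta> x" using \<theta>_small \<delta>x by (intro mult_strict_right_mono) auto
    finally show ?thesis using that by auto
  qed
  define F where "F i = {face I s i | I s. I \<in> near_boxes x \<and> s \<in> {1, -1}}" for i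
  \<comment> \<open>If no face coordinate comes within \<open>h\<close>, the hyperplane is moved to
    the lower side of the cube, so the cells below it are empty.\<close>
  define f where "f i = (if \<exists>v\<in>F i. \<bar>v - x$i\<bar> < h then SOME v. v \<in> F i \<and> \<bar>v - x$i\<bar> < h else x$i - h)" for i
  have f1: "f i \<in> F i \<and> \<bar>f i - x$i\<bar> < h" if "\<exists>v\<in>F i. \<bar>v - x$i\<bar> < h" for i
  proof -
    have "\<exists>v. v \<in> F i \<and> \<bar>v - x$i\<bar> < h" using that by blast
    from someI_ex[OF this] show ?thesis using that by (simp add: f_def)
  qed
  have fr: "x$i - h \<le> f i \<and> f i < x$i + h" for i
    using f1[of i] h by (cases "\<exists>v\<in>F i. \<bar>v - x$i\<bar> < h") (force simp: f_def)+
  have uniq: "v = f i" if v: "v \<in> F i" "\<bar>v - x$i\<bar> < h" for v i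
  proof -
    have fi: "f i \<in> F i" "\<bar>f i - x$i\<bar> < h" using f1[of i] v by blast+
    obtain I s where I: "v = face I s i" "I \<in> near_boxes x" "s \<in> {1, -1}" using v(1) unfolding F_def by blast
    obtain J s' where J: "f i = face J s' i" "J \<in> near_boxes x" "s' \<in> {1, -1}" using fi(1) unfolding F_def by blast
    have "\<bar>v - f i\<bar> < \<kappa> * \<delta> x" using fi(2) v(2) h(2) by linarith
    then show ?thesis using face_separation[OF I(2) J(2) I(3) J(3) x(2), of i] I(1) J(1) by linarith
  qed
  \<comment> \<open>\<open>e\<close> assigns to each direction a side of the hyperplane at
    \<open>f\<close>: above if true, below if false.\<close>
  define lo where "lo e i = (if e i then f i else x$i - h)" for e i
  define hi where "hi e i = (if e i then x$i + h else f i)" for e i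
  define cell where "cell e = {y::real^'n. \<forall>i. lo e i < y$i \<and> y$i < hi e i}" for e
  have cell_Cu: "cell e \<subseteq> Cu" for e
  proof
    fix y assume "y \<in> cell e"
    then have l: "lo e j < y$j \<and> y$j < hi e j" for j by (simp add: cell_def)
    have "\<bar>y$j - x$j\<bar> < h" for j using l[of j] fr[of j] by (auto simp: lo_def hi_def split: if_splits)
    then show "y \<in> Cu" by (simp add: Cu_def)
  qed
  have noface: "v \<le> lo e i \<or> hi e i \<le> v" if "v \<in> F i" for v e i
    using uniq[OF that] that fr[of i] by (cases "\<bar>v - x$i\<bar> < h") (auto simp: lo_def hi_def)
  \<comment> \<open>No face coordinate of a near box lies strictly between \<open>lo\<close> and
    \<open>hi\<close>, so a cell that meets such a box lies in its interior.\<close>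
  have cell_in: "cell e \<subseteq> interior (star I)" if y: "y \<in> cell e" "y \<in> star I" and I: "I \<in> W" for e y I
  proof
    fix y' assume y': "y' \<in> cell e"
    have nI: "I \<in> near_boxes x" using Cu_near cell_Cu y I by blast
    have "face I (-1) i < y'$i \<and> y'$i < face I 1 i" for i
    proof -
      have "face I (-1) i \<in> F i" "face I 1 i \<in> F i" unfolding F_def using nI by blast+
      then show ?thesis
        using noface[of "face I (-1) i" i e] noface[of "face I 1 i" i e] y y'
        by (auto simp: cell_def star_cbox mem_box_cart dest!: spec[of _ i])
    qed
    then show "y' \<in> interior (star I)" by (simp add: star_cbox interior_cbox mem_box_cart)
  qed
  define P where "P e \<longleftrightarrow> cell e \<subseteq> \<Omega>" for e
  have P1: "P e" if ne: "cell e \<inter> \<Omega> \<noteq> {}" for e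
  proof -
    obtain y where y: "y \<in> cell e" "y \<in> \<Omega>" using ne by auto
    obtain I where I: "I \<in> WF" "y \<in> star I" using \<Omega>_star[OF y(2)] by blast
    show ?thesis using cell_in[OF y(1) I(2) WF_W[OF I(1)]] interior_star_sub[OF I(1)] by (auto simp: P_def)
  qed
  \<comment> \<open>These are the cells with \<open>x\<close> in their closure: the side is forced
    in every direction in which \<open>x\<close> is off the hyperplane.\<close>
  define adh where "adh e \<longleftrightarrow> (\<forall>i. (f i < x$i \<longrightarrow> e i) \<and> (x$i < f i \<longrightarrow> \<not> e i))" for e
  have generic: "\<exists>e. adh e \<and> cell e \<inter> G \<noteq> {}" if G: "open G" "x \<in> closure G" for G
  proof -
    \<comment> \<open>No farther than any hyperplane that misses \<open>x\<close>, so points within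
      this distance, once moved off the hyperplanes, lie in adherent cells. The value
      \<open>h\<close> keeps the set nonempty and the points inside the cube.\<close>
    define \<rho> where "\<rho> = Min (insert h ((\<lambda>i. \<bar>x$i - f i\<bar>) ` {i. x$i \<noteq> f i}))"
    have \<rho>: "0 < \<rho>" "\<rho> \<le> h" "\<And>i. x$i \<noteq> f i \<Longrightarrow> \<rho> \<le> \<bar>x$i - f i\<bar>"
      unfolding \<rho>_def using h by (auto simp: Min_gr_iff)
    obtain y where y: "y \<in> G" "dist y x < \<rho>" using G(2) \<rho>(1) closure_approachable by metis
    have "open (G \<inter> ball x \<rho>)" "y \<in> G \<inter> ball x \<rho>" using G y by (auto simp: dist_commute)
    then obtain \<epsilon> where \<epsilon>: "0 < \<epsilon>" "cball y \<epsilon> \<subseteq> G \<inter> ball x \<rho>" using open_contains_cball by metis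
    define \<tau> where "\<tau> = \<epsilon> / rn"
    have \<tau>: "0 < \<tau>" "rn * \<tau> = \<epsilon>" using \<epsilon> rn1 by (auto simp: \<tau>_def)
    define y' :: "real^'n" where "y' = (\<chi> i. if y$i = f i then y$i + \<tau> else y$i)"
    have "dist y y' \<le> rn * \<tau>" unfolding dist_norm using \<tau> by (intro norm_le_rn) (simp add: y'_def)
    then have y'G: "y' \<in> G" "dist x y' < \<rho>" using \<epsilon> \<tau> by auto
    have y'x: "\<bar>y'$i - x$i\<bar> < \<rho>" for i
      using component_le_norm_cart[of "y' - x" i] y'G by (simp add: dist_norm norm_minus_commute)
    have y'f: "y'$i \<noteq> f i" for i using \<tau> by (simp add: y'_def)
    define e where "e i \<longleftrightarrow> f i < y'$i" for i
    have "adh e" unfolding adh_def e_def using y'x \<rho>(3) by (smt (verit))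
    moreover have "y' \<in> cell e"
    proof -
      have "lo e i < y'$i \<and> y'$i < hi e i" for i
        using y'x[of i] y'f[of i] \<rho>(2) by (auto simp: lo_def hi_def e_def)
      then show ?thesis by (simp add: cell_def)
    qed
    ultimately show ?thesis using y'G by blast
  qed
  obtain e1 where e1: "adh e1" "P e1" using generic[OF open_\<Omega> frontier_closure[OF x(1)]] P1 by blast
  \<comment> \<open>\<open>generic\<close> needs an open set. The complement of \<Omega> is not
    open, but that of the closed union of near boxes is, and it accumulates at \<open>x\<close>
    because otherwise \<open>x\<close> would be interior to \<Omega>.\<close>
  define U where "U = (\<Union>I\<in>WF \<inter> near_boxes x. star I)"
  have clU: "closed U" unfolding U_def using near_boxes_finite(1)[OF x(2)]
    by (intro closed_UN ballI closed_box_set) auto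
  have "x \<in> closure (- U)"
  proof (rule ccontr)
    assume "x \<notin> closure (- U)"
    then have "x \<in> interior U" by (simp add: interior_closure)
    moreover have "interior U \<subseteq> \<Omega>" unfolding \<Omega>_eq U_def by (intro interior_mono) auto
    ultimately show False using frontier_\<Omega>_disjoint[OF x(1)] by blast
  qed
  then obtain e2 where e2: "adh e2" "cell e2 \<inter> - U \<noteq> {}" using generic[of "- U"] clU by auto
  have nP2: "\<not> P e2"
  proof
    assume P: "P e2"
    obtain y where y: "y \<in> cell e2" "y \<notin> U" using e2 by auto
    then have "y \<in> \<Omega>" using P by (auto simp: P_def)
    then obtain I where I: "I \<in> WF" "y \<in> star I" using \<Omega>_star by blast
    then have "I \<in> near_boxes x" using Cu_near cell_Cu y WF_W by blast
    then show False using I y by (auto simp: U_def)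
  qed
  define mix where "mix A i = (if i \<in> A then e2 i else e1 i)" for A :: "'n set" and i
  have "\<exists>A i. P (mix A) \<and> \<not> P (mix (insert i A))"
  proof (rule ccontr)
    assume n: "\<not> ?thesis"
    have "P (mix A)" if "finite A" for A
      using that
    proof (induction A rule: finite_induct)
      case empty
      have "mix {} = e1" by (auto simp: mix_def)
      then show ?case using e1 by simp
    next
      case (insert i A) then show ?case using n by blast
    qed
    moreover have "mix UNIV = e2" by (auto simp: mix_def)
    ultimately show False using nP2 by (metis finite)
  qed
  then obtain A i where A: "P (mix A)" "\<not> P (mix (insert i A))" by blast
  have neq: "mix A i \<noteq> mix (insert i A) i"
  proof
    assume "mix A i = mix (insert i A) i"
    then have "mix A = mix (insert i A)" by (intro ext) (auto simp: mix_def)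
    then show False using A by simp
  qed
  \<comment> \<open>Two adherent cells can differ only in a direction whose hyperplane passes
    through \<open>x\<close>; this is why the facet lies in a plane through
    \<open>x\<close>.\<close>
  then have "e1 i \<noteq> e2 i" by (auto simp: mix_def split: if_splits)
  then have xi: "x$i = f i" using e1(1) e2(1) unfolding adh_def by (meson linorder_neqE_linordered_idom)
  define p :: "real^'n" where "p = (\<chi> j. lo (mix A) j)"
  define q :: "real^'n" where "q = (\<chi> j. hi (mix A) j)"
  have len: "h \<le> q$j - p$j" for j
  proof -
    have "(f j < x$j \<longrightarrow> mix A j) \<and> (x$j < f j \<longrightarrow> \<not> mix A j)"
      using e1(1) e2(1) by (auto simp: mix_def adh_def)
    then show ?thesis by (auto simp: p_def q_def lo_def hi_def)
  qed
  have sub: "y \<in> frontier \<Omega> \<and> y \<in> Cu" if y: "y$i = x$i" "\<And>j. j \<noteq> i \<Longrightarrow> p$j < y$j \<and> y$j < q$j" for y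
  proof -
    \<comment> \<open>Moves \<open>y\<close> off the facet, by \<tau> in direction \<open>i\<close>,
      to the side that the cell of \<open>mix B\<close> occupies.\<close>
    define sh where "sh B \<tau> = (\<chi> j. if j = i then (if mix B i then x$i + \<tau> else x$i - \<tau>) else y$j)" for B \<tau>
    have shc: "sh B \<tau> \<in> cell (mix B)" if "0 < \<tau>" "\<tau> < h" "B = A \<or> B = insert i A" for B \<tau>
    proof -
      have "lo (mix B) j < sh B \<tau> $ j \<and> sh B \<tau> $ j < hi (mix B) j" for j
      proof (cases "j = i")
        case True
        then show ?thesis using that xi by (auto simp: sh_def lo_def hi_def)
      next
        case False
        then have "lo (mix B) j = lo (mix A) j" "hi (mix B) j = hi (mix A) j"
          using that(3) by (auto simp: lo_def hi_def mix_def)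
        then show ?thesis using y(2)[OF False] False by (simp add: sh_def p_def q_def)
      qed
      then show ?thesis by (simp add: cell_def)
    qed
    have shd: "dist (sh B \<tau>) y \<le> rn * \<tau>" if "0 < \<tau>" for B \<tau>
      unfolding dist_norm using that y(1) by (intro norm_le_rn) (simp add: sh_def)
    have appr: "\<exists>z\<in>cell (mix B). dist z y < \<epsilon>" if "0 < \<epsilon>" "B = A \<or> B = insert i A" for \<epsilon> B
    proof -
      define \<tau> where "\<tau> = min (h/2) (\<epsilon> / (2 * rn))"
      have \<tau>: "0 < \<tau>" "\<tau> < h" "\<tau> \<le> \<epsilon> / (2 * rn)" using h that rn1 by (auto simp: \<tau>_def)
      have "rn * \<tau> \<le> \<epsilon> / 2" using mult_left_mono[OF \<tau>(3), of rn] rn1 by simp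
      then have "dist (sh B \<tau>) y < \<epsilon>" using shd[OF \<tau>(1), of B] that by linarith
      then show ?thesis using shc[OF \<tau>(1,2) that(2)] by blast
    qed
    have "y \<in> closure \<Omega>" unfolding closure_approachable
      using appr[of _ A] A(1) by (auto simp: P_def)
    moreover have "y \<notin> \<Omega>"
    proof
      assume "y \<in> \<Omega>"
      then obtain \<epsilon> where "0 < \<epsilon>" "ball y \<epsilon> \<subseteq> \<Omega>" using open_\<Omega> open_contains_ball by metis
      moreover obtain z where "z \<in> cell (mix (insert i A))" "dist z y < \<epsilon>" using appr[of \<epsilon> "insert i A"] \<open>0 < \<epsilon>\<close> by blast
      ultimately have "cell (mix (insert i A)) \<inter> \<Omega> \<noteq> {}" by (auto simp: dist_commute subset_iff)
      then show False using P1 A(2) by blast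
    qed
    ultimately have fr\<Omega>: "y \<in> frontier \<Omega>" using open_\<Omega> by (simp add: frontier_def interior_open)
    have "\<bar>y$j - x$j\<bar> < h" for j
    proof (cases "j = i")
      case True then show ?thesis using y(1) h by simp
    next
      case False then show ?thesis using y(2)[OF False] fr[of j] by (auto simp: p_def q_def lo_def hi_def split: if_splits)
    qed
    then show ?thesis using fr\<Omega> by (simp add: Cu_def)
  qed
  show ?thesis
    using len sub unfolding Cu_def by (intro exI[of _ i] exI[of _ p] exI[of _ q]) auto
qed

definition \<kappa>s :: real where "\<kappa>s = \<kappa> / 10"

text \<open>The facet has sides at least \<open>h = t / (2 * rn)\<close>, and the cube of radius
  \<open>h\<close> about \<open>x\<close> fits into \<open>ball x t\<close>.\<close>

lemma local_lower:
  "\<exists>b>0. \<forall>x t. x \<in> frontier \<Omega> \<and> x \<notin> \<Gamma> \<and> 0 < t \<and> t \<le> \<kappa>s * \<delta> x \<longrightarrow>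
     ennreal (b * t ^ (CARD('n) - 1)) \<le> emeasure Hn (frontier \<Omega> \<inter> ball x t)"
proof -
  have n2: "2 \<le> CARD('n)" using n3 by simp
  have "ennreal ((1 / (4 * rn)) ^ (CARD('n) - 1) * t ^ (CARD('n) - 1)) \<le> emeasure Hn (frontier \<Omega> \<inter> ball x t)"
    if x: "x \<in> frontier \<Omega>" "x \<notin> \<Gamma>" and t: "0 < t" "t \<le> \<kappa>s * \<delta> x" for x t
  proof -
    define h where "h = t / (2 * rn)"
    have h: "0 < h" using t rn1 by (simp add: h_def)
    have "2 * h \<le> t" using t rn1 by (simp add: h_def divide_le_eq)
    also have "t \<le> \<kappa> * \<delta> x" using t \<kappa>_pos by (simp add: \<kappa>s_def)
    finally have h2: "2 * h \<le> \<kappa> * \<delta> x" .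
    obtain i :: 'n and p q where pq: "\<And>j. j \<noteq> i \<Longrightarrow> h \<le> q$j - p$j"
      "{y :: real^'n. y$i = x$i \<and> (\<forall>j. j \<noteq> i \<longrightarrow> p$j < y$j \<and> y$j < q$j)} \<subseteq> frontier \<Omega> \<inter> {y. \<forall>j. \<bar>y$j - x$j\<bar> < h}"
      using boundary_facet[OF x h h2] by blast
    have "{y::real^'n. \<forall>j. \<bar>y$j - x$j\<bar> < h} \<subseteq> ball x t"
    proof
      fix y assume "y \<in> {y::real^'n. \<forall>j. \<bar>y$j - x$j\<bar> < h}"
      then have "dist x y \<le> rn * h"
        unfolding dist_norm by (intro norm_le_rn) (simp add: abs_minus_commute less_imp_le)
      then show "y \<in> ball x t" using rn1 t by (simp add: h_def)
    qed
    then have "{y :: real^'n. y$i = x$i \<and> (\<forall>j. j \<noteq> i \<longrightarrow> p$j < y$j \<and> y$j < q$j)} \<subseteq> frontier \<Omega> \<inter> ball x t"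
      using pq(2) by blast
    from hausdorff_facet_ge[OF n2 h pq(1) _ this]
    have "ennreal ((h/2) ^ (CARD('n) - 1)) \<le> emeasure Hn (frontier \<Omega> \<inter> ball x t)" by simp
    moreover have "(h/2) ^ (CARD('n) - 1) = (1 / (4 * rn)) ^ (CARD('n) - 1) * t ^ (CARD('n) - 1)"
      by (simp add: h_def power_mult_distrib[symmetric])
    ultimately show ?thesis by simp
  qed
  moreover have "0 < (1 / (4 * rn)) ^ (CARD('n) - 1)" using rn1 by simp
  ultimately show ?thesis by blast
qed

lemma surf_local_upper:
  "\<exists>C>0. \<forall>z t. z \<notin> \<Gamma> \<and> 0 < t \<and> t \<le> \<delta> z / 10 \<longrightarrow>
     emeasure surf (frontier \<Omega> \<inter> ball z t) \<le> ennreal (C * (t ^ (CARD('n) - 1) * \<delta> z powr (- \<alpha>)))"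
proof -
  obtain C where C: "0 < C" "\<And>z t. z \<notin> \<Gamma> \<Longrightarrow> 0 < t \<Longrightarrow> t \<le> \<delta> z / 10 \<Longrightarrow>
     emeasure Hn (frontier \<Omega> \<inter> ball z t) \<le> ennreal (C * t ^ (CARD('n) - 1))" using local_upper by blast
  have "emeasure surf (frontier \<Omega> \<inter> ball z t) \<le> ennreal ((9/10) powr (- \<alpha>) * C * (t ^ (CARD('n) - 1) * \<delta> z powr (- \<alpha>)))"
    if z: "z \<notin> \<Gamma>" and t: "0 < t" "t \<le> \<delta> z / 10" for z t
  proof -
    have "w y \<le> (9/10 * \<delta> z) powr (- \<alpha>)" if "y \<in> frontier \<Omega> \<inter> ball z t" for y
    proof -
      have "dist z y < \<delta> z / 10" using that t by auto
      then show ?thesis unfolding w_eq using near_ball_\<delta>(1)[of z y] \<delta>_pos[OF z] \<alpha>_pos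
        by (intro powr_mono2') auto
    qed
    then have "emeasure surf (frontier \<Omega> \<inter> ball z t) \<le> ennreal ((9/10 * \<delta> z) powr (- \<alpha>)) * emeasure Hn (frontier \<Omega> \<inter> ball z t)"
      by (intro surf_le) auto
    also have "\<dots> \<le> ennreal ((9/10 * \<delta> z) powr (- \<alpha>)) * ennreal (C * t ^ (CARD('n) - 1))"
      using C(2)[OF z t] by (intro mult_left_mono) auto
    also have "\<dots> = ennreal ((9/10) powr (- \<alpha>) * C * (t ^ (CARD('n) - 1) * \<delta> z powr (- \<alpha>)))"
    proof -
      have "(9/10 * \<delta> z) powr (- \<alpha>) = (9/10) powr (- \<alpha>) * \<delta> z powr (- \<alpha>)"
        by (rule powr_mult)
      then show ?thesis using C(1) t by (simp only:) (subst ennreal_mult''[symmetric], simp_all add: mult_ac) 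
    qed
    finally show ?thesis .
  qed
  moreover have "0 < (9/10) powr (- \<alpha>) * C" using C by simp
  ultimately show ?thesis by blast
qed

lemma surf_local_lower:
  "\<exists>b>0. \<forall>x t. x \<in> frontier \<Omega> \<and> x \<notin> \<Gamma> \<and> 0 < t \<and> t \<le> \<kappa>s * \<delta> x \<longrightarrow>
     ennreal (b * (t ^ (CARD('n) - 1) * \<delta> x powr (- \<alpha>))) \<le> emeasure surf (frontier \<Omega> \<inter> ball x t)"
proof -
  obtain b where b: "0 < b" "\<And>x t. x \<in> frontier \<Omega> \<Longrightarrow> x \<notin> \<Gamma> \<Longrightarrow> 0 < t \<Longrightarrow> t \<le> \<kappa>s * \<delta> x \<Longrightarrow>
     ennreal (b * t ^ (CARD('n) - 1)) \<le> emeasure Hn (frontier \<Omega> \<inter> ball x t)" using local_lower by blast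
  have "ennreal ((11/10) powr (- \<alpha>) * b * (t ^ (CARD('n) - 1) * \<delta> x powr (- \<alpha>))) \<le> emeasure surf (frontier \<Omega> \<inter> ball x t)"
    if x: "x \<in> frontier \<Omega>" "x \<notin> \<Gamma>" and t: "0 < t" "t \<le> \<kappa>s * \<delta> x" for x t
  proof -
    have \<delta>x: "0 < \<delta> x" using \<delta>_pos x by blast
    have "\<kappa>s * \<delta> x \<le> 1/10 * \<delta> x" using \<kappa>_small \<delta>x by (intro mult_right_mono) (auto simp: \<kappa>s_def)
    then have t': "t \<le> \<delta> x / 10" using t by linarith
    have "(11/10 * \<delta> x) powr (- \<alpha>) \<le> w y" if "y \<in> frontier \<Omega> \<inter> ball x t" for y
    proof -
      have "dist x y < \<delta> x / 10" using that t' by auto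
      then show ?thesis unfolding w_eq using near_ball_\<delta>[of x y] \<delta>x \<alpha>_pos
        by (intro powr_mono2') auto
    qed
    then have a: "ennreal ((11/10 * \<delta> x) powr (- \<alpha>)) * emeasure Hn (frontier \<Omega> \<inter> ball x t) \<le> emeasure surf (frontier \<Omega> \<inter> ball x t)"
      by (intro surf_ge) auto
    have "ennreal ((11/10) powr (- \<alpha>) * b * (t ^ (CARD('n) - 1) * \<delta> x powr (- \<alpha>))) =
       ennreal ((11/10 * \<delta> x) powr (- \<alpha>)) * ennreal (b * t ^ (CARD('n) - 1))"
    proof -
      have "(11/10 * \<delta> x) powr (- \<alpha>) = (11/10) powr (- \<alpha>) * \<delta> x powr (- \<alpha>)"
        by (rule powr_mult)
      then show ?thesis using b(1) t by (simp only:) (subst ennreal_mult''[symmetric], simp_all add: mult_ac) 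
    qed
    also have "\<dots> \<le> ennreal ((11/10 * \<delta> x) powr (- \<alpha>)) * emeasure Hn (frontier \<Omega> \<inter> ball x t)"
      using b(2)[OF x t] by (intro mult_left_mono) auto
    finally show ?thesis using a by (rule order_trans)
  qed
  moreover have "0 < (11/10) powr (- \<alpha>) * b" using b by simp
  ultimately show ?thesis by blast
qed

end

subsection \<open>The boundary measure at large scales\<close>

text \<open>The largest scale dominates: the other terms are its multiples by distinct powers of
  \<open>2 powr (- z)\<close>.\<close>

lemma geometric_scale_sum:
  assumes K: "finite K" and B: "\<And>k. k \<in> K \<Longrightarrow> sc k \<le> B" and z: "0 < z" and B0: "0 < B"
  shows "(\<Sum>k\<in>K. sc k powr z) \<le> B powr z / (1 - 2 powr (- z))"
proof (cases "K = {}")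
  case True
  have "2 powr (- z) < 1" using z by (simp add: powr_less_one)
  then show ?thesis using True by simp
next
  case False
  define k0 where "k0 = Min K"
  have k0: "k0 \<in> K" "\<And>k. k \<in> K \<Longrightarrow> k0 \<le> k" using K False by (auto simp: k0_def)
  define q where "q = 2 powr (- z)"
  have q: "0 < q" "q < 1" using z by (auto simp: q_def powr_less_one)
  have sk: "sc k powr z = sc k0 powr z * q ^ nat (k - k0)" if "k \<in> K" for k
  proof -
    define j where "j = nat (k - k0)"
    have k0j: "k0 = k - int j" using k0(2)[OF that] by (simp add: j_def)
    have "sc k0 powr z = 2 powr (real j * z) * sc k powr z"
      unfolding k0j sc_diff by (simp add: powr_mult powr_powr powr_realpow[symmetric])
    moreover have "q ^ j = 2 powr (- (real j * z))" by (simp add: q_def powr_realpow[symmetric] powr_powr algebra_simps)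
    ultimately show ?thesis unfolding j_def[symmetric] by (simp add: powr_minus)
  qed
  have inj: "inj_on (\<lambda>k. nat (k - k0)) K"
  proof (rule inj_onI)
    fix x y assume "x \<in> K" "y \<in> K" "nat (x - k0) = nat (y - k0)"
    then show "x = y" using k0(2)[of x] k0(2)[of y] by linarith
  qed
  define J where "J = (\<lambda>k. nat (k - k0)) ` K"
  have "(\<Sum>k\<in>K. sc k powr z) = (\<Sum>k\<in>K. sc k0 powr z * q ^ nat (k - k0))" using sk by (intro sum.cong) auto
  also have "\<dots> = sc k0 powr z * (\<Sum>j\<in>J. q ^ j)"
    unfolding J_def sum.reindex[OF inj] by (simp add: sum_distrib_left)
  also have "\<dots> \<le> sc k0 powr z * (1 / (1 - q))"
  proof (rule mult_left_mono)
    have "(\<Sum>j\<in>J. q ^ j) \<le> (\<Sum>j. q ^ j)" using q K by (intro sum_le_suminf) (auto simp: J_def)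
    also have "\<dots> = 1 / (1 - q)" using q by (intro suminf_geometric) auto
    finally show "(\<Sum>j\<in>J. q ^ j) \<le> 1 / (1 - q)" .
  qed auto
  also have "\<dots> \<le> B powr z * (1 / (1 - q))"
    using B[OF k0(1)] q z by (intro mult_right_mono powr_mono2) auto
  finally show ?thesis by (simp add: q_def)
qed

context sawtooth begin

section \<open>Upper bound at large scales\<close>

lemma countable_W: "countable W"
proof -
  define g where "g = (\<lambda>(k :: int, f :: 'n \<Rightarrow> int). ((\<chi> i. (real_of_int (f i) + 1/2) * sc k) :: real^'n, sc k))"
  have "W \<subseteq> g ` UNIV"
  proof
    fix I assume "I \<in> W"
    then obtain k where k: "snd I = sc k" "\<forall>i. \<exists>j::int. fst I $ i = (real_of_int j + 1/2) * sc k"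
      using whitney_parts(1) unfolding dyadic_box_def by blast
    then obtain f where "\<forall>i. fst I $ i = (real_of_int (f i) + 1/2) * sc k" by metis
    then have "I = g (k, f)" using k(1) by (simp add: g_def prod_eq_iff vec_eq_iff)
    then show "I \<in> g ` UNIV" by blast
  qed
  then show ?thesis by (meson countable_image countable_subset countableI_type)
qed

text \<open>On a box of side \<open>l\<close> the distance to \<Gamma> is at least
  \<open>4 * rn * l\<close>, so balls of radius \<open>e\<close> are in the range of the local
  bound, and at most \<open>5 ^ n\<close> of them cover the box. Each contributes at most a multiple
  of \<open>l ^ (n - 1) * l powr (- \<alpha>) = l powr d\<close>.\<close>

lemma surf_box:
  "\<exists>C>0. \<forall>J\<in>W. emeasure surf (frontier \<Omega> \<inter> box_set J) \<le> ennreal (C * snd J powr d)"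
proof -
  obtain C where C: "0 < C" "\<And>z t. z \<notin> \<Gamma> \<Longrightarrow> 0 < t \<Longrightarrow> t \<le> \<delta> z / 10 \<Longrightarrow>
     emeasure surf (frontier \<Omega> \<inter> ball z t) \<le> ennreal (C * (t ^ (CARD('n) - 1) * \<delta> z powr (- \<alpha>)))"
    using surf_local_upper by blast
  define C' where "C' = 5 ^ CARD('n) * (C * ((2/5 * rn) ^ (CARD('n) - 1) * (4 * rn) powr (- \<alpha>)))"
  have "emeasure surf (frontier \<Omega> \<inter> box_set J) \<le> ennreal (C' * snd J powr d)" if J: "J \<in> W" for J
  proof -
    define l where "l = snd J"
    have l: "0 < l" using W_pos[OF J] by (simp add: l_def)
    define e where "e = 2/5 * rn * l"
    have e: "0 < e" using l rn1 by (simp add: e_def)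
    have in\<delta>: "4 * rn * l \<le> \<delta> z" "z \<notin> \<Gamma>" if "z \<in> box_set J" for z
      using that \<delta>_star_ge[OF J] star_disjoint_\<Gamma>[OF J] box_in_star[OF J] unfolding l_def by blast+
    have "real (card T) \<le> 5 ^ CARD('n)" if T: "finite T" "T \<subseteq> box_set J" "pairwise (\<lambda>x y. e \<le> dist x y) T" for T
    proof -
      have "real (card T) * (\<omega> * (e/2) ^ CARD('n)) \<le> measure lborel (ball (fst J) (rn * l))"
      proof (rule card_measure_disjoint_le[OF T(1) separated_balls_disjoint[OF T(3)]])
        fix z assume z: "z \<in> T"
        have "dist (fst J) z \<le> rn * (1/2 * l)"
          unfolding dist_norm using T(2) z by (intro norm_le_rn) (auto simp: box_set_def l_def abs_minus_commute)
        moreover have "0 < rn * l" using rn1 l by simp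
        ultimately have "dist (fst J) y < rn * l" if "dist z y < e/2" for y
          using that dist_triangle[of "fst J" y z] unfolding e_def by linarith
        then have "ball z (e/2) \<subseteq> ball (fst J) (rn * l)" by auto
        then show "ball z (e/2) \<in> sets lborel \<and> ball z (e/2) \<subseteq> ball (fst J) (rn * l)" by simp
        show "\<omega> * (e/2) ^ CARD('n) \<le> measure lborel (ball z (e/2))" using e by (simp add: content_ball \<omega>_def)
      qed (simp add: bounded_borel_fmeasurable)
      also have "\<dots> = \<omega> * (5 * (e/2)) ^ CARD('n)" using rn1 l by (simp add: content_ball \<omega>_def e_def mult.commute)
      also have "\<omega> * (5 * (e/2)) ^ CARD('n) = 5 ^ CARD('n) * (\<omega> * (e/2) ^ CARD('n))"
        by (subst power_mult_distrib) simp
      finally show ?thesis using \<omega>_pos e by (elim mult_right_le_imp_le) simp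
    qed
    then obtain T where T: "finite T" "T \<subseteq> box_set J" "box_set J \<subseteq> (\<Union>z\<in>T. ball z e)" "real (card T) \<le> 5 ^ CARD('n)"
      using max_separated[of "box_set J" e "5 ^ CARD('n)"] e by metis
    have "(\<Union>z\<in>T. frontier \<Omega> \<inter> ball z e) \<in> sets surf" using T(1) by (intro sets.finite_UN) auto
    then have "emeasure surf (frontier \<Omega> \<inter> box_set J) \<le> emeasure surf (\<Union>z\<in>T. frontier \<Omega> \<inter> ball z e)"
      using T(3) by (intro emeasure_mono) blast+
    also have "\<dots> \<le> (\<Sum>z\<in>T. emeasure surf (frontier \<Omega> \<inter> ball z e))"
      using T by (intro emeasure_subadditive_finite) auto
    also have "\<dots> \<le> (\<Sum>z\<in>T. ennreal (C * (e ^ (CARD('n) - 1) * (4 * rn * l) powr (- \<alpha>))))"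
    proof (rule sum_mono)
      fix z assume "z \<in> T"
      then have z: "4 * rn * l \<le> \<delta> z" "z \<notin> \<Gamma>" using in\<delta> T(2) by blast+
      have "e \<le> \<delta> z / 10" using z(1) unfolding e_def by linarith
      then have "emeasure surf (frontier \<Omega> \<inter> ball z e) \<le> ennreal (C * (e ^ (CARD('n) - 1) * \<delta> z powr (- \<alpha>)))"
        using C(2)[OF z(2) e] by blast
      also have "\<dots> \<le> ennreal (C * (e ^ (CARD('n) - 1) * (4 * rn * l) powr (- \<alpha>)))"
        using z(1) rn1 l e C(1) \<alpha>_pos by (intro ennreal_leI mult_left_mono powr_mono2') auto
      finally show "emeasure surf (frontier \<Omega> \<inter> ball z e) \<le> ennreal (C * (e ^ (CARD('n) - 1) * (4 * rn * l) powr (- \<alpha>)))" .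
    qed
    also have "\<dots> = ennreal (real (card T) * (C * (e ^ (CARD('n) - 1) * (4 * rn * l) powr (- \<alpha>))))"
      using C e by (simp add: ennreal_of_nat_eq_real_of_nat ennreal_mult)
    also have "\<dots> \<le> ennreal (5 ^ CARD('n) * (C * (e ^ (CARD('n) - 1) * (4 * rn * l) powr (- \<alpha>))))"
      using T(4) C e by (intro ennreal_leI mult_right_mono) auto
    also have "5 ^ CARD('n) * (C * (e ^ (CARD('n) - 1) * (4 * rn * l) powr (- \<alpha>))) = C' * l powr d"
    proof -
      have 1: "(4 * rn * l) powr (- \<alpha>) = (4 * rn) powr (- \<alpha>) * l powr (- \<alpha>)" by (rule powr_mult)
      have 2: "e ^ (CARD('n) - 1) = (2/5 * rn) ^ (CARD('n) - 1) * l ^ (CARD('n) - 1)"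
        unfolding e_def by (rule power_mult_distrib)
      have "l ^ (CARD('n) - 1) = l powr (real CARD('n) - 1)"
        using l n3 by (simp add: powr_realpow[symmetric] of_nat_diff)
      then have "l ^ (CARD('n) - 1) * l powr (- \<alpha>) = l powr d"
        using l by (simp add: powr_add[symmetric] \<alpha>_def)
      then show ?thesis unfolding C'_def 1 2 by (simp add: mult_ac)
    qed
    finally show ?thesis by (simp add: l_def)
  qed
  moreover have "0 < C'" using C rn1 by (simp add: C'_def)
  ultimately show ?thesis by blast
qed

text \<open>Extends the thin boundary property beyond relative widths below \<open>a0\<close>: for
  wider strips the trivial bound by the measure of \<open>E\<close> has the same form once the
  constant is at least \<open>(1 / a0) powr \<zeta>\<close>.\<close>

lemma strip_measure:
  "\<exists>C>0. \<forall>k. \<forall>E\<in>\<DD> k. \<forall>s>0. \<sigma> {q \<in> E. infdist q (\<Gamma> - E) \<le> s} \<le> C * (s / sc k) powr \<zeta> * \<sigma> E"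
proof -
  define C where "C = A0 + (1 / a0) powr \<zeta>"
  have C: "A0 \<le> C" "(1 / a0) powr \<zeta> \<le> C" "0 < C" using A01 a0 by (auto simp: C_def add_pos_nonneg)
  have "\<sigma> {q \<in> E. infdist q (\<Gamma> - E) \<le> s} \<le> C * (s / sc k) powr \<zeta> * \<sigma> E" if E: "E \<in> \<DD> k" and s: "0 < s" for E k s
  proof -
    let ?S = "{q \<in> E. infdist q (\<Gamma> - E) \<le> s}"
    have "{q. infdist q (\<Gamma> - E) \<le> s} \<in> sets borel"
      by (intro borel_closed closed_Collect_le continuous_intros)
    then have "E \<inter> {q. infdist q (\<Gamma> - E) \<le> s} \<in> sets borel" by (intro sets.Int cubeD(1)[OF E])
    moreover have "?S = E \<inter> {q. infdist q (\<Gamma> - E) \<le> s}" by blast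
    ultimately have Sb: "?S \<in> sets borel" by (simp only:)
    have Sfm: "?S \<in> fmeasurable (hausdorff_measure d)"
      by (rule fmeasurableI2[OF cubeD(8)[OF E] Collect_restrict]) (simp only: sets_hausdorff_measure Sb)
    have \<sigma>E: "0 \<le> \<sigma> E" by simp
    define \<rho> where "\<rho> = s / sc k"
    have \<rho>: "0 < \<rho>" "s = \<rho> * sc k" using s by (auto simp: \<rho>_def)
    show ?thesis
    proof (cases "\<rho> < a0")
      case True
      have "ennreal (\<sigma> ?S) = emeasure (hausdorff_measure d) ?S" using Sfm by (simp add: emeasure_eq_measure2)
      also have "\<dots> \<le> ennreal (A0 * \<rho> powr \<zeta>) * emeasure (hausdorff_measure d) E"
        unfolding \<rho>(2) by (rule cube_thin[OF E \<rho>(1) True])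
      also have "\<dots> = ennreal (A0 * \<rho> powr \<zeta> * \<sigma> E)"
        using A01 cubeD(8)[OF E] by (simp add: emeasure_eq_measure2 ennreal_mult)
      finally have "\<sigma> ?S \<le> A0 * \<rho> powr \<zeta> * \<sigma> E" using A01 by (simp add: ennreal_le_iff)
      also have "\<dots> \<le> C * \<rho> powr \<zeta> * \<sigma> E" using C by (intro mult_right_mono) auto
      finally show ?thesis by (simp add: \<rho>_def)
    next
      case False
      have "\<sigma> ?S \<le> 1 * \<sigma> E" using Sfm cubeD(8)[OF E] by (simp, intro measure_mono_fmeasurable) (auto simp: fmeasurableD)
      also have "1 \<le> (1 / a0 * \<rho>) powr \<zeta>"
        using False a0 \<zeta>0 by (intro ge_one_powr_ge_zero) (auto simp: field_simps)
      also have "(1 / a0 * \<rho>) powr \<zeta> = (1 / a0) powr \<zeta> * \<rho> powr \<zeta>" by (rule powr_mult)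
      also have "\<dots> \<le> C * \<rho> powr \<zeta>" using C by (intro mult_right_mono) auto
      finally show ?thesis by (simp add: \<rho>_def mult_right_mono)
    qed
  qed
  with C show ?thesis by blast
qed

text \<open>The cube \<open>Q\<close> beneath \<open>J\<close> given by \<open>box_region\<close>
  cannot be kept, since then a neighbourhood of \<open>J\<close> would lie in \<Omega>; so
  \<open>Q\<close> is contained in a removed cube \<open>P\<close>. But the boundary point in
  \<open>J\<close> also lies in a dilated box of a kept cube, which is not contained in
  \<open>P\<close> and supplies a nearby point of \<open>\<Gamma> - P\<close>.\<close>

lemma boundary_box_cube:
  "\<exists>C>0. \<forall>J\<in>W. box_set J \<inter> frontier \<Omega> \<noteq> {} \<longrightarrow> (\<exists>k. \<exists>Q\<in>\<DD> k. \<exists>P\<in>\<F>.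
     J \<in> WQ Q \<and> rn * snd J \<le> sc k \<and> sc k \<le> 2 * rn * snd J \<and> Q \<subseteq> P \<and> \<Gamma> - P \<noteq> {} \<and>
     (\<forall>q\<in>Q. infdist q (\<Gamma> - P) \<le> C * sc k))"
proof -
  define C where "C = CW * L0 + CW * (CW * 11)"
  have C: "0 < C" using CW1 L0_pos by (simp add: C_def add_pos_pos)
  have "\<exists>k. \<exists>Q\<in>\<DD> k. \<exists>P\<in>\<F>. J \<in> WQ Q \<and> rn * snd J \<le> sc k \<and> sc k \<le> 2 * rn * snd J \<and> Q \<subseteq> P \<and> \<Gamma> - P \<noteq> {} \<and>
     (\<forall>q\<in>Q. infdist q (\<Gamma> - P) \<le> C * sc k)"
    if J: "J \<in> W" and z: "z \<in> box_set J" "z \<in> frontier \<Omega>" for J z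
  proof -
    obtain k Q where Q: "Q \<in> \<DD> k" "J \<in> WQ Q" "rn * snd J \<le> sc k" "sc k \<le> 2 * rn * snd J"
      using box_region[OF J] by blast
    have Qc: "Q \<in> all_cubes \<DD>" using cubeD(7) Q by blast
    have J0: "0 < snd J" using W_pos[OF J] .
    have "Q \<notin> DF"
    proof
      assume "Q \<in> DF"
      then have "ball z (\<theta> * snd J / 2) \<subseteq> \<Omega>" using box_ball WF_I Q z by blast
      moreover have "z \<in> ball z (\<theta> * snd J / 2)" using \<theta>0 J0 by simp
      ultimately show False using frontier_\<Omega>_disjoint[OF z(2)] by blast
    qed
    then obtain P where P: "P \<in> \<F>" "Q \<subseteq> P" using DF_iff[OF Qc] by blast
    have zs: "z \<in> star J" using box_in_star[OF J] z by blast
    then have "z \<notin> \<Gamma>" using star_disjoint_\<Gamma>[OF J] by blast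
    then obtain I where I: "I \<in> WF" "z \<in> star I" using closure_\<Omega>_star frontier_closure z by blast
    then obtain Q' where Q': "I \<in> WQ Q'" "Q' \<in> DF" by (auto simp: WF_def)
    have Q'c: "Q' \<in> all_cubes \<DD>" using DF_cube Q' by blast
    have "\<not> Q' \<subseteq> P" using DF_iff[OF Q'c] Q' P by blast
    then obtain p where p: "p \<in> Q'" "p \<notin> P" by blast
    have p\<Gamma>: "p \<in> \<Gamma> - P" using p Q'c by (auto simp: all_cubes_def dest: cubeD(2))
    have IW: "I \<in> W" using WF_W I by blast
    have "4 * rn * snd I \<le> 41 * rn * snd J" using \<delta>_star_ge[OF IW I(2)] \<delta>_box_le[OF J z(1)] by linarith
    then have "4 * snd I \<le> 41 * snd J" using rn1 by simp
    then have "snd I \<le> 11 * snd J" using J0 by linarith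
    also have "\<dots> \<le> 11 * sc k"
    proof -
      have "1 * snd J \<le> rn * snd J" using rn1 J0 by (intro mult_right_mono) auto
      then show ?thesis using Q(3) by linarith
    qed
    finally have sI: "snd I \<le> 11 * sc k" .
    have "cl Q' \<le> CW * (11 * sc k)"
      using order_trans[OF region_props(1)[OF Q'c Q'(1)] mult_left_mono[OF sI]] CW1 by simp
    then have zp: "dist z p \<le> CW * (CW * (11 * sc k))"
      using order_trans[OF region_props(3)[OF Q'c Q'(1) I(2) p(1)] mult_left_mono] CW1 by simp
    have "infdist q (\<Gamma> - P) \<le> C * sc k" if "q \<in> Q" for q
    proof -
      have "dist z q \<le> CW * (L0 * sc k)"
        using order_trans[OF region_props(3)[OF Qc Q(2) zs that] mult_left_mono[OF cl_bounds(2)[OF Q(1)]]] CW1 by simp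
      then have "dist q p \<le> C * sc k" using zp dist_triangle[of q p z] by (simp add: C_def algebra_simps dist_commute)
      then show ?thesis using infdist_le[OF p\<Gamma>, of q] by linarith
    qed
    moreover have "\<Gamma> - P \<noteq> {}" using p\<Gamma> by blast
    ultimately show ?thesis using Q P by (intro exI[of _ k] bexI[of _ Q] bexI[of _ P] conjI ballI)
  qed
  note cube = this
  show ?thesis
  proof (intro exI[of _ C] conjI C ballI impI)
    fix J assume J: "J \<in> W" "box_set J \<inter> frontier \<Omega> \<noteq> {}"
    then obtain z where "z \<in> box_set J" "z \<in> frontier \<Omega>" by blast
    from cube[OF J(1) this] show "\<exists>k. \<exists>Q\<in>\<DD> k. \<exists>P\<in>\<F>. J \<in> WQ Q \<and> rn * snd J \<le> sc k \<and> sc k \<le> 2 * rn * snd J \<and>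
      Q \<subseteq> P \<and> \<Gamma> - P \<noteq> {} \<and> (\<forall>q\<in>Q. infdist q (\<Gamma> - P) \<le> C * sc k)" .
  qed
qed

text \<open>Each box \<open>J\<close> is charged to the cube \<open>Q J\<close> beneath it, which
  lies in a strip along the boundary of a cube \<open>E J\<close> inside a removed cube. Within one
  generation the charges overlap boundedly and fit into the strip. The distinct cubes
  \<open>E J\<close> are disjoint and lie in a ball of radius comparable to \<open>r\<close>, so
  their total measure is at most a multiple of \<open>r powr d\<close>.\<close>

lemma boundary_boxes_sum:
  "\<exists>C>0. \<forall>x r. \<forall>\<J>. 0 < r \<and> \<delta> x \<le> r \<and> finite \<J> \<and> \<J> \<subseteq> {J\<in>W. box_set J \<inter> frontier \<Omega> \<inter> ball x r \<noteq> {}} \<longrightarrow>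
     (\<Sum>J\<in>\<J>. snd J powr d) \<le> C * r powr d"
proof -
  obtain C2 where C2: "0 < C2" and bbc: "\<forall>J\<in>W. box_set J \<inter> frontier \<Omega> \<noteq> {} \<longrightarrow> (\<exists>k. \<exists>Q\<in>\<DD> k. \<exists>P\<in>\<F>.
     J \<in> WQ Q \<and> rn * snd J \<le> sc k \<and> sc k \<le> 2 * rn * snd J \<and> Q \<subseteq> P \<and> \<Gamma> - P \<noteq> {} \<and>
     (\<forall>q\<in>Q. infdist q (\<Gamma> - P) \<le> C2 * sc k))"
    using boundary_box_cube by (elim exE conjE) (rule that)
  obtain C3 where C3: "0 < C3" and strip: "\<And>k E s. E \<in> \<DD> k \<Longrightarrow> 0 < s \<Longrightarrow>
     \<sigma> {q \<in> E. infdist q (\<Gamma> - E) \<le> s} \<le> C3 * (s / sc k) powr \<zeta> * \<sigma> E"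
    using strip_measure by blast
  \<comment> \<open>In units of \<open>sc i / (2 * rn)\<close>, the least side of the boxes charged
    in generation \<open>i\<close>, this bounds the distance from a point of a cube to the boxes
    charged to it.\<close>
  define B where "B = CW * L0 * (2 * rn) + 1"
  define M where "M = unit_ball_vol (real CARD('n)) * B ^ CARD('n)"
  have B: "0 < B" using CW1 L0_pos rn1 by (simp add: B_def add_pos_pos)
  have M0: "0 \<le> M" using B by (simp add: M_def)
  define G where "G = Cd / a0 powr d * (M * (C3 * (C2 powr \<zeta> * (L0 powr \<zeta> / (1 - 2 powr (- \<zeta>))))))"
  have "2 powr (- \<zeta>) < 1" using \<zeta>0 by (simp add: powr_less_one)
  then have G0: "0 \<le> G" using Cd0 M0 C3 by (simp add: G_def)
  define R0 where "R0 = 3 + CW * L0 + 2 * A0"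
  have R0: "0 < R0" using CW1 L0_pos A01 by (simp add: R0_def add_pos_pos)
  have main: "(\<Sum>J\<in>\<J>. snd J powr d) \<le> G * (Cd * R0 powr d) * r powr d"
    if r: "0 < r" "\<delta> x \<le> r" and fin: "finite \<J>" and \<J>: "\<J> \<subseteq> {J\<in>W. box_set J \<inter> frontier \<Omega> \<inter> ball x r \<noteq> {}}" for x r \<J>
  proof -
    define good where "good J t \<longleftrightarrow> fst (snd t) \<in> \<DD> (fst t) \<and> snd (snd t) \<in> \<F> \<and> J \<in> WQ (fst (snd t)) \<and>
       rn * snd J \<le> sc (fst t) \<and> sc (fst t) \<le> 2 * rn * snd J \<and> fst (snd t) \<subseteq> snd (snd t) \<and> \<Gamma> - snd (snd t) \<noteq> {} \<and>
       (\<forall>q\<in>fst (snd t). infdist q (\<Gamma> - snd (snd t)) \<le> C2 * sc (fst t))"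
      for J and t :: "int \<times> (real^'n) set \<times> (real^'n) set"
    have "\<exists>t. good J t" if J: "J \<in> \<J>" for J
    proof -
      have "J \<in> W" "box_set J \<inter> frontier \<Omega> \<noteq> {}" using \<J> J by blast+
      from bbc[rule_format, OF this] obtain k Q P where "Q \<in> \<DD> k" "P \<in> \<F>" "J \<in> WQ Q" "rn * snd J \<le> sc k"
        "sc k \<le> 2 * rn * snd J" "Q \<subseteq> P" "\<Gamma> - P \<noteq> {}" "\<forall>q\<in>Q. infdist q (\<Gamma> - P) \<le> C2 * sc k"
        by (elim exE bexE conjE) (rule that)
      then have "good J (k, Q, P)" unfolding good_def fst_conv snd_conv by (intro conjI)
      then show ?thesis by blast
    qed
    then obtain t where t: "\<And>J. J \<in> \<J> \<Longrightarrow> good J (t J)" by metis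
    define k where "k J = fst (t J)" for J
    define Q where "Q J = fst (snd (t J))" for J
    define P where "P J = snd (snd (t J))" for J
    note kQP = t[unfolded good_def, folded k_def Q_def P_def, THEN conjunct1]
      t[unfolded good_def, folded k_def Q_def P_def, THEN conjunct2, THEN conjunct1]
      t[unfolded good_def, folded k_def Q_def P_def, THEN conjunct2, THEN conjunct2, THEN conjunct1]
      t[unfolded good_def, folded k_def Q_def P_def, THEN conjunct2, THEN conjunct2, THEN conjunct2, THEN conjunct1]
      t[unfolded good_def, folded k_def Q_def P_def, THEN conjunct2, THEN conjunct2, THEN conjunct2, THEN conjunct2, THEN conjunct1]
      t[unfolded good_def, folded k_def Q_def P_def, THEN conjunct2, THEN conjunct2, THEN conjunct2, THEN conjunct2, THEN conjunct2, THEN conjunct1]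
      t[unfolded good_def, folded k_def Q_def P_def, THEN conjunct2, THEN conjunct2, THEN conjunct2, THEN conjunct2, THEN conjunct2, THEN conjunct2, THEN conjunct1]
      t[unfolded good_def, folded k_def Q_def P_def, THEN conjunct2, THEN conjunct2, THEN conjunct2, THEN conjunct2, THEN conjunct2, THEN conjunct2, THEN conjunct2, THEN bspec]
    have JW: "J \<in> W" if "J \<in> \<J>" for J using \<J> that by blast
    obtain kr where kr: "r \<le> sc kr" "sc kr < 2 * r" using ex_scale[OF r(1)] .
    have small: "sc (k J) \<le> r" and Qx: "\<And>q. q \<in> Q J \<Longrightarrow> dist x q \<le> (1 + CW * L0) * r" if J: "J \<in> \<J>" for J
    proof -
      obtain z where z: "z \<in> box_set J" "z \<in> frontier \<Omega>" "dist x z < r" using \<J> J by fastforce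
      have zs: "z \<in> star J" using box_in_star[OF JW[OF J]] z by blast
      have "4 * rn * snd J \<le> \<delta> z" using \<delta>_star_ge[OF JW[OF J] zs] .
      also have "\<dots> \<le> \<delta> x + dist z x" by (rule \<delta>_lipschitz)
      finally have "2 * rn * snd J \<le> r" using r z by (simp add: dist_commute)
      then show s: "sc (k J) \<le> r" using kQP(5)[OF J] by linarith
      have Qc: "Q J \<in> all_cubes \<DD>" using cubeD(7) kQP(1)[OF J] by blast
      fix q assume q: "q \<in> Q J"
      have "dist z q \<le> CW * cl (Q J)" using region_props(3)[OF Qc kQP(3)[OF J] zs q] .
      also have "\<dots> \<le> CW * (L0 * r)"
        using order_trans[OF cl_bounds(2)[OF kQP(1)[OF J]] mult_left_mono[OF s]] L0_pos CW1 by (intro mult_left_mono) auto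
      finally show "dist x q \<le> (1 + CW * L0) * r"
        using z dist_triangle[of x q z] by (simp add: algebra_simps)
    qed
    have krk: "kr \<le> k J" if "J \<in> \<J>" for J using small[OF that] kr by (simp add: sc_le_iff[symmetric])
    \<comment> \<open>The generation must depend on \<open>P\<close> alone, so that boxes over the
      same removed cube get the same level \<open>l\<close>.\<close>
    define lev where "lev P = (SOME j. P \<in> \<DD> j)" for P
    have lev: "P J \<in> \<DD> (lev (P J))" if "J \<in> \<J>" for J
    proof -
      have "\<exists>j. P J \<in> \<DD> j" using kQP(2)[OF that] \<F>_cubes by (auto simp: all_cubes_def)
      then show ?thesis unfolding lev_def by (rule someI_ex)
    qed
    \<comment> \<open>Removed cubes coarser than the ball are replaced by their subcubes of
      generation \<open>kr\<close>, so that every \<open>E J\<close> has diameter at most a multiple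
      of \<open>r\<close>.\<close>
    define l where "l J = max (lev (P J)) kr" for J
    have "\<exists>E\<in>\<DD> (l J). Q J \<subseteq> E \<and> E \<subseteq> P J" if J: "J \<in> \<J>" for J
    proof (cases "kr \<le> lev (P J)")
      case True
      then show ?thesis using lev[OF J] kQP(6)[OF J] by (intro bexI[of _ "P J"]) (auto simp: l_def)
    next
      case False
      obtain E where E: "E \<in> \<DD> kr" "Q J \<subseteq> E" using cube_ancestor[OF kQP(1)[OF J] krk[OF J]] by blast
      have "E \<inter> P J \<noteq> {}" using E kQP(6)[OF J] cubeD(6)[OF kQP(1)[OF J]] by blast
      then have "E \<subseteq> P J" using cube_nested[OF _ E(1) lev[OF J]] False by simp
      then show ?thesis using E False by (intro bexI[of _ E]) (auto simp: l_def)
    qed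
    then obtain E where E: "\<And>J. J \<in> \<J> \<Longrightarrow> E J \<in> \<DD> (l J)" "\<And>J. J \<in> \<J> \<Longrightarrow> Q J \<subseteq> E J" "\<And>J. J \<in> \<J> \<Longrightarrow> E J \<subseteq> P J"
      by metis
    have E_meet: "P J = P J' \<and> l J = l J' \<and> E J = E J'" if J: "J \<in> \<J>" "J' \<in> \<J>" "E J \<inter> E J' \<noteq> {}" for J J'
    proof -
      have "P J \<inter> P J' \<noteq> {}" using E(3) J by blast
      then have "P J = P J'" using \<F>_eq kQP(2) J by blast
      moreover then have "l J = l J'" by (simp add: l_def)
      moreover then have "E J = E J'" using cube_eq[of "E J" "l J" "E J'"] E(1) J by metis
      ultimately show ?thesis by blast
    qed
    have inner: "(\<Sum>J\<in>{J\<in>\<J>. E J = F}. snd J powr d) \<le> G * \<sigma> F" if F: "F \<in> E ` \<J>" for F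
    proof -
      obtain J0 where J0: "J0 \<in> \<J>" "F = E J0" using F by blast
      define j where "j = l J0"
      have Fj: "F \<in> \<DD> j" using E(1) J0 by (simp add: j_def)
      have Fne: "F \<noteq> {}" using cubeD(6)[OF Fj] .
      let ?T = "{J\<in>\<J>. E J = F}"
      have fT: "finite ?T" using fin by simp
      have PT: "P J = P J0" if "J \<in> ?T" for J using E_meet[of J J0] that J0 Fne by auto
      have level: "(\<Sum>J\<in>{J\<in>?T. k J = i}. snd J powr d) \<le> Cd / a0 powr d * (M * (C3 * (C2 * sc i / sc j) powr \<zeta> * \<sigma> F))" for i
      proof -
        let ?Ti = "{J\<in>?T. k J = i}"
        have fTi: "finite ?Ti" using fT by (rule rev_finite_subset) auto
        \<comment> \<open>Boxes charged to the same cube \<open>S\<close> in one generation have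
          sides bounded below and lie close to \<open>S\<close>, so a volume count bounds their
          number.\<close>
        have mult: "real (card {J\<in>?Ti. Q J = S}) \<le> M" if S: "S \<in> Q ` ?Ti" for S
        proof -
          obtain J1 where J1: "J1 \<in> ?Ti" "S = Q J1" using S by blast
          have "J1 \<in> \<J>" "k J1 = i" using J1(1) by auto
          then have Si: "S \<in> \<DD> i" using kQP(1)[of J1] J1(2) by simp
          have Sc: "S \<in> all_cubes \<DD>" using cubeD(7)[OF Si] .
          obtain s where s: "s \<in> S" using cubeD(6)[OF Si] by auto
          show ?thesis unfolding M_def
          proof (rule W_count[of _ "sc i / (2 * rn)" B s])
            show "0 < sc i / (2 * rn)" using rn1 by simp
            fix J assume J: "J \<in> {J\<in>?Ti. Q J = S}"
            then have J': "J \<in> \<J>" "k J = i" "Q J = S" by auto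
            have 1: "sc i / (2 * rn) \<le> snd J" using kQP(5)[OF J'(1)] J'(2) rn1 by (simp add: field_simps)
            have "dist s y < B * (sc i / (2 * rn))" if y: "y \<in> box_set J" for y
            proof -
              have "dist y s \<le> CW * cl S"
                using region_props(3)[OF Sc _ _ s, of J y] kQP(3)[OF J'(1)] J'(3) box_in_star[OF JW[OF J'(1)]] y by blast
              also have "\<dots> \<le> CW * (L0 * sc i)" using cl_bounds(2)[OF Si] CW1 by (intro mult_left_mono) auto
              also have "\<dots> < B * (sc i / (2 * rn))" using rn1 by (simp add: B_def field_simps)
              finally show ?thesis by (simp add: dist_commute)
            qed
            then show "sc i / (2 * rn) \<le> snd J \<and> box_set J \<subseteq> ball s (B * (sc i / (2 * rn)))" using 1 by auto
          next
            show "finite {J\<in>?Ti. Q J = S}" using fTi by (rule rev_finite_subset) auto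
          qed (use B JW in auto)
        qed
        have X: "(\<Sum>S\<in>Q ` ?Ti. \<sigma> S) \<le> C3 * (C2 * sc i / sc j) powr \<zeta> * \<sigma> F"
        proof -
          let ?S = "{q \<in> F. infdist q (\<Gamma> - F) \<le> C2 * sc i}"
          have "{q. infdist q (\<Gamma> - F) \<le> C2 * sc i} \<in> sets borel"
            by (intro borel_closed closed_Collect_le continuous_intros)
          then have "F \<inter> {q. infdist q (\<Gamma> - F) \<le> C2 * sc i} \<in> sets borel" by (intro sets.Int cubeD(1)[OF Fj])
          moreover have "?S = F \<inter> {q. infdist q (\<Gamma> - F) \<le> C2 * sc i}" by blast
          ultimately have Sb: "?S \<in> sets borel" by (simp only:)
          have "(\<Sum>S\<in>Q ` ?Ti. measure (hausdorff_measure d) (id S)) \<le> \<sigma> ?S"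
          proof (rule sum_measure_disjoint_le)
            show "disjoint_family_on id (Q ` ?Ti)"
              unfolding disjoint_family_on_def
            proof (intro ballI impI)
              fix S S' assume "S \<in> Q ` ?Ti" "S' \<in> Q ` ?Ti" and ne: "S \<noteq> S'"
              then obtain J J' where "J \<in> \<J>" "k J = i" "S = Q J" "J' \<in> \<J>" "k J' = i" "S' = Q J'" by blast
              then have "S \<in> \<DD> i" "S' \<in> \<DD> i" using kQP(1)[of J] kQP(1)[of J'] by simp_all
              then show "id S \<inter> id S' = {}" using cube_eq ne unfolding id_apply by blast
            qed
            show "?S \<in> fmeasurable (hausdorff_measure d)"
              by (rule fmeasurableI2[OF cubeD(8)[OF Fj] Collect_restrict]) (simp only: sets_hausdorff_measure Sb)
            fix S assume "S \<in> Q ` ?Ti"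
            then obtain J where J: "J \<in> \<J>" "E J = F" "k J = i" "S = Q J" by auto
            have "q \<in> ?S" if q: "q \<in> S" for q
            proof -
              \<comment> \<open>Passing from \<open>P J\<close> to its subset \<open>F\<close>
                enlarges the complement and so decreases the distance. That
                \<open>\<Gamma> - P J\<close> is nonempty matters because the distance to the empty
                set is 0 by convention.\<close>
              have "infdist q (\<Gamma> - F) \<le> infdist q (\<Gamma> - P J)"
                using E(3)[OF J(1)] J(2) kQP(7)[OF J(1)] by (intro infdist_mono) auto
              then show ?thesis using kQP(8)[OF J(1), of q] q J E(2)[OF J(1)] by auto
            qed
            then show "id S \<in> sets (hausdorff_measure d) \<and> id S \<subseteq> ?S" using J cubeD(1)[OF kQP(1)] by auto
          qed (use fTi in auto)
          also have "\<dots> \<le> C3 * (C2 * sc i / sc j) powr \<zeta> * \<sigma> F" using strip[OF Fj, of "C2 * sc i"] C2 by simp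
          finally show ?thesis by simp
        qed
        have "(\<Sum>J\<in>?Ti. \<sigma> (Q J)) = (\<Sum>S\<in>Q ` ?Ti. \<Sum>J\<in>{J\<in>?Ti. Q J = S}. \<sigma> (Q J))"
          by (rule sum.image_gen[OF fTi])
        also have "\<dots> = (\<Sum>S\<in>Q ` ?Ti. real (card {J\<in>?Ti. Q J = S}) * \<sigma> S)"
          by (intro sum.cong refl) simp
        also have "\<dots> \<le> (\<Sum>S\<in>Q ` ?Ti. M * \<sigma> S)"
          by (intro sum_mono mult_right_mono mult measure_nonneg)
        also have "\<dots> = M * (\<Sum>S\<in>Q ` ?Ti. \<sigma> S)" by (simp add: sum_distrib_left)
        also have "\<dots> \<le> M * (C3 * (C2 * sc i / sc j) powr \<zeta> * \<sigma> F)"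
          by (rule mult_left_mono[OF X M0])
        finally have Y: "(\<Sum>J\<in>?Ti. \<sigma> (Q J)) \<le> M * (C3 * (C2 * sc i / sc j) powr \<zeta> * \<sigma> F)" .
        have "(\<Sum>J\<in>?Ti. snd J powr d) \<le> (\<Sum>J\<in>?Ti. Cd / a0 powr d * \<sigma> (Q J))"
        proof (rule sum_mono)
          fix J assume J: "J \<in> ?Ti"
          then have J': "J \<in> \<J>" by auto
          have "1 * snd J \<le> rn * snd J" using rn1 W_pos[OF JW[OF J']] by (intro mult_right_mono) auto
          then have "snd J \<le> sc (k J)" using kQP(4)[OF J'] by linarith
          then have "snd J powr d \<le> sc (k J) powr d" using W_pos[OF JW[OF J']] d0 by (intro powr_mono2) auto
          moreover have "a0 powr d * sc (k J) powr d \<le> Cd * \<sigma> (Q J)"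
            using cube_\<sigma>(1)[OF kQP(1)[OF J']] Cd0 by (simp add: powr_mult field_simps)
          moreover have "0 < a0 powr d" using a0 by simp
          ultimately have "a0 powr d * snd J powr d \<le> Cd * \<sigma> (Q J)"
            using mult_left_mono[of "snd J powr d" "sc (k J) powr d" "a0 powr d"] by linarith
          then show "snd J powr d \<le> Cd / a0 powr d * \<sigma> (Q J)" using a0 by (simp add: field_simps)
        qed
        also have "\<dots> = Cd / a0 powr d * (\<Sum>J\<in>?Ti. \<sigma> (Q J))" by (simp add: sum_distrib_left)
        also have "\<dots> \<le> Cd / a0 powr d * (M * (C3 * (C2 * sc i / sc j) powr \<zeta> * \<sigma> F))"
          using Cd0 a0 by (intro mult_left_mono[OF Y]) auto
        finally show ?thesis .
      qed
      have "(\<Sum>J\<in>?T. snd J powr d) = (\<Sum>i\<in>k ` ?T. \<Sum>J\<in>{J\<in>?T. k J = i}. snd J powr d)"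
        by (rule sum.image_gen[OF fT])
      also have "\<dots> \<le> (\<Sum>i\<in>k ` ?T. Cd / a0 powr d * (M * (C3 * (C2 * sc i / sc j) powr \<zeta> * \<sigma> F)))"
        by (intro sum_mono level)
      also have "\<dots> = (\<Sum>i\<in>k ` ?T. (Cd / a0 powr d * (M * (C3 * C2 powr \<zeta> * (1 / sc j) powr \<zeta> * \<sigma> F))) * sc i powr \<zeta>)"
      proof (rule sum.cong[OF refl])
        fix i
        have "(C2 * sc i / sc j) powr \<zeta> = C2 powr \<zeta> * (1 / sc j) powr \<zeta> * sc i powr \<zeta>"
          using powr_mult[of "C2 * (1 / sc j)" "sc i" \<zeta>] powr_mult[of C2 "1 / sc j" \<zeta>] by (simp add: mult_ac)
        then show "Cd / a0 powr d * (M * (C3 * (C2 * sc i / sc j) powr \<zeta> * \<sigma> F)) =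
          (Cd / a0 powr d * (M * (C3 * C2 powr \<zeta> * (1 / sc j) powr \<zeta> * \<sigma> F))) * sc i powr \<zeta>" by simp
      qed
      also have "\<dots> = (Cd / a0 powr d * (M * (C3 * C2 powr \<zeta> * (1 / sc j) powr \<zeta> * \<sigma> F))) * (\<Sum>i\<in>k ` ?T. sc i powr \<zeta>)"
        by (rule sum_distrib_left[symmetric])
      also have "\<dots> \<le> (Cd / a0 powr d * (M * (C3 * C2 powr \<zeta> * (1 / sc j) powr \<zeta> * \<sigma> F))) * ((L0 * sc j) powr \<zeta> / (1 - 2 powr (- \<zeta>)))"
      proof (rule mult_left_mono[OF geometric_scale_sum])
        show "finite (k ` ?T)" using fT by simp
        \<comment> \<open>\<open>Q J\<close> lies in \<open>F\<close>, so its scale exceeds that of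
          \<open>F\<close> at most by \<open>L0\<close>; this bounds the leading term of the
          geometric series.\<close>
        show "sc i \<le> L0 * sc j" if "i \<in> k ` ?T" for i
          using that sub_cube_scale[OF kQP(1) Fj] E(2) by auto
      qed (use \<zeta>0 L0_pos Cd0 a0 M0 C3 in auto)
      also have "\<dots> = G * \<sigma> F"
      proof -
        have "(1 / sc j) powr \<zeta> * (L0 * sc j) powr \<zeta> = L0 powr \<zeta>"
          by (simp add: powr_mult[symmetric])
        then show ?thesis by (simp add: G_def mult_ac)
      qed
      finally show ?thesis .
    qed
    obtain g where g: "g \<in> \<Gamma>" "dist x g = \<delta> x" by (rule \<delta>_attained)
    have "(\<Sum>J\<in>\<J>. snd J powr d) = (\<Sum>F\<in>E ` \<J>. \<Sum>J\<in>{J\<in>\<J>. E J = F}. snd J powr d)"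
      by (rule sum.image_gen[OF fin])
    also have "\<dots> \<le> (\<Sum>F\<in>E ` \<J>. G * \<sigma> F)" by (intro sum_mono inner)
    also have "\<dots> = G * (\<Sum>F\<in>E ` \<J>. measure (hausdorff_measure d) (id F))" by (simp add: sum_distrib_left)
    also have "\<dots> \<le> G * \<sigma> (\<Gamma> \<inter> ball g (R0 * r))"
    proof (rule mult_left_mono[OF sum_measure_disjoint_le G0])
      show "disjoint_family_on id (E ` \<J>)"
        unfolding disjoint_family_on_def
      proof (intro ballI impI)
        fix S S' assume "S \<in> E ` \<J>" "S' \<in> E ` \<J>" "S \<noteq> S'"
        then show "id S \<inter> id S' = {}" using E_meet unfolding id_apply by blast
      qed
      fix F assume "F \<in> E ` \<J>"
      then obtain J where J: "J \<in> \<J>" "F = E J" by blast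
      obtain q where q: "q \<in> Q J" using cubeD(6)[OF kQP(1)[OF J(1)]] by auto
      have Fl: "F \<in> \<DD> (l J)" using E(1) J by simp
      have "sc (l J) \<le> sc kr" by (rule sc_mono) (simp add: l_def)
      then have sl: "sc (l J) \<le> 2 * r" using kr by linarith
      have "dist g y < R0 * r" if y: "y \<in> F" for y
      proof -
        have "dist q y < A0 * sc (l J)" using cube_dist[OF Fl] q y E(2)[OF J(1)] J by blast
        also have "\<dots> \<le> A0 * (2 * r)" using sl A01 by (intro mult_left_mono) auto
        finally have "dist q y < A0 * (2 * r)" .
        moreover have "dist x q \<le> (1 + CW * L0) * r" using Qx[OF J(1) q] .
        ultimately show ?thesis using dist_triangle[of g y x] dist_triangle[of x y q] g(2) r
          by (simp add: R0_def algebra_simps dist_commute)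
      qed
      then show "id F \<in> sets (hausdorff_measure d) \<and> id F \<subseteq> \<Gamma> \<inter> ball g (R0 * r)" using cubeD(1,2)[OF Fl] by auto
    qed (use fin \<Gamma>_ball_fm g in auto)
    also have "\<dots> \<le> G * (Cd * (R0 * r) powr d)"
      using \<sigma>_ball(2)[OF g(1), of "R0 * r"] R0 r G0 by (intro mult_left_mono) auto
    also have "\<dots> = G * (Cd * R0 powr d) * r powr d" by (simp add: powr_mult)
    finally show ?thesis .
  qed
  define C where "C = G * (Cd * R0 powr d) + 1"
  have "0 \<le> G * (Cd * R0 powr d)" using G0 Cd0 by simp
  then have "0 < C" by (simp add: C_def)
  moreover have "(\<Sum>J\<in>\<J>. snd J powr d) \<le> C * r powr d"
    if "0 < r \<and> \<delta> x \<le> r \<and> finite \<J> \<and> \<J> \<subseteq> {J\<in>W. box_set J \<inter> frontier \<Omega> \<inter> ball x r \<noteq> {}}" for x r \<J>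
  proof -
    have "(\<Sum>J\<in>\<J>. snd J powr d) \<le> G * (Cd * R0 powr d) * r powr d" using main that by blast
    also have "\<dots> \<le> C * r powr d" by (intro mult_right_mono) (auto simp: C_def)
    finally show ?thesis .
  qed
  ultimately show ?thesis by blast
qed

text \<open>Off \<Gamma> the frontier is covered by countably many Whitney boxes, and \<Gamma> is a
  null set of \<open>surf\<close> because the weight is 0 there.\<close>

lemma surf_upper_large:
  "\<exists>C>0. \<forall>x r. 0 < r \<and> \<delta> x \<le> r \<longrightarrow> emeasure surf (frontier \<Omega> \<inter> ball x r) \<le> ennreal (C * r powr d)"
proof -
  obtain C1 where C1: "0 < C1" "\<And>J. J \<in> W \<Longrightarrow> emeasure surf (frontier \<Omega> \<inter> box_set J) \<le> ennreal (C1 * snd J powr d)"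
    using surf_box by blast
  obtain C2 where C2: "0 < C2" "\<And>x r \<J>. 0 < r \<Longrightarrow> \<delta> x \<le> r \<Longrightarrow> finite \<J> \<Longrightarrow>
     \<J> \<subseteq> {J\<in>W. box_set J \<inter> frontier \<Omega> \<inter> ball x r \<noteq> {}} \<Longrightarrow> (\<Sum>J\<in>\<J>. snd J powr d) \<le> C2 * r powr d"
    using boundary_boxes_sum by blast
  have "emeasure surf (frontier \<Omega> \<inter> ball x r) \<le> ennreal (C1 * C2 * r powr d)" if r: "0 < r" "\<delta> x \<le> r" for x r
  proof -
    let ?W = "{J\<in>W. box_set J \<inter> frontier \<Omega> \<inter> ball x r \<noteq> {}}"
    have \<Gamma>0: "emeasure surf \<Gamma> = 0"
    proof -
      have eq: "(\<lambda>X. ennreal (w X) * indicator \<Gamma> X) = (\<lambda>X. 0)"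
        using \<alpha>_pos by (auto simp: w_eq fun_eq_iff split: split_indicator)
      show ?thesis unfolding emeasure_surf[OF \<Gamma>_borel] eq by simp
    qed
    have fb: "frontier \<Omega> \<inter> box_set J \<in> sets surf" for J
      unfolding sets_surf by (intro sets.Int frontier_borel borel_box_set)
    have Ub: "(\<Union>J\<in>?W. frontier \<Omega> \<inter> box_set J) \<in> sets surf"
      using countable_subset[OF _ countable_W, of ?W] fb by (intro sets.countable_UN') auto
    have "frontier \<Omega> \<inter> ball x r \<subseteq> (\<Union>J\<in>?W. frontier \<Omega> \<inter> box_set J) \<union> \<Gamma>"
      using W_cover by blast
    then have "emeasure surf (frontier \<Omega> \<inter> ball x r) \<le> emeasure surf ((\<Union>J\<in>?W. frontier \<Omega> \<inter> box_set J) \<union> \<Gamma>)"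
      using Ub \<Gamma>_borel by (intro emeasure_mono) auto
    also have "\<dots> \<le> emeasure surf (\<Union>J\<in>?W. frontier \<Omega> \<inter> box_set J) + emeasure surf \<Gamma>"
      using Ub \<Gamma>_borel by (intro emeasure_subadditive) auto
    also have "\<dots> = emeasure surf (\<Union>J\<in>?W. frontier \<Omega> \<inter> box_set J)" using \<Gamma>0 by simp
    also have "\<dots> \<le> ennreal (C1 * C2 * r powr d)"
    proof (rule emeasure_UN_le_finite)
      show "countable ?W" using countable_subset[OF _ countable_W] by auto
      fix F assume F: "finite F" "F \<subseteq> ?W"
      have "emeasure surf (\<Union>J\<in>F. frontier \<Omega> \<inter> box_set J) \<le> (\<Sum>J\<in>F. emeasure surf (frontier \<Omega> \<inter> box_set J))"
        using F fb by (intro emeasure_subadditive_finite) auto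
      also have "\<dots> \<le> (\<Sum>J\<in>F. ennreal (C1 * snd J powr d))" using F C1(2) by (intro sum_mono) auto
      also have "\<dots> = ennreal (C1 * (\<Sum>J\<in>F. snd J powr d))"
        using C1 by (subst sum_ennreal) (auto simp: sum_distrib_left)
      also have "\<dots> \<le> ennreal (C1 * (C2 * r powr d))"
        using C2(2)[OF r F] C1(1) by (intro ennreal_leI mult_left_mono) auto
      finally show "emeasure surf (\<Union>J\<in>F. frontier \<Omega> \<inter> box_set J) \<le> ennreal (C1 * C2 * r powr d)"
        by (simp add: mult.assoc)
    qed (use fb in auto)
    finally show ?thesis .
  qed
  moreover have "0 < C1 * C2" using C1 C2 by simp
  ultimately show ?thesis by blast
qed

end

section \<open>Lower bound at large scales\<close>

lemma sum_emeasure_overlap_le: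
  assumes T: "finite T" "\<And>P. P \<in> T \<Longrightarrow> A P \<in> sets M \<and> A P \<subseteq> G" and G: "G \<in> sets M"
    and N: "\<And>y. real (card {P\<in>T. y \<in> A P}) \<le> N"
  shows "(\<Sum>P\<in>T. emeasure M (A P)) \<le> ennreal N * emeasure M G"
proof -
  have "(\<Sum>P\<in>T. emeasure M (A P)) = (\<Sum>P\<in>T. (\<integral>\<^sup>+y. indicator (A P) y \<partial>M))"
    using T by (intro sum.cong) auto
  also have "\<dots> = (\<integral>\<^sup>+y. (\<Sum>P\<in>T. indicator (A P) y) \<partial>M)"
    by (intro nn_integral_sum[symmetric] borel_measurable_indicator) (use T in blast)
  also have "\<dots> \<le> (\<integral>\<^sup>+y. ennreal N * indicator G y \<partial>M)"
  proof (intro nn_integral_mono)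
    fix y
    have "(\<Sum>P\<in>T. indicator (A P) y) = (\<Sum>P\<in>{P\<in>T. y \<in> A P}. (1::ennreal))"
      using T(1) by (intro sum.mono_neutral_cong_right) auto
    also have "\<dots> = ennreal (real (card {P\<in>T. y \<in> A P}))" by (simp add: ennreal_of_nat_eq_real_of_nat)
    also have "\<dots> \<le> ennreal N * indicator G y"
    proof (cases "y \<in> G")
      case True then show ?thesis using N[of y] by (simp add: ennreal_leI)
    next
      case False
      then have e: "{P\<in>T. y \<in> A P} = {}" using T(2) by blast
      show ?thesis unfolding e by simp
    qed
    finally show "(\<Sum>P\<in>T. indicator (A P) y) \<le> ennreal N * indicator G y" .
  qed
  also have "\<dots> = ennreal N * emeasure M G" using G by (simp add: nn_integral_cmult_indicator)
  finally show ?thesis .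
qed

lemma ennreal_divide_le:
  assumes "ennreal a \<le> ennreal k * X" "0 < k" shows "ennreal (a / k) \<le> X"
proof -
  have "ennreal (a / k) = ennreal (1 / k) * ennreal a"
    using assms(2) by (simp add: ennreal_mult'[symmetric])
  also have "\<dots> \<le> ennreal (1 / k) * (ennreal k * X)" using assms(1) by (intro mult_left_mono) auto
  also have "\<dots> = X" using assms(2) by (simp add: mult.assoc[symmetric] ennreal_mult[symmetric])
  finally show ?thesis .
qed

context sawtooth begin

text \<open>A corkscrew point at a small scale above the centre of a removed cube lies outside the domain, the
  corkscrew point of its parent lies inside; a Harnack path between them crosses the boundary far from \<open>\<Gamma>\<close>.\<close>

lemma boundary_above_removed_cube:
  "\<exists>b>0. \<exists>C>0. \<forall>P\<in>\<F>. \<forall>k. P \<in> \<DD> k \<and> cl P = sc k \<longrightarrow>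
     (\<exists>x\<in>frontier \<Omega>. b * sc k \<le> \<delta> x \<and> (\<forall>q\<in>P. dist x q \<le> C * sc k))"
proof -
  \<comment> \<open>Chosen with \<open>\<epsilon> * (1 + CW * CW) = 1/2\<close>, so that a kept cube
    with a dilated box containing \<open>X\<close> would be contained in \<open>P\<close>.\<close>
  define \<epsilon> where "\<epsilon> = 1 / (2 * (1 + CW * CW))"
  have cw: "0 \<le> CW * CW" using CW1 by simp
  have \<epsilon>: "0 < \<epsilon>" "\<epsilon> < 1" "\<epsilon> * (1 + CW * CW) = 1/2" 
  proof -
    define v where "v = CW * CW"
    have "0 \<le> v" using cw by (simp only: v_def)
    then show "0 < \<epsilon>" "\<epsilon> < 1" "\<epsilon> * (1 + CW * CW) = 1/2"
      unfolding \<epsilon>_def v_def[symmetric] by (auto simp: field_simps)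
  qed
  define s0 where "s0 = c * (\<epsilon> * a0)"
  have s0: "0 < s0" using c01 \<epsilon> a0 by (simp add: s0_def)
  have s01: "s0 \<le> c * a0" "s0 \<le> 1"
    using \<epsilon> a0 a01 c01 mult_mono[of \<epsilon> 1 a0 1] unfolding s0_def
    by (auto intro!: mult_left_mono mult_le_one)
  define B where "B = 1 + A0 + 4 * (A0 * L0)"
  have B: "1 \<le> B" using A01 L0_pos by (simp add: B_def)
  \<comment> \<open>In units of \<open>sc k\<close>, \<open>B\<close> bounds the distance between
    the two corkscrew points from above and \<open>s0\<close> bounds their distances to \<Gamma>
    from below.\<close>
  define \<Lambda> where "\<Lambda> = B / s0"
  have \<Lambda>: "1 \<le> \<Lambda>" using B s0 s01 by (simp add: \<Lambda>_def field_simps)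
  define b1 where "b1 = cH * \<Lambda> powr (- d / (real CARD('n) - 1 - d))"
  have b1: "0 < b1" using cH01 \<Lambda> by (simp add: b1_def)
  \<comment> \<open>The factor 1/2 serves the two end pieces, which stay within \<open>s/2\<close>
    of the corkscrew points; \<open>b1\<close> serves the middle segment.\<close>
  define b where "b = min (1/2) b1 * s0"
  have b: "0 < b" using b1 s0 by (simp add: b_def)
  define C where "C = B + 1 + 1 + A0"
  have C: "0 < C" using B A01 by (simp add: C_def)
  have main: "\<exists>x\<in>frontier \<Omega>. b * sc k \<le> \<delta> x \<and> (\<forall>q\<in>P. dist x q \<le> C * sc k)"
    if P: "P \<in> \<F>" "P \<in> \<DD> k" "cl P = sc k" for P k
  proof -
    obtain k' R where k': "P \<in> \<DD> k'" "cl P = sc k'" "R \<in> \<DD> (k' - 1)" "P \<subseteq> R" "R \<in> DF" by (rule \<F>_parent[OF P(1)])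
    have "k' = k" using P(3) k'(2) sc_le_iff[of k k'] sc_le_iff[of k' k] by linarith
    then have R: "R \<in> \<DD> (k - 1)" using k'(3) by simp
    have Pc: "P \<in> all_cubes \<DD>" and Rc: "R \<in> all_cubes \<DD>" using cubeD(7) P R by blast+
    have sk: "sc (k - 1) = 2 * sc k" using sc_diff[of k 1] by simp
    have clR: "cl R \<le> L0 * (2 * sc k)" "2 * sc k \<le> cl R" using cl_bounds[OF R] sk by simp_all
    define s where "s = s0 * sc k"
    have s: "0 < s" using s0 by (simp add: s_def)
    have r0: "0 < \<epsilon> * a0 * sc k" using \<epsilon> a0 by simp
    obtain X where X: "ball X (c * (\<epsilon> * a0 * sc k)) \<subseteq> ball (xc P) (\<epsilon> * a0 * sc k) \<inter> - \<Gamma>"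
      using corkscrew xc_props(1)[OF Pc] r0 unfolding corkscrew_constant_def corkscrew_point_def by blast
    have "X \<in> ball X (c * (\<epsilon> * a0 * sc k))" using c01 r0 by simp
    then have "X \<in> ball (xc P) (\<epsilon> * a0 * sc k)" using X by blast
    then have Xd: "dist (xc P) X < \<epsilon> * a0 * sc k" by simp
    have se: "s = c * (\<epsilon> * a0 * sc k)" by (simp add: s_def s0_def)
    have \<delta>X: "s \<le> \<delta> X" unfolding se using X by (intro infdist_ge) blast
    have "X \<notin> \<Omega>"
    proof
      assume "X \<in> \<Omega>"
      then obtain I where I: "I \<in> WF" "X \<in> star I" using \<Omega>_star by blast
      then obtain Q' where Q': "I \<in> WQ Q'" "Q' \<in> DF" by (auto simp: WF_def)
      have Q'c: "Q' \<in> all_cubes \<DD>" using DF_cube Q' by blast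
      have IW: "I \<in> W" using WF_W I by blast
      have "\<delta> X \<le> dist X (xc P)" using xc_props(1)[OF Pc] by (intro infdist_le)
      then have "4 * rn * snd I \<le> \<epsilon> * a0 * sc k" using \<delta>_star_ge[OF IW I(2)] Xd by (simp add: dist_commute)
      moreover have "1 * snd I \<le> rn * snd I" using rn1 W_pos[OF IW] by (intro mult_right_mono) auto
      ultimately have sI: "snd I \<le> \<epsilon> * a0 * sc k" using W_pos[OF IW] by linarith
      have clQ': "cl Q' \<le> CW * (\<epsilon> * a0 * sc k)"
        using order_trans[OF region_props(1)[OF Q'c Q'(1)] mult_left_mono[OF sI]] CW1 by simp
      have "Q' \<subseteq> P"
      proof
        fix z assume z: "z \<in> Q'"
        have "dist X z \<le> CW * (CW * (\<epsilon> * a0 * sc k))"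
          using order_trans[OF region_props(3)[OF Q'c Q'(1) I(2) z] mult_left_mono[OF clQ']] CW1 by simp
        then have "dist (xc P) z < \<epsilon> * a0 * sc k + CW * (CW * (\<epsilon> * a0 * sc k))"
          using Xd dist_triangle[of "xc P" z X] by linarith
        also have "\<dots> = (\<epsilon> * (1 + CW * CW)) * (a0 * sc k)" by (simp add: algebra_simps)
        also have "\<dots> < a0 * cl P" unfolding \<epsilon>(3) P(3) using a0 by simp
        finally have "z \<in> ball (xc P) (a0 * cl P)" by simp
        moreover have "z \<in> \<Gamma>" using z Q'c by (auto simp: all_cubes_def dest: cubeD(2))
        ultimately show "z \<in> P" using xc_props(3)[OF Pc] by blast
      qed
      then show False using DF_iff[OF Q'c] Q'(2) P(1) by blast
    qed
    have "XQ R \<in> \<Omega>"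
    proof -
      have "0 < \<theta> / (2 * CW) * cl R" using \<theta>0 CW1 cl_pos[of R] by (intro mult_pos_pos) auto
      then show ?thesis using XQ_ball[OF k'(5)] by (meson centre_in_ball subsetD)
    qed
    have \<delta>R: "s \<le> \<delta> (XQ R)"
    proof -
      have "s \<le> c * a0 * sc k" unfolding s_def using s01 by (intro mult_right_mono) auto
      also have "\<dots> \<le> c * a0 * cl R" using clR c01 a0 by (intro mult_left_mono) (auto intro: order_trans[OF _ clR(2)])
      finally show ?thesis using XQ_props(1)[OF Rc] by linarith
    qed
    have ea: "\<epsilon> * a0 * sc k \<le> 1 * sc k" using \<epsilon> a0 a01 by (intro mult_right_mono mult_le_one) auto
    have XP: "dist X (xc P) \<le> sc k" using Xd ea dist_commute[of X "xc P"] by linarith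
    have d1: "dist X (XQ R) \<le> B * sc k"
    proof -
      have "dist (xc P) (xc R) \<le> A0 * cl R"
        using cl_dist[OF Rc _ xc_props(2)[OF Rc]] xc_props(2)[OF Pc] k'(4) by (simp add: less_imp_le subsetD)
      also have "\<dots> \<le> A0 * (L0 * (2 * sc k))" using clR A01 by (intro mult_left_mono) auto
      finally have "dist (xc P) (xc R) \<le> 2 * (A0 * L0) * sc k" by simp
      moreover have "a0 * cl R \<le> A0 * (L0 * (2 * sc k))"
        using clR(1) a0 a01 A01 cl_pos[of R] by (intro mult_mono) auto
      then have "dist (xc R) (XQ R) \<le> 2 * (A0 * L0) * sc k" using XQ_props(2)[OF Rc] by (simp add: dist_commute)
      moreover have "B * sc k = sc k + A0 * sc k + 4 * (A0 * L0) * sc k" by (simp add: B_def algebra_simps)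
      moreover have "0 \<le> A0 * sc k" using A01 by simp
      ultimately show ?thesis using XP dist_triangle[of X "XQ R" "xc P"] dist_triangle[of "xc P" "XQ R" "xc R"]
        by linarith
    qed
    have dL: "dist X (XQ R) \<le> \<Lambda> * s" using d1 s0 by (simp add: \<Lambda>_def s_def)
    obtain Y1 Y2 where Y: "harnack_segment d cH \<Gamma> s \<Lambda> X (XQ R) Y1 Y2"
      using harnack \<Lambda> s \<delta>X \<delta>R dL unfolding harnack_constant_def by blast
    then have Y1: "dist X Y1 < s/2" and Y2: "dist (XQ R) Y2 < s/2"
      and Yd: "b1 * s \<le> setdist (closed_segment Y1 Y2) \<Gamma>"
      unfolding harnack_segment_def harnack_distance_def b1_def by auto
    let ?S = "closed_segment X Y1 \<union> closed_segment Y1 Y2 \<union> closed_segment Y2 (XQ R)"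
    have bs: "b * sc k \<le> s / 2" "b * sc k \<le> b1 * s"
      unfolding b_def s_def using s0 mult_right_mono[of "min (1/2) b1" "1/2" "s0 * sc k"]
        mult_right_mono[of "min (1/2) b1" b1 "s0 * sc k"] by (auto simp: mult.assoc)
    have \<delta>S: "b * sc k \<le> \<delta> p" if p: "p \<in> ?S" for p
    proof -
      consider "p \<in> closed_segment X Y1" | "p \<in> closed_segment Y1 Y2" | "p \<in> closed_segment (XQ R) Y2"
        using p by (auto simp: closed_segment_commute)
      then show ?thesis
      proof cases
        case 1
        have "closed_segment X Y1 \<subseteq> cball X (s/2)" using Y1 s by (intro closed_segment_subset) auto
        then have "dist X p \<le> s/2" using 1 by auto
        then show ?thesis using \<delta>_lipschitz[of X p] \<delta>X bs by linarith
      next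
        case 2
        obtain g where g: "g \<in> \<Gamma>" "dist p g = \<delta> p" by (rule \<delta>_attained)
        have "b1 * s \<le> dist p g" using Yd setdist_le_dist[OF 2 g(1)] by linarith
        then show ?thesis using g bs by linarith
      next
        case 3
        have "closed_segment (XQ R) Y2 \<subseteq> cball (XQ R) (s/2)" using Y2 s by (intro closed_segment_subset) auto
        then have "dist (XQ R) p \<le> s/2" using 3 by auto
        then show ?thesis using \<delta>_lipschitz[of "XQ R" p] \<delta>R bs by linarith
      qed
    qed
    have s_le: "s \<le> sc k" unfolding s_def using s01(2) by (simp add: mult_le_cancel_right1)
    have inS: "X \<in> cball X ((B + 1) * sc k)" "Y1 \<in> cball X ((B + 1) * sc k)" "Y2 \<in> cball X ((B + 1) * sc k)"
      "XQ R \<in> cball X ((B + 1) * sc k)"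
    proof -
      have "0 \<le> B * sc k" using B by simp
      then show "X \<in> cball X ((B + 1) * sc k)" "Y1 \<in> cball X ((B + 1) * sc k)"
        "Y2 \<in> cball X ((B + 1) * sc k)" "XQ R \<in> cball X ((B + 1) * sc k)"
        using Y1 Y2 d1 s_le s dist_triangle[of X Y2 "XQ R"] by (auto simp: algebra_simps)
    qed
    then have Sb: "?S \<subseteq> cball X ((B + 1) * sc k)" by (intro Un_least closed_segment_subset) auto
    have "connected ?S"
    proof (intro connected_Un connected_segment)
      show "closed_segment X Y1 \<inter> closed_segment Y1 Y2 \<noteq> {}" by (metis IntI ends_in_segment empty_iff)
      show "(closed_segment X Y1 \<union> closed_segment Y1 Y2) \<inter> closed_segment Y2 (XQ R) \<noteq> {}"
        by (metis IntI UnI2 ends_in_segment empty_iff)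
    qed
    moreover have "?S \<inter> \<Omega> \<noteq> {}" using \<open>XQ R \<in> \<Omega>\<close> by auto
    moreover have "?S - \<Omega> \<noteq> {}" using \<open>X \<notin> \<Omega>\<close> by auto
    ultimately have "?S \<inter> frontier \<Omega> \<noteq> {}" by (rule connected_Int_frontier)
    then obtain x where x: "x \<in> ?S" "x \<in> frontier \<Omega>" by blast
    have "dist x q \<le> C * sc k" if q: "q \<in> P" for q
    proof -
      have "dist X x \<le> (B + 1) * sc k" using Sb x(1) by auto
      moreover have "dist (xc P) q \<le> A0 * sc k" using cube_dist[OF P(2) xc_props(2)[OF Pc] q] by simp
      ultimately show ?thesis
        using XP dist_triangle[of x q X] dist_triangle[of X q "xc P"] by (simp add: C_def algebra_simps dist_commute)
    qed
    then show ?thesis using \<delta>S[OF x(1)] x(2) by blast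
  qed
  show ?thesis
  proof (rule exI[of _ b], rule conjI[OF b], rule exI[of _ C], rule conjI[OF C], intro ballI allI impI)
    fix P k assume "P \<in> \<F>" "P \<in> \<DD> k \<and> cl P = sc k"
    then show "\<exists>x\<in>frontier \<Omega>. b * sc k \<le> \<delta> x \<and> (\<forall>q\<in>P. dist x q \<le> C * sc k)" by (intro main) auto
  qed
qed

text \<open>Every cube containing \<open>z\<close> is kept, so the points \<open>XQ Q\<close> of
  ever smaller cubes around \<open>z\<close> lie in \<Omega> and converge to
  \<open>z\<close>.\<close>

lemma kept_points_in_frontier:
  assumes z: "z \<in> \<Gamma>" "z \<notin> \<Union>\<F>" shows "z \<in> frontier \<Omega>"
proof -
  have "\<exists>y\<in>\<Omega>. dist y z < e" if e: "0 < e" for e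
  proof -
    define B where "B = (A0 + a0) * L0"
    have B: "0 < B" using A01 a0 L0_pos by (simp add: B_def)
    obtain k where k: "sc k < 2 * (e / (2 * B))" using ex_scale[of "e / (2 * B)"] e B by auto
    obtain Q where Q: "Q \<in> \<DD> k" "z \<in> Q" using cube_cover[OF z(1)] by blast
    have Qc: "Q \<in> all_cubes \<DD>" using cubeD(7)[OF Q(1)] .
    have QF: "Q \<in> DF" using DF_iff[OF Qc] z(2) Q(2) by blast
    have "0 < \<theta> / (2 * CW) * cl Q" using \<theta>0 CW1 cl_pos[of Q] by (intro mult_pos_pos) auto
    then have "XQ Q \<in> \<Omega>" using XQ_ball[OF QF] by (meson centre_in_ball subsetD)
    moreover have "dist (XQ Q) z < e"
    proof -
      have "dist (XQ Q) z < (A0 + a0) * cl Q"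
        using XQ_props(2)[OF Qc] cl_dist[OF Qc xc_props(2)[OF Qc] Q(2)] dist_triangle[of "XQ Q" z "xc Q"]
        by (simp add: algebra_simps)
      also have "\<dots> \<le> (A0 + a0) * (L0 * sc k)" using cl_bounds(2)[OF Q(1)] A01 a0 by (intro mult_left_mono) auto
      also have "\<dots> = B * sc k" by (simp add: B_def)
      also have "\<dots> < e" using k B by (simp add: field_simps)
      finally show ?thesis .
    qed
    ultimately show ?thesis by blast
  qed
  then have "z \<in> closure \<Omega>" by (simp add: closure_approachable)
  moreover have "z \<notin> \<Omega>" using \<Omega>_\<Gamma> z by blast
  ultimately show ?thesis using open_\<Omega> by (simp add: frontier_def interior_open)
qed

text \<open>A kept cube \<open>Q\<close> near \<open>x\<close> of scale about \<open>r\<close> has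
  measure about \<open>r powr d\<close>. Its points outside the removed cubes are counted by the
  first part of \<open>sigma_star\<close>; each removed cube in \<open>Q\<close> is paid for by the
  boundary piece \<open>A P\<close> above it, and these pieces overlap boundedly.\<close>

lemma sigma_star_lower_large:
  "\<exists>b>0. \<exists>M>0. \<forall>x\<in>frontier \<Omega>. \<forall>r>0. M * \<delta> x \<le> r \<longrightarrow>
     ennreal (b * r powr d) \<le> emeasure (sigma_star d \<Gamma> \<Omega>) (frontier \<Omega> \<inter> ball x r)"
proof -
  obtain C where C: "1 \<le> C" and near: "\<And>x R. x \<in> closure \<Omega> \<Longrightarrow> 0 < R \<Longrightarrow> \<delta> x \<le> R \<Longrightarrow>
     (\<exists>k. \<exists>Q\<in>\<DD> k. Q \<in> DF \<and> R \<le> sc k \<and> sc k \<le> C * R \<and> Q \<subseteq> cball x (C * R))"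
    using near_cube by blast
  obtain b C' where b: "0 < b" and C': "0 < C'" and above: "\<forall>P\<in>\<F>. \<forall>k. P \<in> \<DD> k \<and> cl P = sc k \<longrightarrow>
     (\<exists>x\<in>frontier \<Omega>. b * sc k \<le> \<delta> x \<and> (\<forall>q\<in>P. dist x q \<le> C' * sc k))"
    using boundary_above_removed_cube by (elim exE conjE) (rule that)
  obtain b2 where b2: "0 < b2" and loc: "\<And>x t. x \<in> frontier \<Omega> \<Longrightarrow> x \<notin> \<Gamma> \<Longrightarrow> 0 < t \<Longrightarrow> t \<le> \<kappa>s * \<delta> x \<Longrightarrow>
     ennreal (b2 * (t ^ (CARD('n) - 1) * \<delta> x powr (- \<alpha>))) \<le> emeasure surf (frontier \<Omega> \<inter> ball x t)"
    using surf_local_lower by blast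
  have \<kappa>s: "0 < \<kappa>s" "\<kappa>s \<le> 1/2" using \<kappa>_pos \<kappa>_small by (auto simp: \<kappa>s_def)
  \<comment> \<open>Small enough for the local lower bound at \<open>xp P\<close>, and at most
    \<open>b / 2\<close>, so that \<open>A P\<close> stays at distance at least
    \<open>b / 2 * sc (lev P)\<close> from \<Gamma>.\<close>
  define \<tau> where "\<tau> = \<kappa>s * b"
  have \<tau>: "0 < \<tau>" "\<tau> \<le> b / 2" using \<kappa>s b by (auto simp: \<tau>_def)
  define b3 where "b3 = b2 * (\<tau> ^ (CARD('n) - 1) * C' powr (- \<alpha>)) / (Cd * A0 powr d)"
  have b3: "0 < b3" using b2 \<tau> C' Cd0 A01 by (simp add: b3_def)
  define M where "M = (C + (C' + b) * C) + 1"
  have M: "0 < M" using C C' b by (simp add: M_def add_pos_pos)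
  define D where "D = 2 * C' / b + 2"
  have D: "0 < D" using C' b by (simp add: D_def add_pos_pos)
  \<comment> \<open>Ratio of the upper bound for the measure of a surface ball of radius
    \<open>(D + 2) * \<delta> y\<close> to the lower bound for the measure of a removed cube
    \<open>P\<close> with \<open>y\<close> in \<open>A P\<close>; the powers of
    \<open>\<delta> y\<close> cancel.\<close>
  define N where "N = Cd * ((D + 2) powr d) / (a0 powr d * (1 / (C' + b)) powr d / Cd)"
  have N: "0 < N" using Cd0 D a0 C' b by (simp add: N_def)
  define K' where "K' = 1 + N / b3"
  have K': "0 < K'" using N b3 by (simp add: K'_def add_pos_pos)
  define b4 where "b4 = (a0 / M) powr d / Cd / K'"
  have b4: "0 < b4" using a0 M Cd0 K' by (simp add: b4_def)
  have "ennreal (b4 * r powr d) \<le> emeasure (sigma_star d \<Gamma> \<Omega>) (frontier \<Omega> \<inter> ball x r)"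
    if x: "x \<in> frontier \<Omega>" and r: "0 < r" "M * \<delta> x \<le> r" for x r
  proof -
    define R where "R = r / M"
    have R: "0 < R" "\<delta> x \<le> R" "r = M * R" using r M by (auto simp: R_def field_simps)
    obtain k Q where Q: "Q \<in> \<DD> k" "Q \<in> DF" "R \<le> sc k" "sc k \<le> C * R" "Q \<subseteq> cball x (C * R)"
      using near[OF frontier_closure[OF x] R(1,2)] by blast
    let ?G = "frontier \<Omega> \<inter> ball x r"
    let ?FQ = "{P\<in>\<F>. P \<inter> Q \<noteq> {}}"
    \<comment> \<open>The generation must be the one with \<open>cl P = sc j\<close>, as
      \<open>above\<close> assumes.\<close>
    define lev where "lev P = (SOME j. P \<in> \<DD> j \<and> cl P = sc j)" for P
    have lev: "P \<in> \<DD> (lev P)" "cl P = sc (lev P)" if "P \<in> \<F>" for P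
    proof -
      have "\<exists>j. P \<in> \<DD> j \<and> cl P = sc j" using \<F>_parent[OF that] by metis
      then have "P \<in> \<DD> (lev P) \<and> cl P = sc (lev P)" unfolding lev_def by (rule someI_ex)
      then show "P \<in> \<DD> (lev P)" "cl P = sc (lev P)" by auto
    qed
    have PQ: "P \<subseteq> Q" "sc (lev P) \<le> sc k" if P: "P \<in> ?FQ" for P
    proof -
      have PF: "P \<in> \<F>" "P \<inter> Q \<noteq> {}" using P by auto
      \<comment> \<open>A removed cube that meets \<open>Q\<close> and is not finer would contain
        \<open>Q\<close>, although \<open>Q\<close> is kept.\<close>
      have "\<not> lev P \<le> k"
      proof
        assume "lev P \<le> k"
        then have "Q \<subseteq> P" using cube_nested[OF _ Q(1) lev(1)[OF PF(1)]] PF(2) by blast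
        then show False using DF_iff[OF cubeD(7)[OF Q(1)]] Q(2) PF(1) by blast
      qed
      then show "P \<subseteq> Q" "sc (lev P) \<le> sc k"
        using cube_nested[OF _ lev(1)[OF PF(1)] Q(1)] PF(2) sc_mono[of k "lev P"] by auto
    qed
    have "\<exists>y. y \<in> frontier \<Omega> \<and> b * sc (lev P) \<le> \<delta> y \<and> (\<forall>q\<in>P. dist y q \<le> C' * sc (lev P))" if "P \<in> \<F>" for P
      using above[rule_format, OF that, of "lev P"] lev[OF that] by blast
    then obtain xp where xp: "\<And>P. P \<in> \<F> \<Longrightarrow> xp P \<in> frontier \<Omega>" "\<And>P. P \<in> \<F> \<Longrightarrow> b * sc (lev P) \<le> \<delta> (xp P)"
       "\<And>P q. P \<in> \<F> \<Longrightarrow> q \<in> P \<Longrightarrow> dist (xp P) q \<le> C' * sc (lev P)"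
      by metis
    define A where "A P = frontier \<Omega> \<inter> ball (xp P) (\<tau> * sc (lev P))" for P
    have \<delta>xp: "\<delta> (xp P) \<le> C' * sc (lev P)" if PF: "P \<in> \<F>" for P
    proof -
      obtain q where q: "q \<in> P" using cubeD(6)[OF lev(1)[OF PF]] by auto
      then have "\<delta> (xp P) \<le> dist (xp P) q" using cubeD(2)[OF lev(1)[OF PF]] by (intro infdist_le) auto
      then show ?thesis using xp(3)[OF PF q] by linarith
    qed
    have AG: "A P \<subseteq> ?G" if P: "P \<in> ?FQ" for P
    proof
      fix y assume y: "y \<in> A P"
      have PF: "P \<in> \<F>" using P by auto
      obtain q where q: "q \<in> P" "q \<in> Q" using P by blast
      have "\<tau> * sc (lev P) \<le> b * sc (lev P)" using \<tau> b by (intro mult_right_mono) auto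
      moreover have "dist (xp P) y < \<tau> * sc (lev P)" using y by (simp add: A_def)
      ultimately have "dist (xp P) y < b * sc (lev P)" by linarith
      then have "dist x y < C * R + (C' + b) * sc (lev P)"
        using xp(3)[OF PF q(1)] Q(5) q(2) dist_triangle[of x y q] dist_triangle[of q y "xp P"]
        by (fastforce simp: algebra_simps dist_commute subset_iff)
      also have "\<dots> \<le> C * R + (C' + b) * (C * R)"
        using PQ(2)[OF P] Q(4) C' b by (intro add_left_mono mult_left_mono) auto
      also have "\<dots> \<le> M * R" using R(1) by (simp add: M_def algebra_simps)
      finally show "y \<in> ?G" using y R(3) by (simp add: A_def)
    qed
    have surfP: "ennreal (b3 * \<sigma> P) \<le> emeasure surf (A P)" if P: "P \<in> \<F>" for P
    proof -
      let ?s = "sc (lev P)"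
      have \<delta>0: "0 < \<delta> (xp P)" using xp(2)[OF P] b by (smt (verit) mult_pos_pos sc_pos)
      then have nG: "xp P \<notin> \<Gamma>" by auto
      have "\<tau> * ?s = \<kappa>s * (b * ?s)" by (simp add: \<tau>_def)
      also have "\<dots> \<le> \<kappa>s * \<delta> (xp P)" using xp(2)[OF P] \<kappa>s by (intro mult_left_mono) auto
      finally have l: "ennreal (b2 * ((\<tau> * ?s) ^ (CARD('n) - 1) * \<delta> (xp P) powr (- \<alpha>))) \<le> emeasure surf (A P)"
        unfolding A_def using \<tau> by (intro loc[OF xp(1)[OF P] nG]) auto
      have "b3 * \<sigma> P \<le> b3 * (Cd * (A0 * ?s) powr d)"
        using cube_\<sigma>(2)[OF lev(1)[OF P]] b3 by (intro mult_left_mono) auto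
      also have "\<dots> = b2 * (\<tau> ^ (CARD('n) - 1) * C' powr (- \<alpha>)) * ?s powr d"
        using Cd0 A01 by (simp add: b3_def powr_mult)
      also have "?s powr d = ?s ^ (CARD('n) - 1) * ?s powr (- \<alpha>)"
      proof -
        have "?s ^ (CARD('n) - 1) = ?s powr (real CARD('n) - 1)"
          using n3 by (simp add: powr_realpow[symmetric] of_nat_diff)
        then show ?thesis by (simp add: powr_add[symmetric] \<alpha>_def)
      qed
      also have "b2 * (\<tau> ^ (CARD('n) - 1) * C' powr (- \<alpha>)) * (?s ^ (CARD('n) - 1) * ?s powr (- \<alpha>))
          = b2 * ((\<tau> * ?s) ^ (CARD('n) - 1) * (C' * ?s) powr (- \<alpha>))"
        unfolding powr_mult power_mult_distrib by (simp add: mult_ac)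
      also have "\<dots> \<le> b2 * ((\<tau> * ?s) ^ (CARD('n) - 1) * \<delta> (xp P) powr (- \<alpha>))"
        using \<delta>xp[OF P] \<delta>0 b2 \<tau> \<alpha>_pos by (intro mult_left_mono powr_mono2') auto
      finally show ?thesis using l by (meson ennreal_leI order_trans)
    qed
    \<comment> \<open>If \<open>y\<close> lies in \<open>A P\<close>, then \<open>P\<close> has
      scale comparable to \<open>\<delta> y\<close> and lies within a multiple of
      \<open>\<delta> y\<close> of \<open>y\<close>. Removed cubes are disjoint, so boundedly many
      of them qualify.\<close>
    have overlap: "real (card {P\<in>T. y \<in> A P}) \<le> N" if T: "finite T" "T \<subseteq> ?FQ" for T y
    proof (cases "{P\<in>T. y \<in> A P} = {}")
      case True
      show ?thesis unfolding True using N by simp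
    next
      case False
      let ?T = "{P\<in>T. y \<in> A P}"
      have PF: "P \<in> \<F>" "y \<in> A P" if "P \<in> ?T" for P using that T by auto
      have yb: "b / 2 * sc (lev P) \<le> \<delta> y" "\<delta> y \<le> (C' + b) * sc (lev P)" "dist (xp P) y \<le> b * sc (lev P)" if P: "P \<in> ?T" for P
      proof -
        have "dist (xp P) y < \<tau> * sc (lev P)" using PF(2)[OF P] by (simp add: A_def)
        also have "\<dots> \<le> b / 2 * sc (lev P)" using \<tau> by (intro mult_right_mono) auto
        finally have d: "dist (xp P) y < b / 2 * sc (lev P)" .
        then show "b / 2 * sc (lev P) \<le> \<delta> y" "\<delta> y \<le> (C' + b) * sc (lev P)" "dist (xp P) y \<le> b * sc (lev P)"
          using xp(2)[OF PF(1)[OF P]] \<delta>xp[OF PF(1)[OF P]] \<delta>_lipschitz[of "xp P" y] \<delta>_lipschitz[of y "xp P"] b sc_pos[of "lev P"]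
            mult_pos_pos[OF b sc_pos[of "lev P"]]
          by (simp_all add: algebra_simps dist_commute)
      qed
      obtain P0 where "P0 \<in> ?T" using False by blast
      then have \<delta>y: "0 < \<delta> y" using yb(1)[of P0] mult_pos_pos[OF b sc_pos[of "lev P0"]] by linarith
      obtain g where g: "g \<in> \<Gamma>" "dist y g = \<delta> y" by (rule \<delta>_attained)
      have "real (card ?T) * (a0 powr d * (1 / (C' + b)) powr d / Cd * \<delta> y powr d) \<le> \<sigma> (\<Gamma> \<inter> ball g (D * \<delta> y + 2 * \<delta> y))"
      proof (rule card_measure_disjoint_le[where A = id])
        show "finite ?T" using T by simp
        show "disjoint_family_on id ?T"
          unfolding disjoint_family_on_def using \<F>_eq PF(1) unfolding id_apply by blast
        fix P assume P: "P \<in> ?T"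
        have PD: "P \<in> \<DD> (lev P)" using lev PF P by blast
        have "q \<in> ball g (D * \<delta> y + 2 * \<delta> y)" if q: "q \<in> P" for q
        proof -
          have "dist y q \<le> b * sc (lev P) + C' * sc (lev P)"
            using yb(3)[OF P] xp(3)[OF PF(1)[OF P] q] dist_triangle[of y q "xp P"] by (simp add: dist_commute)
          also have "\<dots> = (2 + 2 * C' / b) * (b / 2 * sc (lev P))" using b by (simp add: field_simps)
          also have "\<dots> \<le> D * \<delta> y" unfolding D_def using yb(1)[OF P] C' b by (intro mult_mono) auto
          finally show ?thesis using g(2) \<delta>y dist_triangle[of g q y] by (simp add: dist_commute)
        qed
        then show "id P \<in> sets (hausdorff_measure d) \<and> id P \<subseteq> \<Gamma> \<inter> ball g (D * \<delta> y + 2 * \<delta> y)"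
          using cubeD(1,2)[OF PD] by auto
        have "1 / (C' + b) * \<delta> y \<le> sc (lev P)" using yb(2)[OF P] C' b by (simp add: field_simps)
        then have "(1 / (C' + b) * \<delta> y) powr d \<le> sc (lev P) powr d" using C' b \<delta>y d0 by (intro powr_mono2) auto
        then have "a0 powr d * (1 / (C' + b) * \<delta> y) powr d / Cd \<le> a0 powr d * sc (lev P) powr d / Cd"
          using Cd0 by (intro divide_right_mono mult_left_mono) auto
        also have "\<dots> \<le> \<sigma> P" using cube_\<sigma>(1)[OF PD] by (simp add: powr_mult)
        finally show "a0 powr d * (1 / (C' + b)) powr d / Cd * \<delta> y powr d \<le> \<sigma> (id P)" by (simp only: powr_mult) simp
      qed (use g \<Gamma>_ball_fm in auto)
      also have "\<dots> \<le> Cd * ((D + 2) * \<delta> y) powr d"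
        using \<sigma>_ball(2)[OF g(1), of "D * \<delta> y + 2 * \<delta> y"] mult_pos_pos[OF D \<delta>y] \<delta>y
        by (simp add: distrib_right)
      also have "\<dots> = Cd * (D + 2) powr d * \<delta> y powr d" by (simp add: powr_mult)
      finally have fin: "real (card ?T) * (a0 powr d * (1 / (C' + b)) powr d / Cd * \<delta> y powr d) \<le> Cd * (D + 2) powr d * \<delta> y powr d" .
      have "real (card ?T) * (a0 powr d * (1 / (C' + b)) powr d / Cd) \<le> Cd * (D + 2) powr d"
      proof (rule mult_right_le_imp_le)
        show "real (card ?T) * (a0 powr d * (1 / (C' + b)) powr d / Cd) * \<delta> y powr d \<le> Cd * (D + 2) powr d * \<delta> y powr d"
          using fin by (simp only: mult.assoc)
      qed (use \<delta>y in simp)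
      then show ?thesis unfolding N_def using a0 Cd0 C' b by (simp add: field_simps)
    qed
    have union: "emeasure (hausdorff_measure d) (\<Union>P\<in>?FQ. P) \<le> ennreal (N / b3) * emeasure surf ?G"
    proof (rule emeasure_UN_le_finite)
      show "countable ?FQ" by (rule countable_subset[OF _ countable_cubes]) (use \<F>_cubes in blast)
      fix T assume T: "finite T" "T \<subseteq> ?FQ"
      have TF: "P \<in> \<F>" if "P \<in> T" for P using T that by auto
      have eP: "emeasure (hausdorff_measure d) P = ennreal (\<sigma> P)" if "P \<in> T" for P
        using cubeD(8)[OF lev(1)[OF TF[OF that]]] by (simp add: emeasure_eq_measure2)
      have "emeasure (hausdorff_measure d) (\<Union>P\<in>T. P) \<le> (\<Sum>P\<in>T. emeasure (hausdorff_measure d) P)"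
        using T cubeD(1)[OF lev(1)[OF TF]] by (intro emeasure_subadditive_finite) auto
      also have "\<dots> \<le> (\<Sum>P\<in>T. ennreal (1 / b3) * emeasure surf (A P))"
      proof (rule sum_mono)
        fix P assume P: "P \<in> T"
        have "ennreal (\<sigma> P) = ennreal (1 / b3) * ennreal (b3 * \<sigma> P)" using b3 by (simp add: ennreal_mult[symmetric])
        also have "\<dots> \<le> ennreal (1 / b3) * emeasure surf (A P)" using surfP[OF TF[OF P]] by (intro mult_left_mono) auto
        finally show "emeasure (hausdorff_measure d) P \<le> ennreal (1 / b3) * emeasure surf (A P)" unfolding eP[OF P] .
      qed
      also have "\<dots> = ennreal (1 / b3) * (\<Sum>P\<in>T. emeasure surf (A P))" by (simp add: sum_distrib_left)
      also have "\<dots> \<le> ennreal (1 / b3) * (ennreal N * emeasure surf ?G)"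
      proof (intro mult_left_mono sum_emeasure_overlap_le)
        show "A P \<in> sets surf \<and> A P \<subseteq> ?G" if "P \<in> T" for P using AG[of P] T that by (auto simp: A_def)
      qed (use T overlap[OF T] in auto)
      also have "\<dots> = ennreal (N / b3) * emeasure surf ?G"
        using b3 N by (simp add: mult.assoc[symmetric] ennreal_mult[symmetric])
      finally show "emeasure (hausdorff_measure d) (\<Union>P\<in>T. P) \<le> ennreal (N / b3) * emeasure surf ?G" .
    next
      show "P \<in> sets (hausdorff_measure d)" if "P \<in> ?FQ" for P using cubeD(1)[OF lev(1), of P] that by simp
    qed
    have Ub: "(\<Union>P\<in>?FQ. P) \<in> sets borel"
    proof (intro sets.countable_UN')
      show "countable ?FQ" by (rule countable_subset[OF _ countable_cubes]) (use \<F>_cubes in blast)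
      show "(\<lambda>P. P) ` ?FQ \<subseteq> sets borel" using cubeD(1)[OF lev(1)] by auto
    qed
    have Qr: "Q \<subseteq> ball x r"
    proof
      fix q assume "q \<in> Q"
      then have "dist x q \<le> C * R" using Q(5) by auto
      also have "\<dots> < M * R" using R(1) C' b C by (simp add: M_def algebra_simps add_pos_pos)
      finally show "q \<in> ball x r" using R(3) by simp
    qed
    have "Q \<subseteq> (?G \<inter> \<Gamma>) \<union> (\<Union>P\<in>?FQ. P)"
    proof
      fix q assume q: "q \<in> Q"
      show "q \<in> (?G \<inter> \<Gamma>) \<union> (\<Union>P\<in>?FQ. P)"
      proof (cases "q \<in> \<Union>\<F>")
        case True then show ?thesis using q by blast
      next
        case False
        have "q \<in> \<Gamma>" using q cubeD(2)[OF Q(1)] by blast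
        then show ?thesis using kept_points_in_frontier False q Qr by blast
      qed
    qed
    then have "emeasure (hausdorff_measure d) Q \<le> emeasure (hausdorff_measure d) ((?G \<inter> \<Gamma>) \<union> (\<Union>P\<in>?FQ. P))"
      using Ub \<Gamma>_borel by (intro emeasure_mono) auto
    also have "\<dots> \<le> emeasure (hausdorff_measure d) (?G \<inter> \<Gamma>) + emeasure (hausdorff_measure d) (\<Union>P\<in>?FQ. P)"
      using Ub \<Gamma>_borel by (intro emeasure_subadditive) auto
    also have "\<dots> \<le> emeasure (hausdorff_measure d) (?G \<inter> \<Gamma>) + ennreal (N / b3) * emeasure surf ?G"
      using union by (rule add_left_mono)
    also have "\<dots> \<le> ennreal K' * emeasure (hausdorff_measure d) (?G \<inter> \<Gamma>) + ennreal K' * emeasure surf ?G"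
    proof (rule add_mono)
      have "1 * emeasure (hausdorff_measure d) (?G \<inter> \<Gamma>) \<le> ennreal K' * emeasure (hausdorff_measure d) (?G \<inter> \<Gamma>)"
        using N b3 by (intro mult_right_mono) (auto simp: K'_def)
      then show "emeasure (hausdorff_measure d) (?G \<inter> \<Gamma>) \<le> ennreal K' * emeasure (hausdorff_measure d) (?G \<inter> \<Gamma>)" by simp
      show "ennreal (N / b3) * emeasure surf ?G \<le> ennreal K' * emeasure surf ?G"
        by (intro mult_right_mono ennreal_leI) (auto simp: K'_def)
    qed
    also have "\<dots> = ennreal K' * emeasure (sigma_star d \<Gamma> \<Omega>) ?G"
      by (subst sigma_star_eq) (auto simp: distrib_left)
    finally have QG: "emeasure (hausdorff_measure d) Q \<le> ennreal K' * emeasure (sigma_star d \<Gamma> \<Omega>) ?G" .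
    have "ennreal ((a0 / M) powr d / Cd * r powr d) \<le> ennreal (\<sigma> Q)"
    proof (rule ennreal_leI)
      have "(a0 / M) powr d / Cd * r powr d = (a0 * R) powr d / Cd"
        using powr_mult[of "a0 / M" r d] by (simp add: R_def)
      also have "\<dots> \<le> (a0 * sc k) powr d / Cd" using Q(3) a0 R(1) Cd0 d0 by (intro divide_right_mono powr_mono2 mult_left_mono) auto
      also have "\<dots> \<le> \<sigma> Q" by (rule cube_\<sigma>(1)[OF Q(1)])
      finally show "(a0 / M) powr d / Cd * r powr d \<le> \<sigma> Q" .
    qed
    also have "\<dots> = emeasure (hausdorff_measure d) Q" using cubeD(8)[OF Q(1)] by (simp add: emeasure_eq_measure2)
    finally have "ennreal ((a0 / M) powr d / Cd * r powr d) \<le> ennreal K' * emeasure (sigma_star d \<Gamma> \<Omega>) ?G"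
      using QG by (rule order_trans)
    from ennreal_divide_le[OF this K'] show ?thesis by (simp add: b4_def)
  qed
  then show ?thesis using b4 M by blast
qed

end

subsection \<open>Doubling of the boundary measure\<close>

context sawtooth begin

definition \<psi> :: "real^'n \<Rightarrow> real \<Rightarrow> real" where "\<psi> X r = r ^ (CARD('n) - 1) * (r + \<delta> X) powr (- \<alpha>)"

lemma \<psi>_pos: "0 < r \<Longrightarrow> 0 < \<psi> X r"
  using infdist_nonneg[of X \<Gamma>] by (auto simp: \<psi>_def intro!: mult_pos_pos)

text \<open>The factor \<open>r\<close> is the one in the denominator of \<open>mass_ratio\<close>,
  so that the two model quantities cancel there.\<close>

lemma \<phi>_\<psi>: "\<phi> X r = r * \<psi> X r"
proof -
  have "r ^ CARD('n) = r * r ^ (CARD('n) - 1)"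
    using n3 by (metis One_nat_def Suc_pred power_Suc zero_less_card_finite)
  then show ?thesis by (simp add: \<phi>_def \<psi>_def)
qed

lemma \<psi>_double: "0 < r \<Longrightarrow> \<psi> X (2 * r) \<le> 2 ^ (CARD('n) - 1) * \<psi> X r"
proof -
  assume r: "0 < r"
  have "(2 * r + \<delta> X) powr (- \<alpha>) \<le> (r + \<delta> X) powr (- \<alpha>)"
    using r \<alpha>_pos infdist_nonneg[of X \<Gamma>] by (intro powr_mono2') auto
  then have "(2 * r) ^ (CARD('n) - 1) * (2 * r + \<delta> X) powr (- \<alpha>) \<le> (2 * r) ^ (CARD('n) - 1) * (r + \<delta> X) powr (- \<alpha>)"
    using r by (intro mult_left_mono) auto
  then show ?thesis by (simp add: \<psi>_def power_mult_distrib mult.assoc)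
qed

lemma power_\<alpha>: "0 < r \<Longrightarrow> r ^ (CARD('n) - 1) * r powr (- \<alpha>) = r powr d"
proof -
  assume r: "0 < r"
  have "r ^ (CARD('n) - 1) = r powr (real CARD('n) - 1)"
    using r n3 by (simp add: powr_realpow[symmetric] of_nat_diff)
  then show ?thesis using r by (simp add: powr_add[symmetric] \<alpha>_def)
qed

abbreviation \<sigma>s :: "(real^'n) measure" where "\<sigma>s \<equiv> sigma_star d \<Gamma> \<Omega>"

lemma sigma_star_ball: "emeasure \<sigma>s (frontier \<Omega> \<inter> ball x r) =
    emeasure (hausdorff_measure d) (frontier \<Omega> \<inter> ball x r \<inter> \<Gamma>) + emeasure surf (frontier \<Omega> \<inter> ball x r)"
  by (intro sigma_star_eq) auto

text \<open>Small balls miss \<Gamma> and fall under the local bound. For larger \<open>r\<close> a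
  ball of comparable radius centred on \<Gamma> bounds the first part, and the surface part is
  estimated on the radius \<open>10 * r\<close>, which exceeds \<open>\<delta> x\<close>.\<close>

lemma sigma_star_upper:
  "\<exists>C>0. \<forall>x. \<forall>r>0. emeasure \<sigma>s (frontier \<Omega> \<inter> ball x r) \<le> ennreal (C * \<psi> x r)"
proof -
  obtain C1 where C1: "0 < C1" "\<And>z t. z \<notin> \<Gamma> \<Longrightarrow> 0 < t \<Longrightarrow> t \<le> \<delta> z / 10 \<Longrightarrow>
     emeasure surf (frontier \<Omega> \<inter> ball z t) \<le> ennreal (C1 * (t ^ (CARD('n) - 1) * \<delta> z powr (- \<alpha>)))"
    using surf_local_upper by blast
  obtain C2 where C2: "0 < C2" "\<And>x r. 0 < r \<Longrightarrow> \<delta> x \<le> r \<Longrightarrow>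
     emeasure surf (frontier \<Omega> \<inter> ball x r) \<le> ennreal (C2 * r powr d)"
    using surf_upper_large by blast
  define C where "C = C1 * 2 powr \<alpha> + (Cd * 11 powr d + C2 * 10 powr d) * 11 powr \<alpha>"
  have C0: "0 < C" using C1 C2 Cd0 by (simp add: C_def add_pos_pos)
  have "emeasure \<sigma>s (frontier \<Omega> \<inter> ball x r) \<le> ennreal (C * \<psi> x r)" if r: "0 < r" for x r
  proof (cases "r \<le> \<delta> x / 10")
    case True
    then have x: "x \<notin> \<Gamma>" "0 < \<delta> x" using r by auto
    have "frontier \<Omega> \<inter> ball x r \<inter> \<Gamma> = {}"
    proof -
      have "\<not> dist x y < r" if "y \<in> \<Gamma>" for y using infdist_le[OF that, of x] True x(2) by linarith
      then show ?thesis by auto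
    qed
    then have "emeasure \<sigma>s (frontier \<Omega> \<inter> ball x r) = emeasure surf (frontier \<Omega> \<inter> ball x r)"
      by (simp add: sigma_star_ball)
    also have "\<dots> \<le> ennreal (C1 * (r ^ (CARD('n) - 1) * \<delta> x powr (- \<alpha>)))" using C1(2)[OF x(1) r True] .
    also have "\<dots> \<le> ennreal (C * \<psi> x r)"
    proof (rule ennreal_leI)
      have "(2 * \<delta> x) powr (- \<alpha>) \<le> (r + \<delta> x) powr (- \<alpha>)" using True r \<alpha>_pos by (intro powr_mono2') auto
      then have "2 powr \<alpha> * (2 * \<delta> x) powr (- \<alpha>) \<le> 2 powr \<alpha> * (r + \<delta> x) powr (- \<alpha>)" by (intro mult_left_mono) auto
      moreover have "2 powr \<alpha> * (2 * \<delta> x) powr (- \<alpha>) = \<delta> x powr (- \<alpha>)" by (simp add: powr_mult powr_minus)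
      ultimately have "\<delta> x powr (- \<alpha>) \<le> 2 powr \<alpha> * (r + \<delta> x) powr (- \<alpha>)" by linarith
      then have "C1 * (r ^ (CARD('n) - 1) * \<delta> x powr (- \<alpha>)) \<le> C1 * (r ^ (CARD('n) - 1) * (2 powr \<alpha> * (r + \<delta> x) powr (- \<alpha>)))"
        using C1(1) r by (intro mult_left_mono) auto
      also have "\<dots> = C1 * 2 powr \<alpha> * \<psi> x r" by (simp add: \<psi>_def)
      also have "\<dots> \<le> C * \<psi> x r" using \<psi>_pos[OF r, of x] C2 Cd0 by (intro mult_right_mono) (auto simp: C_def)
      finally show "C1 * (r ^ (CARD('n) - 1) * \<delta> x powr (- \<alpha>)) \<le> C * \<psi> x r" .
    qed
    finally show ?thesis .
  next
    case False
    obtain g where g: "g \<in> \<Gamma>" "dist x g = \<delta> x" by (rule \<delta>_attained)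
    have sub: "ball x r \<subseteq> ball g (11 * r)"
    proof
      fix y assume "y \<in> ball x r"
      then show "y \<in> ball g (11 * r)" using g(2) False dist_triangle[of g y x] by (simp add: dist_commute)
    qed
    have "emeasure (hausdorff_measure d) (frontier \<Omega> \<inter> ball x r \<inter> \<Gamma>) \<le> emeasure (hausdorff_measure d) (\<Gamma> \<inter> ball g (11 * r))"
      using sub \<Gamma>_borel by (intro emeasure_mono) auto
    also have "\<dots> = ennreal (\<sigma> (\<Gamma> \<inter> ball g (11 * r)))" using \<Gamma>_ball_fm[OF g(1)] by (simp add: emeasure_eq_measure2)
    also have "\<dots> \<le> ennreal (Cd * 11 powr d * r powr d)"
      using \<sigma>_ball(2)[OF g(1), of "11 * r"] r by (intro ennreal_leI) (simp add: powr_mult)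
    finally have a: "emeasure (hausdorff_measure d) (frontier \<Omega> \<inter> ball x r \<inter> \<Gamma>) \<le> ennreal (Cd * 11 powr d * r powr d)" .
    have "ball x r \<subseteq> ball x (10 * r)" using r by (intro subset_ball) auto
    then have "emeasure surf (frontier \<Omega> \<inter> ball x r) \<le> emeasure surf (frontier \<Omega> \<inter> ball x (10 * r))"
      by (intro emeasure_mono) auto
    also have "\<dots> \<le> ennreal (C2 * (10 * r) powr d)" using C2(2)[of "10 * r" x] r False by simp
    finally have b: "emeasure surf (frontier \<Omega> \<inter> ball x r) \<le> ennreal (C2 * 10 powr d * r powr d)"
      by (simp only: powr_mult mult.assoc)
    have "emeasure \<sigma>s (frontier \<Omega> \<inter> ball x r) \<le> ennreal (Cd * 11 powr d * r powr d) + ennreal (C2 * 10 powr d * r powr d)"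
      unfolding sigma_star_ball using a b by (intro add_mono)
    also have "\<dots> = ennreal ((Cd * 11 powr d + C2 * 10 powr d) * r powr d)"
      using Cd0 C2 by (simp add: ennreal_plus[symmetric] distrib_right del: ennreal_plus)
    also have "\<dots> \<le> ennreal (C * \<psi> x r)"
    proof (rule ennreal_leI)
      have "(11 * r) powr (- \<alpha>) \<le> (r + \<delta> x) powr (- \<alpha>)"
        using False r \<alpha>_pos infdist_nonneg[of x \<Gamma>] by (intro powr_mono2') auto
      then have "r ^ (CARD('n) - 1) * (11 * r) powr (- \<alpha>) \<le> \<psi> x r" unfolding \<psi>_def using r by (intro mult_left_mono) auto
      moreover have "r ^ (CARD('n) - 1) * (11 * r) powr (- \<alpha>) = 11 powr (- \<alpha>) * r powr d"
        unfolding power_\<alpha>[OF r, symmetric] powr_mult by simp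
      ultimately have "11 powr \<alpha> * (11 powr (- \<alpha>) * r powr d) \<le> 11 powr \<alpha> * \<psi> x r" by (intro mult_left_mono) auto
      moreover have "11 powr \<alpha> * (11 powr (- \<alpha>) * r powr d) = r powr d"
        by (simp add: mult.assoc[symmetric] powr_add[symmetric])
      ultimately have "r powr d \<le> 11 powr \<alpha> * \<psi> x r" by linarith
      then have "(Cd * 11 powr d + C2 * 10 powr d) * r powr d \<le> (Cd * 11 powr d + C2 * 10 powr d) * (11 powr \<alpha> * \<psi> x r)"
        using Cd0 C2 by (intro mult_left_mono) auto
      also have "\<dots> \<le> C * \<psi> x r"
        using \<psi>_pos[OF r, of x] C1 mult_right_mono[of "(Cd * 11 powr d + C2 * 10 powr d) * 11 powr \<alpha>" C "\<psi> x r"] by (simp add: C_def mult.assoc)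
      finally show "(Cd * 11 powr d + C2 * 10 powr d) * r powr d \<le> C * \<psi> x r" .
    qed
    finally show ?thesis .
  qed
  with C0 show ?thesis by blast
qed

lemma sigma_star_lower:
  "\<exists>b>0. \<forall>x\<in>frontier \<Omega>. \<forall>r>0. ennreal (b * \<psi> x r) \<le> emeasure \<sigma>s (frontier \<Omega> \<inter> ball x r)"
proof -
  obtain b1 where b1: "0 < b1" "\<And>x t. x \<in> frontier \<Omega> \<Longrightarrow> x \<notin> \<Gamma> \<Longrightarrow> 0 < t \<Longrightarrow> t \<le> \<kappa>s * \<delta> x \<Longrightarrow>
     ennreal (b1 * (t ^ (CARD('n) - 1) * \<delta> x powr (- \<alpha>))) \<le> emeasure surf (frontier \<Omega> \<inter> ball x t)"
    using surf_local_lower by blast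
  obtain b2 M where b2: "0 < b2" "0 < M" "\<And>x r. x \<in> frontier \<Omega> \<Longrightarrow> 0 < r \<Longrightarrow> M * \<delta> x \<le> r \<Longrightarrow>
     ennreal (b2 * r powr d) \<le> emeasure \<sigma>s (frontier \<Omega> \<inter> ball x r)"
    using sigma_star_lower_large by blast
  have \<kappa>s: "0 < \<kappa>s" using \<kappa>_pos by (simp add: \<kappa>s_def)
  define b3 where "b3 = b1 * (\<kappa>s / M) ^ (CARD('n) - 1)"
  have b3: "0 < b3" using b1 b2 \<kappa>s by (simp add: b3_def)
  define b where "b = min b1 (min b2 b3)"
  have b: "0 < b" "b \<le> b1" "b \<le> b2" "b \<le> b3" using b1 b2 b3 by (auto simp: b_def)
  have surf_le_\<sigma>: "emeasure surf (frontier \<Omega> \<inter> ball x r) \<le> emeasure \<sigma>s (frontier \<Omega> \<inter> ball x r)" for x r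
    unfolding sigma_star_ball by simp
  have "ennreal (b * \<psi> x r) \<le> emeasure \<sigma>s (frontier \<Omega> \<inter> ball x r)" if x: "x \<in> frontier \<Omega>" and r: "0 < r" for x r
  proof -
    have \<psi>0: "0 < \<psi> x r" using \<psi>_pos[OF r] .
    have \<delta>0: "0 \<le> \<delta> x" by (rule infdist_nonneg)
    consider "r \<le> \<kappa>s * \<delta> x" | "\<kappa>s * \<delta> x < r" "r < M * \<delta> x" | "M * \<delta> x \<le> r" by linarith
    then show ?thesis
    proof cases
      case 1
      then have x': "0 < \<delta> x" "x \<notin> \<Gamma>" using r \<kappa>s \<delta>0 by (auto simp: order.order_iff_strict)
      have "b * \<psi> x r \<le> b1 * (r ^ (CARD('n) - 1) * \<delta> x powr (- \<alpha>))"
      proof (rule mult_mono)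
        have "(r + \<delta> x) powr (- \<alpha>) \<le> \<delta> x powr (- \<alpha>)" using x' r \<alpha>_pos by (intro powr_mono2') auto
        then show "\<psi> x r \<le> r ^ (CARD('n) - 1) * \<delta> x powr (- \<alpha>)" unfolding \<psi>_def using r by (intro mult_left_mono) auto
      qed (use b b1 \<psi>0 in auto)
      then have "ennreal (b * \<psi> x r) \<le> ennreal (b1 * (r ^ (CARD('n) - 1) * \<delta> x powr (- \<alpha>)))" by (rule ennreal_leI)
      then show ?thesis using order_trans[OF b1(2)[OF x x'(2) r 1] surf_le_\<sigma>] by (rule order_trans)
    next
      \<comment> \<open>In the intermediate range \<open>r\<close> and \<open>\<delta> x\<close> are
        comparable, and the smaller ball of radius \<open>\<kappa>s * \<delta> x\<close> already
        carries enough measure.\<close>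
      case 2
      then have x': "0 < \<delta> x" "x \<notin> \<Gamma>" using r b2(2) \<delta>0 by (auto simp: order.order_iff_strict)
      let ?t = "\<kappa>s * \<delta> x"
      have t: "0 < ?t" using \<kappa>s x' by simp
      have "b * \<psi> x r \<le> b3 * ((M * \<delta> x) ^ (CARD('n) - 1) * \<delta> x powr (- \<alpha>))"
      proof (rule mult_mono)
        have "(r + \<delta> x) powr (- \<alpha>) \<le> \<delta> x powr (- \<alpha>)" using x' r \<alpha>_pos by (intro powr_mono2') auto
        moreover have "r ^ (CARD('n) - 1) \<le> (M * \<delta> x) ^ (CARD('n) - 1)" using r 2 by (intro power_mono) auto
        ultimately show "\<psi> x r \<le> (M * \<delta> x) ^ (CARD('n) - 1) * \<delta> x powr (- \<alpha>)"
          unfolding \<psi>_def using r b2(2) x' by (intro mult_mono) auto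
      qed (use b b3 \<psi>0 in auto)
      also have "\<dots> = b1 * (?t ^ (CARD('n) - 1) * \<delta> x powr (- \<alpha>))"
        using b2(2) by (simp add: b3_def power_mult_distrib power_divide)
      finally have "ennreal (b * \<psi> x r) \<le> ennreal (b1 * (?t ^ (CARD('n) - 1) * \<delta> x powr (- \<alpha>)))" by (rule ennreal_leI)
      also have "\<dots> \<le> emeasure surf (frontier \<Omega> \<inter> ball x ?t)" using b1(2)[OF x x'(2) t] by simp
      also have "\<dots> \<le> emeasure surf (frontier \<Omega> \<inter> ball x r)"
        using subset_ball[of ?t r x] 2 by (intro emeasure_mono) auto
      finally show ?thesis using surf_le_\<sigma> by (rule order_trans)
    next
      case 3
      have "(r + \<delta> x) powr (- \<alpha>) \<le> r powr (- \<alpha>)" using r \<delta>0 \<alpha>_pos by (intro powr_mono2') auto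
      then have "\<psi> x r \<le> r powr d" unfolding \<psi>_def power_\<alpha>[OF r, symmetric] using r by (intro mult_left_mono) auto
      then have "b * \<psi> x r \<le> b2 * r powr d" using b \<psi>0 by (intro mult_mono) auto
      then have "ennreal (b * \<psi> x r) \<le> ennreal (b2 * r powr d)" by (rule ennreal_leI)
      then show ?thesis using b2(3)[OF x r 3] by (rule order_trans)
    qed
  qed
  with b show ?thesis by blast
qed

lemma sigma_estimates:
  obtains b C where "0 < b" "0 < C"
    "\<And>x r. x \<in> frontier \<Omega> \<Longrightarrow> 0 < r \<Longrightarrow> ennreal (b * \<psi> x r) \<le> emeasure \<sigma>s (ball x r \<inter> frontier \<Omega>)"
    "\<And>x r. 0 < r \<Longrightarrow> emeasure \<sigma>s (ball x r \<inter> frontier \<Omega>) \<le> ennreal (C * \<psi> x r)"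
proof -
  obtain C where C: "0 < C" "\<And>x r. 0 < r \<Longrightarrow> emeasure \<sigma>s (frontier \<Omega> \<inter> ball x r) \<le> ennreal (C * \<psi> x r)"
    using sigma_star_upper by blast
  obtain b where b: "0 < b" "\<And>x r. x \<in> frontier \<Omega> \<Longrightarrow> 0 < r \<Longrightarrow> ennreal (b * \<psi> x r) \<le> emeasure \<sigma>s (frontier \<Omega> \<inter> ball x r)"
    using sigma_star_lower by blast
  show ?thesis using that[OF b(1) C(1)] b(2) C(2) by (simp add: Int_commute)
qed

lemma condition_H3: "cond_H3 \<Omega> \<sigma>s"
proof -
  obtain b C where bC: "0 < b" "0 < C"
    "\<And>x r. x \<in> frontier \<Omega> \<Longrightarrow> 0 < r \<Longrightarrow> ennreal (b * \<psi> x r) \<le> emeasure \<sigma>s (ball x r \<inter> frontier \<Omega>)"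
    "\<And>x r. 0 < r \<Longrightarrow> emeasure \<sigma>s (ball x r \<inter> frontier \<Omega>) \<le> ennreal (C * \<psi> x r)"
    by (rule sigma_estimates) blast
  have "0 < emeasure \<sigma>s (U \<inter> frontier \<Omega>)" if x: "x \<in> frontier \<Omega>" and U: "open U" "x \<in> U" for x U
  proof -
    obtain r where r: "0 < r" "ball x r \<subseteq> U" using U open_contains_ball by metis
    have "0 < ennreal (b * \<psi> x r)" using bC(1) \<psi>_pos[OF r(1)] by simp
    also have "\<dots> \<le> emeasure \<sigma>s (ball x r \<inter> frontier \<Omega>)" using bC(3)[OF x r(1)] .
    also have "\<dots> \<le> emeasure \<sigma>s (U \<inter> frontier \<Omega>)"
      using r U by (intro emeasure_mono) (auto simp: sets_restrict_space_iff)
    finally show ?thesis .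
  qed
  then have supp: "measure_support \<sigma>s = frontier \<Omega>" by (auto simp: measure_support_def)
  define C3 where "C3 = C * 2 ^ (CARD('n) - 1) / b + 2"
  have C3: "1 < C3" "C * 2 ^ (CARD('n) - 1) / b \<le> C3" using bC by (auto simp: C3_def add_nonneg_pos intro: add_strict_increasing2)
  have "emeasure \<sigma>s (ball x r \<inter> frontier \<Omega>) < \<infinity> \<and>
      emeasure \<sigma>s (ball x (2 * r) \<inter> frontier \<Omega>) \<le> ennreal C3 * emeasure \<sigma>s (ball x r \<inter> frontier \<Omega>)"
    if x: "x \<in> frontier \<Omega>" and r: "0 < r" for x r
  proof
    show "emeasure \<sigma>s (ball x r \<inter> frontier \<Omega>) < \<infinity>" using bC(4)[OF r, of x] by (simp add: order_le_less_trans)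
    have "emeasure \<sigma>s (ball x (2 * r) \<inter> frontier \<Omega>) \<le> ennreal (C * \<psi> x (2 * r))" using bC(4) r by simp
    also have "\<dots> \<le> ennreal (C * (2 ^ (CARD('n) - 1) * \<psi> x r))"
      using \<psi>_double[OF r] bC(2) by (intro ennreal_leI mult_left_mono) auto
    also have "\<dots> = ennreal (C * 2 ^ (CARD('n) - 1) / b) * ennreal (b * \<psi> x r)"
      using bC(1,2) \<psi>_pos[OF r, of x] by (simp add: ennreal_mult[symmetric])
    also have "\<dots> \<le> ennreal C3 * emeasure \<sigma>s (ball x r \<inter> frontier \<Omega>)"
      using bC(3)[OF x r] C3(2) by (intro mult_mono ennreal_leI) auto
    finally show "emeasure \<sigma>s (ball x (2 * r) \<inter> frontier \<Omega>) \<le> ennreal C3 * emeasure \<sigma>s (ball x r \<inter> frontier \<Omega>)" .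
  qed
  then show ?thesis unfolding cond_H3_def using supp C3(1) by blast
qed

lemma condition_H5: "cond_H5 \<Omega> m \<sigma>s"
proof -
  obtain b C where bC: "0 < b" "0 < C"
    "\<And>x r. x \<in> frontier \<Omega> \<Longrightarrow> 0 < r \<Longrightarrow> ennreal (b * \<psi> x r) \<le> emeasure \<sigma>s (ball x r \<inter> frontier \<Omega>)"
    "\<And>x r. 0 < r \<Longrightarrow> emeasure \<sigma>s (ball x r \<inter> frontier \<Omega>) \<le> ennreal (C * \<psi> x r)"
    by (rule sigma_estimates) blast
  obtain b' C' where bC': "0 < b'" "0 < C'"
    "\<And>X r. X \<in> closure \<Omega> \<Longrightarrow> 0 < r \<Longrightarrow> ennreal (b' * \<phi> X r) \<le> emeasure m (ball X r \<inter> \<Omega>)"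
    "\<And>X r. 0 < r \<Longrightarrow> emeasure m (ball X r \<inter> \<Omega>) \<le> ennreal (C' * \<phi> X r)"
    by (rule m_estimates) blast
  have real_bounds: "p \<le> measure N A" "measure N A \<le> q"
    if "ennreal p \<le> emeasure N A" "emeasure N A \<le> ennreal q" "0 < p" "0 \<le> q" for N :: "(real^'n) measure" and A p q
  proof -
    have "emeasure N A < top" using that(2) by (rule order_le_less_trans) simp
    then have e: "emeasure N A = ennreal (measure N A)" by (simp add: emeasure_eq_ennreal_measure)
    show "p \<le> measure N A" using that(1) unfolding e by (simp add: ennreal_le_iff)
    show "measure N A \<le> q" using that(2,4) unfolding e by (simp add: ennreal_le_iff)
  qed
  have ratio: "b' / C \<le> mass_ratio \<Omega> m \<sigma>s x r" "mass_ratio \<Omega> m \<sigma>s x r \<le> C' / b"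
    if x: "x \<in> frontier \<Omega>" and r: "0 < r" for x r
  proof -
    have \<psi>0: "0 < \<psi> x r" using \<psi>_pos[OF r] .
    have s: "b * \<psi> x r \<le> measure \<sigma>s (ball x r \<inter> frontier \<Omega>)" "measure \<sigma>s (ball x r \<inter> frontier \<Omega>) \<le> C * \<psi> x r"
      using real_bounds[OF bC(3)[OF x r] bC(4)[OF r]] bC \<psi>0 by simp_all
    have mm: "b' * (r * \<psi> x r) \<le> measure m (ball x r \<inter> \<Omega>)" "measure m (ball x r \<inter> \<Omega>) \<le> C' * (r * \<psi> x r)"
      using real_bounds[OF bC'(3)[OF frontier_closure[OF x] r] bC'(4)[OF r]] bC' \<psi>0 r unfolding \<phi>_\<psi> by simp_all
    have pos: "0 < b * \<psi> x r" "0 < C * \<psi> x r" using bC \<psi>0 by auto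
    have s0: "0 < measure \<sigma>s (ball x r \<inter> frontier \<Omega>)" using s(1) pos by linarith
    have "b' / C = b' * (r * \<psi> x r) / (r * (C * \<psi> x r))" using r \<psi>0 by simp
    also have "\<dots> \<le> measure m (ball x r \<inter> \<Omega>) / (r * measure \<sigma>s (ball x r \<inter> frontier \<Omega>))"
      using mm(1) s(2) s0 r bC' \<psi>0 by (intro frac_le mult_left_mono) (auto intro: order_trans[OF _ mm(1)])
    finally show "b' / C \<le> mass_ratio \<Omega> m \<sigma>s x r" by (simp add: mass_ratio_def)
    have "mass_ratio \<Omega> m \<sigma>s x r \<le> C' * (r * \<psi> x r) / (r * (b * \<psi> x r))"
      unfolding mass_ratio_def using mm(2) s(1) pos r bC' \<psi>0 by (intro frac_le mult_left_mono) auto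
    also have "\<dots> = C' / b" using r \<psi>0 by simp
    finally show "mass_ratio \<Omega> m \<sigma>s x r \<le> C' / b" .
  qed
  \<comment> \<open>At least 1, so that the exponent \<open>1 - 1 / C5\<close> is nonnegative and
    the power of \<open>r / s > 1\<close> is at least 1.\<close>
  define C5 where "C5 = max 1 ((C' / b) / (b' / C))"
  have C5: "1 \<le> C5" "(C' / b) / (b' / C) \<le> C5" by (auto simp: C5_def)
  have "mass_ratio \<Omega> m \<sigma>s x r / mass_ratio \<Omega> m \<sigma>s x s \<le> C5 * (r / s) powr (1 - 1 / C5)"
    if x: "x \<in> frontier \<Omega>" and rs: "0 < s" "s < r" for x r s
  proof -
    have bc: "0 < b' / C" using bC bC' by simp
    have "mass_ratio \<Omega> m \<sigma>s x r / mass_ratio \<Omega> m \<sigma>s x s \<le> (C' / b) / (b' / C)"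
      using ratio[OF x, of r] ratio[OF x, of s] rs bc bC bC' by (intro frac_le) auto
    also have "\<dots> \<le> C5 * 1" using C5 by simp
    also have "\<dots> \<le> C5 * (r / s) powr (1 - 1 / C5)"
      using C5(1) rs by (intro mult_left_mono ge_one_powr_ge_zero) auto
    finally show ?thesis .
  qed
  then show ?thesis unfolding cond_H5_def using C5(1) by (intro exI[of _ C5]) auto
qed

end

subsection \<open>Weak limits of gradients\<close>

text \<open>The measures with the positive and the negative part of \<open>f\<close> as densities
  agree on boxes, an intersection-stable generator, hence on all Borel sets.\<close>

lemma AE_zero_if_cbox_integrals_zero:
  fixes f :: "'a::ordered_euclidean_space \<Rightarrow> real"
  assumes f: "integrable lborel f" and zero: "\<And>a b. (LINT x:cbox a b|lborel. f x) = 0"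
  shows "AE x in lborel. f x = 0"
proof -
  have fm [measurable]: "f \<in> borel_measurable borel" using borel_measurable_integrable[OF f] by simp
  define p where "p x = ennreal (f x)" for x
  define q where "q x = ennreal (- f x)" for x
  have pm: "p \<in> borel_measurable lborel" and qm: "q \<in> borel_measurable lborel"
    unfolding p_def[abs_def] q_def[abs_def] by measurable
  have int: "set_integrable lborel A f" if "A \<in> sets borel" for A
    using f that unfolding set_integrable_def by (intro integrable_mult_indicator) auto
  have parts: "(LINT x:A|lborel. f x) = enn2real (\<integral>\<^sup>+x. p x * indicator A x \<partial>lborel) - enn2real (\<integral>\<^sup>+x. q x * indicator A x \<partial>lborel)"
    and fin: "(\<integral>\<^sup>+x. p x * indicator A x \<partial>lborel) < top" "(\<integral>\<^sup>+x. q x * indicator A x \<partial>lborel) < top"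
    if A: "A \<in> sets borel" for A
  proof -
    have i: "integrable lborel (\<lambda>x. indicator A x *\<^sub>R f x)" using int[OF A] by (simp add: set_integrable_def)
    have e: "ennreal (indicator A x *\<^sub>R f x) = p x * indicator A x" "ennreal (- (indicator A x *\<^sub>R f x)) = q x * indicator A x" for x
      by (auto simp: p_def q_def split: split_indicator)
    show "(LINT x:A|lborel. f x) = enn2real (\<integral>\<^sup>+x. p x * indicator A x \<partial>lborel) - enn2real (\<integral>\<^sup>+x. q x * indicator A x \<partial>lborel)"
      unfolding set_lebesgue_integral_def using real_lebesgue_integral_def[OF i] by (simp only: e)
    show "(\<integral>\<^sup>+x. p x * indicator A x \<partial>lborel) < top" "(\<integral>\<^sup>+x. q x * indicator A x \<partial>lborel) < top"
      using i unfolding real_integrable_def e by (auto simp: less_top)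
  qed
  have enn_eq: "a = b" if "a < top" "b < top" "enn2real a = enn2real b" for a b :: ennreal
    using that by (metis ennreal_enn2real)
  let ?E = "range (\<lambda>(a, b). cbox a b :: 'a set)"
  have "density lborel p = density lborel q"
  proof (rule measure_eqI_generator_eq[where E = ?E and \<Omega> = UNIV and A = "\<lambda>n::nat. cbox (- (real n *\<^sub>R One)) (real n *\<^sub>R One)"])
    show "Int_stable ?E" by (auto simp: Int_stable_def Int_interval)
    have "(\<lambda>(a, b). {a..b} :: 'a set) = (\<lambda>(a, b). cbox a b)" by (simp add: fun_eq_iff cbox_interval)
    then have "sets (borel :: 'a measure) = sigma_sets UNIV ?E"
      unfolding borel_eq_atLeastAtMost by simp
    then show "sets (density lborel p) = sigma_sets UNIV ?E" "sets (density lborel q) = sigma_sets UNIV ?E" by auto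
    fix X assume "X \<in> ?E"
    then obtain a b where X: "X = cbox a b" by auto
    have Xb: "X \<in> sets borel" by (simp add: X)
    have "enn2real (\<integral>\<^sup>+x. p x * indicator X x \<partial>lborel) = enn2real (\<integral>\<^sup>+x. q x * indicator X x \<partial>lborel)"
      using parts[OF Xb] zero[of a b] by (simp add: X)
    then have "(\<integral>\<^sup>+x. p x * indicator X x \<partial>lborel) = (\<integral>\<^sup>+x. q x * indicator X x \<partial>lborel)"
      using enn_eq fin[OF Xb] by blast
    then show "emeasure (density lborel p) X = emeasure (density lborel q) X"
      using Xb pm qm by (simp add: emeasure_density)
  next
    show "(\<Union>i::nat. cbox (- (real i *\<^sub>R One)) (real i *\<^sub>R One)) = (UNIV :: 'a set)"
    proof -
      have "(\<Union>i::nat. box (- (real i *\<^sub>R One)) (real i *\<^sub>R One :: 'a)) \<subseteq> (\<Union>i::nat. cbox (- (real i *\<^sub>R One)) (real i *\<^sub>R One))"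
        by (intro UN_mono box_subset_cbox subset_refl)
      then show ?thesis unfolding UN_box_eq_UNIV by (rule top.extremum_uniqueI)
    qed
    fix i :: nat
    show "emeasure (density lborel p) (cbox (- (real i *\<^sub>R One)) (real i *\<^sub>R One)) \<noteq> \<infinity>"
      using fin(1)[of "cbox (- (real i *\<^sub>R One)) (real i *\<^sub>R One)"] pm by (simp add: emeasure_density less_top)
  qed auto
  then have eq: "emeasure (density lborel p) A = emeasure (density lborel q) A" for A by simp
  have "AE x in lborel. f x = 0"
  proof (rule density_unique_real[OF f integrable_zero])
    fix A :: "'a set" assume "A \<in> sets lborel"
    then have A: "A \<in> sets borel" by simp
    have "(\<integral>\<^sup>+x. p x * indicator A x \<partial>lborel) = (\<integral>\<^sup>+x. q x * indicator A x \<partial>lborel)"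
      using eq[of A] A pm qm by (simp add: emeasure_density)
    then show "(LINT x:A|lborel. f x) = (LINT x:A|lborel. 0)" using parts[OF A] by (simp add: set_lebesgue_integral_def)
  qed
  then show ?thesis .
qed

text \<open>The bound does not depend on the shift \<open>c\<close>; this is the uniformity in
  \<open>t\<close> that differentiating the limit of the averages requires.\<close>

lemma shifted_integral_bound:
  fixes f :: "'a::euclidean_space \<Rightarrow> real"
  assumes f: "f \<in> borel_measurable borel" "(\<integral>\<^sup>+x. ennreal \<bar>f x\<bar> \<partial>lborel) < \<infinity>" and B: "B \<in> sets borel"
  shows "integrable lborel (\<lambda>y. f (c + y))" "set_integrable lborel B (\<lambda>y. f (c + y))"
    "ennreal \<bar>LINT y:B|lborel. f (c + y)\<bar> \<le> (\<integral>\<^sup>+x. ennreal \<bar>f x\<bar> \<partial>lborel)"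
proof -
  have [measurable]: "f \<in> borel_measurable borel" by fact
  have shift: "(\<integral>\<^sup>+y. ennreal \<bar>f (c + y)\<bar> \<partial>lborel) = (\<integral>\<^sup>+x. ennreal \<bar>f x\<bar> \<partial>lborel)"
    by (subst (2) lborel_distr_plus[of c, symmetric], subst nn_integral_distr) auto
  show i: "integrable lborel (\<lambda>y. f (c + y))"
    using f(2) unfolding shift[symmetric] by (intro integrableI_bounded) auto
  then show s: "set_integrable lborel B (\<lambda>y. f (c + y))"
    using B unfolding set_integrable_def by (intro integrable_mult_indicator) auto
  have "ennreal (norm (LINT y:B|lborel. f (c + y))) \<le> (\<integral>\<^sup>+y. ennreal (norm (indicator B y *\<^sub>R f (c + y))) \<partial>lborel)"
    using s unfolding set_integrable_def set_lebesgue_integral_def by (rule integral_norm_bound_ennreal)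
  also have "\<dots> \<le> (\<integral>\<^sup>+y. ennreal \<bar>f (c + y)\<bar> \<partial>lborel)"
    by (intro nn_integral_mono) (auto split: split_indicator)
  finally show "ennreal \<bar>LINT y:B|lborel. f (c + y)\<bar> \<le> (\<integral>\<^sup>+x. ennreal \<bar>f x\<bar> \<partial>lborel)" by (simp add: shift)
qed

text \<open>The averages \<open>F k t\<close> of \<open>u k\<close> over \<open>B + t e\<close> tend to 0 uniformly in \<open>t\<close>, and their derivatives tend
  uniformly to the averages of \<open>g\<close>; hence the latter vanish.\<close>

lemma weak_limit_integral_zero:
  fixes u p :: "nat \<Rightarrow> 'a::euclidean_space \<Rightarrow> real" and g :: "'a \<Rightarrow> real" and e :: 'a
  assumes D: "open D" and B: "cbox a b \<subseteq> D"
    and der: "\<And>k x t. x + t *\<^sub>R e \<in> D \<Longrightarrow> ((\<lambda>s. u k (x + s *\<^sub>R e)) has_field_derivative p k (x + t *\<^sub>R e)) (at t)"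
    and cu: "\<And>k. continuous_on D (u k)" and cp: "\<And>k. continuous_on D (p k)"
    and g: "integrable lborel g"
    and lu: "(\<lambda>k. \<integral>\<^sup>+x. ennreal \<bar>indicator D x * u k x\<bar> \<partial>lborel) \<longlonglongrightarrow> 0"
    and lp: "(\<lambda>k. \<integral>\<^sup>+x. ennreal \<bar>indicator D x * p k x - g x\<bar> \<partial>lborel) \<longlonglongrightarrow> 0"
  shows "(LINT x:cbox a b|lborel. g x) = 0"
proof -
  obtain \<epsilon> where \<epsilon>: "0 < \<epsilon>" "(\<Union>x\<in>cbox a b. cball x \<epsilon>) \<subseteq> D"
    using compact_subset_open_imp_cball_epsilon_subset[OF compact_cbox D B] by blast
  \<comment> \<open>Keeps the shifted boxes inside \<open>D\<close>. The summand 1 avoids division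
    by zero, as \<open>e\<close> is an arbitrary vector.\<close>
  define h where "h = \<epsilon> / (norm e + 1)"
  have ne: "0 < norm e + 1" by (simp add: add_nonneg_pos)
  have h: "0 < h" "h * norm e \<le> \<epsilon>" using \<epsilon> ne by (auto simp: h_def field_simps)
  let ?S = "{- h..h}"
  have inD: "x + t *\<^sub>R e \<in> D" if "x \<in> cbox a b" "t \<in> ?S" for x t
  proof -
    have "dist x (x + t *\<^sub>R e) = \<bar>t\<bar> * norm e" by (simp add: dist_norm)
    also have "\<dots> \<le> h * norm e" using that by (intro mult_right_mono) auto
    finally have "x + t *\<^sub>R e \<in> cball x \<epsilon>" using h by simp
    then show ?thesis using \<epsilon>(2) that(1) by blast
  qed
  \<comment> \<open>Extension by zero, so that translation invariance can be applied on the whole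
    space.\<close>
  define U where "U k x = indicator D x * u k x" for k x
  define P where "P k x = indicator D x * p k x" for k x
  have Um [measurable]: "U k \<in> borel_measurable borel" for k
    using borel_measurable_continuous_on_indicator[OF _ cu[of k]] D by (simp add: U_def[abs_def])
  have Pm [measurable]: "P k \<in> borel_measurable borel" for k
    using borel_measurable_continuous_on_indicator[OF _ cp[of k]] D by (simp add: P_def[abs_def])
  have gm [measurable]: "g \<in> borel_measurable borel" using borel_measurable_integrable[OF g] by simp
  have gfin: "(\<integral>\<^sup>+x. ennreal \<bar>g x\<bar> \<partial>lborel) < \<infinity>" using g by (simp add: integrable_iff_bounded)
  define F where "F k t = integral (cbox a b) (\<lambda>x. u k (x + t *\<^sub>R e))" for k t
  define F' where "F' k t = integral (cbox a b) (\<lambda>x. p k (x + t *\<^sub>R e))" for k t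
  define G where "G t = (LINT x:cbox a b|lborel. g (t *\<^sub>R e + x))" for t
  have cshift: "continuous_on (cbox a b) (\<lambda>x. f (x + t *\<^sub>R e))" if "continuous_on D f" "t \<in> ?S" for f :: "'a \<Rightarrow> real" and t
    using inD that by (intro continuous_on_compose2[OF that(1)] continuous_intros) auto
  have leb: "set_integrable lborel (cbox a b) f \<and> integral (cbox a b) f = (LINT x:cbox a b|lborel. f x)"
    if "continuous_on (cbox a b) f" for f :: "'a \<Rightarrow> real"
  proof -
    have s: "set_integrable lborel (cbox a b) f"
      unfolding set_integrable_def using that by (intro borel_integrable_compact) auto
    then show ?thesis using set_borel_integral_eq_integral(2)[OF s] by simp
  qed
  have F_eq: "F k t = (LINT x:cbox a b|lborel. U k (t *\<^sub>R e + x))" if "t \<in> ?S" for k t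
  proof -
    have "F k t = (LINT x:cbox a b|lborel. u k (x + t *\<^sub>R e))" unfolding F_def using leb cshift[OF cu that] by blast
    also have "\<dots> = (LINT x:cbox a b|lborel. U k (t *\<^sub>R e + x))"
      using inD[OF _ that] by (intro set_lebesgue_integral_cong) (auto simp: U_def add.commute)
    finally show ?thesis .
  qed
  have F'_eq: "set_integrable lborel (cbox a b) (\<lambda>x. P k (t *\<^sub>R e + x)) \<and> F' k t = (LINT x:cbox a b|lborel. P k (t *\<^sub>R e + x))"
    if t: "t \<in> ?S" for k t
  proof -
    have eq: "p k (x + t *\<^sub>R e) = P k (t *\<^sub>R e + x)" if "x \<in> cbox a b" for x
      using inD[OF that t] by (simp add: P_def add.commute)
    have "set_integrable lborel (cbox a b) (\<lambda>x. p k (x + t *\<^sub>R e))" using leb cshift[OF cp t] by blast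
    then have 1: "set_integrable lborel (cbox a b) (\<lambda>x. P k (t *\<^sub>R e + x))"
      using eq by (subst set_integrable_cong[OF refl refl, of _ _ "\<lambda>x. p k (x + t *\<^sub>R e)"]) auto
    have "F' k t = (LINT x:cbox a b|lborel. p k (x + t *\<^sub>R e))" unfolding F'_def using leb cshift[OF cp t] by blast
    also have "\<dots> = (LINT x:cbox a b|lborel. P k (t *\<^sub>R e + x))"
      using eq by (intro set_lebesgue_integral_cong) auto
    finally show ?thesis using 1 by blast
  qed
  have derF: "(F k has_derivative (\<lambda>s. s * F' k t)) (at t within ?S)" if t: "t \<in> ?S" for k t
  proof -
    have "((\<lambda>t. integral (cbox a b) (\<lambda>x. u k (x + t *\<^sub>R e))) has_field_derivative
        integral (cbox a b) (\<lambda>x. p k (x + t *\<^sub>R e))) (at t within ?S)"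
    proof (rule leibniz_rule_field_derivative)
      show "((\<lambda>t. u k (x + t *\<^sub>R e)) has_field_derivative p k (x + t *\<^sub>R e)) (at t within ?S)"
        if "t \<in> ?S" "x \<in> cbox a b" for t x
        using der[OF inD[OF that(2,1)]] by (rule has_field_derivative_at_within)
      show "(\<lambda>x. u k (x + t *\<^sub>R e)) integrable_on cbox a b" if "t \<in> ?S" for t
        using cshift[OF cu that] by (rule integrable_continuous)
      show "continuous_on (?S \<times> cbox a b) (\<lambda>(t, x). p k (x + t *\<^sub>R e))"
        unfolding split_beta using inD
        by (intro continuous_on_compose2[OF cp[of k]] continuous_intros) auto
    qed (use t in auto)
    then show ?thesis unfolding has_field_derivative_def F_def[abs_def] F'_def
      by (rule has_derivative_eq_rhs) (simp add: fun_eq_iff mult.commute)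
  qed
  have small: "\<forall>\<^sub>F k in sequentially. (\<integral>\<^sup>+x. ennreal \<bar>U k x\<bar> \<partial>lborel) < ennreal \<eta> \<and> (\<integral>\<^sup>+x. ennreal \<bar>P k x - g x\<bar> \<partial>lborel) < ennreal \<eta>"
    if "0 < \<eta>" for \<eta>
    using order_tendstoD(2)[OF lu, of "ennreal \<eta>"] order_tendstoD(2)[OF lp, of "ennreal \<eta>"] that
    unfolding U_def P_def by (auto elim: eventually_elim2)
  have Fsmall: "\<bar>F k t\<bar> < \<eta>" if "(\<integral>\<^sup>+x. ennreal \<bar>U k x\<bar> \<partial>lborel) < ennreal \<eta>" "t \<in> ?S" for k t \<eta>
  proof -
    have fin: "(\<integral>\<^sup>+x. ennreal \<bar>U k x\<bar> \<partial>lborel) < \<infinity>" using that(1) by (rule order_less_trans) simp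
    have "ennreal \<bar>F k t\<bar> < ennreal \<eta>"
      unfolding F_eq[OF that(2)] using shifted_integral_bound(3)[OF Um fin, of "cbox a b" "t *\<^sub>R e"] that(1) by simp
    then show ?thesis by (metis abs_ge_zero ennreal_less_iff)
  qed
  have F'small: "\<bar>F' k t - G t\<bar> < \<eta>" if sm: "(\<integral>\<^sup>+x. ennreal \<bar>P k x - g x\<bar> \<partial>lborel) < ennreal \<eta>" and t: "t \<in> ?S" for k t \<eta>
  proof -
    have fin: "(\<integral>\<^sup>+x. ennreal \<bar>P k x - g x\<bar> \<partial>lborel) < \<infinity>" using sm by (rule order_less_trans) simp
    have "F' k t - G t = (LINT x:cbox a b|lborel. P k (t *\<^sub>R e + x) - g (t *\<^sub>R e + x))"
      unfolding G_def using F'_eq[OF t, of k] shifted_integral_bound(2)[OF gm gfin, of "cbox a b" "t *\<^sub>R e"]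
      by (simp add: set_integral_diff)
    moreover have "ennreal \<bar>LINT x:cbox a b|lborel. P k (t *\<^sub>R e + x) - g (t *\<^sub>R e + x)\<bar> < ennreal \<eta>"
      using shifted_integral_bound(3)[of "\<lambda>x. P k x - g x", OF _ fin, of "cbox a b" "t *\<^sub>R e"] sm by simp
    ultimately show ?thesis by (metis abs_ge_zero ennreal_less_iff)
  qed
  have Flim: "(\<lambda>k. F k t) \<longlonglongrightarrow> 0" if "t \<in> ?S" for t
  proof (rule tendstoI)
    fix \<eta> :: real assume "0 < \<eta>"
    from small[OF this] show "\<forall>\<^sub>F k in sequentially. dist (F k t) 0 < \<eta>"
      by (rule eventually_mono) (use Fsmall[OF _ that] in auto)
  qed
  have h0: "0 \<in> ?S" using h by simp
  \<comment> \<open>Uniform convergence of the derivatives and convergence at one point make the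
    limit differentiable with derivative \<open>G\<close>; the limit is 0.\<close>
  have "\<exists>f. \<forall>t\<in>?S. (\<lambda>k. F k t) \<longlonglongrightarrow> f t \<and> (f has_derivative (\<lambda>s. s * G t)) (at t within ?S)"
  proof (rule has_derivative_sequence[where g' = "\<lambda>t s. s * G t", OF _ derF _ h0 Flim[OF h0]])
    fix \<eta> :: real assume \<eta>: "0 < \<eta>"
    from small[OF \<eta>] show "\<forall>\<^sub>F k in sequentially. \<forall>t\<in>?S. \<forall>s. norm (s * F' k t - s * G t) \<le> \<eta> * norm s"
    proof (rule eventually_mono)
      fix k assume k: "(\<integral>\<^sup>+x. ennreal \<bar>U k x\<bar> \<partial>lborel) < ennreal \<eta> \<and> (\<integral>\<^sup>+x. ennreal \<bar>P k x - g x\<bar> \<partial>lborel) < ennreal \<eta>"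
      show "\<forall>t\<in>?S. \<forall>s. norm (s * F' k t - s * G t) \<le> \<eta> * norm s"
      proof (intro ballI allI)
        fix t s assume t: "t \<in> ?S"
        have "norm (s * F' k t - s * G t) = \<bar>s\<bar> * \<bar>F' k t - G t\<bar>"
          by (simp add: right_diff_distrib[symmetric] abs_mult)
        also have "\<dots> \<le> \<bar>s\<bar> * \<eta>" using F'small[of k \<eta> t] k t by (intro mult_left_mono) auto
        finally show "norm (s * F' k t - s * G t) \<le> \<eta> * norm s" by (simp add: mult.commute)
      qed
    qed
  qed auto
  then obtain f where f: "\<And>t. t \<in> ?S \<Longrightarrow> (\<lambda>k. F k t) \<longlonglongrightarrow> f t"
    "\<And>t. t \<in> ?S \<Longrightarrow> (f has_derivative (\<lambda>s. s * G t)) (at t within ?S)" by blast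
  have f0: "f t = 0" if "t \<in> ?S" for t using LIMSEQ_unique[OF f(1)[OF that] Flim[OF that]] .
  have "((\<lambda>t. 0::real) has_derivative (\<lambda>s. s * G 0)) (at 0 within ?S)"
    by (rule has_derivative_transform[OF h0 _ f(2)[OF h0]]) (use f0 in auto)
  moreover have "at 0 within ?S = at (0::real)" using h by (intro at_within_interior) simp
  ultimately have "((\<lambda>t. 0::real) has_derivative (\<lambda>s. s * G 0)) (at 0)" by simp
  then have "(\<lambda>s. s * G 0) = (\<lambda>s. 0)" using has_derivative_unique has_derivative_const by blast
  then have "G 0 = 0" by (metis mult_1)
  then show ?thesis by (simp add: G_def)
qed

text \<open>Continuity of the first partial derivatives comes from their own differentiability, the
  next order of smoothness.\<close>

lemma smooth_on_closure_line:
  fixes u :: "real^'n \<Rightarrow> real"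
  assumes u: "smooth_on_closure D u"
  shows "continuous_on D u" "continuous_on D (partial_deriv i u)"
    "x + t *\<^sub>R axis i 1 \<in> D \<Longrightarrow>
      ((\<lambda>s. u (x + s *\<^sub>R axis i 1)) has_field_derivative partial_deriv i u (x + t *\<^sub>R axis i 1)) (at t)"
proof -
  have d: "\<forall>x\<in>D. iterated_partial is u differentiable (at x)" for "is"
    using u unfolding smooth_on_closure_def by blast
  have d0: "u differentiable (at x)" if "x \<in> D" for x using d[of "[]"] that by simp
  have d1: "partial_deriv i u differentiable (at x)" if "x \<in> D" for x using d[of "[i]"] that by simp
  show "continuous_on D u" "continuous_on D (partial_deriv i u)"
    using d0 d1 by (meson continuous_at_imp_continuous_on differentiable_imp_continuous_within)+
  assume x: "x + t *\<^sub>R axis i 1 \<in> D"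
  define f' where "f' = frechet_derivative u (at (x + t *\<^sub>R axis i 1))"
  have uf: "(u has_derivative f') (at (x + t *\<^sub>R axis i 1))"
    unfolding f'_def using d0[OF x] frechet_derivative_works by blast
  have "((\<lambda>s. x + s *\<^sub>R axis i 1) has_derivative (\<lambda>s. s *\<^sub>R axis i 1)) (at t)"
    by (auto intro!: derivative_eq_intros)
  from has_derivative_compose[OF this uf]
  have "((\<lambda>s. u (x + s *\<^sub>R axis i 1)) has_derivative (\<lambda>s. f' (s *\<^sub>R axis i 1))) (at t)" .
  moreover have "f' (s *\<^sub>R axis i 1) = partial_deriv i u (x + t *\<^sub>R axis i 1) * s" for s
    using linear_scale[OF has_derivative_linear[OF uf], of s "axis i 1"] by (simp add: partial_deriv_def f'_def)
  ultimately show "((\<lambda>s. u (x + s *\<^sub>R axis i 1)) has_field_derivative partial_deriv i u (x + t *\<^sub>R axis i 1)) (at t)"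
    by (simp add: has_field_derivative_def)
qed

section \<open>Condition (H6)\<close>

context sawtooth begin

lemma w_lower_bound:
  assumes D: "compact (closure D)" "closure D \<subseteq> \<Omega>"
  obtains w0 where "0 < w0" "\<And>X. X \<in> D \<Longrightarrow> w0 \<le> w X"
proof (cases "D = {}")
  case True then show ?thesis using that[of 1] by simp
next
  case False
  have pos: "0 < \<delta> X" if "X \<in> closure D" for X using D that \<Omega>_\<Gamma> \<delta>_pos by blast
  then have "continuous_on (closure D) w" unfolding w_eq[abs_def] by (intro continuous_intros) force
  moreover have "closure D \<noteq> {}" using False by simp
  ultimately obtain Y where Y: "Y \<in> closure D" "\<And>X. X \<in> closure D \<Longrightarrow> w Y \<le> w X"
    using continuous_attains_inf[OF D(1), of w] by blast
  have "0 < w Y" using pos[OF Y(1)] by (simp add: w_eq)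
  then show ?thesis using that[of "w Y"] Y(2) closure_subset by blast
qed

text \<open>Carries the integral hypotheses of (H6) from \<open>m\<close> to Lebesgue
  measure.\<close>

lemma m_integral_ge:
  assumes w0: "0 < w0" "\<And>X. X \<in> D \<Longrightarrow> w0 \<le> w X"
    and f: "(\<lambda>X. f X * indicator D X) \<in> borel_measurable lebesgue"
  shows "(\<integral>\<^sup>+X\<in>D. f X \<partial>lebesgue) \<le> ennreal (1 / w0) * (\<integral>\<^sup>+X\<in>D. f X \<partial>m)"
proof -
  have wm: "(\<lambda>X. ennreal (w X)) \<in> borel_measurable lebesgue" by (intro measurable_completion) measurable
  have "ennreal w0 * (\<integral>\<^sup>+X\<in>D. f X \<partial>lebesgue) = (\<integral>\<^sup>+X. ennreal w0 * (f X * indicator D X) \<partial>lebesgue)"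
    by (rule nn_integral_cmult[symmetric, OF f])
  also have "\<dots> \<le> (\<integral>\<^sup>+X. ennreal (w X) * (f X * indicator D X) \<partial>lebesgue)"
    using w0(2) by (intro nn_integral_mono) (auto split: split_indicator intro!: mult_right_mono ennreal_leI)
  also have "\<dots> = (\<integral>\<^sup>+X\<in>D. f X \<partial>m)"
    unfolding interior_measure_def by (rule nn_integral_density[symmetric, OF wm f])
  finally have "ennreal (1 / w0) * (ennreal w0 * (\<integral>\<^sup>+X\<in>D. f X \<partial>lebesgue)) \<le> ennreal (1 / w0) * (\<integral>\<^sup>+X\<in>D. f X \<partial>m)"
    by (rule mult_left_mono) simp
  then show ?thesis using w0(1) by (simp add: mult.assoc[symmetric] ennreal_mult[symmetric])
qed

text \<open>On \<open>D\<close> the weight is bounded below and the volume is finite, so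
  Cauchy-Schwarz turns the assumptions into L1 convergence for Lebesgue measure. Each coordinate of
  \<open>v\<close> then has zero integral over every box in \<open>D\<close>, and countably many
  such boxes cover \<open>D\<close>.\<close>

lemma condition_H6: "cond_H6 \<Omega> m"
  unfolding cond_H6_def
proof (intro allI impI)
  fix D and u :: "nat \<Rightarrow> real^'n \<Rightarrow> real" and v :: "real^'n \<Rightarrow> real^'n"
  assume "open D \<and> compact (closure D) \<and> closure D \<subseteq> \<Omega> \<and> (\<forall>i. smooth_on_closure D (u i)) \<and>
        set_borel_measurable m D v \<and> (\<integral>\<^sup>+X\<in>D. ennreal ((norm (v X))\<^sup>2) \<partial>m) < \<infinity> \<and>
        (\<lambda>i. \<integral>\<^sup>+X\<in>D. ennreal \<bar>u i X\<bar> \<partial>m) \<longlonglongrightarrow> 0 \<and>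
        (\<lambda>i. \<integral>\<^sup>+X\<in>D. ennreal ((norm (gradient (u i) X - v X))\<^sup>2) \<partial>m) \<longlonglongrightarrow> 0"
  then have D: "open D" "compact (closure D)" "closure D \<subseteq> \<Omega>" and su: "\<And>k. smooth_on_closure D (u k)"
    and vm: "set_borel_measurable m D v" and v2: "(\<integral>\<^sup>+X\<in>D. ennreal ((norm (v X))\<^sup>2) \<partial>m) < \<infinity>"
    and lu: "(\<lambda>k. \<integral>\<^sup>+X\<in>D. ennreal \<bar>u k X\<bar> \<partial>m) \<longlonglongrightarrow> 0"
    and lg: "(\<lambda>k. \<integral>\<^sup>+X\<in>D. ennreal ((norm (gradient (u k) X - v X))\<^sup>2) \<partial>m) \<longlonglongrightarrow> 0" by blast+
  obtain w0 where w0: "0 < w0" "\<And>X. X \<in> D \<Longrightarrow> w0 \<le> w X" using w_lower_bound[OF D(2,3)] by blast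
  have Db: "D \<in> sets borel" using D(1) by simp
  have bD: "bounded D" using D(2) bounded_subset[OF compact_imp_bounded closure_subset] by blast
  have Dfin: "emeasure lebesgue D < \<infinity>" using emeasure_bounded_finite[OF bD] Db by simp
  \<comment> \<open>\<open>v\<close> is controlled on \<open>D\<close> alone, so it is cut off to
    zero outside.\<close>
  define V where "V x = indicator D x *\<^sub>R v x" for x
  have Vm: "V \<in> borel_measurable lebesgue"
    using vm unfolding set_borel_measurable_def V_def[abs_def] interior_measure_def by simp
  have Vi: "(\<lambda>x. V x $ i) \<in> borel_measurable lebesgue" for i
    by (rule measurable_compose[OF Vm borel_measurable_continuous_onI]) (intro continuous_intros)
  have ind: "indicator D \<in> borel_measurable lebesgue" using Db by (intro borel_measurable_indicator) simp
  have um: "(\<lambda>X. indicator D X * u k X) \<in> borel_measurable borel" for k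
    using borel_measurable_continuous_on_indicator[OF Db smooth_on_closure_line(1)[OF su]] by simp
  have pm: "(\<lambda>X. indicator D X * partial_deriv i (u k) X) \<in> borel_measurable borel" for k i
    using borel_measurable_continuous_on_indicator[OF Db smooth_on_closure_line(2)[OF su]] by simp
  have coord: "AE x in lebesgue. V x $ i = 0" for i
  proof -
    define e where "e k = (\<integral>\<^sup>+x. ennreal \<bar>indicator D x * partial_deriv i (u k) x - V x $ i\<bar> \<partial>lebesgue)" for k
    have pml: "(\<lambda>X. indicator D X * partial_deriv i (u k) X) \<in> borel_measurable lebesgue" for k
      by (intro measurable_completion) (use pm in simp)
    have diffm: "(\<lambda>x. ennreal \<bar>indicator D x * partial_deriv i (u k) x - V x $ i\<bar>) \<in> borel_measurable lebesgue" for k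
      using pml Vi by (intro measurable_compose[OF _ measurable_ennreal] borel_measurable_abs borel_measurable_diff)
    have CS: "(\<integral>\<^sup>+x. q x * indicator D x \<partial>lebesgue)\<^sup>2 \<le> (\<integral>\<^sup>+x. q x ^ 2 \<partial>lebesgue) * emeasure lebesgue D"
      if q: "q \<in> borel_measurable lebesgue" for q :: "real^'n \<Rightarrow> ennreal"
    proof -
      have "(\<integral>\<^sup>+x. (indicator D x :: ennreal) ^ 2 \<partial>lebesgue) = (\<integral>\<^sup>+x. indicator D x \<partial>lebesgue)"
        by (intro nn_integral_cong) (auto split: split_indicator)
      also have "\<dots> = emeasure lebesgue D" using Db by (intro nn_integral_indicator) simp
      finally show ?thesis using Cauchy_Schwarz_nn_integral[OF q ind] by simp
    qed
    have sq: "(\<integral>\<^sup>+x. (ennreal \<bar>indicator D x * partial_deriv i (u k) x - V x $ i\<bar>)\<^sup>2 \<partial>lebesgue) \<le>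
       ennreal (1 / w0) * (\<integral>\<^sup>+X\<in>D. ennreal ((norm (gradient (u k) X - v X))\<^sup>2) \<partial>m)" for k
    proof -
      have gm: "(\<lambda>X. indicator D X *\<^sub>R gradient (u k) X) \<in> borel_measurable lebesgue"
      proof -
        have "(\<lambda>X. indicator D X *\<^sub>R gradient (u k) X) = (\<lambda>X. \<chi> j. indicator D X * partial_deriv j (u k) X)"
          by (auto simp: gradient_def fun_eq_iff vec_eq_iff)
        moreover have "(\<lambda>X. (\<chi> j. indicator D X * partial_deriv j (u k) X) :: real^'n) \<in> borel_measurable borel"
          using pm by (subst borel_measurable_euclidean_space) (auto simp: Basis_vec_def inner_axis)
        ultimately show ?thesis by (intro measurable_completion) simp
      qed
      have "(\<lambda>X. ennreal ((norm (indicator D X *\<^sub>R gradient (u k) X - V X))\<^sup>2)) \<in> borel_measurable lebesgue"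
      proof -
        have "(\<lambda>X. indicator D X *\<^sub>R gradient (u k) X - V X) \<in> borel_measurable lebesgue"
          using gm Vm by (rule borel_measurable_diff)
        then show ?thesis by measurable
      qed
      moreover have eq: "(\<lambda>X. ennreal ((norm (gradient (u k) X - v X))\<^sup>2) * indicator D X) =
          (\<lambda>X. ennreal ((norm (indicator D X *\<^sub>R gradient (u k) X - V X))\<^sup>2))"
        by (auto simp: V_def fun_eq_iff split: split_indicator)
      ultimately have gm2: "(\<lambda>X. ennreal ((norm (gradient (u k) X - v X))\<^sup>2) * indicator D X) \<in> borel_measurable lebesgue" by simp
      have "(\<integral>\<^sup>+x. (ennreal \<bar>indicator D x * partial_deriv i (u k) x - V x $ i\<bar>)\<^sup>2 \<partial>lebesgue) \<le>
          (\<integral>\<^sup>+X\<in>D. ennreal ((norm (gradient (u k) X - v X))\<^sup>2) \<partial>lebesgue)"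
      proof (intro nn_integral_mono)
        fix x
        have "\<bar>(gradient (u k) x - v x) $ i\<bar> \<le> norm (gradient (u k) x - v x)" by (rule component_le_norm_cart)
        then have "(\<bar>partial_deriv i (u k) x - v x $ i\<bar>)\<^sup>2 \<le> (norm (gradient (u k) x - v x))\<^sup>2"
          by (intro power_mono) (auto simp: gradient_def)
        then show "(ennreal \<bar>indicator D x * partial_deriv i (u k) x - V x $ i\<bar>)\<^sup>2 \<le>
           ennreal ((norm (gradient (u k) x - v x))\<^sup>2) * indicator D x"
          by (auto simp: V_def ennreal_power intro: ennreal_leI split: split_indicator)
      qed
      also have "\<dots> \<le> ennreal (1 / w0) * (\<integral>\<^sup>+X\<in>D. ennreal ((norm (gradient (u k) X - v X))\<^sup>2) \<partial>m)"
        by (rule m_integral_ge[OF w0 gm2])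
      finally show ?thesis .
    qed
    have e2: "(e k)\<^sup>2 \<le> ennreal (1 / w0) * (\<integral>\<^sup>+X\<in>D. ennreal ((norm (gradient (u k) X - v X))\<^sup>2) \<partial>m) * emeasure lebesgue D" for k
    proof -
      have "e k = (\<integral>\<^sup>+x. ennreal \<bar>indicator D x * partial_deriv i (u k) x - V x $ i\<bar> * indicator D x \<partial>lebesgue)"
        unfolding e_def by (intro nn_integral_cong) (auto simp: V_def split: split_indicator)
      then show ?thesis using order_trans[OF CS[OF diffm] mult_right_mono[OF sq]] by simp
    qed
    have elim: "e \<longlonglongrightarrow> 0"
    proof -
      have "(\<lambda>k. ennreal (1 / w0) * (\<integral>\<^sup>+X\<in>D. ennreal ((norm (gradient (u k) X - v X))\<^sup>2) \<partial>m) * emeasure lebesgue D) \<longlonglongrightarrow>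
          ennreal (1 / w0) * 0 * emeasure lebesgue D"
        using Dfin by (intro tendsto_mult_ennreal tendsto_const lg) auto
      then have t0: "(\<lambda>k. ennreal (1 / w0) * (\<integral>\<^sup>+X\<in>D. ennreal ((norm (gradient (u k) X - v X))\<^sup>2) \<partial>m) * emeasure lebesgue D) \<longlonglongrightarrow> 0"
        by simp
      have e2lim: "(\<lambda>k. (e k)\<^sup>2) \<longlonglongrightarrow> 0"
        by (rule tendsto_sandwich[OF _ _ tendsto_const t0]) (use e2 in auto)
      show ?thesis
      proof (rule order_tendstoI)
        fix y :: ennreal assume y: "0 < y"
        then have "0 < y\<^sup>2" by (simp add: power2_eq_square ennreal_zero_less_mult_iff)
        from order_tendstoD(2)[OF e2lim this] show "\<forall>\<^sub>F k in sequentially. e k < y"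
          by eventually_elim (metis not_le_imp_less power_mono zero_le leD)
      qed auto
    qed
    have Vint: "(\<integral>\<^sup>+x. ennreal \<bar>V x $ i\<bar> \<partial>lebesgue) < \<infinity>"
    proof -
      have "(\<integral>\<^sup>+x. ennreal \<bar>V x $ i\<bar> \<partial>lebesgue) = (\<integral>\<^sup>+x. ennreal \<bar>V x $ i\<bar> * indicator D x \<partial>lebesgue)"
        by (intro nn_integral_cong) (auto simp: V_def split: split_indicator)
      then have "(\<integral>\<^sup>+x. ennreal \<bar>V x $ i\<bar> \<partial>lebesgue)\<^sup>2 \<le> (\<integral>\<^sup>+x. (ennreal \<bar>V x $ i\<bar>)\<^sup>2 \<partial>lebesgue) * emeasure lebesgue D"
        using CS[of "\<lambda>x. ennreal \<bar>V x $ i\<bar>"] Vi[of i] by (simp add: borel_measurable_abs measurable_compose[OF _ measurable_ennreal])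
      also have "(\<integral>\<^sup>+x. (ennreal \<bar>V x $ i\<bar>)\<^sup>2 \<partial>lebesgue) \<le> (\<integral>\<^sup>+X\<in>D. ennreal ((norm (v X))\<^sup>2) \<partial>lebesgue)"
      proof (intro nn_integral_mono)
        fix x
        have "(\<bar>v x $ i\<bar>)\<^sup>2 \<le> (norm (v x))\<^sup>2" by (intro power_mono component_le_norm_cart) auto
        then show "(ennreal \<bar>V x $ i\<bar>)\<^sup>2 \<le> ennreal ((norm (v x))\<^sup>2) * indicator D x"
          by (auto simp: V_def ennreal_power intro: ennreal_leI split: split_indicator)
      qed
      also have "\<dots> \<le> ennreal (1 / w0) * (\<integral>\<^sup>+X\<in>D. ennreal ((norm (v X))\<^sup>2) \<partial>m)"
      proof (rule m_integral_ge[OF w0])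
        have "(\<lambda>X. ennreal ((norm (v X))\<^sup>2) * indicator D X) = (\<lambda>X. ennreal ((norm (V X))\<^sup>2))"
          by (auto simp: V_def fun_eq_iff split: split_indicator)
        moreover have "(\<lambda>X. ennreal ((norm (V X))\<^sup>2)) \<in> borel_measurable lebesgue"
          using Vm by measurable
        ultimately show "(\<lambda>X. ennreal ((norm (v X))\<^sup>2) * indicator D X) \<in> borel_measurable lebesgue" by simp
      qed
      finally have "(\<integral>\<^sup>+x. ennreal \<bar>V x $ i\<bar> \<partial>lebesgue)\<^sup>2 \<le> ennreal (1 / w0) * (\<integral>\<^sup>+X\<in>D. ennreal ((norm (v X))\<^sup>2) \<partial>m) * emeasure lebesgue D"
        by (simp add: mult_right_mono)
      also have "\<dots> < \<infinity>" using v2 Dfin by (simp add: ennreal_mult_less_top)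
      finally show ?thesis by (simp add: power_less_top_ennreal)
    qed
    \<comment> \<open>\<open>v\<close> is measurable only for the completed measure, while the box
      argument and the translations are set up for Borel functions.\<close>
    obtain g where g: "g \<in> borel_measurable lborel" "AE x in lborel. V x $ i = g x"
      using completion_ex_borel_measurable_real[of "\<lambda>x. V x $ i" lborel] Vi[of i] by auto
    have gl: "AE x in lebesgue. V x $ i = g x" using g(2) by (rule AE_completion)
    have gm: "g \<in> borel_measurable borel" using g(1) by simp
    have gint: "integrable lborel g"
    proof (rule integrableI_bounded[OF g(1)])
      have "(\<integral>\<^sup>+x. ennreal (norm (g x)) \<partial>lborel) = (\<integral>\<^sup>+x. ennreal (norm (g x)) \<partial>lebesgue)"
        by (simp add: nn_integral_completion)
      also have "\<dots> = (\<integral>\<^sup>+x. ennreal \<bar>V x $ i\<bar> \<partial>lebesgue)"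
        using gl by (intro nn_integral_cong_AE) auto
      finally show "(\<integral>\<^sup>+x. ennreal (norm (g x)) \<partial>lborel) < \<infinity>" using Vint by simp
    qed
    have lu': "(\<lambda>k. \<integral>\<^sup>+x. ennreal \<bar>indicator D x * u k x\<bar> \<partial>lborel) \<longlonglongrightarrow> 0"
    proof (rule tendsto_sandwich[OF _ _ tendsto_const])
      have "(\<integral>\<^sup>+x. ennreal \<bar>indicator D x * u k x\<bar> \<partial>lborel) \<le> ennreal (1 / w0) * (\<integral>\<^sup>+X\<in>D. ennreal \<bar>u k X\<bar> \<partial>m)" for k
      proof -
        have eq: "ennreal \<bar>indicator D x * u k x\<bar> = ennreal \<bar>u k x\<bar> * indicator D x" for x
          by (auto split: split_indicator)
        have "(\<lambda>x. ennreal \<bar>indicator D x * u k x\<bar>) \<in> borel_measurable lborel"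
          using um[of k] by (intro measurable_compose[OF _ measurable_ennreal] borel_measurable_abs) simp
        then have "(\<lambda>x. ennreal \<bar>u k x\<bar> * indicator D x) \<in> borel_measurable lebesgue"
          unfolding eq by (rule measurable_completion)
        from m_integral_ge[OF w0 this] show ?thesis unfolding eq by (simp add: nn_integral_completion)
      qed
      then show "\<forall>\<^sub>F k in sequentially. (\<integral>\<^sup>+x. ennreal \<bar>indicator D x * u k x\<bar> \<partial>lborel) \<le> ennreal (1 / w0) * (\<integral>\<^sup>+X\<in>D. ennreal \<bar>u k X\<bar> \<partial>m)"
        by simp
      have "(\<lambda>k. ennreal (1 / w0) * (\<integral>\<^sup>+X\<in>D. ennreal \<bar>u k X\<bar> \<partial>m)) \<longlonglongrightarrow> ennreal (1 / w0) * 0"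
        by (intro tendsto_mult_ennreal tendsto_const lu) auto
      then show "(\<lambda>k. ennreal (1 / w0) * (\<integral>\<^sup>+X\<in>D. ennreal \<bar>u k X\<bar> \<partial>m)) \<longlonglongrightarrow> 0" by simp
    qed simp
    have lp': "(\<lambda>k. \<integral>\<^sup>+x. ennreal \<bar>indicator D x * partial_deriv i (u k) x - g x\<bar> \<partial>lborel) \<longlonglongrightarrow> 0"
    proof -
      have "(\<integral>\<^sup>+x. ennreal \<bar>indicator D x * partial_deriv i (u k) x - g x\<bar> \<partial>lborel) = e k" for k
      proof -
        have "(\<integral>\<^sup>+x. ennreal \<bar>indicator D x * partial_deriv i (u k) x - g x\<bar> \<partial>lborel)
            = (\<integral>\<^sup>+x. ennreal \<bar>indicator D x * partial_deriv i (u k) x - g x\<bar> \<partial>lebesgue)"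
          by (simp add: nn_integral_completion)
        also have "\<dots> = e k" unfolding e_def using gl by (intro nn_integral_cong_AE) auto
        finally show ?thesis .
      qed
      then show ?thesis using elim by simp
    qed
    have zero: "(LINT x:cbox a b|lborel. g x) = 0" if "cbox a b \<subseteq> D" for a b
      by (rule weak_limit_integral_zero[where u = u and p = "\<lambda>k. partial_deriv i (u k)" and e = "axis i 1", OF D(1) that
            _ smooth_on_closure_line(1)[OF su] smooth_on_closure_line(2)[OF su] gint lu' lp'])
        (rule smooth_on_closure_line(3)[OF su])
    \<comment> \<open>Multiplying by the indicator of the box turns the integral over an arbitrary
      box into one over a box inside \<open>D\<close>, where \<open>zero\<close> applies.\<close>
    have onbox: "AE x in lborel. x \<in> cbox a b \<longrightarrow> g x = 0" if sub: "cbox a b \<subseteq> D" for a b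
    proof -
      have "AE x in lborel. indicator (cbox a b) x * g x = 0"
      proof (rule AE_zero_if_cbox_integrals_zero)
        show "integrable lborel (\<lambda>x. indicator (cbox a b) x * g x)"
          using integrable_mult_indicator[OF _ gint, of "cbox a b"] by simp
        fix a' b' :: "real^'n"
        obtain a'' b'' where i: "cbox a' b' \<inter> cbox a b = cbox a'' b''" using Int_interval by blast
        have "(LINT x:cbox a' b'|lborel. indicator (cbox a b) x * g x) = (LINT x:cbox a'' b''|lborel. g x)"
          unfolding set_lebesgue_integral_def i[symmetric]
          by (intro Bochner_Integration.integral_cong) (auto split: split_indicator)
        also have "\<dots> = 0" using sub i by (intro zero) blast
        finally show "(LINT x:cbox a' b'|lborel. indicator (cbox a b) x * g x) = 0" .
      qed
      then show ?thesis by (rule AE_mp) (auto split: split_indicator)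
    qed
    obtain \<C> where \<C>: "countable \<C>" "\<And>X. X \<in> \<C> \<Longrightarrow> \<exists>a b. X = cbox a b" "\<C> \<subseteq> Pow D" "\<Union>\<C> = D"
      using open_countable_Union_open_cbox[OF D(1)] by metis
    have "AE x in lborel. \<forall>X\<in>\<C>. x \<in> X \<longrightarrow> g x = 0"
    proof (rule AE_ball_countable'[OF _ \<C>(1)])
      fix X assume "X \<in> \<C>"
      then obtain a b where "X = cbox a b" "cbox a b \<subseteq> D" using \<C> by blast
      then show "AE x in lborel. x \<in> X \<longrightarrow> g x = 0" using onbox by simp
    qed
    then have "AE x in lborel. x \<in> D \<longrightarrow> g x = 0" by (rule AE_mp) (use \<C>(4) in auto)
    then have "AE x in lebesgue. x \<in> D \<longrightarrow> g x = 0" by (rule AE_completion)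
    then show "AE x in lebesgue. V x $ i = 0" using gl by eventually_elim (auto simp: V_def split: split_indicator)
  qed
  have "AE x in lebesgue. \<forall>i. V x $ i = 0" using coord by (simp add: AE_all_countable)
  then have "AE x in lebesgue. x \<in> D \<longrightarrow> v x = 0"
    by eventually_elim (auto simp: V_def vec_eq_iff)
  moreover have "(\<lambda>X. ennreal (w X)) \<in> borel_measurable lebesgue" by (intro measurable_completion) measurable
  ultimately show "AE X in m. X \<in> D \<longrightarrow> v X = 0"
    unfolding interior_measure_def by (subst AE_density) auto
qed

end

theorem theorem5p2:
  fixes \<Gamma> \<Omega> :: "(real^'n) set"
    and d C\<^sub>d a0 A0 \<zeta> c cH \<eta> K \<theta> :: real
    and \<DD> :: "int \<Rightarrow> (real^'n) set set"
    and xc XQ :: "(real^'n) set \<Rightarrow> real^'n"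
    and W :: "'n box set"
    and W0 :: "(real^'n) set \<Rightarrow> 'n box set"
    and H :: "(real^'n) set \<Rightarrow> 'n box \<Rightarrow> (real^'n) set"
    and \<F> :: "(real^'n) set set"
  assumes "3 \<le> CARD('n)" and "0 < d" and "d < real CARD('n) - 1"
    and "closed \<Gamma>" and "\<not> bounded \<Gamma>"
    and "0 < C\<^sub>d" and "ahlfors_david_regular d C\<^sub>d \<Gamma>"
    and "0 < a0" and "a0 \<le> 1" and "1 \<le> A0" and "0 < \<zeta>" and "\<zeta> < 1"
    and "dyadic_system d \<Gamma> a0 A0 \<zeta> \<DD>" and "cube_centres \<Gamma> a0 A0 \<DD> xc"
    and "whitney_decomposition \<Gamma> W"
    and "corkscrew_constant c \<Gamma>" and "harnack_constant d cH \<Gamma>"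
    and "0 < \<eta>" and "\<eta> < a0 / (2 powr ((2 * d + 1) / d) * C\<^sub>d powr (2 / d) * A0)"
    and "500 * A0 / a0 \<le> K"
    and "0 < \<theta>" and "\<theta> < 1 / (16 * sqrt (real CARD('n)))"
    and "W0 = whitney_initial a0 c \<eta> K \<DD> W"
    and "\<forall>Q\<in>all_cubes \<DD>. corkscrew_point c \<Gamma> (xc Q) (a0 * cube_length \<DD> Q) (XQ Q) \<and>
           (\<exists>I\<in>W0 Q. XQ Q \<in> box_set I)"
    and "\<forall>Q\<in>all_cubes \<DD>. \<forall>I\<in>W0 Q.
           harnack_chain d cH \<Gamma> (2 / 41 * a0 * c * \<eta> * cube_length \<DD> Q)
             (41 / (2 * c * \<eta>) * (1 + 5 / 4 * K + A0 / a0)) (fst I) (XQ Q) (H Q I) \<and>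
           H Q I \<inter> box_set I \<noteq> {}"
    and "\<F> \<subseteq> all_cubes \<DD>" and "disjoint \<F>"
    and "\<Omega> = sawtooth_domain \<DD> (whitney_region W W0 H) \<theta> \<F>"
  shows "(\<exists>c1 N. cond_H1 \<Omega> c1 \<and> cond_H2 \<Omega> c1 N) \<and>
         cond_H3 \<Omega> (sigma_star d \<Gamma> \<Omega>) \<and>
         cond_H4 \<Omega> (interior_measure d \<Gamma>) (dist_weight d \<Gamma>) \<and>
         cond_H5 \<Omega> (interior_measure d \<Gamma>) (sigma_star d \<Gamma> \<Omega>) \<and>
         cond_H6 \<Omega> (interior_measure d \<Gamma>)"
proof -
  interpret sawtooth \<Gamma> \<Omega> d C\<^sub>d a0 A0 \<zeta> c cH \<eta> K \<theta> \<DD> xc XQ W W0 H \<F>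
    by (rule sawtooth.intro[OF assms])
  obtain c1 where c1: "0 < c1" and corkscrews: "\<And>x r. x \<in> closure \<Omega> \<Longrightarrow> 0 < r \<Longrightarrow> \<exists>X\<in>ball x r. ball X (c1 * r) \<subseteq> \<Omega>"
    using interior_corkscrew by blast
  have "cond_H1 \<Omega> c1"
    unfolding cond_H1_def using c1 corkscrews frontier_closure by blast
  moreover obtain N where "cond_H2 \<Omega> c1 N"
    using harnack_chains[OF c1] by blast
  ultimately show ?thesis
    using condition_H3 doubling_condition_H4 condition_H5 condition_H6 by blast
qed

end
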